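(* Let $\Omega\subset\mathbb{R}^N$ ($N\ge 2$) be a smooth bounded domain and $\lambda\in\mathbb{R}$. Let $p,q,r\in C_+(\overline\Omega)$ with $p$ log-H\"older continuous, $1<q^-\le q(x)\le q^+<p^-\le p(x)\le p^+<\infty$ and $2<r^-\le r(x)\le r^+<p^-$ for all $x\in\overline\Omega$. Let $p'(x)=p(x)/(p(x)-1)$. Let $f:\Omega\times\mathbb{R}\to\mathbb{R}$ satisfy: (1) $f(\cdot,\eta)$ is measurable on $\Omega$ for all $\eta\in\mathbb{R}$ and $f(x,\cdot)$ is continuous on $\mathbb{R}$ for a.e. $x\in\Omega$; (2) there are a constant $c_1>0$ and a function $k\in L^{p'(\cdot)}(\Omega)$, $k\ge 0$, such that $|f(x,\eta)|\le c_1\big(k(x)+|\eta|^{r(x)-1}\big)$ for a.e. $x\in\Omega$ and all $\eta\in\mathbb{R}$. Let $a:\Omega\times\mathbb{R}^N\to\mathbb{R}^N$ satisfy: (3) $a(\cdot,\xi)$ is measurable on $\Omega$ for all $\xi\in\mathbb{R}^N$ and $a(x,\cdot)$ is continuous on $\mathbb{R}^N$ for a.e. $x\in\Omega$; (4) there are a positive function $b\in L^{p'(\cdot)}(\Omega)$ and a constant $c>0$ such that $|a(x,\xi)|\le b(x)+c|\xi|^{p(x)-1}$ for all $\xi\in\mathbb{R}^N$ and a.e. $x\in\Omega$; (5) $(a(x,\xi)-a(x,\xi'))\cdot(\xi-\xi')>0$ for a.e. $x\in\Omega$ and all $\xi,\xi'\in\mathbb{R}^N$ with $\xi\ne\xi'$;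 (6) there is a constant $c'>0$ such that $a(x,\xi)\cdot\xi\ge c'|\xi|^{p(x)}$ for a.e. $x\in\Omega$ and all $\xi\in\mathbb{R}^N$. Then there exists at least one weak solution $u\in W_0^{1,p(\cdot)}(\Omega)$ of the equation $-\operatorname{div}a(x,\nabla u)+\lambda|u|^{q(x)-2}u=f(x,u)$ in $\Omega$, i.e. at least one $u\in W_0^{1,p(\cdot)}(\Omega)$ such that $$\int_\Omega a(x,\nabla u)\cdot\nabla v\,dx=-\int_\Omega\lambda|u|^{q(x)-2}u\,v\,dx+\int_\Omega f(x,u)\,v\,dx\qquad\text{for all } v\in W_0^{1,p(\cdot)}(\Omega).$$
   Context: $C_+(\overline\Omega)$ is the set of continuous functions $h:\overline\Omega\to\mathbb{R}$ with $h(x)>1$ for every $x\in\overline\Omega$; for such $h$, $h^-=\min_{\overline\Omega}h$ and $h^+=\max_{\overline\Omega}h$. The exponent $p$ is log-H\"older continuous if there is $C>0$ such that $|p(x)-p(y)|\log\big(e+\frac{1}{|x-y|}\big)\le C$ for all $x,y\in\Omega$, $x\neq y$. For $h\in C_+(\overline\Omega)$, $L^{h(\cdot)}(\Omega)$ is the space of measurable $u:\Omega\to\mathbb{R}$ with $\rho_{h(\cdot)}(u)=\int_\Omega|u(x)|^{h(x)}dx<\infty$, with the Luxemburg norm $\|u\|_{h(\cdot)}=\inf\{\mu>0:\rho_{h(\cdot)}(u/\mu)\le 1\}$. $W^{1,p(\cdot)}(\Omega)=\{u\in L^{p(\cdot)}(\Omega):|\nabla u|\in L^{p(\cdot)}(\Omega)\}$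 (weak gradient) with norm $\|u\|_{p(\cdot)}+\|\nabla u\|_{p(\cdot)}$, and $W_0^{1,p(\cdot)}(\Omega)$ is the closure of $C_0^\infty(\Omega)$ in $W^{1,p(\cdot)}(\Omega)$. *)

theory Defs
  imports "HOL-Analysis.Analysis"
begin

text \<open>A function on \<open>\<Omega>\<close> (or, for exponents, on its closure) is represented by a total function on
  the ambient Euclidean space whose values elsewhere are irrelevant. A test function is represented
  by its extension by zero.\<close>

primrec Ck :: "nat \<Rightarrow> ('a::euclidean_space \<Rightarrow> real) \<Rightarrow> bool" where
  "Ck 0 f \<longleftrightarrow> continuous_on UNIV f"
| "Ck (Suc k) f \<longleftrightarrow> (\<forall>x. f differentiable (at x)) \<and>
     (\<forall>i\<in>Basis. Ck k (\<lambda>x. frechet_derivative f (at x) i))"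

definition smooth :: "('a::euclidean_space \<Rightarrow> real) \<Rightarrow> bool" where
  "smooth f \<longleftrightarrow> (\<forall>k. Ck k f)"

text \<open>Near each boundary point the domain is, after a rotation of the coordinate axes, the region
  strictly above the graph of a smooth function of the remaining \<open>N - 1\<close> coordinates. The unit
  vector \<open>e\<close> is the vertical direction, and \<open>y - (y \<bullet> e) e\<close> is the projection of \<open>y\<close> to the
  hyperplane orthogonal to \<open>e\<close>; only the values of \<open>\<gamma>\<close> on that hyperplane matter.\<close>

definition smooth_boundary :: "'a::euclidean_space set \<Rightarrow> bool" where
  "smooth_boundary \<Omega> \<longleftrightarrow>
     (\<forall>x\<in>frontier \<Omega>. \<exists>\<delta>>0. \<exists>e \<gamma>. norm e = 1 \<and> smooth \<gamma> \<and>
        \<Omega> \<inter> ball x \<delta> = {y \<in> ball x \<delta>. \<gamma> (y - (y \<bullet> e) *\<^sub>R e) < y \<bullet> e})"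

definition smooth_bounded_domain :: "'a::euclidean_space set \<Rightarrow> bool" where
  "smooth_bounded_domain \<Omega> \<longleftrightarrow>
     open \<Omega> \<and> connected \<Omega> \<and> \<Omega> \<noteq> {} \<and> bounded \<Omega> \<and> smooth_boundary \<Omega>"

definition C_plus :: "'a::euclidean_space set \<Rightarrow> ('a \<Rightarrow> real) set" where
  "C_plus \<Omega> = {h. continuous_on (closure \<Omega>) h \<and> (\<forall>x\<in>closure \<Omega>. 1 < h x)}"

text \<open>For a bounded nonempty \<open>\<Omega>\<close> and a continuous exponent the following infimum and supremum
  are attained, i.e. they are the minimum and the maximum over the closure.\<close>

definition exp_min :: "'a::euclidean_space set \<Rightarrow> ('a \<Rightarrow> real) \<Rightarrow> real" where
  "exp_min \<Omega> h = (INF x\<in>closure \<Omega>. h x)"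

definition exp_max :: "'a::euclidean_space set \<Rightarrow> ('a \<Rightarrow> real) \<Rightarrow> real" where
  "exp_max \<Omega> h = (SUP x\<in>closure \<Omega>. h x)"

definition log_Hoelder :: "'a::euclidean_space set \<Rightarrow> ('a \<Rightarrow> real) \<Rightarrow> bool" where
  "log_Hoelder \<Omega> p \<longleftrightarrow>
     (\<exists>C>0. \<forall>x\<in>\<Omega>. \<forall>y\<in>\<Omega>. x \<noteq> y \<longrightarrow> \<bar>p x - p y\<bar> * ln (exp 1 + 1 / norm (x - y)) \<le> C)"

definition conj_exp :: "('a \<Rightarrow> real) \<Rightarrow> 'a \<Rightarrow> real" where
  "conj_exp p x = p x / (p x - 1)"

definition modular :: "'a::euclidean_space set \<Rightarrow> ('a \<Rightarrow> real) \<Rightarrow> ('a \<Rightarrow> real) \<Rightarrow> ennreal" where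
  "modular \<Omega> h u = (\<integral>\<^sup>+x. ennreal (\<bar>u x\<bar> powr h x) \<partial>lebesgue_on \<Omega>)"

definition Lvar :: "'a::euclidean_space set \<Rightarrow> ('a \<Rightarrow> real) \<Rightarrow> ('a \<Rightarrow> real) set" where
  "Lvar \<Omega> h = {u \<in> borel_measurable (lebesgue_on \<Omega>). modular \<Omega> h u < \<infinity>}"

definition Lvar_norm :: "'a::euclidean_space set \<Rightarrow> ('a \<Rightarrow> real) \<Rightarrow> ('a \<Rightarrow> real) \<Rightarrow> real" where
  "Lvar_norm \<Omega> h u = Inf {\<mu>. 0 < \<mu> \<and> modular \<Omega> h (\<lambda>x. u x / \<mu>) \<le> 1}"

definition test_functions :: "'a::euclidean_space set \<Rightarrow> ('a \<Rightarrow> real) set" where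
  "test_functions \<Omega> =
     {\<phi>. smooth \<phi> \<and> compact (closure {x. \<phi> x \<noteq> 0}) \<and> closure {x. \<phi> x \<noteq> 0} \<subseteq> \<Omega>}"

definition has_weak_gradient ::
    "'a::euclidean_space set \<Rightarrow> ('a \<Rightarrow> real) \<Rightarrow> ('a \<Rightarrow> 'a) \<Rightarrow> bool" where
  "has_weak_gradient \<Omega> u g \<longleftrightarrow>
     (\<forall>K. compact K \<and> K \<subseteq> \<Omega> \<longrightarrow> u absolutely_integrable_on K \<and> g absolutely_integrable_on K) \<and>
     (\<forall>\<phi>\<in>test_functions \<Omega>. \<forall>i\<in>Basis.
        (LINT x|lebesgue_on \<Omega>. u x * frechet_derivative \<phi> (at x) i) =
        - (LINT x|lebesgue_on \<Omega>. (g x \<bullet> i) * \<phi> x))"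

text \<open>The weak gradient is unique up to a null set of \<open>\<Omega>\<close>; we choose a representative.\<close>

definition wgrad :: "'a::euclidean_space set \<Rightarrow> ('a \<Rightarrow> real) \<Rightarrow> 'a \<Rightarrow> 'a" where
  "wgrad \<Omega> u = (SOME g. has_weak_gradient \<Omega> u g)"

definition W1 :: "'a::euclidean_space set \<Rightarrow> ('a \<Rightarrow> real) \<Rightarrow> ('a \<Rightarrow> real) set" where
  "W1 \<Omega> p = {u \<in> Lvar \<Omega> p. (\<exists>g. has_weak_gradient \<Omega> u g) \<and> (\<lambda>x. norm (wgrad \<Omega> u x)) \<in> Lvar \<Omega> p}"

definition W1_norm :: "'a::euclidean_space set \<Rightarrow> ('a \<Rightarrow> real) \<Rightarrow> ('a \<Rightarrow> real) \<Rightarrow> real" where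
  "W1_norm \<Omega> p u = Lvar_norm \<Omega> p u + Lvar_norm \<Omega> p (\<lambda>x. norm (wgrad \<Omega> u x))"

definition W01 :: "'a::euclidean_space set \<Rightarrow> ('a \<Rightarrow> real) \<Rightarrow> ('a \<Rightarrow> real) set" where
  "W01 \<Omega> p =
     {u \<in> W1 \<Omega> p. \<forall>\<epsilon>>0. \<exists>\<phi>\<in>test_functions \<Omega>. W1_norm \<Omega> p (\<lambda>x. u x - \<phi> x) < \<epsilon>}"

text \<open>The Bochner integral of a non-integrable function is 0 by convention, so the existence of the
  three integrals is demanded explicitly. Where \<open>u x = 0\<close>, the term \<open>\<bar>u x\<bar> powr (q x - 2) * u x\<close>
  is 0, also for \<open>q x < 2\<close>.\<close>

definition weak_solution ::
    "'a::euclidean_space set \<Rightarrow> ('a \<Rightarrow> real) \<Rightarrow> ('a \<Rightarrow> real) \<Rightarrow> real \<Rightarrow>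
     ('a \<Rightarrow> 'a \<Rightarrow> 'a) \<Rightarrow> ('a \<Rightarrow> real \<Rightarrow> real) \<Rightarrow> ('a \<Rightarrow> real) \<Rightarrow> bool" where
  "weak_solution \<Omega> p q l a f u \<longleftrightarrow> u \<in> W01 \<Omega> p \<and>
     (\<forall>v\<in>W01 \<Omega> p.
        integrable (lebesgue_on \<Omega>) (\<lambda>x. a x (wgrad \<Omega> u x) \<bullet> wgrad \<Omega> v x) \<and>
        integrable (lebesgue_on \<Omega>) (\<lambda>x. l * (\<bar>u x\<bar> powr (q x - 2) * u x) * v x) \<and>
        integrable (lebesgue_on \<Omega>) (\<lambda>x. f x (u x) * v x) \<and>
        (LINT x|lebesgue_on \<Omega>. a x (wgrad \<Omega> u x) \<bullet> wgrad \<Omega> v x) =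
          - (LINT x|lebesgue_on \<Omega>. l * (\<bar>u x\<bar> powr (q x - 2) * u x) * v x)
          + (LINT x|lebesgue_on \<Omega>. f x (u x) * v x))"

end

theory Submission
  imports Defs "HOL-Library.Diagonal_Subsequence"
begin

text \<open>Galerkin approximation without weak topologies. Along a countable \<open>C\<^sup>1\<close>-dense sequence of test
  functions, Kuhn's lemma gives approximate solutions \<open>u\<^sub>n\<close> in the span of the first \<open>n\<close> of them.
  Coercivity and the modular Poincare inequality bound their energies, since the lower order term
  grows with a power below the minimum of \<open>p\<close>. By Rellich's theorem in \<open>L\<^sup>1\<close> a subsequence converges
  almost everywhere. Energy-minimising iterated midpoints of its tails have strongly convergent
  gradients, by Clarkson's inequality (\<open>p \<ge> 2\<close>), so the limit \<open>u\<close> lies in \<open>W01\<close>. By monotonicity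
  \<open>u\<^sub>n\<close> satisfies Minty's inequality, which is affine in the gradient of \<open>u\<^sub>n\<close> and therefore passes to
  the midpoints and to the limit; Minty's trick then turns it into the equation.\<close>

subsection \<open>Smooth functions\<close>

text \<open>The hypotheses \<open>2 < r\<close> and \<open>r < p\<close> force \<open>p > 2\<close>
  throughout. This is the range in which Clarkson's inequality has its elementary form, and it keeps
  the conjugate exponent between 1 and 2, so that constants coming from Young's inequality are
  uniform in the point. The \<lambda> term is moved to the right-hand side: a single Caratheodory
  function \<open>F\<close>, of growth strictly below the minimum of \<open>p\<close>, carries all
  lower order terms, whatever the sign of \<lambda>. The obstacle in the Poincare inequality is that
  the exponent moves with the point: an estimate at \<open>x\<close> is raised to the power
  \<open>p x\<close>, while the modular of the gradient sees \<open>p\<close> at other points. A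
  loss of \<open>1 / (2 n)\<close> in the exponent, \<open>n\<close> being the dimension, covers the
  oscillation of \<open>p\<close> at small distances, and the weight of a suitably parametrised ray
  pays for that loss. The obstacle in the limit is that the lower order term is not affine in the
  solution, so it is passed to the limit on the Galerkin sequence itself, before any midpoints are
  taken.\<close>

lemma Ck_SucI:
  assumes "\<And>x. (f has_derivative f' x) (at x)" "\<And>i. i \<in> Basis \<Longrightarrow> Ck k (\<lambda>x. f' x i)"
  shows "Ck (Suc k) f"
proof -
  have "frechet_derivative f (at x) = f' x" for x
    using frechet_derivative_at[OF assms(1)] by metis
  then show ?thesis
    using assms by (auto simp: differentiable_def)
qed

lemma Ck_Suc_has_derivative:
  "Ck (Suc k) f \<Longrightarrow> (f has_derivative frechet_derivative f (at x)) (at x)"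
  by (simp add: frechet_derivative_works[symmetric])

lemma Ck_Suc_imp_Ck: "Ck (Suc k) f \<Longrightarrow> Ck k f"
proof (induction k arbitrary: f)
  case 0
  then show ?case
    by (auto intro!: continuous_at_imp_continuous_on differentiable_imp_continuous_within)
qed auto

lemma Ck_const: "Ck k (\<lambda>x. c)"
proof (induction k arbitrary: c)
  case (Suc k)
  show ?case by (rule Ck_SucI[where f'="\<lambda>x h. 0"]) (auto intro: Suc)
qed simp

lemma Ck_add: "Ck k f \<Longrightarrow> Ck k g \<Longrightarrow> Ck k (\<lambda>x. f x + g x)"
proof (induction k arbitrary: f g)
  case 0
  then show ?case by (auto intro: continuous_intros)
next
  case (Suc k)
  show ?case
    using Suc.prems
    by (intro Ck_SucI[OF has_derivative_add[OF Ck_Suc_has_derivative Ck_Suc_has_derivative]] Suc.IH)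
       auto
qed

lemma Ck_mult: "Ck k f \<Longrightarrow> Ck k g \<Longrightarrow> Ck k (\<lambda>x. f x * g x)"
proof (induction k arbitrary: f g)
  case 0
  then show ?case by (auto intro: continuous_intros)
next
  case (Suc k)
  have "Ck k f" "Ck k g" using Suc.prems by (auto intro: Ck_Suc_imp_Ck)
  then show ?case
    using Suc.prems
    by (intro Ck_SucI[OF has_derivative_mult[OF Ck_Suc_has_derivative Ck_Suc_has_derivative]]
        Ck_add Suc.IH) auto
qed

lemma Ck_prod: "finite I \<Longrightarrow> (\<And>i. i \<in> I \<Longrightarrow> Ck k (f i)) \<Longrightarrow> Ck k (\<lambda>x. \<Prod>i\<in>I. f i x)"
  by (induction I rule: finite_induct) (auto intro: Ck_const Ck_mult)

lemma smooth_add: "smooth f \<Longrightarrow> smooth g \<Longrightarrow> smooth (\<lambda>x. f x + g x)"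
  and smooth_mult: "smooth f \<Longrightarrow> smooth g \<Longrightarrow> smooth (\<lambda>x. f x * g x)"
  and smooth_const: "smooth (\<lambda>x. c)"
  and smooth_prod: "finite I \<Longrightarrow> (\<And>i. i \<in> I \<Longrightarrow> smooth (h i)) \<Longrightarrow> smooth (\<lambda>x. \<Prod>i\<in>I. h i x)"
  by (auto simp: smooth_def intro: Ck_add Ck_mult Ck_const Ck_prod)

text \<open>The family of all \<open>t\<^sup>-\<^sup>k exp (- c / t)\<close>, extended by zero to \<open>t \<le> 0\<close>, is closed under
  differentiation up to linear combinations.\<close>

definition flat_exp :: "nat \<Rightarrow> real \<Rightarrow> real \<Rightarrow> real" where
  "flat_exp k c t = (if t > 0 then (1 / t) ^ k * exp (- (c / t)) else 0)"

lemma power_div_fact_le_exp: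
  fixes x :: real
  assumes "0 \<le> x"
  shows "x ^ k / fact k \<le> exp x"
proof -
  have "(\<Sum>n\<in>{k}. x ^ n /\<^sub>R fact n) \<le> (\<Sum>n. x ^ n /\<^sub>R fact n)"
    using assms summable_exp_generic[of x] by (intro sum_le_suminf) (auto simp: summable_exp)
  then show ?thesis
    by (simp add: exp_def field_simps)
qed

text \<open>The term of order \<open>k + 2\<close> of the exponential series at \<open>c / t\<close>
  beats the factor \<open>(1 / t) ^ k\<close> and leaves \<open>t\<^sup>2\<close>. One of the two
  spare powers makes the function continuous at 0, the other makes its difference quotient vanish
  there.\<close>

lemma flat_exp_le_square:
  assumes "0 < c"
  shows "\<bar>flat_exp k c t\<bar> \<le> (fact (k + 2) / c ^ (k + 2)) * t\<^sup>2"
proof (cases "t > 0")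
  case True
  have "(c / t) ^ (k + 2) / fact (k + 2) \<le> exp (c / t)"
    using assms True by (intro power_div_fact_le_exp) auto
  then have "(1 / t) ^ k * exp (- (c / t)) \<le> (1 / t) ^ k * (fact (k + 2) / (c / t) ^ (k + 2))"
    using assms True
  proof (intro mult_left_mono)
    assume *: "(c / t) ^ (k + 2) / fact (k + 2) \<le> exp (c / t)"
    have pos: "0 < (c / t) ^ (k + 2) / fact (k + 2)" using assms True by simp
    show "exp (- (c / t)) \<le> fact (k + 2) / (c / t) ^ (k + 2)"
      using le_imp_inverse_le[OF * pos] by (simp only: exp_minus inverse_divide)
  qed auto
  also have "\<dots> = (fact (k + 2) / c ^ (k + 2)) * t\<^sup>2"
    using True assms by (simp add: power_divide power_add field_simps del: fact_Suc) (simp add: power2_eq_square)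
  finally show ?thesis using True by (simp add: flat_exp_def)
qed (use assms in \<open>auto simp: flat_exp_def\<close>)

lemma flat_exp_has_real_derivative:
  assumes "0 < c"
  shows "(flat_exp k c has_real_derivative
      c * flat_exp (k + 2) c t + (- real k) * flat_exp (k + 1) c t) (at t)"
proof -
  consider "t > 0" | "t < 0" | "t = 0" by linarith
  then show ?thesis
  proof cases
    case 1
    have "((\<lambda>t. (1 / t) ^ k) has_real_derivative - real k * (1 / t) ^ (k + 1)) (at t)"
    proof (cases k)
      case (Suc j)
      have "((\<lambda>t. 1 / t) has_real_derivative - ((1 / t)\<^sup>2)) (at t)"
        using 1 by (auto intro!: derivative_eq_intros simp: field_simps power2_eq_square)
      from DERIV_power[OF this, of k] show ?thesis
        by (rule DERIV_cong) (simp add: Suc power2_eq_square mult.assoc del: of_nat_Suc)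
    qed auto
    moreover have "((\<lambda>t. exp (- (c / t))) has_real_derivative c * (1 / t)\<^sup>2 * exp (- (c / t))) (at t)"
      using 1 by (auto intro!: derivative_eq_intros simp: field_simps power2_eq_square)
    ultimately have "((\<lambda>t. (1 / t) ^ k * exp (- (c / t))) has_real_derivative
        c * flat_exp (k + 2) c t + (- real k) * flat_exp (k + 1) c t) (at t)"
      by (rule DERIV_cong[OF DERIV_mult]) (use 1 in \<open>simp add: flat_exp_def algebra_simps power_add power2_eq_square\<close>)
    then show ?thesis
      by (rule DERIV_cong_ev[THEN iffD1, rotated -1])
         (use 1 eventually_nhds_in_open[of "{0<..}" t] in
           \<open>auto simp: flat_exp_def elim!: eventually_mono\<close>)
  next
    case 2
    have "((\<lambda>t. 0) has_real_derivative
        c * flat_exp (k + 2) c t + (- real k) * flat_exp (k + 1) c t) (at t)"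
      using 2 by (auto simp: flat_exp_def)
    then show ?thesis
      by (rule DERIV_cong_ev[THEN iffD1, rotated -1])
         (use 2 eventually_nhds_in_open[of "{..<0}" t] in
           \<open>auto simp: flat_exp_def elim!: eventually_mono\<close>)
  next
    case 3
    \<comment> \<open>At the junction the claimed derivative is 0, and the quadratic bound makes the
      difference quotient at most \<open>K * \<bar>h\<bar>\<close>.\<close>
    define K where "K = fact (k + 2) / c ^ (k + 2)"
    have "((\<lambda>h. K * \<bar>h\<bar>) \<longlongrightarrow> K * \<bar>0\<bar>) (at 0)"
      by (intro tendsto_intros)
    then have K0: "((\<lambda>h. K * \<bar>h\<bar>) \<longlongrightarrow> 0) (at 0)" by simp
    have "((\<lambda>h. (flat_exp k c (0 + h) - flat_exp k c 0) / h) \<longlongrightarrow> 0) (at 0)"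
    proof (rule Lim_null_comparison[OF _ K0], intro always_eventually allI)
      fix h :: real
      have "\<bar>flat_exp k c h\<bar> \<le> K * h\<^sup>2"
        using flat_exp_le_square[OF assms] by (simp add: K_def)
      then show "norm ((flat_exp k c (0 + h) - flat_exp k c 0) / h) \<le> K * \<bar>h\<bar>"
        by (cases "h = 0")
           (auto simp: flat_exp_def[of k c 0] pos_divide_le_eq power2_eq_square mult.assoc abs_mult_self_eq)
    qed
    then show ?thesis
      using 3 by (simp add: DERIV_def flat_exp_def)
  qed
qed

text \<open>Each derivative is a combination of members with larger \<open>k\<close>, so the
  induction on \<open>n\<close> runs over all \<open>k\<close> at once. The affine argument lets the
  same statement serve both faces of a box in every coordinate direction.\<close>

lemma Ck_flat_exp:
  fixes v :: "'a::euclidean_space"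
  assumes "0 < c"
  shows "Ck n (\<lambda>x. flat_exp k c (x \<bullet> v + \<alpha>))"
proof (induction n arbitrary: k)
  case 0
  have "continuous_on UNIV (flat_exp k c)"
    using flat_exp_has_real_derivative[OF assms]
    by (meson DERIV_isCont continuous_at_imp_continuous_on)
  then show ?case
    by (auto intro!: continuous_on_compose2[of UNIV "flat_exp k c"] continuous_intros)
next
  case (Suc n)
  have "((\<lambda>x. flat_exp k c (x \<bullet> v + \<alpha>)) has_derivative
     (\<lambda>h. (c * flat_exp (k + 2) c (x \<bullet> v + \<alpha>) + (- real k) * flat_exp (k + 1) c (x \<bullet> v + \<alpha>)) * (h \<bullet> v)))
     (at x)" for x
    using flat_exp_has_real_derivative[OF assms, THEN has_field_derivative_imp_has_derivative]
    by (rule has_derivative_compose[rotated]) (auto intro!: derivative_eq_intros)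
  then show ?case
    by (rule Ck_SucI) (intro Ck_mult Ck_add Ck_const Suc)
qed

section \<open>Bump functions on boxes\<close>

text \<open>The parameter \<open>c\<close> is not a width: as \<open>c\<close> tends to 0, each
  factor tends to the indicator of an open half space, so the products tend to the indicator of the
  open box. The two kinds of factors belong to the lower and the upper faces.\<close>

definition box_bump :: "real \<Rightarrow> 'a::euclidean_space \<Rightarrow> 'a \<Rightarrow> 'a \<Rightarrow> real" where
  "box_bump c a b x = (\<Prod>i\<in>Basis. flat_exp 0 c (x \<bullet> i + - (a \<bullet> i)) * flat_exp 0 c (x \<bullet> (- i) + b \<bullet> i))"

lemma smooth_box_bump: "0 < c \<Longrightarrow> smooth (box_bump c a b)"
  unfolding box_bump_def
  by (intro smooth_prod smooth_mult) (auto simp only: smooth_def finite_Basis intro!: Ck_flat_exp)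

lemma flat_exp_bounds: "0 < c \<Longrightarrow> 0 \<le> flat_exp 0 c t \<and> flat_exp 0 c t \<le> 1"
  by (auto simp: flat_exp_def)

lemma box_bump_bounds: "0 < c \<Longrightarrow> 0 \<le> box_bump c a b x \<and> box_bump c a b x \<le> 1"
  unfolding box_bump_def
  by (intro conjI prod_nonneg prod_le_1) (auto simp: flat_exp_bounds mult_le_one)

lemma box_bump_outside: "x \<notin> box a b \<Longrightarrow> box_bump c a b x = 0"
proof -
  assume "x \<notin> box a b"
  then obtain i where i: "i \<in> Basis" "\<not> (a \<bullet> i < x \<bullet> i \<and> x \<bullet> i < b \<bullet> i)"
    by (auto simp: mem_box)
  show ?thesis
    unfolding box_bump_def
    by (rule prod_zero) (use i in \<open>auto simp: flat_exp_def intro!: bexI[of _ i]\<close>)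
qed

lemma box_bump_tendsto:
  "(\<lambda>n. box_bump (1 / real (Suc n)) a b x) \<longlonglongrightarrow> indicator (box a b) x"
proof -
  have *: "(\<lambda>n. flat_exp 0 (1 / real (Suc n)) t) \<longlonglongrightarrow> (if t > 0 then 1 else 0)" for t
  proof -
    have "(\<lambda>n. exp (- ((1 / t) * (1 / real (Suc n))))) \<longlonglongrightarrow> exp (- ((1 / t) * 0))"
      by (intro tendsto_intros lim_1_over_n[THEN LIMSEQ_Suc])
    then show ?thesis by (simp add: flat_exp_def mult.commute)
  qed
  have "(\<lambda>n. box_bump (1 / real (Suc n)) a b x) \<longlonglongrightarrow>
     (\<Prod>i\<in>Basis. (if x \<bullet> i + - (a \<bullet> i) > 0 then 1 else 0) * (if x \<bullet> (- i) + b \<bullet> i > 0 then 1 else 0))"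
    unfolding box_bump_def by (intro tendsto_prod tendsto_mult *)
  also have "(\<Prod>i\<in>Basis. (if x \<bullet> i + - (a \<bullet> i) > 0 then 1 else 0) * (if x \<bullet> (- i) + b \<bullet> i > 0 then 1 else 0)) =
     (indicator (box a b) x :: real)"
  proof (cases "x \<in> box a b")
    case True
    then show ?thesis by (auto simp: mem_box intro!: prod.neutral)
  next
    case False
    then obtain i where i: "i \<in> Basis" "\<not> (a \<bullet> i < x \<bullet> i \<and> x \<bullet> i < b \<bullet> i)"
      by (auto simp: mem_box)
    have "(\<Prod>i\<in>Basis. (if x \<bullet> i + - (a \<bullet> i) > 0 then 1 else 0) *
        (if x \<bullet> (- i) + b \<bullet> i > 0 then 1 else (0::real))) = 0"
      by (rule prod_zero) (use i in \<open>auto intro!: bexI[of _ i]\<close>)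
    then show ?thesis using False by simp
  qed
  finally show ?thesis .
qed

lemma box_bump_test_function:
  assumes "0 < c" "cbox a b \<subseteq> \<Omega>"
  shows "box_bump c a b \<in> test_functions \<Omega>"
proof -
  have "{x. box_bump c a b x \<noteq> 0} \<subseteq> cbox a b"
    using box_bump_outside box_subset_cbox by blast
  then have "closure {x. box_bump c a b x \<noteq> 0} \<subseteq> cbox a b"
    by (intro closure_minimal) auto
  then show ?thesis
    using assms unfolding test_functions_def
    by (auto simp: smooth_box_bump compact_closure intro: bounded_subset[OF bounded_cbox] closure_subset[THEN subsetD])
qed

lemma compact_closed_subset:
  "compact K \<Longrightarrow> closure A \<subseteq> K \<Longrightarrow> compact (closure A)"
  by (metis closed_closure compact_Int_closed inf.absorb_iff2)

subsection \<open>Gradients of test functions\<close>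

text \<open>A vector instead of the linear map \<open>frechet_derivative\<close>, so that classical
  and weak gradients are objects of the same type.\<close>

definition grad :: "('a::euclidean_space \<Rightarrow> real) \<Rightarrow> 'a \<Rightarrow> 'a" where
  "grad \<phi> x = (\<Sum>i\<in>Basis. frechet_derivative \<phi> (at x) i *\<^sub>R i)"

lemma smooth_has_derivative:
  assumes "smooth \<phi>"
  shows "(\<phi> has_derivative (\<lambda>h. grad \<phi> x \<bullet> h)) (at x)"
proof -
  have *: "(\<phi> has_derivative frechet_derivative \<phi> (at x)) (at x)"
    using assms unfolding smooth_def by (intro Ck_Suc_has_derivative[of 0]) auto
  then interpret bounded_linear "frechet_derivative \<phi> (at x)"
    by (rule has_derivative_bounded_linear)
  have "frechet_derivative \<phi> (at x) = (\<lambda>h. grad \<phi> x \<bullet> h)"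
  proof
    fix h
    have "frechet_derivative \<phi> (at x) h = frechet_derivative \<phi> (at x) (\<Sum>i\<in>Basis. (h \<bullet> i) *\<^sub>R i)"
      by (simp add: euclidean_representation)
    also have "\<dots> = grad \<phi> x \<bullet> h"
      by (simp add: grad_def sum scaleR inner_sum_left inner_commute[of h] mult.commute)
    finally show "frechet_derivative \<phi> (at x) h = grad \<phi> x \<bullet> h" .
  qed
  with * show ?thesis by simp
qed

lemma has_derivative_imp_grad_eq:
  assumes "(\<phi> has_derivative (\<lambda>h. g \<bullet> h)) (at x)"
  shows "grad \<phi> x = g"
  using frechet_derivative_at[OF assms]
  by (metis (no_types, lifting) grad_def euclidean_representation sum.cong)

lemma frechet_derivative_eq_grad:
  "smooth \<phi> \<Longrightarrow> frechet_derivative \<phi> (at x) i = grad \<phi> x \<bullet> i"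
  using frechet_derivative_at[OF smooth_has_derivative] by metis

lemma grad_add: "smooth \<phi> \<Longrightarrow> smooth \<psi> \<Longrightarrow> grad (\<lambda>x. \<phi> x + \<psi> x) x = grad \<phi> x + grad \<psi> x"
  by (intro has_derivative_imp_grad_eq)
     (auto intro!: derivative_eq_intros smooth_has_derivative simp: inner_add_left)

lemma grad_cmult: "smooth \<phi> \<Longrightarrow> grad (\<lambda>x. c * \<phi> x) x = c *\<^sub>R grad \<phi> x"
  by (intro has_derivative_imp_grad_eq)
     (auto intro!: derivative_eq_intros smooth_has_derivative)

lemma smooth_continuous_on: "smooth \<phi> \<Longrightarrow> continuous_on S \<phi>"
  by (metis Ck.simps(1) continuous_on_subset smooth_def top_greatest)

lemma smooth_frechet:
  assumes "smooth \<phi>" "i \<in> Basis"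
  shows "smooth (\<lambda>x. grad \<phi> x \<bullet> i)"
  unfolding smooth_def
proof
  fix k
  have "Ck (Suc k) \<phi>" using assms by (simp add: smooth_def del: Ck.simps)
  then show "Ck k (\<lambda>x. grad \<phi> x \<bullet> i)"
    using assms by (simp add: frechet_derivative_eq_grad)
qed

lemma smooth_continuous_on_grad: "smooth \<phi> \<Longrightarrow> continuous_on S (grad \<phi>)"
  unfolding continuous_on_componentwise[of S "grad \<phi>"]
  by (auto intro: smooth_continuous_on smooth_frechet)

lemma grad_outside_support:
  assumes "x \<notin> closure {x. \<phi> x \<noteq> 0}"
  shows "grad \<phi> x = 0"
proof (rule has_derivative_imp_grad_eq)
  have "((\<lambda>x. 0) has_derivative (\<lambda>h. 0 \<bullet> h)) (at x)"
    by (auto intro!: derivative_eq_intros)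
  then show "(\<phi> has_derivative (\<lambda>h. 0 \<bullet> h)) (at x)"
    by (rule has_derivative_transform_within_open[where s="- closure {x. \<phi> x \<noteq> 0}"])
       (use assms closure_subset[of "{x. \<phi> x \<noteq> 0}"] in auto)
qed

lemma test_function_zero: "(\<lambda>x. 0) \<in> test_functions \<Omega>"
  by (simp add: test_functions_def smooth_const)

lemma test_function_add:
  assumes "\<phi> \<in> test_functions \<Omega>" "\<psi> \<in> test_functions \<Omega>"
  shows "(\<lambda>x. \<phi> x + \<psi> x) \<in> test_functions \<Omega>"
proof -
  let ?K = "closure {x. \<phi> x \<noteq> 0} \<union> closure {x. \<psi> x \<noteq> 0}"
  have "compact ?K" "?K \<subseteq> \<Omega>" using assms by (auto simp: test_functions_def)
  moreover have "closure {x. \<phi> x + \<psi> x \<noteq> 0} \<subseteq> ?K"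
    unfolding closure_Un[symmetric] by (rule closure_mono) auto
  ultimately show ?thesis
    using assms unfolding test_functions_def
    by (auto simp: smooth_add simp del: compact_closure intro: compact_closed_subset)
qed

lemma test_function_mult:
  assumes "\<phi> \<in> test_functions \<Omega>" "smooth \<psi>"
  shows "(\<lambda>x. \<psi> x * \<phi> x) \<in> test_functions \<Omega>"
proof -
  let ?K = "closure {x. \<phi> x \<noteq> 0}"
  have "compact ?K" "?K \<subseteq> \<Omega>" using assms by (auto simp: test_functions_def)
  moreover have "closure {x. \<psi> x * \<phi> x \<noteq> 0} \<subseteq> ?K"
    by (intro closure_mono) auto
  ultimately show ?thesis
    using assms unfolding test_functions_def
    by (auto simp: smooth_mult simp del: compact_closure intro: compact_closed_subset)
qed

lemma test_function_cmult: "\<phi> \<in> test_functions \<Omega> \<Longrightarrow> (\<lambda>x. c * \<phi> x) \<in> test_functions \<Omega>"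
  by (rule test_function_mult[OF _ smooth_const])

text \<open>Both claims go through one induction, because the gradient of a sum may be split only
  once the partial sum is known to be smooth. The Galerkin functions have this form.\<close>

lemma test_function_sum:
  fixes \<phi> :: "'i \<Rightarrow> 'a::euclidean_space \<Rightarrow> real"
  assumes "finite I" "\<And>i. i \<in> I \<Longrightarrow> \<phi> i \<in> test_functions \<Omega>"
  shows "(\<lambda>x. \<Sum>i\<in>I. c i * \<phi> i x) \<in> test_functions \<Omega> \<and>
    (\<forall>x. grad (\<lambda>x. \<Sum>i\<in>I. c i * \<phi> i x) x = (\<Sum>i\<in>I. c i *\<^sub>R grad (\<phi> i) x))"
  using assms
proof (induction I rule: finite_induct)
  case empty
  have "grad (\<lambda>x. 0) y = 0" for y :: 'a
    by (rule has_derivative_imp_grad_eq) (auto intro!: derivative_eq_intros)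
  then show ?case by (auto simp: test_function_zero)
next
  case (insert j I)
  then have *: "\<phi> j \<in> test_functions \<Omega>" "(\<lambda>x. \<Sum>i\<in>I. c i * \<phi> i x) \<in> test_functions \<Omega>" by auto
  then have "smooth (\<phi> j)" "smooth (\<lambda>x. c j * \<phi> j x)" "smooth (\<lambda>x. \<Sum>i\<in>I. c i * \<phi> i x)"
    by (auto simp: test_functions_def intro: smooth_mult smooth_const)
  then show ?case
    using insert * test_function_add[OF test_function_cmult[OF *(1), of "c j"] *(2)]
    by (simp add: grad_add grad_cmult)
qed

lemma
  assumes "\<phi> \<in> test_functions \<Omega>"
  shows test_function_smooth: "smooth \<phi>"
    and test_function_outside: "x \<notin> \<Omega> \<Longrightarrow> \<phi> x = 0"
    and test_grad_outside: "x \<notin> \<Omega> \<Longrightarrow> grad \<phi> x = 0"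
    and test_function_bounded: "\<exists>B. \<forall>x. \<bar>\<phi> x\<bar> \<le> B"
    and test_grad_bounded: "\<exists>B. \<forall>x. norm (grad \<phi> x) \<le> B"
proof -
  let ?K = "closure {x. \<phi> x \<noteq> 0}"
  have K: "compact ?K" "?K \<subseteq> \<Omega>" and sm: "smooth \<phi>" using assms by (auto simp: test_functions_def)
  have *: "\<phi> x = 0" "grad \<phi> x = 0" if "x \<notin> ?K" for x
    using that grad_outside_support[OF that] closure_subset[of "{x. \<phi> x \<noteq> 0}"] by auto
  show "smooth \<phi>" "x \<notin> \<Omega> \<Longrightarrow> \<phi> x = 0" "x \<notin> \<Omega> \<Longrightarrow> grad \<phi> x = 0" using *[of x] K(2) sm by auto
  have "bounded (\<phi> ` ?K)" "bounded (grad \<phi> ` ?K)"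
    using K sm by (auto intro!: compact_imp_bounded compact_continuous_image
        smooth_continuous_on smooth_continuous_on_grad)
  then obtain B C where "\<forall>x\<in>?K. norm (\<phi> x) \<le> B" "\<forall>x\<in>?K. norm (grad \<phi> x) \<le> C"
    unfolding bounded_iff by (auto simp del: real_norm_def)
  then have "\<bar>\<phi> x\<bar> \<le> \<bar>B\<bar>" "norm (grad \<phi> x) \<le> \<bar>C\<bar>" for x
    using *[of x] by (cases "x \<in> ?K"; fastforce)+
  then show "\<exists>B. \<forall>x. \<bar>\<phi> x\<bar> \<le> B" "\<exists>B. \<forall>x. norm (grad \<phi> x) \<le> B" by blast+
qed

subsection \<open>The fundamental lemma of the calculus of variations\<close>

text \<open>Dynkin's argument: boxes are stable under intersection and generate the Borel sets, and
  the sets over which \<open>H\<close> integrates to 0 are closed under countable disjoint unions;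
  \<open>total\<close> supplies closure under complements.\<close>

lemma AE_eq_0_if_box_integrals_eq_0:
  fixes H :: "'a::euclidean_space \<Rightarrow> real"
  assumes int: "integrable lborel H"
    and total: "(LINT x|lborel. H x) = 0"
    and box: "\<And>a b. (LINT x:box a b|lborel. H x) = 0"
  shows "AE x in lborel. H x = 0"
proof -
  have si: "set_integrable lborel A H" if "A \<in> sets borel" for A
    unfolding set_integrable_def using int that by (intro integrable_mult_indicator) auto
  have *: "(LINT x:A|lborel. H x) = 0" if A: "A \<in> sets borel" for A
  proof -
    have "Int_stable  (range (\<lambda>(a, b). box a b :: 'a set))"
      by (auto simp: Int_stable_def box_Int_box)
    moreover have "(range (\<lambda>(a, b). box a b :: 'a set)) \<subseteq> Pow UNIV"
      by auto
    moreover have "A \<in> sigma_sets UNIV (range (\<lambda>(a, b). box a b))"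
      using A unfolding borel_eq_box by simp
    ultimately show ?thesis
    proof (induction rule: sigma_sets_induct_disjoint)
      case (basic A) then show ?case by (auto simp: box)
    next
      case empty then show ?case by (simp add: set_lebesgue_integral_def)
    next
      case (compl A)
      then have [measurable]: "A \<in> sets borel" by (simp add: borel_eq_box)
      have "(LINT x:UNIV - A|lborel. H x) = (LINT x|lborel. H x) - (LINT x:A|lborel. H x)"
      proof -
        have "(LINT x:UNIV - A|lborel. H x) = (LINT x|lborel. H x - indicator A x *\<^sub>R H x)"
          unfolding set_lebesgue_integral_def
          by (rule Bochner_Integration.integral_cong) (auto simp: indicator_def)
        then show ?thesis
          using int si[of A] by (simp add: set_integrable_def set_lebesgue_integral_def)
      qed
      then show ?case using total compl by simp
    next
      case (union f)
      then have [measurable]: "\<And>i. f i \<in> sets borel"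
        unfolding borel_eq_box by (simp add: image_subset_iff)
      have "(LINT x:(\<Union>i. f i)|lborel. H x) = (\<Sum>i. LINT x:f i|lborel. H x)"
        using union by (intro lebesgue_integral_countable_add si) (auto simp: disjoint_family_on_def)
      then show ?case using union by simp
    qed
  qed
  show ?thesis
    using int * by (intro density_unique_real[where f'="\<lambda>x. 0"]) auto
qed

text \<open>A bridge between integrals over \<Omega>, in which the weak formulation is written, and
  integrability on compact subsets, which is what \<open>has_weak_gradient\<close> provides.\<close>

lemma integrable_lebesgue_on_subset_support:
  fixes F :: "'a::euclidean_space \<Rightarrow> 'b::euclidean_space"
  assumes "open \<Omega>" "K \<subseteq> \<Omega>" "compact K" "\<And>x. x \<in> \<Omega> \<Longrightarrow> x \<notin> K \<Longrightarrow> F x = 0"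
  shows "integrable (lebesgue_on \<Omega>) F \<longleftrightarrow> F absolutely_integrable_on K"
    and "(LINT x|lebesgue_on \<Omega>. F x) = (LINT x:K|lebesgue. F x)"
proof -
  have "indicator \<Omega> x *\<^sub>R F x = indicator K x *\<^sub>R F x" for x
    using assms by (auto simp: indicator_def)
  moreover have "\<Omega> \<in> sets lebesgue" using assms(1) by auto
  ultimately show "integrable (lebesgue_on \<Omega>) F \<longleftrightarrow> F absolutely_integrable_on K"
    "(LINT x|lebesgue_on \<Omega>. F x) = (LINT x:K|lebesgue. F x)"
    by (simp_all only: integrable_restrict_space integral_restrict_space set_integrable_def
        set_lebesgue_integral_def space_completion space_lborel space_borel Int_UNIV_right)
qed

lemma absolutely_integrable_continuous_on_compact:
  fixes f :: "'a::euclidean_space \<Rightarrow> 'b::euclidean_space"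
  assumes "compact K" "continuous_on K f"
  shows "f absolutely_integrable_on K"
proof -
  have "integrable lborel (\<lambda>x. indicator K x *\<^sub>R f x)"
    using assms by (rule borel_integrable_compact)
  then show ?thesis
    unfolding set_integrable_def by (subst integrable_completion) auto
qed

lemma absolutely_integrable_mult_continuous:
  fixes G \<phi> :: "'a::euclidean_space \<Rightarrow> real"
  assumes "G absolutely_integrable_on K" "compact K" "continuous_on K \<phi>"
  shows "(\<lambda>x. G x * \<phi> x) absolutely_integrable_on K"
proof -
  have "(\<lambda>x. \<phi> x * G x) absolutely_integrable_on K"
    using assms
    by (intro absolutely_integrable_bounded_measurable_product[OF bilinear_times])
       (auto intro: continuous_imp_measurable_on_sets_lebesgue compact_imp_bounded compact_continuous_image
         lmeasurable_compact fmeasurableD simp: measurable_on_iff_borel_measurable)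
  then show ?thesis by (simp add: mult.commute)
qed

text \<open>Box bumps with \<open>c\<close> tending to 0 turn the hypothesis into vanishing
  integrals over boxes. As \<open>G\<close> is only locally integrable, the measure theoretic
  argument is run inside one closed box at a time.\<close>

lemma fundamental_lemma:
  fixes G :: "'a::euclidean_space \<Rightarrow> real"
  assumes op: "open \<Omega>"
    and loc: "\<And>K. compact K \<Longrightarrow> K \<subseteq> \<Omega> \<Longrightarrow> G absolutely_integrable_on K"
    and zero: "\<And>\<phi>. \<phi> \<in> test_functions \<Omega> \<Longrightarrow> (LINT x|lebesgue_on \<Omega>. G x * \<phi> x) = 0"
  shows "AE x in lebesgue_on \<Omega>. G x = 0"
proof -
  have box0: "(LINT x:box a b|lebesgue. G x) = 0" if ab: "cbox a b \<subseteq> \<Omega>" for a b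
  proof -
    let ?\<phi> = "\<lambda>n. box_bump (1 / real (Suc n)) a b"
    have G: "G absolutely_integrable_on cbox a b" using loc ab by auto
    have tf: "?\<phi> n \<in> test_functions \<Omega>" for n by (intro box_bump_test_function ab) auto
    have "(LINT x|lebesgue_on \<Omega>. G x * ?\<phi> n x) = (LINT x:cbox a b|lebesgue. G x * ?\<phi> n x)" for n
    proof (rule integrable_lebesgue_on_subset_support(2)[OF op ab compact_cbox])
      fix x assume "x \<notin> cbox a b"
      then have "x \<notin> box a b" using box_subset_cbox[of a b] by blast
      then show "G x * ?\<phi> n x = 0" by (simp add: box_bump_outside)
    qed
    then have z: "(LINT x:cbox a b|lebesgue. G x * ?\<phi> n x) = 0" for n
      using zero[OF tf] by simp
    have ai: "(\<lambda>x. G x * ?\<phi> n x) absolutely_integrable_on cbox a b" for n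
      using tf[of n] by (intro absolutely_integrable_mult_continuous G)
        (auto intro: smooth_continuous_on test_function_smooth)
    have "(\<lambda>n. LINT x:cbox a b|lebesgue. G x * ?\<phi> n x) \<longlonglongrightarrow> (LINT x:box a b|lebesgue. G x)"
      unfolding set_lebesgue_integral_def
    proof (rule integral_dominated_convergence[where w="\<lambda>x. norm (indicator (cbox a b) x *\<^sub>R G x)"])
      show "(\<lambda>x. indicator (box a b) x *\<^sub>R G x) \<in> borel_measurable lebesgue"
        using set_integrable_subset[OF G, of "box a b"] box_subset_cbox[of a b]
        unfolding set_integrable_def by (intro borel_measurable_integrable) auto
      show "(\<lambda>x. indicator (cbox a b) x *\<^sub>R (G x * ?\<phi> n x)) \<in> borel_measurable lebesgue" for n
        using ai[of n] by (auto simp: set_integrable_def)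
      show "integrable lebesgue (\<lambda>x. norm (indicator (cbox a b) x *\<^sub>R G x))"
        using G unfolding set_integrable_def by (rule integrable_norm)
      show "AE x in lebesgue. (\<lambda>n. indicator (cbox a b) x *\<^sub>R (G x * ?\<phi> n x))
          \<longlonglongrightarrow> indicator (box a b) x *\<^sub>R G x"
      proof (intro always_eventually allI)
        fix x
        have "(\<lambda>n. indicator (cbox a b) x * (G x * ?\<phi> n x))
          \<longlonglongrightarrow> indicator (cbox a b) x * (G x * indicator (box a b) x)"
          by (intro tendsto_intros box_bump_tendsto)
        moreover have "indicator (cbox a b) x * (G x * indicator (box a b) x) = indicator (box a b) x * G x"
          using box_subset_cbox[of a b] by (auto simp: indicator_def)
        ultimately show "(\<lambda>n. indicator (cbox a b) x *\<^sub>R (G x * ?\<phi> n x))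
          \<longlonglongrightarrow> indicator (box a b) x *\<^sub>R G x" by simp
      qed
      show "AE x in lebesgue. norm (indicator (cbox a b) x *\<^sub>R (G x * ?\<phi> n x))
         \<le> norm (indicator (cbox a b) x *\<^sub>R G x)" for n
        using box_bump_bounds[of "1 / real (Suc n)" a b]
        by (intro always_eventually allI) (auto simp: indicator_def abs_mult intro!: mult_left_le)
    qed
    then show ?thesis using z by (simp add: LIMSEQ_const_iff)
  qed
  have AEbox: "AE x in lebesgue. x \<in> box u v \<longrightarrow> G x = 0" if uv: "cbox u v \<subseteq> \<Omega>" for u v
  proof -
    let ?H = "\<lambda>x. indicator (box u v) x * G x"
    have "G absolutely_integrable_on box u v"
      by (rule set_integrable_subset[OF loc[OF compact_cbox uv]]) (auto simp: box_subset_cbox)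
    then have Hint: "integrable lebesgue ?H" by (simp add: set_integrable_def)
    \<comment> \<open>\<open>G\<close> is only Lebesgue measurable, whereas the box criterion is
      stated for \<open>lborel\<close>; hence the Borel representative.\<close>
    then obtain H where H: "H \<in> borel_measurable lborel" "AE x in lborel. ?H x = H x"
      using completion_ex_borel_measurable_real by blast
    then have AE: "AE x in lebesgue. ?H x = H x" by (simp add: AE_completion)
    have Hm: "H \<in> borel_measurable lebesgue" using H(1) by (rule measurable_completion)
    have "integrable lebesgue H"
      using Hint AE Hm by (subst integrable_cong_AE[symmetric, of ?H]) auto
    then have Hi: "integrable lborel H" using H(1) by (simp add: integrable_completion)
    have HA: "(LINT x:A|lborel. H x) = (LINT x|lebesgue. indicator A x * ?H x)" if A: "A \<in> sets borel" for A
    proof -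
      have "(LINT x:A|lborel. H x) = (LINT x|lebesgue. indicator A x * H x)"
        using H(1) A by (simp add: set_lebesgue_integral_def integral_completion)
      also have "\<dots> = (LINT x|lebesgue. indicator A x * ?H x)"
      proof (intro integral_cong_AE)
        have "A \<in> sets lebesgue" using A by auto
        then have "(indicator A :: 'a \<Rightarrow> real) \<in> borel_measurable lebesgue"
          by (rule borel_measurable_indicator)
        then show "(\<lambda>x. indicator A x * H x) \<in> borel_measurable lebesgue"
          "(\<lambda>x. indicator A x * ?H x) \<in> borel_measurable lebesgue"
          using Hm borel_measurable_integrable[OF Hint] by (auto intro: borel_measurable_times)
        show "AE x in lebesgue. indicator A x * H x = indicator A x * ?H x"
          using AE by eventually_elim simp
      qed
      finally show ?thesis .
    qed
    have bx: "(LINT x:box a b|lborel. H x) = 0" for a b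
    proof -
      obtain c d where cd: "box a b \<inter> box u v = box c d" using box_Int_box[of a b u v] by blast
      have eq: "indicator (box a b) x * ?H x = indicator (box c d) x *\<^sub>R G x" for x
        unfolding cd[symmetric] by (simp add: indicator_inter_arith)
      show ?thesis
      \<comment> \<open>If the open box is empty, the closed box with the same corners need not lie
        in \<Omega>, so this case is separate.\<close>
      proof (cases "box c d = {}")
        case True
        then show ?thesis by (simp add: HA eq)
      next
        case False
        have "cbox c d = closure (box c d)" using False closure_box by auto
        also have "\<dots> \<subseteq> closure (box u v)" using cd by (intro closure_mono) auto
        also have "\<dots> \<subseteq> cbox u v" by (intro closure_minimal box_subset_cbox) auto
        finally show ?thesis
          using box0[of c d] uv HA[of "box a b"] unfolding eq by (simp add: set_lebesgue_integral_def)
      qed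
    qed
    have "(LINT x|lborel. H x) = (LINT x:UNIV|lborel. H x)" by (simp add: set_lebesgue_integral_def)
    also have "\<dots> = (LINT x|lebesgue. indicator (box u v) x * ?H x)"
      by (subst HA) (auto simp: indicator_def intro!: Bochner_Integration.integral_cong)
    also have "\<dots> = 0" using HA[of "box u v"] bx by simp
    finally have "AE x in lborel. H x = 0"
      by (intro AE_eq_0_if_box_integrals_eq_0 Hi bx)
    then have "AE x in lebesgue. H x = 0" by (rule AE_completion)
    with AE show ?thesis by eventually_elim (auto simp: indicator_def split: if_splits)
  qed
  \<comment> \<open>\<Omega> is a countable union of closed boxes, and the boundary of each is
    negligible, so the open boxes suffice.\<close>
  obtain \<D> where D: "countable \<D>" "\<D> \<subseteq> Pow \<Omega>" "\<And>X. X \<in> \<D> \<Longrightarrow> \<exists>a b. X = cbox a b" "\<Union>\<D> = \<Omega>"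
    using open_countable_Union_open_cbox[OF op] by metis
  have "AE x in lebesgue. x \<in> X \<longrightarrow> G x = 0" if XD: "X \<in> \<D>" for X
  proof -
    obtain u v where X: "X = cbox u v" using D(3)[OF XD] by auto
    have "negligible (cbox u v - box u v)" by (rule negligible_frontier_interval)
    then have "AE x in lebesgue. x \<notin> cbox u v - box u v"
      using negligible_iff_null_sets AE_not_in by blast
    moreover have "AE x in lebesgue. x \<in> box u v \<longrightarrow> G x = 0"
      using D that X by (intro AEbox) auto
    ultimately show ?thesis by eventually_elim (auto simp: X)
  qed
  then have "AE x in lebesgue. \<forall>X\<in>\<D>. x \<in> X \<longrightarrow> G x = 0"
    by (subst AE_ball_countable[OF D(1)]) blast
  then have "AE x in lebesgue. x \<in> \<Omega> \<longrightarrow> G x = 0"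
    by eventually_elim (use D(4) in blast)
  then show ?thesis
    using op by (subst AE_restrict_space_iff) auto
qed

lemma has_weak_gradient_test_integrable:
  fixes u \<phi> :: "'a::euclidean_space \<Rightarrow> real"
  assumes "open \<Omega>" "has_weak_gradient \<Omega> u g" "\<phi> \<in> test_functions \<Omega>" "i \<in> Basis"
  shows "integrable (lebesgue_on \<Omega>) (\<lambda>x. u x * (grad \<phi> x \<bullet> i))"
    and "integrable (lebesgue_on \<Omega>) (\<lambda>x. (g x \<bullet> i) * \<phi> x)"
proof -
  let ?K = "closure {x. \<phi> x \<noteq> 0}"
  have K: "compact ?K" "?K \<subseteq> \<Omega>" and sm: "smooth \<phi>"
    using assms(3) by (auto simp: test_functions_def)
  have ai: "u absolutely_integrable_on ?K" "g absolutely_integrable_on ?K"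
    using conjunct1[OF assms(2)[unfolded has_weak_gradient_def], rule_format, OF conjI[OF K]] by auto
  have gi: "(\<lambda>x. g x \<bullet> i) absolutely_integrable_on ?K"
    using ai(2) by (rule absolutely_integrable_component)
  have 1: "(\<lambda>x. u x * (grad \<phi> x \<bullet> i)) absolutely_integrable_on ?K"
    by (rule absolutely_integrable_mult_continuous[OF ai(1) K(1)])
       (intro continuous_intros smooth_continuous_on_grad sm)
  have 2: "(\<lambda>x. (g x \<bullet> i) * \<phi> x) absolutely_integrable_on ?K"
    by (rule absolutely_integrable_mult_continuous[OF gi K(1) smooth_continuous_on[OF sm]])
  have \<phi>0: "\<phi> x = 0" if "x \<notin> ?K" for x
    using that closure_subset[of "{x. \<phi> x \<noteq> 0}"] by blast
  have grad0: "grad \<phi> x = 0" if "x \<notin> ?K" for x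
    using that by (rule grad_outside_support)
  show "integrable (lebesgue_on \<Omega>) (\<lambda>x. u x * (grad \<phi> x \<bullet> i))"
  proof (rule iffD2[OF integrable_lebesgue_on_subset_support(1)[OF assms(1) K(2) K(1)]])
    show "u x * (grad \<phi> x \<bullet> i) = 0" if "x \<notin> ?K" for x
      unfolding grad0[OF that] by simp
  qed (rule 1)
  show "integrable (lebesgue_on \<Omega>) (\<lambda>x. (g x \<bullet> i) * \<phi> x)"
  proof (rule iffD2[OF integrable_lebesgue_on_subset_support(1)[OF assms(1) K(2) K(1)]])
    show "(g x \<bullet> i) * \<phi> x = 0" if "x \<notin> ?K" for x
      unfolding \<phi>0[OF that] by simp
  qed (rule 2)
qed

lemma has_weak_gradient_diff:
  assumes "open \<Omega>" "has_weak_gradient \<Omega> u g" "has_weak_gradient \<Omega> v h"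
  shows "has_weak_gradient \<Omega> (\<lambda>x. u x - v x) (\<lambda>x. g x - h x)"
  unfolding has_weak_gradient_def
proof (intro conjI allI impI ballI)
  fix K assume "compact K \<and> K \<subseteq> \<Omega>"
  then have *: "u absolutely_integrable_on K" "g absolutely_integrable_on K"
    "v absolutely_integrable_on K" "h absolutely_integrable_on K"
    using assms(2,3) unfolding has_weak_gradient_def by metis+
  show "(\<lambda>x. u x - v x) absolutely_integrable_on K" by (rule set_integral_diff(1)[OF *(1,3)])
  show "(\<lambda>x. g x - h x) absolutely_integrable_on K" by (rule set_integral_diff(1)[OF *(2,4)])
next
  fix \<phi> and i :: 'a assume \<phi>: "\<phi> \<in> test_functions \<Omega>" and i: "i \<in> Basis"
  note I = has_weak_gradient_test_integrable[OF assms(1,2) \<phi> i] has_weak_gradient_test_integrable[OF assms(1,3) \<phi> i]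
  have fd: "frechet_derivative \<phi> (at x) i = grad \<phi> x \<bullet> i" for x
    by (rule frechet_derivative_eq_grad[OF test_function_smooth[OF \<phi>]])
  show "(LINT x|lebesgue_on \<Omega>. (u x - v x) * frechet_derivative \<phi> (at x) i) =
           - (LINT x|lebesgue_on \<Omega>. (g x - h x) \<bullet> i * \<phi> x)"
    using bspec[OF bspec[OF conjunct2[OF assms(2)[unfolded has_weak_gradient_def]] \<phi>] i]
      bspec[OF bspec[OF conjunct2[OF assms(3)[unfolded has_weak_gradient_def]] \<phi>] i] I
    by (simp add: left_diff_distrib inner_diff_left fd)
qed

text \<open>Linearity reduces uniqueness to weak gradients of the zero function, whose components
  satisfy the hypotheses of the fundamental lemma.\<close>

lemma has_weak_gradient_unique:
  assumes "open \<Omega>" "has_weak_gradient \<Omega> u g" "has_weak_gradient \<Omega> u h"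
  shows "AE x in lebesgue_on \<Omega>. g x = h x"
proof -
  have w: "has_weak_gradient \<Omega> (\<lambda>x. 0) (\<lambda>x. g x - h x)"
    using has_weak_gradient_diff[OF assms] by simp
  have "AE x in lebesgue_on \<Omega>. (g x - h x) \<bullet> i = 0" if i: "i \<in> Basis" for i
  proof (rule fundamental_lemma[OF assms(1)])
    show "(\<lambda>x. (g x - h x) \<bullet> i) absolutely_integrable_on K" if "compact K" "K \<subseteq> \<Omega>" for K
      using w that unfolding has_weak_gradient_def by (intro absolutely_integrable_component) blast
    show "(LINT x|lebesgue_on \<Omega>. (g x - h x) \<bullet> i * \<phi> x) = 0" if "\<phi> \<in> test_functions \<Omega>" for \<phi>
      using bspec[OF bspec[OF conjunct2[OF w[unfolded has_weak_gradient_def]] that] i] by simp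
  qed
  then have "AE x in lebesgue_on \<Omega>. \<forall>i\<in>Basis. (g x - h x) \<bullet> i = 0"
    by (simp add: AE_finite_all)
  then show ?thesis
  proof eventually_elim
    case (elim x)
    then show ?case using euclidean_all_zero_iff[of "g x - h x"] by simp
  qed
qed

lemma has_weak_gradient_wgrad: "has_weak_gradient \<Omega> u g \<Longrightarrow> has_weak_gradient \<Omega> u (wgrad \<Omega> u)"
  unfolding wgrad_def by (rule someI[of "has_weak_gradient \<Omega> u"])

text \<open>Makes the arbitrary choice in \<open>wgrad\<close> harmless: any weak gradient found by
  other means may replace it almost everywhere.\<close>

lemma wgrad_eq:
  "open \<Omega> \<Longrightarrow> has_weak_gradient \<Omega> u g \<Longrightarrow> AE x in lebesgue_on \<Omega>. wgrad \<Omega> u x = g x"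
  by (rule has_weak_gradient_unique[OF _ has_weak_gradient_wgrad])

subsection \<open>Integration by parts\<close>

lemma onorm_inner_le: "onorm (\<lambda>h. g \<bullet> h) \<le> norm g"
  for g :: "'a::euclidean_space"
  by (rule onorm_le) (simp add: Cauchy_Schwarz_ineq2)

lemma smooth_lipschitz:
  assumes "smooth \<phi>" "\<And>x. norm (grad \<phi> x) \<le> B"
  shows "\<bar>\<phi> x - \<phi> y\<bar> \<le> B * norm (x - y)"
  using differentiable_bound[of UNIV \<phi> "\<lambda>x h. grad \<phi> x \<bullet> h" B x y] assms smooth_has_derivative[OF assms(1)]
    order_trans[OF onorm_inner_le] by auto

lemma lborel_integral_translation:
  fixes f :: "'a::euclidean_space \<Rightarrow> real"
  assumes [measurable]: "f \<in> borel_measurable borel"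
  shows "(LINT x|lborel. f (x + z)) = (LINT x|lborel. f x)"
    and "integrable lborel (\<lambda>x. f (x + z)) \<longleftrightarrow> integrable lborel f"
proof -
  have "(LINT x|lborel. f x) = (LINT x|distr lborel borel ((+) z). f x)"
    by (simp add: lborel_distr_plus)
  also have "\<dots> = (LINT x|lborel. f (x + z))" by (subst integral_distr) (auto simp: add.commute)
  finally show "(LINT x|lborel. f (x + z)) = (LINT x|lborel. f x)" by simp
  have "integrable lborel f \<longleftrightarrow> integrable (distr lborel borel ((+) z)) f"
    by (simp add: lborel_distr_plus)
  also have "\<dots> \<longleftrightarrow> integrable lborel (\<lambda>x. f (x + z))" by (subst integrable_distr_eq) (auto simp: add.commute)
  finally show "integrable lborel (\<lambda>x. f (x + z)) \<longleftrightarrow> integrable lborel f" by simp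
qed

lemma integrable_continuous_compact_support:
  fixes f :: "'a::euclidean_space \<Rightarrow> 'b::euclidean_space"
  assumes "continuous_on UNIV f" "bounded S" "\<And>x. x \<notin> S \<Longrightarrow> f x = 0"
  shows "integrable lborel f"
proof -
  have "integrable lborel (\<lambda>x. indicator (closure S) x *\<^sub>R f x)"
    using assms by (intro borel_integrable_compact) (auto intro: continuous_on_subset)
  also have "(\<lambda>x. indicator (closure S) x *\<^sub>R f x) = f"
    using assms closure_subset by (fastforce simp: indicator_def)
  finally show ?thesis .
qed

text \<open>Difference quotients of a compactly supported function integrate to 0 by translation
  invariance, and the limit may be taken under the integral.\<close>

lemma integral_grad_eq_0:
  fixes \<phi> :: "'a::euclidean_space \<Rightarrow> real"
  assumes "\<phi> \<in> test_functions UNIV" "norm i = 1"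
  shows "(LINT x|lborel. grad \<phi> x \<bullet> i) = 0"
proof -
  have sm: "smooth \<phi>" using assms by (rule_tac test_function_smooth)
  then have cont: "continuous_on UNIV \<phi>" by (rule smooth_continuous_on)
  then have [measurable]: "\<phi> \<in> borel_measurable borel" by (rule borel_measurable_continuous_onI)
  have "continuous_on UNIV (grad \<phi>)" using sm by (rule smooth_continuous_on_grad)
  then have [measurable]: "grad \<phi> \<in> borel_measurable borel" by (rule borel_measurable_continuous_onI)
  obtain B where B: "\<And>x. norm (grad \<phi> x) \<le> B" using test_grad_bounded[OF assms(1)] by blast
  have "bounded (closure {x. \<phi> x \<noteq> 0})" using assms by (auto simp: test_functions_def)
  then obtain R where R: "\<And>x. x \<in> closure {x. \<phi> x \<noteq> 0} \<Longrightarrow> norm x \<le> R" by (auto simp: bounded_iff)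
  have out: "\<phi> x = 0" if "norm x > R" for x
    using R[of x] that closure_subset[of "{x. \<phi> x \<noteq> 0}"] by auto
  have int: "integrable lborel \<phi>"
    by (rule integrable_continuous_compact_support[OF cont, of "cball 0 R"]) (auto simp: out)
  let ?d = "\<lambda>n x. real (Suc n) * (\<phi> (x + (1 / real (Suc n)) *\<^sub>R i) - \<phi> x)"
  have "(LINT x|lborel. ?d n x) = 0" for n
    using int by (simp add: lborel_integral_translation)
  \<comment> \<open>The increments have length at most 1, so all difference quotients vanish outside
    the ball of radius \<open>R + 1\<close>; inside it the Lipschitz constant \<open>B\<close>
    dominates them.\<close>
  moreover have "(\<lambda>n. LINT x|lborel. ?d n x) \<longlonglongrightarrow> (LINT x|lborel. grad \<phi> x \<bullet> i)"
  proof (rule integral_dominated_convergence[where w="\<lambda>x. indicator (cball 0 (R + 1)) x *\<^sub>R B"])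
    show "integrable lborel (\<lambda>x. indicator (cball 0 (R + 1)) x *\<^sub>R B :: real)"
      by (intro borel_integrable_compact) auto
    show "AE x in lborel. (\<lambda>n. ?d n x) \<longlonglongrightarrow> grad \<phi> x \<bullet> i"
    proof (intro always_eventually allI)
      fix x
      have "((\<lambda>t. x + t *\<^sub>R i) has_derivative (\<lambda>t. t *\<^sub>R i)) (at 0)"
        by (auto intro!: derivative_eq_intros)
      from has_derivative_compose[OF this, of \<phi> "\<lambda>h. grad \<phi> x \<bullet> h"]
      have "((\<lambda>t. \<phi> (x + t *\<^sub>R i)) has_derivative (\<lambda>t. grad \<phi> x \<bullet> (t *\<^sub>R i))) (at 0)"
        using smooth_has_derivative[OF sm, of x] by simp
      then have "((\<lambda>t. \<phi> (x + t *\<^sub>R i)) has_real_derivative grad \<phi> x \<bullet> i) (at 0)"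
        by (simp add: has_field_derivative_def mult_commute_abs)
      then have "(\<lambda>t. (\<phi> (x + t *\<^sub>R i) - \<phi> x) / t) \<midarrow>0\<rightarrow> grad \<phi> x \<bullet> i"
        by (simp add: DERIV_def)
      then have "(\<lambda>n. (\<phi> (x + (1 / real (Suc n)) *\<^sub>R i) - \<phi> x) / (1 / real (Suc n))) \<longlonglongrightarrow> grad \<phi> x \<bullet> i"
        unfolding tendsto_at_iff_sequentially
        by (elim allE[of _ "\<lambda>n. 1 / real (Suc n)"])
           (use lim_1_over_n[where 'a=real, THEN LIMSEQ_Suc] in \<open>simp add: o_def\<close>)
      then show "(\<lambda>n. ?d n x) \<longlonglongrightarrow> grad \<phi> x \<bullet> i" by (simp add: mult.commute)
    qed
    show "AE x in lborel. norm (?d n x) \<le> indicator (cball 0 (R + 1)) x *\<^sub>R B" for n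
    proof (intro always_eventually allI)
      fix x
      show "norm (?d n x) \<le> indicator (cball 0 (R + 1)) x *\<^sub>R B"
      proof (cases "x \<in> cball 0 (R + 1)")
        case True
        have "\<bar>\<phi> (x + (1 / real (Suc n)) *\<^sub>R i) - \<phi> x\<bar> \<le> B * (1 / real (Suc n))"
          using smooth_lipschitz[OF sm B, of "x + (1 / real (Suc n)) *\<^sub>R i" x] assms(2) by simp
        then have "real (Suc n) * \<bar>\<phi> (x + (1 / real (Suc n)) *\<^sub>R i) - \<phi> x\<bar> \<le> real (Suc n) * (B * (1 / real (Suc n)))"
          by (intro mult_left_mono) auto
        then show ?thesis using True by (simp add: abs_mult del: of_nat_Suc)
      next
        case False
        have "norm ((1 / real (Suc n)) *\<^sub>R i) \<le> 1" unfolding norm_scaleR assms(2) by simp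
        moreover have "norm x \<le> norm (x + (1 / real (Suc n)) *\<^sub>R i) + norm ((1 / real (Suc n)) *\<^sub>R i)"
          by (metis add_diff_cancel norm_triangle_ineq4)
        ultimately have "norm (x + (1 / real (Suc n)) *\<^sub>R i) > R" "norm x > R"
          using False unfolding mem_cball_0 by linarith+
        then show ?thesis using False by (simp add: out)
      qed
    qed
  qed auto
  ultimately show ?thesis by (simp add: LIMSEQ_const_iff)
qed

lemma lebesgue_on_eq_lborel:
  fixes f :: "'a::euclidean_space \<Rightarrow> 'b::euclidean_space"
  assumes "open \<Omega>" "f \<in> borel_measurable borel" "\<And>x. x \<notin> \<Omega> \<Longrightarrow> f x = 0"
  shows "(LINT x|lebesgue_on \<Omega>. f x) = (LINT x|lborel. f x)"
    and "integrable (lebesgue_on \<Omega>) f \<longleftrightarrow> integrable lborel f"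
proof -
  have "(\<lambda>x. indicator \<Omega> x *\<^sub>R f x) = f" using assms by (auto simp: indicator_def)
  then show "(LINT x|lebesgue_on \<Omega>. f x) = (LINT x|lborel. f x)"
    "integrable (lebesgue_on \<Omega>) f \<longleftrightarrow> integrable lborel f"
    using assms by (simp_all add: integral_restrict_space integrable_restrict_space
      integral_completion integrable_completion)
qed

lemma test_function_mono: "\<Omega> \<subseteq> \<Omega>' \<Longrightarrow> test_functions \<Omega> \<subseteq> test_functions \<Omega>'"
  by (auto simp: test_functions_def)

text \<open>Integration by parts: the gradient of the product of two test functions has integral
  0.\<close>

lemma has_weak_gradient_grad:
  assumes op: "open \<Omega>" and \<phi>: "\<phi> \<in> test_functions \<Omega>"
  shows "has_weak_gradient \<Omega> \<phi> (grad \<phi>)"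
  unfolding has_weak_gradient_def
proof (intro conjI allI impI ballI)
  have sm: "smooth \<phi>" using \<phi> by (rule test_function_smooth)
  fix K assume K: "compact K \<and> K \<subseteq> \<Omega>"
  then show "\<phi> absolutely_integrable_on K" "grad \<phi> absolutely_integrable_on K"
    using sm by (auto intro!: absolutely_integrable_continuous_on_compact smooth_continuous_on smooth_continuous_on_grad)
next
  have sm: "smooth \<phi>" using \<phi> by (rule test_function_smooth)
  fix \<psi> and i :: 'a assume \<psi>: "\<psi> \<in> test_functions \<Omega>" and i: "i \<in> Basis"
  then have sm': "smooth \<psi>" using test_function_smooth by metis
  have "(\<lambda>x. \<phi> x * \<psi> x) \<in> test_functions UNIV"
    using test_function_mult[OF \<psi> sm] test_function_mono[of \<Omega> UNIV] by auto
  from integral_grad_eq_0[OF this, of i]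
  have zero: "(LINT x|lborel. grad (\<lambda>x. \<phi> x * \<psi> x) x \<bullet> i) = 0" using i by simp
  have prod: "grad (\<lambda>x. \<phi> x * \<psi> x) x = \<phi> x *\<^sub>R grad \<psi> x + \<psi> x *\<^sub>R grad \<phi> x" for x
  proof (rule has_derivative_imp_grad_eq)
    have "(\<lambda>h. (\<phi> x *\<^sub>R grad \<psi> x + \<psi> x *\<^sub>R grad \<phi> x) \<bullet> h) =
        (\<lambda>h. \<phi> x * (grad \<psi> x \<bullet> h) + (grad \<phi> x \<bullet> h) * \<psi> x)"
      by (auto simp: inner_add_left)
    then show "((\<lambda>x. \<phi> x * \<psi> x) has_derivative
        (\<lambda>h. (\<phi> x *\<^sub>R grad \<psi> x + \<psi> x *\<^sub>R grad \<phi> x) \<bullet> h)) (at x)"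
      using has_derivative_mult[OF smooth_has_derivative[OF sm, of x] smooth_has_derivative[OF sm', of x]]
      by simp
  qed
  have cont: "continuous_on UNIV (\<lambda>x. \<phi> x * (grad \<psi> x \<bullet> i))" "continuous_on UNIV (\<lambda>x. (grad \<phi> x \<bullet> i) * \<psi> x)"
    by (intro continuous_intros smooth_continuous_on smooth_continuous_on_grad sm sm')+
  have bd: "bounded {x. \<psi> x \<noteq> 0}" "bounded {x. \<phi> x \<noteq> 0}" using \<psi> \<phi> by (auto simp: test_functions_def)
  have int: "integrable lborel (\<lambda>x. \<phi> x * (grad \<psi> x \<bullet> i))" "integrable lborel (\<lambda>x. (grad \<phi> x \<bullet> i) * \<psi> x)"
    by (rule integrable_continuous_compact_support[OF cont(1) bd(2)], simp)
       (rule integrable_continuous_compact_support[OF cont(2) bd(1)], simp)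
  have "(LINT x|lborel. grad (\<lambda>x. \<phi> x * \<psi> x) x \<bullet> i) =
      (LINT x|lborel. \<phi> x * (grad \<psi> x \<bullet> i) + (grad \<phi> x \<bullet> i) * \<psi> x)"
    unfolding prod inner_add_left by (simp add: mult.commute)
  then have "(LINT x|lborel. \<phi> x * (grad \<psi> x \<bullet> i)) = - (LINT x|lborel. (grad \<phi> x \<bullet> i) * \<psi> x)"
    using int zero by simp
  moreover have "(LINT x|lebesgue_on \<Omega>. \<phi> x * (grad \<psi> x \<bullet> i)) = (LINT x|lborel. \<phi> x * (grad \<psi> x \<bullet> i))"
    by (rule lebesgue_on_eq_lborel(1)[OF op borel_measurable_continuous_onI[OF cont(1)]])
       (simp add: test_function_outside[OF \<phi>])
  moreover have "(LINT x|lebesgue_on \<Omega>. (grad \<phi> x \<bullet> i) * \<psi> x) = (LINT x|lborel. (grad \<phi> x \<bullet> i) * \<psi> x)"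
    by (rule lebesgue_on_eq_lborel(1)[OF op borel_measurable_continuous_onI[OF cont(2)]])
       (simp add: test_function_outside[OF \<psi>])
  ultimately show "(LINT x|lebesgue_on \<Omega>. \<phi> x * frechet_derivative \<psi> (at x) i) =
           - (LINT x|lebesgue_on \<Omega>. grad \<phi> x \<bullet> i * \<psi> x)"
    by (simp only: frechet_derivative_eq_grad[OF sm'])
qed

subsection \<open>A modular Poincare inequality\<close>

text \<open>Convexity of the power function, whose graph lies above its tangent at \<open>m\<close>;
  obtained from Young's inequality for the product \<open>a * m powr (s - 1)\<close>.\<close>

lemma powr_tangent_le:
  fixes a m s :: real
  assumes "0 \<le> a" "0 < m" "1 \<le> s"
  shows "m powr s + s * m powr (s - 1) * (a - m) \<le> a powr s"
proof (cases "a = 0")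
  case True
  have "m powr s = m * m powr (s - 1)" using assms by (simp add: powr_mult_base)
  moreover have "0 \<le> (s - 1) * (m * m powr (s - 1))" using assms by simp
  ultimately show ?thesis using True by (simp add: algebra_simps)
next
  case False
  have m1: "m powr s = m * m powr (s - 1)" using assms by (simp add: powr_mult_base)
  have "a * m powr (s - 1) = (a powr s) powr (1 / s) * (m powr s) powr (1 - 1 / s)"
  proof -
    have "s * (1 - 1 / s) = s - 1" using assms by (simp add: right_diff_distrib)
    then show ?thesis using assms False by (simp add: powr_powr)
  qed
  also have "\<dots> \<le> (1 / s) * a powr s + (1 - 1 / s) * m powr s"
    using assms False by (intro Youngs_inequality_0) (auto simp: divide_le_eq_1)
  finally have "s * (a * m powr (s - 1)) \<le> s * ((1 / s) * a powr s + (1 - 1 / s) * m powr s)"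
    using assms by (intro mult_left_mono) auto
  then have "s * a * m powr (s - 1) \<le> a powr s + (s - 1) * m powr s"
    using assms by (simp add: algebra_simps)
  then show ?thesis unfolding m1 by (simp add: algebra_simps)
qed

text \<open>The tangent at the mean \<open>m\<close> integrates to \<open>m powr s\<close>, since
  its linear part has mean 0. The right-hand side lives in \<open>ennreal\<close>, so its finiteness
  does not have to be shown beforehand.\<close>

lemma jensen_powr:
  fixes a :: "'b \<Rightarrow> real"
  assumes "finite_measure N" "measure N (space N) = 1" "1 \<le> s"
    and "integrable N a" "AE x in N. 0 \<le> a x"
  shows "ennreal ((LINT x|N. a x) powr s) \<le> (\<integral>\<^sup>+x. ennreal (a x powr s) \<partial>N)"
proof (cases "(\<integral>\<^sup>+x. ennreal (a x powr s) \<partial>N) = \<infinity>")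
  case False
  interpret finite_measure N by fact
  define m where "m = (LINT x|N. a x)"
  have m0: "0 \<le> m" unfolding m_def using assms by (intro integral_nonneg_AE) auto
  have [measurable]: "a \<in> borel_measurable N" using assms by auto
  have I: "integrable N (\<lambda>x. a x powr s)"
    using False by (intro integrableI_nonneg) (auto simp: top.not_eq_extremum)
  have "m powr s \<le> (LINT x|N. a x powr s)"
  proof (cases "m = 0")
    case False
    have "m powr s = (LINT x|N. m powr s + s * m powr (s - 1) * (a x - m))"
      using assms by (simp add: m_def[symmetric])
    also have "\<dots> \<le> (LINT x|N. a x powr s)"
    proof (rule integral_mono_AE)
      show "AE x in N. m powr s + s * m powr (s - 1) * (a x - m) \<le> a x powr s"
        using assms(5) by eventually_elim (use assms(3) False m0 in \<open>auto intro: powr_tangent_le\<close>)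
    qed (use assms I in auto)
    finally show ?thesis .
  qed (auto intro!: integral_nonneg_AE)
  then show ?thesis
    using I by (simp add: nn_integral_eq_integral m_def[symmetric])
qed simp

lemma nn_integral_lborel_affine:
  fixes f :: "'a::euclidean_space \<Rightarrow> ennreal"
  assumes [measurable]: "f \<in> borel_measurable borel" and "c \<noteq> 0"
  shows "(\<integral>\<^sup>+x. f x \<partial>lborel) = ennreal (\<bar>c\<bar> ^ DIM('a)) * (\<integral>\<^sup>+z. f (t + c *\<^sub>R z) \<partial>lborel)"
  by (subst lborel_affine[OF assms(2), of t])
     (simp add: nn_integral_density nn_integral_distr nn_integral_cmult)

lemma nn_integral_lborel_translation:
  fixes f :: "'a::euclidean_space \<Rightarrow> ennreal"
  assumes [measurable]: "f \<in> borel_measurable borel"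
  shows "(\<integral>\<^sup>+x. f (x + t) \<partial>lborel) = (\<integral>\<^sup>+x. f x \<partial>lborel)"
  using nn_integral_lborel_affine[OF assms, of 1 t] by (simp add: add.commute)

text \<open>A probability measure on the whole line, so that Jensen's inequality and Fubini's
  theorem apply to the ray parameter.\<close>

definition unit_interval_measure :: "real measure" where
  "unit_interval_measure = density lborel (indicator {0..1})"

lemma unit_interval_measure:
  shows "finite_measure unit_interval_measure"
    and "measure unit_interval_measure (space unit_interval_measure) = 1"
    and sets_unit_interval_measure [measurable_cong]: "sets unit_interval_measure = sets borel"
    and "AE t in unit_interval_measure. 0 < t \<and> t \<le> 1"
proof -
  have *: "emeasure unit_interval_measure (space unit_interval_measure) = 1"
    by (simp add: unit_interval_measure_def emeasure_density)
  then show "finite_measure unit_interval_measure"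
    by (intro finite_measureI) auto
  show "measure unit_interval_measure (space unit_interval_measure) = 1"
    by (simp add: measure_def *)
  show "sets unit_interval_measure = sets borel" by (simp add: unit_interval_measure_def)
  have "AE t in lborel. t \<noteq> (0::real)" by (rule AE_lborel_singleton)
  then show "AE t in unit_interval_measure. 0 < t \<and> t \<le> 1"
    unfolding unit_interval_measure_def
    by (subst AE_density) (auto elim!: eventually_mono split: split_indicator simp: indicator_def)
qed

text \<open>Integrating along \<open>t \<mapsto> x + t\<^sup>2 z\<close> instead of the segment gives the weight \<open>t\<close>, which
  absorbs the singularity of the averages as \<open>t\<close> tends to \<open>0\<close>.\<close>

lemma test_function_ray:
  fixes \<phi> :: "'a::euclidean_space \<Rightarrow> real"
  assumes \<phi>: "\<phi> \<in> test_functions \<Omega>" and L: "norm z \<le> L"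
  shows "ennreal \<bar>\<phi> (x + z) - \<phi> x\<bar> \<le>
    (\<integral>\<^sup>+t. ennreal (2 * L * t * norm (grad \<phi> (x + t\<^sup>2 *\<^sub>R z))) \<partial>unit_interval_measure)"
proof -
  have sm: "smooth \<phi>" using \<phi> by (rule test_function_smooth)
  let ?f = "\<lambda>t::real. grad \<phi> (x + t\<^sup>2 *\<^sub>R z) \<bullet> ((2 * t) *\<^sub>R z)"
  have cg: "continuous_on UNIV (\<lambda>t::real. grad \<phi> (x + t\<^sup>2 *\<^sub>R z))"
    by (rule continuous_on_compose2[OF smooth_continuous_on_grad[OF sm, of UNIV]])
       (auto intro!: continuous_intros)
  have cont: "continuous_on {0..1} ?f"
    by (intro continuous_intros continuous_on_subset[OF cg]) auto
  have der: "((\<lambda>t. \<phi> (x + t\<^sup>2 *\<^sub>R z)) has_vector_derivative ?f t) (at t within {0..1})" for t :: real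
  proof -
    have "((\<lambda>t. x + t\<^sup>2 *\<^sub>R z) has_derivative (\<lambda>h. h *\<^sub>R (2 * t) *\<^sub>R z)) (at t within {0..1})"
      by (auto intro!: derivative_eq_intros)
    from has_derivative_compose[OF this smooth_has_derivative[OF sm]]
    show ?thesis unfolding has_vector_derivative_def by (simp add: mult.assoc)
  qed
  have "(LINT t|lborel. indicator {0..1} t *\<^sub>R ?f t) = \<phi> (x + 1\<^sup>2 *\<^sub>R z) - \<phi> (x + 0\<^sup>2 *\<^sub>R z)"
    by (rule integral_FTC_atLeastAtMost[OF _ der cont]) auto
  then have eq: "(LINT t|lborel. indicator {0..1} t *\<^sub>R ?f t) = \<phi> (x + z) - \<phi> x"
    by simp
  have [measurable]: "(\<lambda>t. norm (grad \<phi> (x + t\<^sup>2 *\<^sub>R z))) \<in> borel_measurable borel"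
    by (intro borel_measurable_continuous_onI continuous_intros cg)
  have int: "integrable lborel (\<lambda>t. indicator {0..1} t *\<^sub>R ?f t)"
    by (intro borel_integrable_compact cont) auto
  have "ennreal \<bar>\<phi> (x + z) - \<phi> x\<bar> = ennreal (norm (LINT t|lborel. indicator {0..1} t *\<^sub>R ?f t))"
    unfolding eq by simp
  also have "\<dots> \<le> (\<integral>\<^sup>+t. ennreal (norm (indicator {0..1} t *\<^sub>R ?f t)) \<partial>lborel)"
    using int by (rule integral_norm_bound_ennreal)
  also have "\<dots> \<le> (\<integral>\<^sup>+t. indicator {0..1} t * ennreal (2 * L * t * norm (grad \<phi> (x + t\<^sup>2 *\<^sub>R z))) \<partial>lborel)"
  proof (intro nn_integral_mono)
    fix t :: real
    have "\<bar>?f t\<bar> \<le> 2 * L * t * norm (grad \<phi> (x + t\<^sup>2 *\<^sub>R z))" if "0 \<le> t"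
    proof -
      have "\<bar>?f t\<bar> \<le> norm (grad \<phi> (x + t\<^sup>2 *\<^sub>R z)) * norm ((2 * t) *\<^sub>R z)"
        by (rule Cauchy_Schwarz_ineq2)
      also have "\<dots> \<le> norm (grad \<phi> (x + t\<^sup>2 *\<^sub>R z)) * (2 * t * L)"
        using that L by (intro mult_left_mono) (auto intro!: mult_left_mono)
      finally show ?thesis by (simp add: algebra_simps)
    qed
    then show "ennreal (norm (indicator {0..1} t *\<^sub>R ?f t)) \<le>
        indicator {0..1} t * ennreal (2 * L * t * norm (grad \<phi> (x + t\<^sup>2 *\<^sub>R z)))"
      by (auto simp: indicator_def intro!: ennreal_leI simp del: inner_scaleR_right)
  qed
  also have "\<dots> = (\<integral>\<^sup>+t. ennreal (2 * L * t * norm (grad \<phi> (x + t\<^sup>2 *\<^sub>R z))) \<partial>unit_interval_measure)"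
    unfolding unit_interval_measure_def by (subst nn_integral_density) auto
  finally show ?thesis .
qed

text \<open>\<phi> vanishes at the endpoint \<open>x + z\<close> outside \<Omega>, so the ray
  estimate bounds \<phi> itself. Averaging over a whole distribution \<open>N\<close> of endpoints
  replaces line integrals of the gradient by volume averages.\<close>

lemma test_function_average:
  fixes \<phi> :: "'a::euclidean_space \<Rightarrow> real"
  assumes \<phi>: "\<phi> \<in> test_functions \<Omega>"
    and N: "finite_measure N" "measure N (space N) = 1" "sets N = sets borel"
    and out: "AE z in N. x + z \<notin> \<Omega> \<and> norm z \<le> L" and L0: "0 \<le> L"
  shows "integrable unit_interval_measure (\<lambda>t. 2 * L * t * (LINT z|N. norm (grad \<phi> (x + t\<^sup>2 *\<^sub>R z))))"
    and "\<bar>\<phi> x\<bar> \<le> (LINT t|unit_interval_measure. 2 * L * t * (LINT z|N. norm (grad \<phi> (x + t\<^sup>2 *\<^sub>R z))))"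
proof -
  interpret N: finite_measure N by fact
  interpret U: finite_measure unit_interval_measure by (rule unit_interval_measure)
  interpret P: pair_sigma_finite unit_interval_measure N ..
  note N(3)[measurable_cong]
  have sm: "smooth \<phi>" using \<phi> by (rule test_function_smooth)
  have [measurable]: "grad \<phi> \<in> borel_measurable borel"
    using smooth_continuous_on_grad[OF sm] by (rule borel_measurable_continuous_onI)
  obtain B where B: "\<And>x. norm (grad \<phi> x) \<le> B" using test_grad_bounded[OF \<phi>] by blast
  let ?A = "\<lambda>t. LINT z|N. norm (grad \<phi> (x + t\<^sup>2 *\<^sub>R z))"
  have I: "integrable N (\<lambda>z. norm (grad \<phi> (x + t\<^sup>2 *\<^sub>R z)))" for t :: real
    by (rule N.integrable_const_bound[where B=B]) (auto simp: B)
  have A0: "0 \<le> ?A t" for t by (intro integral_nonneg_AE) auto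
  have AB: "?A t \<le> B" for t
  proof -
    have "?A t \<le> (LINT z|N. B)" by (intro integral_mono I) (auto simp: B)
    then show ?thesis using N(2) by simp
  qed
  have tU: "AE t in unit_interval_measure. 0 < t \<and> t \<le> 1" by (rule unit_interval_measure)
  show int: "integrable unit_interval_measure (\<lambda>t. 2 * L * t * ?A t)"
  proof (rule U.integrable_const_bound[where B="2 * L * 1 * B"])
    show "AE t in unit_interval_measure. norm (2 * L * t * ?A t) \<le> 2 * L * 1 * B"
      using tU
    proof eventually_elim
      case (elim t)
      then show ?case using A0[of t] AB[of t] L0
        by (auto simp: abs_mult intro!: mult_mono[of t 1, simplified] mult_left_mono simp: mult.assoc)
    qed
  qed auto
  have nn: "AE t in unit_interval_measure. 0 \<le> 2 * L * t * ?A t"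
    using tU
  proof eventually_elim
    case (elim t)
    then show ?case using A0[of t] L0 by simp
  qed
  have "ennreal \<bar>\<phi> x\<bar> = (\<integral>\<^sup>+z. ennreal \<bar>\<phi> x\<bar> \<partial>N)"
    using N(2) by (simp add: N.emeasure_eq_measure)
  also have "\<dots> \<le> (\<integral>\<^sup>+z. \<integral>\<^sup>+t. ennreal (2 * L * t * norm (grad \<phi> (x + t\<^sup>2 *\<^sub>R z))) \<partial>unit_interval_measure \<partial>N)"
    using out by (intro nn_integral_mono_AE) (erule eventually_mono,
        use test_function_ray[OF \<phi>, of _ L x] test_function_outside[OF \<phi>] in fastforce)
  also have "\<dots> = (\<integral>\<^sup>+t. \<integral>\<^sup>+z. ennreal (2 * L * t * norm (grad \<phi> (x + t\<^sup>2 *\<^sub>R z))) \<partial>N \<partial>unit_interval_measure)"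
    by (rule P.Fubini') simp
  also have "\<dots> = (\<integral>\<^sup>+t. ennreal (2 * L * t * ?A t) \<partial>unit_interval_measure)"
  proof (intro nn_integral_cong_AE, use tU in eventually_elim)
    case (elim t)
    then have nn: "0 \<le> 2 * L * t" using L0 by simp
    have "(\<integral>\<^sup>+z. ennreal (2 * L * t * norm (grad \<phi> (x + t\<^sup>2 *\<^sub>R z))) \<partial>N)
      = ennreal (LINT z|N. 2 * L * t * norm (grad \<phi> (x + t\<^sup>2 *\<^sub>R z)))"
      using I[of t] nn by (intro nn_integral_eq_integral) auto
    then show ?case by simp
  qed
  also have "\<dots> = ennreal (LINT t|unit_interval_measure. 2 * L * t * ?A t)"
    by (intro nn_integral_eq_integral int nn)
  finally show "\<bar>\<phi> x\<bar> \<le> (LINT t|unit_interval_measure. 2 * L * t * ?A t)"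
    using integral_nonneg_AE[OF nn] by (subst (asm) ennreal_le_iff) auto
qed

definition uniform_on :: "'a::euclidean_space set \<Rightarrow> 'a measure" where
  "uniform_on S = density lborel (\<lambda>z. ennreal (indicator S z / measure lborel S))"

text \<open>The density is at most \<open>1 / measure lborel S\<close>, whence the last claim; it
  compares averages of the gradient with its full integral.\<close>

lemma uniform_on:
  fixes S :: "'a::euclidean_space set"
  assumes [measurable]: "S \<in> sets borel" and "emeasure lborel S < \<infinity>" "0 < measure lborel S"
  shows "finite_measure (uniform_on S)" "measure (uniform_on S) (space (uniform_on S)) = 1"
    "sets (uniform_on S) = sets borel"
    "(AE z in uniform_on S. Q z) \<longleftrightarrow> (AE z in lborel. z \<in> S \<longrightarrow> Q z)"
    "f \<in> borel_measurable borel \<Longrightarrow>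
      (\<integral>\<^sup>+z. f z \<partial>uniform_on S) \<le> ennreal (1 / measure lborel S) * (\<integral>\<^sup>+z. f z \<partial>lborel)"
proof -
  have "emeasure (uniform_on S) (space (uniform_on S)) = 1"
  proof -
    have "(\<lambda>z. ennreal (indicator S z / measure lborel S)) = (\<lambda>z. ennreal (1 / measure lborel S) * indicator S z)"
      by (auto simp: indicator_def)
    then have "emeasure (uniform_on S) (space (uniform_on S)) =
        ennreal (1 / measure lborel S) * emeasure lborel S"
      by (simp add: uniform_on_def emeasure_density nn_integral_cmult)
    also have "emeasure lborel S = ennreal (measure lborel S)"
      using assms(2) by (intro emeasure_eq_ennreal_measure) auto
    finally show ?thesis using assms(3) by (simp add: ennreal_mult[symmetric])
  qed
  then show "finite_measure (uniform_on S)" "measure (uniform_on S) (space (uniform_on S)) = 1"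
    by (auto intro!: finite_measureI simp: measure_def)
  show "sets (uniform_on S) = sets borel" by (simp add: uniform_on_def)
  show "(AE z in uniform_on S. Q z) \<longleftrightarrow> (AE z in lborel. z \<in> S \<longrightarrow> Q z)"
    unfolding uniform_on_def using assms(3)
    by (subst AE_density) (auto simp: indicator_def intro!: eventually_cong)
  assume [measurable]: "f \<in> borel_measurable borel"
  have "(\<integral>\<^sup>+z. f z \<partial>uniform_on S) = (\<integral>\<^sup>+z. ennreal (indicator S z / measure lborel S) * f z \<partial>lborel)"
    unfolding uniform_on_def by (subst nn_integral_density) auto
  also have "\<dots> \<le> (\<integral>\<^sup>+z. ennreal (1 / measure lborel S) * f z \<partial>lborel)"
    by (intro nn_integral_mono mult_right_mono ennreal_leI) (auto simp: indicator_def)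
  finally show "(\<integral>\<^sup>+z. f z \<partial>uniform_on S) \<le> ennreal (1 / measure lborel S) * (\<integral>\<^sup>+z. f z \<partial>lborel)"
    by (simp add: nn_integral_cmult)
qed

text \<open>Fubini's theorem and translation invariance are applied to Borel functions on the whole
  space. Continuity of \<open>p\<close> is known only on \<Omega>, so the exponent is cut off by the
  indicator before measurability is claimed.\<close>

lemma modular_eq_lborel:
  fixes \<Omega> :: "'a::euclidean_space set"
  assumes "open \<Omega>" "continuous_on \<Omega> p" "u \<in> borel_measurable borel"
  shows "(\<lambda>x. indicator \<Omega> x * ennreal (\<bar>u x\<bar> powr p x)) \<in> borel_measurable borel"
    and "modular \<Omega> p u = (\<integral>\<^sup>+x. indicator \<Omega> x * ennreal (\<bar>u x\<bar> powr p x) \<partial>lborel)"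
proof -
  have [measurable]: "(\<lambda>x. indicator \<Omega> x *\<^sub>R p x) \<in> borel_measurable borel" "\<Omega> \<in> sets borel"
    using assms by (auto intro: borel_measurable_continuous_on_indicator[OF _ assms(2)] simp del: real_scaleR_def)
  note assms(3)[measurable]
  have "(\<lambda>x. indicator \<Omega> x * ennreal (\<bar>u x\<bar> powr (indicator \<Omega> x *\<^sub>R p x))) \<in> borel_measurable borel"
    by measurable
  also have "(\<lambda>x. indicator \<Omega> x * ennreal (\<bar>u x\<bar> powr (indicator \<Omega> x *\<^sub>R p x))) =
      (\<lambda>x. indicator \<Omega> x * ennreal (\<bar>u x\<bar> powr p x))"
    by (auto simp: indicator_def)
  finally show *: "(\<lambda>x. indicator \<Omega> x * ennreal (\<bar>u x\<bar> powr p x)) \<in> borel_measurable borel" .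
  have "modular \<Omega> p u = (\<integral>\<^sup>+x. ennreal (\<bar>u x\<bar> powr p x) * indicator \<Omega> x \<partial>lebesgue)"
    unfolding modular_def using assms(1) by (subst nn_integral_restrict_space) auto
  then show "modular \<Omega> p u = (\<integral>\<^sup>+x. indicator \<Omega> x * ennreal (\<bar>u x\<bar> powr p x) \<partial>lborel)"
    by (simp add: nn_integral_completion mult.commute)
qed

text \<open>Here \<open>a\<close> stands for an average of the gradient at scale
  \<open>t\<^sup>2\<close>, which may grow like \<open>1 / t ^ (2 * n)\<close>. Its power with
  exponent \<open>1 / (2 * n)\<close> is then at most of order \<open>1 / t\<close>, and one factor
  \<open>t\<close> cancels it.\<close>

lemma poincare_near_factor:
  fixes a t M :: real
  assumes "0 \<le> a" "0 < t" "t \<le> 1" "a * (t\<^sup>2) ^ n \<le> M" "1 \<le> M" "1 \<le> q" "0 < n"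
  shows "t powr q * a powr (1 / (2 * real n)) \<le> M"
proof -
  have t2: "(t\<^sup>2) ^ n = t powr (2 * real n)"
    using powr_realpow[of t "2 * n"] assms(2) by (simp add: power_mult)
  have "a \<le> M / (t\<^sup>2) ^ n" using assms by (simp add: pos_le_divide_eq)
  then have "a powr (1 / (2 * real n)) \<le> (M / (t\<^sup>2) ^ n) powr (1 / (2 * real n))"
    using assms by (intro powr_mono2) auto
  also have "\<dots> = M powr (1 / (2 * real n)) / t"
    using assms by (simp add: powr_divide t2 powr_powr)
  finally have 1: "a powr (1 / (2 * real n)) \<le> M powr (1 / (2 * real n)) / t" .
  have "t powr q \<le> t powr 1" using assms by (intro powr_mono') auto
  then have "t powr q * a powr (1 / (2 * real n)) \<le> t * (M powr (1 / (2 * real n)) / t)"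
    using 1 assms by (intro mult_mono) auto
  also have "\<dots> = M powr (1 / (2 * real n))" using assms by simp
  also have "\<dots> \<le> M powr 1" using assms by (intro powr_mono) (auto simp: divide_le_eq_1)
  finally show ?thesis using assms by simp
qed

lemma powr_le_one_plus_powr:
  fixes g s q :: real
  assumes "0 \<le> g" "0 \<le> s" "s \<le> q"
  shows "g powr s \<le> 1 + g powr q"
proof (cases "g \<le> 1")
  case True
  then have "g powr s \<le> 1" using assms by (simp add: powr_le1)
  then show ?thesis using powr_ge_zero[of g q] by linarith
next
  case False
  then have "g powr s \<le> g powr q" using assms by (intro powr_mono) auto
  then show ?thesis by linarith
qed

text \<open>Jensen's inequality at a fixed \<open>x\<close> confronts the exponent
  \<open>p x\<close> with the gradient at points where \<open>p\<close> differs. Near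
  \<open>x\<close> the exponent is lowered to \<open>s = p x - \<epsilon>\<close>, which uniform
  continuity keeps below the values of \<open>p\<close> there; the missing power \<epsilon> of the
  average is bounded through \<open>poincare_near_factor\<close>. Far from \<open>x\<close> the
  averages are bounded outright. By Fubini's theorem the resulting majorant integrates to a multiple
  of the volume plus the modular of the gradient.\<close>

lemma poincare_modular:
  fixes p :: "'a::euclidean_space \<Rightarrow> real"
  assumes op: "open \<Omega>" and bd: "bounded \<Omega>" and p: "continuous_on (closure \<Omega>) p"
    and p2: "\<And>x. x \<in> closure \<Omega> \<Longrightarrow> 2 \<le> p x"
  obtains C where "1 \<le> C"
    "\<And>\<phi>. \<phi> \<in> test_functions \<Omega> \<Longrightarrow> modular \<Omega> p (\<lambda>x. norm (grad \<phi> x)) \<le> 1 \<Longrightarrow>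
      modular \<Omega> p \<phi> \<le> ennreal C"
proof -
  let ?n = "DIM('a)"
  have cpt: "compact (closure \<Omega>)" using bd by simp
  have p\<Omega>: "continuous_on \<Omega> p" using p closure_subset by (rule continuous_on_subset)
  obtain P where P: "\<And>x. x \<in> closure \<Omega> \<Longrightarrow> p x \<le> P" "2 \<le> P"
  proof -
    have "bounded (p ` closure \<Omega>)"
      using cpt p by (intro compact_imp_bounded compact_continuous_image)
    then obtain P where "\<forall>x\<in>closure \<Omega>. \<bar>p x\<bar> \<le> P" by (auto simp: bounded_iff)
    then show ?thesis by (intro that[of "max 2 P"]) fastforce+
  qed
  obtain R where R: "0 < R" "\<And>x. x \<in> \<Omega> \<Longrightarrow> norm x \<le> R"
    using bd by (auto simp: bounded_pos)
  obtain e :: 'a where e: "norm e = 1" using norm_Basis nonempty_Basis by blast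
  \<comment> \<open>The centre of \<open>S\<close> has norm \<open>2 * R + 2\<close> and its radius
    is 1, so a translation by \<open>z \<in> S\<close> moves every point of \<Omega>, which lies in
    the ball of radius \<open>R\<close>, out of \<Omega>; \<open>L\<close> bounds the norms in
    \<open>S\<close>.\<close>
  define L where "L = 2 * R + 3"
  define S where "S = cball ((2 * R + 2) *\<^sub>R e) 1"
  define N where "N = uniform_on S"
  define m where "m = measure lborel S"
  define vol where "vol = measure lborel \<Omega>"
  have L: "1 \<le> L" using R by (simp add: L_def)
  have SL: "norm z \<le> L \<and> 2 * R + 1 \<le> norm z" if "z \<in> S" for z
  proof -
    have d: "norm (z - (2 * R + 2) *\<^sub>R e) \<le> 1" using that by (simp add: S_def dist_norm norm_minus_commute)
    have n: "norm ((2 * R + 2) *\<^sub>R e) = 2 * R + 2" using R e by simp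
    show ?thesis
      using norm_triangle_ineq2[of z "(2 * R + 2) *\<^sub>R e"] norm_triangle_ineq3[of z "(2 * R + 2) *\<^sub>R e"]
        d n R unfolding L_def by linarith
  qed
  have out: "x + z \<notin> \<Omega>" if "x \<in> \<Omega>" "z \<in> S" for x z
  proof
    assume "x + z \<in> \<Omega>"
    then have "norm (x + z) \<le> R" using R by auto
    moreover have "norm x \<le> R" using R that by auto
    moreover have "2 * R + 1 \<le> norm z" using SL that by auto
    ultimately show False
      using norm_triangle_ineq4[of "x + z" x] R(1) by simp
  qed
  have Sm: "S \<in> sets borel" "emeasure lborel S < \<infinity>" "0 < m"
  proof -
    show "S \<in> sets borel" by (simp add: S_def)
    show "emeasure lborel S < \<infinity>" unfolding S_def by (rule emeasure_lborel_cball_finite)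
    show "0 < m" unfolding m_def S_def by (rule content_cball_pos) simp
  qed
  note U = uniform_on[OF Sm(1,2) Sm(3)[unfolded m_def], folded N_def m_def]
  interpret N: finite_measure N by (rule U)
  note U(3)[measurable_cong]
  have Nout: "AE z in N. x + z \<notin> \<Omega> \<and> norm z \<le> L" if "x \<in> \<Omega>" for x
    unfolding U(4) using SL out[OF that] by auto
  have NL: "AE z in N. norm z \<le> L" unfolding U(4) using SL by auto
  \<comment> \<open>\<open>vol + 1\<close> bounds the integral of the norm of the gradient when its
    modular is at most 1, and \<open>1 / m\<close> bounds the density of \<open>N\<close>; thus
    \<open>M\<close> will bound the averages times \<open>(t\<^sup>2) ^ n\<close>.\<close>
  define M where "M = max 1 ((vol + 1) / m)"
  have M1: "1 \<le> M" by (simp add: M_def)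
  have uc: "uniformly_continuous_on (closure \<Omega>) p"
    using p cpt by (rule compact_uniformly_continuous)
  have "0 < 1 / (2 * real ?n)" using DIM_positive[where 'a='a] by simp
  then obtain \<delta> where \<delta>: "0 < \<delta>"
    "\<And>x y. x \<in> closure \<Omega> \<Longrightarrow> y \<in> closure \<Omega> \<Longrightarrow> dist y x < \<delta> \<Longrightarrow> dist (p y) (p x) < 1 / (2 * real ?n)"
    using uc unfolding uniformly_continuous_on_def by meson
  \<comment> \<open>Bound for the averages once \<open>t\<^sup>2 * L \<ge> \<delta>\<close>;
    \<open>K\<close> unites both regimes with the factor \<open>2 * L\<close> from the ray
    estimate.\<close>
  define M2 where "M2 = max 1 (M * (L / \<delta>) ^ ?n)"
  define K where "K = (2 * L) powr P * max M (M2 powr P)"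
  have K1: "1 \<le> K"
  proof -
    have "1 * 1 \<le> (2 * L) powr P * max M (M2 powr P)"
      using L P(2) M1 by (intro mult_mono ge_one_powr_ge_zero) auto
    then show ?thesis by (simp add: K_def)
  qed
  have K0: "0 \<le> K" using K1 by simp
  have volfin: "emeasure lborel \<Omega> < \<infinity>" using bd by (rule emeasure_bounded_finite)
  then have vol: "emeasure lborel \<Omega> = ennreal vol"
    unfolding vol_def by (intro emeasure_eq_ennreal_measure) auto
  have vol0: "0 \<le> vol" by (simp add: vol_def)
  let ?U = unit_interval_measure
  interpret U: finite_measure ?U by (rule unit_interval_measure)
  have tU: "AE t in ?U. 0 < t \<and> t \<le> 1" by (rule unit_interval_measure)
  show ?thesis
  proof (rule that[of "K * (vol + 1)"])
    show "1 \<le> K * (vol + 1)" using mult_mono[OF K1, of 1 "vol + 1"] vol0 K1 by simp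
    fix \<phi> assume \<phi>: "\<phi> \<in> test_functions \<Omega>" and mod: "modular \<Omega> p (\<lambda>x. norm (grad \<phi> x)) \<le> 1"
    define g where "g = (\<lambda>x. norm (grad \<phi> x))"
    define G where "G = (\<lambda>x. indicator \<Omega> x * ennreal (\<bar>g x\<bar> powr p x))"
    have sm: "smooth \<phi>" using \<phi> by (rule test_function_smooth)
    have [measurable]: "\<phi> \<in> borel_measurable borel"
      by (intro borel_measurable_continuous_onI smooth_continuous_on sm)
    have gm [measurable]: "g \<in> borel_measurable borel"
      unfolding g_def by (intro borel_measurable_continuous_onI continuous_intros smooth_continuous_on_grad sm)
    have Gm [measurable]: "G \<in> borel_measurable borel"
      unfolding G_def by (rule modular_eq_lborel(1)[OF op p\<Omega> gm])
    have Gint: "(\<integral>\<^sup>+x. G x \<partial>lborel) \<le> 1"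
      using mod modular_eq_lborel(2)[OF op p\<Omega> gm] by (simp add: G_def g_def)
    obtain B where B: "\<And>x. g x \<le> B" using test_grad_bounded[OF \<phi>] by (auto simp: g_def)
    have g0: "0 \<le> g x" for x by (simp add: g_def)
    have gout: "g x = 0" if "x \<notin> \<Omega>" for x using test_grad_outside[OF \<phi> that] by (simp add: g_def)
    have pge: "2 \<le> p x" and ple: "p x \<le> P" if "x \<in> \<Omega>" for x
      using that closure_subset p2 P(1) by blast+
    have g1: "(\<integral>\<^sup>+x. ennreal (g x) \<partial>lborel) \<le> ennreal (vol + 1)"
    proof -
      have "(\<integral>\<^sup>+x. ennreal (g x) \<partial>lborel) \<le> (\<integral>\<^sup>+x. indicator \<Omega> x + G x \<partial>lborel)"
      proof (intro nn_integral_mono)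
        fix x
        show "ennreal (g x) \<le> indicator \<Omega> x + G x"
        proof (cases "x \<in> \<Omega>")
          case True
          have "g x \<le> 1 + g x powr p x"
            using powr_le_one_plus_powr[of "g x" 1 "p x"] pge[OF True] g0[of x] by simp
          then have "ennreal (g x) \<le> ennreal (1 + g x powr p x)" by (rule ennreal_leI)
          then show ?thesis using True g0 by (simp add: G_def ennreal_plus)
        qed (simp add: gout)
      qed
      also have "\<dots> = ennreal vol + (\<integral>\<^sup>+x. G x \<partial>lborel)"
        using op by (subst nn_integral_add) (auto simp: vol)
      also have "\<dots> \<le> ennreal vol + 1" using Gint by (intro add_left_mono)
      finally show ?thesis using vol0 by (simp add: ennreal_plus)
    qed
    define A where "A = (\<lambda>x t. LINT z|N. g (x + t\<^sup>2 *\<^sub>R z))"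
    define H where "H = (\<lambda>x t. \<integral>\<^sup>+z. G (x + t\<^sup>2 *\<^sub>R z) \<partial>N)"
    have gi: "integrable N (\<lambda>z. g (x + t\<^sup>2 *\<^sub>R z))" for x and t :: real
      by (rule N.integrable_const_bound[where B=B]) (use B g0 in auto)
    have A0: "0 \<le> A x t" for x t unfolding A_def using g0 by (intro integral_nonneg_AE) auto
    \<comment> \<open>The substitution \<open>z \<mapsto> x + t\<^sup>2 *\<^sub>R z\<close> has
      Jacobian \<open>(t\<^sup>2) ^ n\<close>, which limits the growth of the averages as
      \<open>t\<close> tends to 0.\<close>
    have Abound: "A x t * (t\<^sup>2) ^ ?n \<le> M" if t: "0 < t" for x t
    proof -
      have "ennreal (A x t) = (\<integral>\<^sup>+z. ennreal (g (x + t\<^sup>2 *\<^sub>R z)) \<partial>N)"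
        unfolding A_def using g0 by (intro nn_integral_eq_integral[symmetric] gi) auto
      also have "\<dots> \<le> ennreal (1 / m) * (\<integral>\<^sup>+z. ennreal (g (x + t\<^sup>2 *\<^sub>R z)) \<partial>lborel)"
        by (rule U(5)) measurable
      finally have "ennreal ((t\<^sup>2) ^ ?n) * ennreal (A x t) \<le>
         ennreal ((t\<^sup>2) ^ ?n) * (ennreal (1 / m) * (\<integral>\<^sup>+z. ennreal (g (x + t\<^sup>2 *\<^sub>R z)) \<partial>lborel))"
        by (intro mult_left_mono) auto
      also have "\<dots> = ennreal (1 / m) * (\<integral>\<^sup>+z. ennreal (g z) \<partial>lborel)"
        using nn_integral_lborel_affine[of "\<lambda>z. ennreal (g z)" "t\<^sup>2" x] t by (simp add: mult_ac)
      also have "\<dots> \<le> ennreal (1 / m) * ennreal (vol + 1)"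
        using g1 by (intro mult_left_mono) auto
      also have "\<dots> = ennreal ((vol + 1) / m)"
        using Sm(3) vol0 by (subst ennreal_mult[symmetric]) auto
      finally have "(t\<^sup>2) ^ ?n * A x t \<le> (vol + 1) / m"
        using A0[of x t] Sm(3) vol0 by (simp add: ennreal_mult[symmetric])
      then show ?thesis by (simp add: M_def mult.commute)
    qed
    have key: "ennreal ((2 * L * t * A x t) powr p x) \<le> ennreal K * (1 + H x t)"
      if x: "x \<in> \<Omega>" and t: "0 < t" "t \<le> 1" for x t
    proof -
      have px: "2 \<le> p x" "p x \<le> P" using pge ple x by auto
      have sp: "(2 * L * t * A x t) powr p x = (2 * L) powr p x * (t * A x t) powr p x"
        using L t A0[of x t] by (simp add: powr_mult[symmetric] mult.assoc)
      have Lp: "(2 * L) powr p x \<le> (2 * L) powr P" using L px by (intro powr_mono) auto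
      have "ennreal ((t * A x t) powr p x) \<le> ennreal (max M (M2 powr P)) * (1 + H x t)"
      proof (cases "t\<^sup>2 * L < \<delta>")
        case True
        define \<epsilon> where "\<epsilon> = 1 / (2 * real ?n)"
        define s where "s = p x - \<epsilon>"
        have "1 \<le> real ?n" using DIM_positive[where 'a='a] by linarith
        then have "1 \<le> 2 * real ?n" by linarith
        then have e1: "\<epsilon> \<le> 1" unfolding \<epsilon>_def by (subst divide_le_eq_1_pos) auto
        then have s1: "1 \<le> s" using px by (simp add: s_def)
        have f1: "t powr p x * A x t powr \<epsilon> \<le> M"
          unfolding \<epsilon>_def using A0 t Abound[OF t(1)] M1 px by (intro poincare_near_factor) auto
        \<comment> \<open>The power is split: exponent \<epsilon> of the average is absorbed
          together with the weight in \<open>t\<close>, exponent \<open>s\<close> is left to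
          Jensen's inequality.\<close>
        have "(t * A x t) powr p x = (t powr p x * A x t powr \<epsilon>) * A x t powr s"
          using t A0[of x t] by (simp add: powr_mult s_def mult.assoc powr_add[symmetric])
        also have "\<dots> \<le> M * A x t powr s"
          using f1 by (intro mult_right_mono) auto
        finally have "ennreal ((t * A x t) powr p x) \<le> ennreal M * ennreal (A x t powr s)"
          using M1 by (simp add: ennreal_mult[symmetric])
        also have "ennreal (A x t powr s) \<le> (\<integral>\<^sup>+z. ennreal (g (x + t\<^sup>2 *\<^sub>R z) powr s) \<partial>N)"
          unfolding A_def using g0 by (intro jensen_powr U(1,2) s1 gi) auto
        also have "\<dots> \<le> (\<integral>\<^sup>+z. 1 + G (x + t\<^sup>2 *\<^sub>R z) \<partial>N)"
        proof (intro nn_integral_mono_AE, use NL in eventually_elim)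
          case (elim z)
          show ?case
          proof (cases "x + t\<^sup>2 *\<^sub>R z \<in> \<Omega>")
            case in\<Omega>: True
            have "dist (x + t\<^sup>2 *\<^sub>R z) x = t\<^sup>2 * norm z" by (simp add: dist_norm)
            also have "\<dots> \<le> t\<^sup>2 * L" using elim by (intro mult_left_mono) auto
            finally have "dist (x + t\<^sup>2 *\<^sub>R z) x < \<delta>" using True by simp
            then have "dist (p (x + t\<^sup>2 *\<^sub>R z)) (p x) < \<epsilon>"
              unfolding \<epsilon>_def using x in\<Omega> closure_subset by (intro \<delta>(2)) auto
            then have "s \<le> p (x + t\<^sup>2 *\<^sub>R z)" unfolding s_def dist_real_def by linarith
            then have "g (x + t\<^sup>2 *\<^sub>R z) powr s \<le> 1 + g (x + t\<^sup>2 *\<^sub>R z) powr p (x + t\<^sup>2 *\<^sub>R z)"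
              using s1 g0 by (intro powr_le_one_plus_powr) auto
            then have "ennreal (g (x + t\<^sup>2 *\<^sub>R z) powr s) \<le>
                ennreal (1 + g (x + t\<^sup>2 *\<^sub>R z) powr p (x + t\<^sup>2 *\<^sub>R z))"
              by (rule ennreal_leI)
            then show ?thesis using in\<Omega> g0 by (simp add: G_def ennreal_plus)
          qed (simp add: gout)
        qed
        also have "\<dots> = 1 + H x t"
          unfolding H_def using U(2) by (subst nn_integral_add) (auto simp: N.emeasure_eq_measure)
        finally have "ennreal ((t * A x t) powr p x) \<le> ennreal M * (1 + H x t)"
          by (simp add: mult_left_mono)
        also have "\<dots> \<le> ennreal (max M (M2 powr P)) * (1 + H x t)"
          by (intro mult_right_mono ennreal_leI) auto
        finally show ?thesis .
      next
        case False
        have "(\<delta> / L) ^ ?n \<le> (t\<^sup>2) ^ ?n"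
          using False \<delta>(1) L by (intro power_mono) (auto simp: divide_le_eq)
        then have "A x t * (\<delta> / L) ^ ?n \<le> A x t * (t\<^sup>2) ^ ?n"
          using A0 by (intro mult_left_mono)
        also have "\<dots> \<le> M" by (rule Abound[OF t(1)])
        finally have "A x t \<le> M / (\<delta> / L) ^ ?n"
          using \<delta>(1) L by (simp add: pos_le_divide_eq)
        also have "\<dots> = M * (L / \<delta>) ^ ?n" by (simp add: power_divide)
        finally have AM2: "A x t \<le> M2" by (simp add: M2_def)
        have "t * A x t \<le> 1 * A x t" using t A0 by (intro mult_right_mono)
        then have "t * A x t \<le> M2" using AM2 by simp
        then have "(t * A x t) powr p x \<le> M2 powr p x"
          using t A0 px by (intro powr_mono2) auto
        also have "\<dots> \<le> M2 powr P" using px by (intro powr_mono) (auto simp: M2_def)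
        finally have "ennreal ((t * A x t) powr p x) \<le> ennreal (max M (M2 powr P)) * 1"
          by (simp add: ennreal_leI le_max_iff_disj)
        also have "\<dots> \<le> ennreal (max M (M2 powr P)) * (1 + H x t)"
          by (intro mult_left_mono) auto
        finally show ?thesis .
      qed
      then have "ennreal ((2 * L) powr P) * ennreal ((t * A x t) powr p x) \<le>
          ennreal ((2 * L) powr P) * (ennreal (max M (M2 powr P)) * (1 + H x t))"
        by (intro mult_left_mono) auto
      moreover have "ennreal ((2 * L * t * A x t) powr p x) \<le>
          ennreal ((2 * L) powr P) * ennreal ((t * A x t) powr p x)"
        unfolding sp using Lp by (simp add: ennreal_mult[symmetric] mult_right_mono)
      ultimately show ?thesis
        using M1 by (simp add: K_def ennreal_mult mult.assoc)
    qed
    have [measurable]: "\<Omega> \<in> sets borel" using op by simp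
    have pw: "ennreal (\<bar>\<phi> x\<bar> powr p x) \<le> (\<integral>\<^sup>+t. ennreal K * (1 + H x t) \<partial>?U)" if x: "x \<in> \<Omega>" for x
    proof -
      have T: "integrable ?U (\<lambda>t. 2 * L * t * A x t)" "\<bar>\<phi> x\<bar> \<le> (LINT t|?U. 2 * L * t * A x t)"
        unfolding A_def g_def
        by (rule test_function_average[OF \<phi> U(1,2,3) Nout[OF x] order_trans[OF zero_le_one L]])+
      have "\<bar>\<phi> x\<bar> powr p x \<le> (LINT t|?U. 2 * L * t * A x t) powr p x"
        using T(2) pge[OF x] by (intro powr_mono2) auto
      then have "ennreal (\<bar>\<phi> x\<bar> powr p x) \<le> ennreal ((LINT t|?U. 2 * L * t * A x t) powr p x)"
        by (rule ennreal_leI)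
      also have "\<dots> \<le> (\<integral>\<^sup>+t. ennreal ((2 * L * t * A x t) powr p x) \<partial>?U)"
      proof (rule jensen_powr[OF unit_interval_measure(1,2) _ T(1)])
        show "1 \<le> p x" using pge[OF x] by simp
        show "AE t in ?U. 0 \<le> 2 * L * t * A x t"
          using tU by eventually_elim (use A0 L in auto)
      qed
      also have "\<dots> \<le> (\<integral>\<^sup>+t. ennreal K * (1 + H x t) \<partial>?U)"
        using tU by (intro nn_integral_mono_AE) (erule eventually_mono, blast intro: key[OF x])
      finally show ?thesis .
    qed
    interpret PU: pair_sigma_finite lborel ?U ..
    interpret PN: pair_sigma_finite lborel N ..
    \<comment> \<open>\<open>H\<close> averages translates of \<open>G\<close> over the probability
      measure \<open>N\<close>, so its integral over \<open>x\<close> is again that of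
      \<open>G\<close>.\<close>
    have HI: "(\<integral>\<^sup>+x. H x t \<partial>lborel) \<le> 1" for t
    proof -
      have "(\<integral>\<^sup>+x. H x t \<partial>lborel) = (\<integral>\<^sup>+z. \<integral>\<^sup>+x. G (x + t\<^sup>2 *\<^sub>R z) \<partial>lborel \<partial>N)"
        unfolding H_def by (rule PN.Fubini'[symmetric]) measurable
      also have "\<dots> = (\<integral>\<^sup>+z. (\<integral>\<^sup>+x. G x \<partial>lborel) \<partial>N)"
        by (simp add: nn_integral_lborel_translation)
      also have "\<dots> = (\<integral>\<^sup>+x. G x \<partial>lborel)"
        using U(2) by (simp add: N.emeasure_eq_measure)
      finally show ?thesis using Gint by simp
    qed
    have "modular \<Omega> p \<phi> = (\<integral>\<^sup>+x. indicator \<Omega> x * ennreal (\<bar>\<phi> x\<bar> powr p x) \<partial>lborel)"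
      by (rule modular_eq_lborel(2)[OF op p\<Omega>]) simp
    also have "\<dots> \<le> (\<integral>\<^sup>+x. \<integral>\<^sup>+t. ennreal K * (indicator \<Omega> x + H x t) \<partial>?U \<partial>lborel)"
      using pw by (intro nn_integral_mono) (auto simp: indicator_def)
    also have "\<dots> = (\<integral>\<^sup>+t. \<integral>\<^sup>+x. ennreal K * (indicator \<Omega> x + H x t) \<partial>lborel \<partial>?U)"
      unfolding H_def by (intro PU.Fubini'[symmetric]) measurable
    also have "\<dots> \<le> (\<integral>\<^sup>+t. ennreal K * (ennreal vol + 1) \<partial>?U)"
    proof (intro nn_integral_mono)
      fix t
      have [measurable]: "(\<lambda>x. H x t) \<in> borel_measurable borel" unfolding H_def by measurable
      have "(\<integral>\<^sup>+x. ennreal K * (indicator \<Omega> x + H x t) \<partial>lborel) =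
          ennreal K * (ennreal vol + (\<integral>\<^sup>+x. H x t \<partial>lborel))"
        using op by (simp add: nn_integral_cmult nn_integral_add vol)
      also have "\<dots> \<le> ennreal K * (ennreal vol + 1)"
        using HI by (intro mult_left_mono add_left_mono) auto
      finally show "(\<integral>\<^sup>+x. ennreal K * (indicator \<Omega> x + H x t) \<partial>lborel) \<le> ennreal K * (ennreal vol + 1)" .
    qed
    also have "\<dots> = ennreal K * (ennreal vol + 1)"
      using unit_interval_measure(2) by (simp add: U.emeasure_eq_measure)
    also have "\<dots> = ennreal (K * (vol + 1))"
      using vol0 K0 by (simp add: ennreal_mult ennreal_plus)
    finally show "modular \<Omega> p \<phi> \<le> ennreal (K * (vol + 1))" .
  qed
qed

subsection \<open>Zeros of coercive maps and diagonal sequences\<close>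

lemma bounded_diagonal_subseq:
  fixes f :: "nat \<Rightarrow> nat \<Rightarrow> real"
  assumes bd: "\<And>m n. \<bar>f m n\<bar> \<le> B m"
  obtains d where "strict_mono d" "\<And>m. convergent (\<lambda>n. f m (d n))"
proof -
  let ?P = "\<lambda>m s. convergent (\<lambda>n. f m (s n))"
  interpret D: subseqs ?P
  proof
    fix m and s :: "nat \<Rightarrow> nat" assume "strict_mono s"
    have "\<And>k. f m (s k) \<in> {- B m..B m}" using bd by (auto simp: abs_le_iff minus_le_iff)
    then obtain l r where "strict_mono r" "((\<lambda>n. f m (s n)) \<circ> r) \<longlonglongrightarrow> l"
      using compact_imp_seq_compact[OF compact_Icc] unfolding seq_compact_def by metis
    then show "\<exists>r. strict_mono r \<and> convergent (\<lambda>n. f m ((s \<circ> r) n))"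
      by (auto simp: convergent_def o_def)
  qed
  have "?P m D.diagseq" for m
  proof -
    have *: "?P m (D.seqseq (Suc m))" by (rule D.seqseq_holds)
    \<comment> \<open>From index \<open>Suc m\<close> on, the diagonal sequence is a subsequence of
      the stage at which \<open>f m\<close> was made convergent.\<close>
    have "?P m (D.diagseq \<circ> ((+) (Suc m)))"
      unfolding D.diagseq_seqseq
      using convergent_subseq_convergent[OF * D.subseq_diagonal_rest[of "Suc m"]] by (simp add: o_def)
    then obtain l where "(\<lambda>n. f m (D.diagseq (n + Suc m))) \<longlonglongrightarrow> l"
      by (auto simp: convergent_def add.commute)
    then show ?thesis unfolding convergent_def by (blast intro: LIMSEQ_offset)
  qed
  then show ?thesis using D.subseq_diagseq that by blast
qed

text \<open>The dimension \<open>n\<close> is a term here, so that Brouwer's theorem, which is stated for a type,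
  does not apply; Kuhn's combinatorial lemma behind it does.\<close>

lemma coercive_zero:
  fixes E :: "(nat \<Rightarrow> real) \<Rightarrow> nat \<Rightarrow> real"
  assumes cont: "\<And>c cs i. i < n \<Longrightarrow> (\<And>j. j < n \<Longrightarrow> (\<lambda>k. cs k j) \<longlonglongrightarrow> c j) \<Longrightarrow>
      (\<lambda>k. E (cs k) i) \<longlonglongrightarrow> E c i"
    and R: "0 < R"
    and coercive: "\<And>c i. i < n \<Longrightarrow> \<bar>c i\<bar> = R \<Longrightarrow> 0 < (\<Sum>i<n. c i * E c i)"
  obtains c where "\<And>i. i < n \<Longrightarrow> E c i = 0"
proof -
  \<comment> \<open>The minimum and the maximum encode closed alternatives: \<open>r\<close> lies on
    or beyond the lower face or has \<open>E r i \<le> 0\<close>, and dually for \<open>s\<close>.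
    In this form they survive the limit of vanishing mesh size.\<close>
  have approx: "\<exists>x. (\<forall>j<n. \<bar>x j\<bar> \<le> R) \<and> (\<forall>i<n. \<exists>r s.
      (\<forall>j<n. \<bar>r j - x j\<bar> \<le> 2 * R / real (Suc k) \<and> \<bar>s j - x j\<bar> \<le> 2 * R / real (Suc k)) \<and>
      min (r i + R) (E r i) \<le> 0 \<and> 0 \<le> max (s i - R) (E s i))" for k
  proof -
    define N where "N = Suc k"
    \<comment> \<open>A grid of mesh \<open>2 * R / N\<close> on the cube with side
      \<open>2 * R\<close>. The labels are forced to be 0 and 1 on opposite faces, as Kuhn's lemma
      demands, and follow the sign of \<open>E\<close> elsewhere.\<close>
    define X where "X = (\<lambda>(q::nat \<Rightarrow> nat) i. - R + 2 * R * real (q i) / real N)"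
    define lab where "lab = (\<lambda>q i. if q i = 0 then 0 else if q i = N then 1 else if E (X q) i \<le> 0 then 0 else (1::nat))"
    have N: "0 < N" by (simp add: N_def)
    obtain q where q: "\<forall>i<n. q i < N"
      and rs: "\<forall>i<n. \<exists>r s. (\<forall>j<n. q j \<le> r j \<and> r j \<le> q j + 1) \<and> (\<forall>j<n. q j \<le> s j \<and> s j \<le> q j + 1) \<and>
        lab r i \<noteq> lab s i"
      by (rule kuhn_lemma[of N n lab]) (use N in \<open>auto simp: lab_def\<close>)
    have near: "\<bar>X r j - X q j\<bar> \<le> 2 * R / real N" if "q j \<le> r j" "r j \<le> q j + 1" for r j
    proof -
      have "X r j - X q j = (2 * R / real N) * (real (r j) - real (q j))"
        by (simp add: X_def diff_divide_distrib right_diff_distrib)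
      moreover have "\<bar>real (r j) - real (q j)\<bar> \<le> 1" using that by linarith
      ultimately show ?thesis using R
        by (auto simp: abs_mult intro!: divide_right_mono mult_left_le)
    qed
    have lab0: "min (X r i + R) (E (X r) i) \<le> 0" if "lab r i = 0" for r i
      using that by (auto simp: lab_def X_def min_le_iff_disj split: if_splits)
    have lab1: "0 \<le> max (X r i - R) (E (X r) i)" if "lab r i \<noteq> 0" for r i
      using that N by (auto simp: lab_def X_def le_max_iff_disj split: if_splits)
    have lab01: "lab r i = 0 \<or> lab r i = 1" for r i by (auto simp: lab_def)
    show ?thesis
    proof (rule exI[of _ "X q"], intro conjI allI impI)
      fix j assume "j < n"
      then have "real (q j) \<le> real N" using q by (simp add: less_imp_le)
      then have "0 \<le> 2 * R * real (q j) / real N" "2 * R * real (q j) / real N \<le> 2 * R"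
        using R N by (auto simp: divide_le_eq)
      then show "\<bar>X q j\<bar> \<le> R" unfolding X_def by linarith
    next
      fix i assume i: "i < n"
      then obtain r s where rs: "\<forall>j<n. q j \<le> r j \<and> r j \<le> q j + 1" "\<forall>j<n. q j \<le> s j \<and> s j \<le> q j + 1"
        "lab r i \<noteq> lab s i" using rs by blast
      show "\<exists>r s. (\<forall>j<n. \<bar>r j - X q j\<bar> \<le> 2 * R / real (Suc k) \<and> \<bar>s j - X q j\<bar> \<le> 2 * R / real (Suc k)) \<and>
        min (r i + R) (E r i) \<le> 0 \<and> 0 \<le> max (s i - R) (E s i)"
      proof (cases "lab r i = 0")
        case True
        then show ?thesis
          by (intro exI[of _ "X r"] exI[of _ "X s"] conjI lab0 lab1)
             (use rs near in \<open>auto simp: N_def[symmetric]\<close>)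
      next
        case False
        then have "lab s i = 0" using rs(3) lab01[of r i] lab01[of s i] by auto
        with False show ?thesis
          by (intro exI[of _ "X s"] exI[of _ "X r"] conjI lab0 lab1)
             (use rs near in \<open>auto simp: N_def[symmetric]\<close>)
      qed
    qed
  qed
  then obtain x where x: "\<And>k j. j < n \<Longrightarrow> \<bar>x k j\<bar> \<le> R" and
    rs: "\<And>k i. i < n \<Longrightarrow> \<exists>r s.
      (\<forall>j<n. \<bar>r j - x k j\<bar> \<le> 2 * R / real (Suc k) \<and> \<bar>s j - x k j\<bar> \<le> 2 * R / real (Suc k)) \<and>
      min (r i + R) (E r i) \<le> 0 \<and> 0 \<le> max (s i - R) (E s i)"
    by metis
  obtain d where d: "strict_mono d" and conv: "\<And>m. convergent (\<lambda>k. if m < n then x (d k) m else 0)"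
    by (rule bounded_diagonal_subseq[of "\<lambda>m k. if m < n then x k m else 0" "\<lambda>_. R"])
       (use x R in auto)
  define c where "c = (\<lambda>m. lim (\<lambda>k. if m < n then x (d k) m else 0))"
  have lim: "(\<lambda>k. x (d k) j) \<longlonglongrightarrow> c j" if "j < n" for j
    using conv[of j] that unfolding c_def convergent_LIMSEQ_iff by simp
  have cR: "\<bar>c j\<bar> \<le> R" if "j < n" for j
    using tendsto_rabs[OF lim[OF that]] x[OF that] by (intro LIMSEQ_le_const2[where x="\<bar>c j\<bar>"]) auto
  have lim': "(\<lambda>k. y k j) \<longlonglongrightarrow> c j"
    if "j < n" "\<And>k. \<bar>y k j - x (d k) j\<bar> \<le> 2 * R / real (Suc (d k))" for y j
  proof -
    have "(\<lambda>k. 2 * R / real (Suc (d k))) \<longlonglongrightarrow> 0"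
      using LIMSEQ_subseq_LIMSEQ[OF tendsto_mult_right_zero[OF LIMSEQ_inverse_real_of_nat, of "2 * R"] d]
      by (simp add: o_def divide_inverse)
    then have "(\<lambda>k. y k j - x (d k) j) \<longlonglongrightarrow> 0"
      by (rule Lim_null_comparison[rotated]) (use that(2) in auto)
    from tendsto_add[OF this lim[OF that(1)]] show ?thesis by simp
  qed
  have signs: "min (c i + R) (E c i) \<le> 0 \<and> 0 \<le> max (c i - R) (E c i)" if i: "i < n" for i
  proof -
    obtain r s where r: "\<And>k j. j < n \<Longrightarrow> \<bar>r k j - x k j\<bar> \<le> 2 * R / real (Suc k)"
      and s: "\<And>k j. j < n \<Longrightarrow> \<bar>s k j - x k j\<bar> \<le> 2 * R / real (Suc k)"
      and r0: "\<And>k. min (r k i + R) (E (r k) i) \<le> 0" and s0: "\<And>k. 0 \<le> max (s k i - R) (E (s k) i)"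
      using rs[OF i] by metis
    have r': "(\<lambda>k. r (d k) j) \<longlonglongrightarrow> c j" and s': "(\<lambda>k. s (d k) j) \<longlonglongrightarrow> c j" if "j < n" for j
      using r s that by (auto intro!: lim'[of j "\<lambda>k. r (d k)"] lim'[of j "\<lambda>k. s (d k)"])
    have "(\<lambda>k. min (r (d k) i + R) (E (r (d k)) i)) \<longlonglongrightarrow> min (c i + R) (E c i)"
      by (intro tendsto_intros r' i cont)
    then have 1: "min (c i + R) (E c i) \<le> 0" by (rule LIMSEQ_le_const2) (use r0 in auto)
    have "(\<lambda>k. max (s (d k) i - R) (E (s (d k)) i)) \<longlonglongrightarrow> max (c i - R) (E c i)"
      by (intro tendsto_intros s' i cont)
    then have 2: "0 \<le> max (c i - R) (E c i)" by (rule LIMSEQ_le_const) (use s0 in auto)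
    show ?thesis using 1 2 by blast
  qed
  \<comment> \<open>On a face the alternatives force \<open>E c i\<close> against the sign of
    \<open>c i\<close>; off the faces they force it to be 0. Every product is thus nonpositive, and
    coercivity excludes the faces.\<close>
  have nonpos: "c i * E c i \<le> 0" if "i < n" for i
    using signs[OF that] cR[OF that] R
    by (auto simp: min_le_iff_disj le_max_iff_disj mult_le_0_iff)
  then have "(\<Sum>i<n. c i * E c i) \<le> 0" by (intro sum_nonpos) auto
  then have ne: "\<bar>c i\<bar> \<noteq> R" if "i < n" for i using coercive[OF that] by fastforce
  have "E c i = 0" if "i < n" for i
    using signs[OF that] ne[OF that] cR[OF that]
    by (auto simp: min_le_iff_disj le_max_iff_disj abs_if split: if_splits)
  then show ?thesis by (rule that)
qed

subsection \<open>A countable dense set of test functions\<close>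

lemma test_function_grad_component:
  assumes \<phi>: "\<phi> \<in> test_functions \<Omega>" and i: "i \<in> Basis"
  shows "(\<lambda>x. grad \<phi> x \<bullet> i) \<in> test_functions \<Omega>"
proof -
  let ?K = "closure {x. \<phi> x \<noteq> 0}"
  have K: "compact ?K" "?K \<subseteq> \<Omega>" and sm: "smooth \<phi>"
    using \<phi> by (auto simp: test_functions_def)
  have "{x. grad \<phi> x \<bullet> i \<noteq> 0} \<subseteq> ?K"
  proof
    fix x assume "x \<in> {x. grad \<phi> x \<bullet> i \<noteq> 0}"
    then have "grad \<phi> x \<noteq> 0" by auto
    then show "x \<in> ?K" using grad_outside_support by blast
  qed
  then have cl: "closure {x. grad \<phi> x \<bullet> i \<noteq> 0} \<subseteq> ?K" by (rule closure_minimal) simp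
  then show ?thesis
    using compact_closed_subset[OF K(1) cl] K(2) smooth_frechet[OF sm i]
    unfolding test_functions_def by blast
qed

lemma test_function_lipschitz:
  assumes "\<phi> \<in> test_functions \<Omega>"
  obtains K where "0 \<le> K" "\<And>x y. \<bar>\<phi> x - \<phi> y\<bar> \<le> K * norm (x - y)"
proof -
  obtain B where "\<And>x. norm (grad \<phi> x) \<le> B" using test_grad_bounded[OF assms] by blast
  then show ?thesis
    using that[of B] smooth_lipschitz[OF test_function_smooth[OF assms]] order_trans[OF norm_ge_zero] by blast
qed

text \<open>A common integer constant sorts the test functions into countably many classes, each
  uniformly Lipschitz together with the gradient components.\<close>

lemma test_function_C2:
  fixes \<phi> :: "'a::euclidean_space \<Rightarrow> real"
  assumes \<phi>: "\<phi> \<in> test_functions \<Omega>"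
  obtains K :: nat where "\<And>x y. \<bar>\<phi> x - \<phi> y\<bar> \<le> real K * norm (x - y)"
    "\<And>x y i. i \<in> Basis \<Longrightarrow> \<bar>grad \<phi> x \<bullet> i - grad \<phi> y \<bullet> i\<bar> \<le> real K * norm (x - y)"
proof -
  obtain K0 where K0: "0 \<le> K0" "\<And>x y. \<bar>\<phi> x - \<phi> y\<bar> \<le> K0 * norm (x - y)"
    using test_function_lipschitz[OF \<phi>] by blast
  have "\<exists>K\<ge>0. \<forall>x y. \<bar>grad \<phi> x \<bullet> i - grad \<phi> y \<bullet> i\<bar> \<le> K * norm (x - y)" if "i \<in> Basis" for i
    by (rule test_function_lipschitz[OF test_function_grad_component[OF \<phi> that]]) blast
  then obtain k where k: "\<And>i. i \<in> Basis \<Longrightarrow> 0 \<le> k i"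
    "\<And>i x y. i \<in> Basis \<Longrightarrow> \<bar>grad \<phi> x \<bullet> i - grad \<phi> y \<bullet> i\<bar> \<le> k i * norm (x - y)"
    by metis
  obtain K :: nat where K: "K0 + (\<Sum>i\<in>Basis. k i) \<le> real K" using real_arch_simple by blast
  have s0: "0 \<le> (\<Sum>i\<in>Basis. k i)" using k by (intro sum_nonneg) auto
  show ?thesis
  proof (rule that[of K])
    fix x y :: 'a
    have "K0 * norm (x - y) \<le> real K * norm (x - y)" using K s0 by (intro mult_right_mono) auto
    then show "\<bar>\<phi> x - \<phi> y\<bar> \<le> real K * norm (x - y)" using K0(2)[of x y] by linarith
    fix i :: 'a assume i: "i \<in> Basis"
    have "k i \<le> (\<Sum>i\<in>Basis. k i)" using k i by (intro member_le_sum) auto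
    then have "k i * norm (x - y) \<le> real K * norm (x - y)" using K K0(1) by (intro mult_right_mono) auto
    then show "\<bar>grad \<phi> x \<bullet> i - grad \<phi> y \<bullet> i\<bar> \<le> real K * norm (x - y)" using k(2)[OF i, of x y] by linarith
  qed
qed

lemma floor_eq_imp_close:
  fixes a b :: real
  assumes "\<lfloor>real (Suc j) * a\<rfloor> = \<lfloor>real (Suc j) * b\<rfloor>"
  shows "\<bar>a - b\<bar> \<le> 1 / real (Suc j)"
proof -
  have "\<bar>real (Suc j) * a - real (Suc j) * b\<bar> \<le> 1" using assms by linarith
  then have "real (Suc j) * \<bar>a - b\<bar> \<le> 1" by (simp only: right_diff_distrib[symmetric] abs_mult abs_of_nat)
  then show ?thesis by (simp add: pos_le_divide_eq mult.commute del: of_nat_Suc)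
qed

text \<open>Within a class of fixed Lipschitz constant, a test function and its gradient are
  determined up to a small error by finitely many rounded values on a finite net, and there are only
  countably many such tables. One representative is kept for every class, mesh and table.\<close>

lemma countable_dense_test_functions:
  fixes \<Omega> :: "'a::euclidean_space set"
  assumes bd: "bounded \<Omega>"
  obtains D :: "nat \<Rightarrow> 'a \<Rightarrow> real" where "\<And>m. D m \<in> test_functions \<Omega>"
    "\<And>\<phi> e. \<phi> \<in> test_functions \<Omega> \<Longrightarrow> 0 < e \<Longrightarrow>
      \<exists>m. \<forall>x\<in>\<Omega>. \<bar>\<phi> x - D m x\<bar> \<le> e \<and> norm (grad \<phi> x - grad (D m) x) \<le> e"
proof -
  define T where "T = (\<lambda>K::nat. {\<phi> \<in> test_functions \<Omega>. (\<forall>x y. \<bar>\<phi> x - \<phi> y\<bar> \<le> real K * norm (x - y)) \<and>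
    (\<forall>x y. \<forall>i\<in>Basis. \<bar>grad \<phi> x \<bullet> i - grad \<phi> y \<bullet> i\<bar> \<le> real K * norm (x - y))})"
  have "\<exists>X. finite X \<and> \<Omega> \<subseteq> (\<Union>y\<in>X. ball y (1 / real (Suc j)))" for j
  proof -
    have "compact (closure \<Omega>)" using bd by simp
    then obtain X where "finite X" "closure \<Omega> \<subseteq> (\<Union>y\<in>X. ball y (1 / real (Suc j)))"
      unfolding compact_eq_totally_bounded by (metis of_nat_0_less_iff zero_less_Suc zero_less_divide_1_iff)
    then show ?thesis using closure_subset[of \<Omega>] by blast
  qed
  then obtain X where X: "\<And>j. finite (X j)" "\<And>j. \<Omega> \<subseteq> (\<Union>y\<in>X j. ball y (1 / real (Suc j)))"
    by metis
  define val where "val = (\<lambda>j \<phi> (y::'a). (\<lfloor>real (Suc j) * \<phi> y\<rfloor>, \<lambda>i\<in>Basis. \<lfloor>real (Suc j) * (grad \<phi> y \<bullet> i)\<rfloor>))"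
  define code where "code = (\<lambda>j \<phi>. \<lambda>y\<in>X j. val j \<phi> y)"
  \<comment> \<open>\<open>inv_into\<close> picks a preimage for each table that actually occurs, so
    the chosen functions are test functions of the same class.\<close>
  define S where "S = (\<Union>K. \<Union>j. inv_into (T K) (code j) ` code j ` T K)"
  have "countable (code j ` T K)" for j K
  proof (rule countable_subset)
    show "code j ` T K \<subseteq> (\<Pi>\<^sub>E y\<in>X j. UNIV \<times> (\<Pi>\<^sub>E i\<in>(Basis :: 'a set). UNIV))"
      by (auto simp: code_def val_def)
    show "countable (\<Pi>\<^sub>E y\<in>X j. (UNIV :: int set) \<times> (\<Pi>\<^sub>E i\<in>(Basis :: 'a set). (UNIV :: int set)))"
      by (intro countable_PiE X countable_SIGMA) auto
  qed
  then have "countable (inv_into (T K) (code j) ` code j ` T K)" for K j by (rule countable_image)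
  then have cS: "countable S" unfolding S_def by (intro countable_UN) auto
  have S: "S \<subseteq> test_functions \<Omega>"
  proof
    fix \<psi> assume "\<psi> \<in> S"
    then obtain K j c where "\<psi> = inv_into (T K) (code j) c" "c \<in> code j ` T K" by (auto simp: S_def)
    then have "\<psi> \<in> T K" using inv_into_into by metis
    then show "\<psi> \<in> test_functions \<Omega>" by (simp add: T_def)
  qed
  have dense: "\<exists>\<psi>\<in>S. \<forall>x\<in>\<Omega>. \<bar>\<phi> x - \<psi> x\<bar> \<le> e \<and> norm (grad \<phi> x - grad \<psi> x) \<le> e"
    if \<phi>: "\<phi> \<in> test_functions \<Omega>" and e: "0 < e" for \<phi> e
  proof -
    obtain K where "\<And>x y. \<bar>\<phi> x - \<phi> y\<bar> \<le> real K * norm (x - y)"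
      "\<And>x y i. i \<in> Basis \<Longrightarrow> \<bar>grad \<phi> x \<bullet> i - grad \<phi> y \<bullet> i\<bar> \<le> real K * norm (x - y)"
      using test_function_C2[OF \<phi>] by blast
    then have K: "\<phi> \<in> T K" using \<phi> by (simp add: T_def)
    define n where "n = real DIM('a)"
    have n1: "1 \<le> n" unfolding n_def using DIM_positive[where 'a='a] by linarith
    \<comment> \<open>Each scalar comparison costs \<open>2 * K + 1\<close> mesh widths: two
      Lipschitz moves to the net point and one rounding error. Summing over the gradient components
      costs the further factor \<open>n\<close>.\<close>
    obtain j :: nat where j: "n * (2 * real K + 1) / e \<le> real j" using real_arch_simple by blast
    define h where "h = 1 / real (Suc j)"
    have h0: "0 \<le> h" by (simp add: h_def)
    have h: "n * ((2 * real K + 1) * h) \<le> e"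
    proof -
      have "n * (2 * real K + 1) \<le> e * real (Suc j)"
        using j e by (simp add: divide_le_eq algebra_simps)
      then show ?thesis by (simp add: h_def divide_le_eq del: of_nat_Suc)
    qed
    define \<psi> where "\<psi> = inv_into (T K) (code j) (code j \<phi>)"
    have \<psi>S: "\<psi> \<in> S" using K by (auto simp: S_def \<psi>_def)
    have \<psi>T: "\<psi> \<in> T K" and codeq: "code j \<psi> = code j \<phi>"
      unfolding \<psi>_def using inv_into_into[OF imageI[OF K]] f_inv_into_f[OF imageI[OF K]] by auto
    have close: "\<bar>F x - G x\<bar> \<le> (2 * real K + 1) * h"
      if y: "norm (x - y) \<le> h" and fl: "\<lfloor>real (Suc j) * F y\<rfloor> = \<lfloor>real (Suc j) * G y\<rfloor>"
        and "\<bar>F x - F y\<bar> \<le> real K * norm (x - y)" "\<bar>G x - G y\<bar> \<le> real K * norm (x - y)" for F G :: "'a \<Rightarrow> real" and x y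
    proof -
      have "\<bar>F y - G y\<bar> \<le> h" unfolding h_def using fl by (rule floor_eq_imp_close)
      moreover have "real K * norm (x - y) \<le> real K * h" using y by (intro mult_left_mono) auto
      ultimately have "\<bar>F x - G x\<bar> \<le> real K * h + h + real K * h" using that(3,4) by linarith
      then show ?thesis by (simp add: algebra_simps)
    qed
    show ?thesis
    proof (intro bexI[OF _ \<psi>S] ballI)
      fix x assume "x \<in> \<Omega>"
      then obtain y where y: "y \<in> X j" "norm (x - y) \<le> h"
        using X(2)[of j] by (force simp: h_def dist_norm norm_minus_commute)
      have v: "val j \<psi> y = val j \<phi> y"
        using fun_cong[OF codeq, of y] y(1) by (simp add: code_def)
      have "\<bar>\<phi> x - \<psi> x\<bar> \<le> (2 * real K + 1) * h"
        by (rule close[OF y(2)]) (use v K \<psi>T in \<open>auto simp: val_def T_def\<close>)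
      moreover have "(2 * real K + 1) * h \<le> n * ((2 * real K + 1) * h)"
        using mult_right_mono[OF n1, of "(2 * real K + 1) * h"] h0 by simp
      ultimately have 1: "\<bar>\<phi> x - \<psi> x\<bar> \<le> e" using h by linarith
      have "norm (grad \<phi> x - grad \<psi> x) \<le> (\<Sum>i\<in>Basis. \<bar>(grad \<phi> x - grad \<psi> x) \<bullet> i\<bar>)" by (rule norm_le_l1)
      also have "\<dots> \<le> (\<Sum>i\<in>(Basis :: 'a set). (2 * real K + 1) * h)"
      proof (rule sum_mono)
        fix i :: 'a assume i: "i \<in> Basis"
        have "\<lfloor>real (Suc j) * (grad \<phi> y \<bullet> i)\<rfloor> = \<lfloor>real (Suc j) * (grad \<psi> y \<bullet> i)\<rfloor>"
          using fun_cong[OF arg_cong[OF v, of snd], of i] i by (simp add: val_def)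
        then have "\<bar>grad \<phi> x \<bullet> i - grad \<psi> x \<bullet> i\<bar> \<le> (2 * real K + 1) * h"
          by (rule close[OF y(2), of "\<lambda>x. grad \<phi> x \<bullet> i" "\<lambda>x. grad \<psi> x \<bullet> i"])
             (use K \<psi>T i in \<open>auto simp: T_def\<close>)
        then show "\<bar>(grad \<phi> x - grad \<psi> x) \<bullet> i\<bar> \<le> (2 * real K + 1) * h" by (simp add: inner_diff_left)
      qed
      also have "\<dots> \<le> e" using h by (simp add: n_def)
      finally show "\<bar>\<phi> x - \<psi> x\<bar> \<le> e \<and> norm (grad \<phi> x - grad \<psi> x) \<le> e" using 1 by blast
    qed
  qed
  have "S \<noteq> {}" using dense[OF test_function_zero, of 1] by auto
  then obtain D :: "nat \<Rightarrow> 'a \<Rightarrow> real" where D: "range D = S" using cS by (metis range_from_nat_into)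
  show ?thesis
  proof (rule that[of D])
    show "D m \<in> test_functions \<Omega>" for m using D S by auto
    show "\<exists>m. \<forall>x\<in>\<Omega>. \<bar>\<phi> x - D m x\<bar> \<le> e \<and> norm (grad \<phi> x - grad (D m) x) \<le> e"
      if "\<phi> \<in> test_functions \<Omega>" "0 < e" for \<phi> e
      using dense[OF that] unfolding D[symmetric] by blast
  qed
qed

subsection \<open>Compactness in \<open>L\<^sup>1\<close>\<close>

text \<open>The ray estimate integrated over \<open>x\<close>, where all translates of the gradient
  have the same integral. The constant \<open>2 * L\<close> comes from bounding the weight
  \<open>2 * t\<close> by 2.\<close>

lemma test_function_translation:
  fixes \<phi> :: "'a::euclidean_space \<Rightarrow> real"
  assumes \<phi>: "\<phi> \<in> test_functions \<Omega>" and L: "norm z \<le> L"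
  shows "(\<integral>\<^sup>+x. ennreal \<bar>\<phi> (x + z) - \<phi> x\<bar> \<partial>lborel) \<le>
    ennreal (2 * L) * (\<integral>\<^sup>+x. ennreal (norm (grad \<phi> x)) \<partial>lborel)"
proof -
  have sm: "smooth \<phi>" using \<phi> by (rule test_function_smooth)
  have [measurable]: "grad \<phi> \<in> borel_measurable borel"
    using smooth_continuous_on_grad[OF sm] by (rule borel_measurable_continuous_onI)
  let ?U = unit_interval_measure
  interpret U: finite_measure ?U by (rule unit_interval_measure)
  interpret P: pair_sigma_finite lborel ?U ..
  have L0: "0 \<le> L" using L norm_ge_zero order_trans by blast
  have "(\<integral>\<^sup>+x. ennreal \<bar>\<phi> (x + z) - \<phi> x\<bar> \<partial>lborel) \<le>
      (\<integral>\<^sup>+x. \<integral>\<^sup>+t. ennreal (2 * L * t * norm (grad \<phi> (x + t\<^sup>2 *\<^sub>R z))) \<partial>?U \<partial>lborel)"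
    by (intro nn_integral_mono test_function_ray[OF \<phi> L])
  also have "\<dots> = (\<integral>\<^sup>+t. \<integral>\<^sup>+x. ennreal (2 * L * t * norm (grad \<phi> (x + t\<^sup>2 *\<^sub>R z))) \<partial>lborel \<partial>?U)"
    by (rule P.Fubini'[symmetric]) measurable
  also have "\<dots> \<le> (\<integral>\<^sup>+t. ennreal (2 * L) * (\<integral>\<^sup>+x. ennreal (norm (grad \<phi> x)) \<partial>lborel) \<partial>?U)"
  proof (intro nn_integral_mono_AE, use unit_interval_measure(4) in eventually_elim)
    case (elim t)
    have "(\<integral>\<^sup>+x. ennreal (2 * L * t * norm (grad \<phi> (x + t\<^sup>2 *\<^sub>R z))) \<partial>lborel) \<le>
        (\<integral>\<^sup>+x. ennreal (2 * L) * ennreal (norm (grad \<phi> (x + t\<^sup>2 *\<^sub>R z))) \<partial>lborel)"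
    proof (rule nn_integral_mono)
      fix x
      have "L * t * norm (grad \<phi> (x + t\<^sup>2 *\<^sub>R z)) \<le> L * 1 * norm (grad \<phi> (x + t\<^sup>2 *\<^sub>R z))"
        using elim L0 by (intro mult_right_mono mult_left_mono) auto
      then show "ennreal (2 * L * t * norm (grad \<phi> (x + t\<^sup>2 *\<^sub>R z))) \<le>
          ennreal (2 * L) * ennreal (norm (grad \<phi> (x + t\<^sup>2 *\<^sub>R z)))"
        using L0 by (simp add: ennreal_mult[symmetric] mult.assoc)
    qed
    also have "\<dots> = ennreal (2 * L) * (\<integral>\<^sup>+x. ennreal (norm (grad \<phi> x)) \<partial>lborel)"
      using nn_integral_lborel_translation[of "\<lambda>x. ennreal (norm (grad \<phi> x))" "t\<^sup>2 *\<^sub>R z"]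
      by (simp add: nn_integral_cmult)
    finally show ?case .
  qed
  also have "\<dots> = ennreal (2 * L) * (\<integral>\<^sup>+x. ennreal (norm (grad \<phi> x)) \<partial>lborel)"
    using unit_interval_measure(2) by (simp add: U.emeasure_eq_measure)
  finally show ?thesis .
qed

text \<open>A mollifier kernel of which the Lipschitz constant \<open>1 / h\<close> and the positive
  mass matter. It is left unnormalised, and its mass is carried along as a factor.\<close>

definition tent :: "real \<Rightarrow> 'a::euclidean_space \<Rightarrow> real" where
  "tent h z = max 0 (1 - norm z / h)"

lemma tent_props:
  fixes x y z :: "'a::euclidean_space"
  assumes "0 < h"
  shows "0 \<le> tent h z" "tent h z \<le> 1" "h < norm z \<Longrightarrow> tent h z = 0"
    and "\<bar>tent h x - tent h y\<bar> \<le> norm (x - y) / h"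
    and "continuous_on UNIV (tent h :: 'a \<Rightarrow> real)" "integrable lborel (tent h :: 'a \<Rightarrow> real)"
    and "0 < (LINT z|lborel. tent h (z :: 'a))"
proof -
  show "0 \<le> tent h z" "tent h z \<le> 1" "h < norm z \<Longrightarrow> tent h z = 0"
    using assms by (auto simp: tent_def pos_le_divide_eq intro!: max.absorb1)
  have d: "\<bar>norm x / h - norm y / h\<bar> \<le> norm (x - y) / h"
    using assms norm_triangle_ineq3[of x y] by (simp add: diff_divide_distrib[symmetric] divide_right_mono)
  then show "\<bar>tent h x - tent h y\<bar> \<le> norm (x - y) / h"
    unfolding tent_def by linarith
  show c: "continuous_on UNIV (tent h :: 'a \<Rightarrow> real)"
    unfolding tent_def by (intro continuous_intros) (use assms in auto)
  show i: "integrable lborel (tent h :: 'a \<Rightarrow> real)"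
    by (rule integrable_continuous_compact_support[OF c bounded_cball[of 0 h]])
       (use assms in \<open>auto simp: tent_def pos_le_divide_eq intro!: max.absorb1\<close>)
  have "0 < measure lborel (cball (0::'a) (h / 2))" using assms by (intro content_cball_pos) auto
  then have "0 < (1 / 2) * measure lborel (cball (0::'a) (h / 2))" by simp
  also have "\<dots> = (LINT z|lborel. indicator (cball (0::'a) (h / 2)) z *\<^sub>R (1 / 2 :: real))"
    by simp
  also have "\<dots> \<le> (LINT z|lborel. tent h (z :: 'a))"
  proof (intro integral_mono i)
    show "integrable lborel (\<lambda>z. indicator (cball (0::'a) (h / 2)) z *\<^sub>R (1 / 2 :: real))"
      by (intro borel_integrable_compact) auto
    fix z :: 'a
    have "norm z / h \<le> 1 / 2" if "norm z \<le> h / 2" using that assms by (simp add: divide_le_eq)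
    then show "indicator (cball (0::'a) (h / 2)) z *\<^sub>R (1 / 2) \<le> tent h z"
      by (cases "norm z \<le> h / 2") (auto simp: tent_def le_max_iff_disj)
  qed
  finally show "0 < (LINT z|lborel. tent h (z :: 'a))" .
qed

text \<open>Once the shift is moved from \<open>u\<close> to the kernel, the bounds depend on
  \<open>u\<close> only through its \<open>L^1\<close> norm. This is the boundedness and
  equicontinuity of the mollified functions at a fixed scale.\<close>

lemma tent_smoothing:
  fixes u :: "'a::euclidean_space \<Rightarrow> real"
  assumes h: "0 < h" and u [measurable]: "u \<in> borel_measurable borel"
    and ui: "integrable lborel u" and C: "(LINT x|lborel. \<bar>u x\<bar>) \<le> C"
  defines "v \<equiv> \<lambda>x. LINT z|lborel. tent h z * u (x + z)"
  shows "integrable lborel (\<lambda>z. tent h z * u (x + z))"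
    and "\<bar>v x\<bar> \<le> C" and "\<bar>v x - v y\<bar> \<le> norm (x - y) / h * C"
proof -
  have [measurable]: "(tent h :: 'a \<Rightarrow> real) \<in> borel_measurable borel"
    using tent_props(5)[OF h] by (rule borel_measurable_continuous_onI)
  have tr: "integrable lborel (\<lambda>z. u (x + z))" for x
    using lborel_integral_translation(2)[OF u, of x] ui by (simp add: add.commute)
  show I: "integrable lborel (\<lambda>z. tent h z * u (x + z))" for x
    by (rule Bochner_Integration.integrable_bound[OF tr[of x]])
       (auto simp: abs_mult tent_props(1,2)[OF h] intro!: mult_left_le_one_le)
  have eq: "v x = (LINT z|lborel. tent h (z - x) * u z)" for x
    using lborel_integral_translation(1)[of "\<lambda>z. tent h (z - x) * u z" x] by (simp add: v_def add.commute)
  have I': "integrable lborel (\<lambda>z. tent h (z - x) * u z)" for x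
    by (rule Bochner_Integration.integrable_bound[OF ui])
       (auto simp: abs_mult tent_props(1,2)[OF h] intro!: mult_left_le_one_le)
  have "\<bar>v x\<bar> \<le> (LINT z|lborel. \<bar>tent h (z - x) * u z\<bar>)"
    unfolding eq by (rule integral_abs_bound)
  also have "\<dots> \<le> (LINT x|lborel. \<bar>u x\<bar>)"
    by (intro integral_mono integrable_abs I' ui) (auto simp: abs_mult tent_props(1,2)[OF h] intro!: mult_left_le_one_le)
  finally show "\<bar>v x\<bar> \<le> C" using C by simp
  have "\<bar>v x - v y\<bar> = \<bar>LINT z|lborel. (tent h (z - x) - tent h (z - y)) * u z\<bar>"
    unfolding eq using I' by (simp add: left_diff_distrib)
  also have "\<dots> \<le> (LINT z|lborel. \<bar>(tent h (z - x) - tent h (z - y)) * u z\<bar>)"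
    by (rule integral_abs_bound)
  also have "\<dots> \<le> (LINT z|lborel. norm (x - y) / h * \<bar>u z\<bar>)"
  proof (intro integral_mono)
    show "integrable lborel (\<lambda>z. \<bar>(tent h (z - x) - tent h (z - y)) * u z\<bar>)"
      using I' by (auto simp: left_diff_distrib)
    show "integrable lborel (\<lambda>z. norm (x - y) / h * \<bar>u z\<bar>)" using ui by auto
    fix z
    have "\<bar>tent h (z - x) - tent h (z - y)\<bar> \<le> norm (x - y) / h"
      using tent_props(4)[OF h, of "z - x" "z - y"] by (simp add: norm_minus_commute)
    then show "\<bar>(tent h (z - x) - tent h (z - y)) * u z\<bar> \<le> norm (x - y) / h * \<bar>u z\<bar>"
      using mult_right_mono[of _ _ "\<bar>u z\<bar>"] by (fastforce simp: abs_mult)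
  qed
  also have "\<dots> \<le> norm (x - y) / h * C" using C h by (auto intro!: divide_right_mono mult_left_mono)
  finally show "\<bar>v x - v y\<bar> \<le> norm (x - y) / h * C" .
qed

text \<open>The error is an average of translation errors for vectors of length at most
  \<open>h\<close>, hence of order \<open>h\<close> uniformly over functions whose gradients are
  bounded in \<open>L^1\<close>.\<close>

lemma tent_smoothing_error:
  fixes \<phi> :: "'a::euclidean_space \<Rightarrow> real"
  assumes h: "0 < h" and \<phi>: "\<phi> \<in> test_functions \<Omega>" and C0: "0 \<le> C"
    and C: "(\<integral>\<^sup>+x. ennreal (norm (grad \<phi> x)) \<partial>lborel) \<le> ennreal C"
  shows "(\<integral>\<^sup>+x. ennreal \<bar>(LINT z|lborel. tent h z * \<phi> (x + z)) - (LINT z|lborel. tent h (z::'a)) * \<phi> x\<bar> \<partial>lborel)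
    \<le> ennreal (2 * h * C * (LINT z|lborel. tent h (z::'a)))"
proof -
  have sm: "smooth \<phi>" using \<phi> by (rule test_function_smooth)
  have cont: "continuous_on UNIV \<phi>" by (rule smooth_continuous_on[OF sm])
  have m [measurable]: "\<phi> \<in> borel_measurable borel" using cont by (rule borel_measurable_continuous_onI)
  have [measurable]: "(tent h :: 'a \<Rightarrow> real) \<in> borel_measurable borel"
    using tent_props(5)[OF h] by (rule borel_measurable_continuous_onI)
  have int: "integrable lborel \<phi>"
    by (rule integrable_continuous_compact_support[OF cont, of "{x. \<phi> x \<noteq> 0}"])
       (use \<phi> in \<open>auto simp: test_functions_def\<close>)
  note ti = tent_props(6)[OF h, where 'a='a]
  note I = tent_smoothing(1)[OF h m int order_refl]
  have "(\<integral>\<^sup>+x. ennreal \<bar>(LINT z|lborel. tent h z * \<phi> (x + z)) - (LINT z|lborel. tent h (z::'a)) * \<phi> x\<bar> \<partial>lborel)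
      \<le> (\<integral>\<^sup>+x. \<integral>\<^sup>+z. ennreal (tent h z) * ennreal \<bar>\<phi> (x + z) - \<phi> x\<bar> \<partial>lborel \<partial>lborel)"
  proof (rule nn_integral_mono)
    fix x
    have "(LINT z|lborel. tent h z * \<phi> (x + z)) - (LINT z|lborel. tent h (z::'a)) * \<phi> x =
        (LINT z|lborel. tent h z * (\<phi> (x + z) - \<phi> x))"
      using I ti by (simp add: right_diff_distrib)
    then have "ennreal \<bar>(LINT z|lborel. tent h z * \<phi> (x + z)) - (LINT z|lborel. tent h (z::'a)) * \<phi> x\<bar> =
       ennreal (norm (LINT z|lborel. tent h z * (\<phi> (x + z) - \<phi> x)))" by simp
    also have "\<dots> \<le> (\<integral>\<^sup>+z. ennreal (norm (tent h z * (\<phi> (x + z) - \<phi> x))) \<partial>lborel)"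
      using I ti by (intro integral_norm_bound_ennreal) (simp add: right_diff_distrib)
    also have "\<dots> = (\<integral>\<^sup>+z. ennreal (tent h z) * ennreal \<bar>\<phi> (x + z) - \<phi> x\<bar> \<partial>lborel)"
      by (intro nn_integral_cong) (simp add: abs_mult tent_props(1)[OF h] ennreal_mult)
    finally show "ennreal \<bar>(LINT z|lborel. tent h z * \<phi> (x + z)) - (LINT z|lborel. tent h (z::'a)) * \<phi> x\<bar> \<le> \<dots>" .
  qed
  also have "\<dots> = (\<integral>\<^sup>+z. \<integral>\<^sup>+x. ennreal (tent h z) * ennreal \<bar>\<phi> (x + z) - \<phi> x\<bar> \<partial>lborel \<partial>lborel)"
    by (rule lborel_pair.Fubini'[symmetric]) measurable
  also have "\<dots> \<le> (\<integral>\<^sup>+z. ennreal (2 * h * C) * ennreal (tent h (z::'a)) \<partial>lborel)"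
  proof (rule nn_integral_mono)
    fix z :: 'a
    show "(\<integral>\<^sup>+x. ennreal (tent h z) * ennreal \<bar>\<phi> (x + z) - \<phi> x\<bar> \<partial>lborel) \<le> ennreal (2 * h * C) * ennreal (tent h z)"
    proof (cases "norm z \<le> h")
      case True
      have "(\<integral>\<^sup>+x. ennreal \<bar>\<phi> (x + z) - \<phi> x\<bar> \<partial>lborel) \<le>
          ennreal (2 * h) * (\<integral>\<^sup>+x. ennreal (norm (grad \<phi> x)) \<partial>lborel)"
        by (rule test_function_translation[OF \<phi> True])
      also have "\<dots> \<le> ennreal (2 * h) * ennreal C" by (intro mult_left_mono C) auto
      also have "\<dots> = ennreal (2 * h * C)" using h C0 by (simp add: ennreal_mult)
      finally have "ennreal (tent h z) * (\<integral>\<^sup>+x. ennreal \<bar>\<phi> (x + z) - \<phi> x\<bar> \<partial>lborel) \<le>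
         ennreal (tent h z) * ennreal (2 * h * C)" by (intro mult_left_mono) auto
      then show ?thesis by (simp add: nn_integral_cmult mult.commute)
    next
      case False
      then show ?thesis using tent_props(3)[OF h, of z] by simp
    qed
  qed
  also have "\<dots> = ennreal (2 * h * C) * ennreal (LINT z|lborel. tent h (z::'a))"
  proof -
    have "(\<integral>\<^sup>+z. ennreal (tent h (z::'a)) \<partial>lborel) = ennreal (LINT z|lborel. tent h (z::'a))"
      by (rule nn_integral_eq_integral[OF ti]) (simp add: tent_props(1)[OF h])
    then show ?thesis by (simp add: nn_integral_cmult)
  qed
  also have "\<dots> = ennreal (2 * h * C * (LINT z|lborel. tent h (z::'a)))"
    using h C0 tent_props(7)[OF h, where 'a='a] by (simp add: ennreal_mult)
  finally show ?thesis .
qed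

text \<open>A Frechet-Kolmogorov argument. At every scale the mollified functions are bounded and
  equicontinuous, so convergence on a countable dense set spreads to all points and, by domination
  on the bounded set \<Omega>, to \<open>L^1\<close>; the mollification errors are uniformly
  small.\<close>

lemma rellich_L1:
  fixes u :: "nat \<Rightarrow> 'a::euclidean_space \<Rightarrow> real"
  assumes op: "open \<Omega>" and bd: "bounded \<Omega>"
    and u: "\<And>k. u k \<in> test_functions \<Omega>"
    and C1: "\<And>k. (\<integral>\<^sup>+x. ennreal \<bar>u k x\<bar> \<partial>lborel) \<le> ennreal C"
    and C2: "\<And>k. (\<integral>\<^sup>+x. ennreal (norm (grad (u k) x)) \<partial>lborel) \<le> ennreal C" and C: "0 \<le> C"
  obtains r :: "nat \<Rightarrow> nat" where "strict_mono r"
    "\<And>e. 0 < e \<Longrightarrow> \<exists>N. \<forall>i\<ge>N. \<forall>j\<ge>N. (\<integral>\<^sup>+x. ennreal \<bar>u (r i) x - u (r j) x\<bar> \<partial>lborel) < ennreal e"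
proof -
  have cont: "continuous_on UNIV (u k)" for k by (intro smooth_continuous_on test_function_smooth[OF u])
  have m [measurable]: "u k \<in> borel_measurable borel" for k using cont by (rule borel_measurable_continuous_onI)
  have int: "integrable lborel (u k)" for k
    by (rule integrable_continuous_compact_support[OF cont, of "{x. u k x \<noteq> 0}"])
       (use u[of k] in \<open>auto simp: test_functions_def\<close>)
  have C1': "(LINT x|lborel. \<bar>u k x\<bar>) \<le> C" for k
    using C1[of k] int[of k] C by (simp add: nn_integral_eq_integral)
  define h where "h = (\<lambda>j. 1 / real (Suc j))"
  have h: "0 < h j" for j by (simp add: h_def)
  define W where "W = (\<lambda>j. LINT z|lborel. tent (h j) (z::'a))"
  have W: "0 < W j" for j unfolding W_def by (rule tent_props(7)[OF h])
  define v where "v = (\<lambda>j k x. LINT z|lborel. tent (h j) z * u k (x + z))"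
  note S = tent_smoothing[OF h m int C1', folded v_def]
  have vb: "\<bar>v j k x\<bar> \<le> C" and vl: "\<bar>v j k x - v j k y\<bar> \<le> norm (x - y) / h j * C" for j k x y
    unfolding v_def by (rule tent_smoothing[OF h m int C1'])+
  obtain Q :: "'a set" where Q: "countable Q" "\<And>X. open X \<Longrightarrow> X \<noteq> {} \<Longrightarrow> \<exists>d\<in>Q. d \<in> X"
    using countable_dense_setE by blast
  have "Q \<noteq> {}" using Q(2)[of UNIV] by auto
  then obtain q :: "nat \<Rightarrow> 'a" where q: "range q = Q" using Q(1) by (metis range_from_nat_into)
  \<comment> \<open>\<open>prod_decode\<close> enumerates the pairs of a scale and a dense point, so
    that one diagonal subsequence serves all of them.\<close>
  obtain r where r: "strict_mono r"
    and conv: "\<And>m. convergent (\<lambda>k. v (fst (prod_decode m)) (r k) (q (snd (prod_decode m))))"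
    using bounded_diagonal_subseq[of "\<lambda>m k. v (fst (prod_decode m)) k (q (snd (prod_decode m)))" "\<lambda>_. C"] vb
    by blast
  have convq: "convergent (\<lambda>k. v j (r k) (q i))" for i j
    using conv[of "prod_encode (j, i)"] by simp
  have convx: "convergent (\<lambda>k. v j (r k) x)" for j x
  proof -
    have "Cauchy (\<lambda>k. v j (r k) x)"
    proof (rule metric_CauchyI)
      fix e :: real assume e: "0 < e"
      \<comment> \<open>Chosen so that moving from \<open>x\<close> to a dense point changes every
        mollified function by less than \<open>e / 3\<close>; \<open>C + 1\<close> guards against
        \<open>C = 0\<close>.\<close>
      define d where "d = e * h j / (3 * (C + 1))"
      have d: "0 < d" using e h[of j] C by (simp add: d_def)
      obtain i where i: "q i \<in> ball x d" using Q(2)[of "ball x d"] d q by force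
      have small: "\<bar>v j k x - v j k (q i)\<bar> < e / 3" for k
      proof -
        have "\<bar>v j k x - v j k (q i)\<bar> \<le> norm (x - q i) / h j * C" by (rule vl)
        also have "\<dots> \<le> d / h j * C"
          using i h[of j] C by (intro mult_right_mono divide_right_mono) (auto simp: dist_norm)
        also have "d / h j = e / (3 * (C + 1))" using h[of j] by (simp add: d_def)
        also have "e / (3 * (C + 1)) * C = e / 3 * (C / (C + 1))" by simp
        also have "\<dots> < e / 3 * 1" using e C by (intro mult_strict_left_mono) (auto simp: divide_less_eq)
        finally show ?thesis by simp
      qed
      obtain M where M: "\<And>k l. k \<ge> M \<Longrightarrow> l \<ge> M \<Longrightarrow> dist (v j (r k) (q i)) (v j (r l) (q i)) < e / 3"
        using metric_CauchyD[OF convergent_Cauchy[OF convq[of j i]], of "e / 3"] e by auto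
      show "\<exists>M. \<forall>k\<ge>M. \<forall>l\<ge>M. dist (v j (r k) x) (v j (r l) x) < e"
      proof (intro exI allI impI)
        fix k l assume "k \<ge> M" "l \<ge> M"
        then have "\<bar>v j (r k) (q i) - v j (r l) (q i)\<bar> < e / 3" using M by (simp add: dist_real_def)
        then show "dist (v j (r k) x) (v j (r l) x) < e"
          using small[of "r k"] small[of "r l"] unfolding dist_real_def by linarith
      qed
    qed
    then show ?thesis by (rule Cauchy_convergent)
  qed
  have vm [measurable]: "v j k \<in> borel_measurable borel" for j k
  proof -
    have [measurable]: "(tent (h j) :: 'a \<Rightarrow> real) \<in> borel_measurable borel"
      using tent_props(5)[OF h] by (rule borel_measurable_continuous_onI)
    show ?thesis unfolding v_def by measurable
  qed
  have \<Omega>m [measurable]: "\<Omega> \<in> sets borel" using op by simp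
  have volfin: "emeasure lborel \<Omega> < \<infinity>" using bd by (rule emeasure_bounded_finite)
  show ?thesis
  proof (rule that[OF r])
    fix e :: real assume e: "0 < e"
    \<comment> \<open>The two mollification errors of size \<open>2 * h j * C\<close> must together
      stay below half of \<open>e\<close>; the other half is left to the mollified
      functions.\<close>
    obtain j :: nat where j: "8 * C / e < real (Suc j)" using reals_Archimedean2 by (meson less_Suc_eq less_trans of_nat_less_iff)
    have hj: "4 * h j * C < e / 2"
    proof -
      have "8 * C < e * real (Suc j)" using j e by (simp add: divide_less_eq mult.commute)
      then show ?thesis by (simp add: h_def divide_less_eq del: of_nat_Suc)
    qed
    define vlim where "vlim = (\<lambda>x. lim (\<lambda>k. v j (r k) x))"
    have vlim: "(\<lambda>k. v j (r k) x) \<longlonglongrightarrow> vlim x" for x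
      using convx[of j x] by (simp add: vlim_def convergent_LIMSEQ_iff)
    have [measurable]: "vlim \<in> borel_measurable borel"
      by (rule borel_measurable_LIMSEQ_real[OF vlim]) simp_all
    have "(\<lambda>k. \<integral>\<^sup>+x. indicator \<Omega> x * ennreal \<bar>v j (r k) x - vlim x\<bar> \<partial>lborel) \<longlonglongrightarrow> (\<integral>\<^sup>+(x::'a). 0 \<partial>lborel)"
    proof (rule nn_integral_dominated_convergence[where w="\<lambda>x. indicator \<Omega> x * ennreal (2 * C)"])
      show "(\<integral>\<^sup>+x. indicator \<Omega> x * ennreal (2 * C) \<partial>lborel) < \<infinity>"
        using volfin by (simp add: nn_integral_multc ennreal_mult_less_top)
      have "\<bar>vlim x\<bar> \<le> C" for x
        using tendsto_rabs[OF vlim[of x]] vb by (intro LIMSEQ_le_const2[where x="\<bar>vlim x\<bar>"]) auto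
      then have "\<bar>v j (r k) x - vlim x\<bar> \<le> 2 * C" for k x
        using vb[of j "r k" x] by (smt (verit))
      then show "AE x in lborel. indicator \<Omega> x * ennreal \<bar>v j (r k) x - vlim x\<bar> \<le> indicator \<Omega> x * ennreal (2 * C)" for k
        by (intro always_eventually allI mult_left_mono ennreal_leI) auto
      show "AE x in lborel. (\<lambda>k. indicator \<Omega> x * ennreal \<bar>v j (r k) x - vlim x\<bar>) \<longlonglongrightarrow> 0"
      proof (intro always_eventually allI)
        fix x
        have "(\<lambda>k. ennreal \<bar>v j (r k) x - vlim x\<bar>) \<longlonglongrightarrow> ennreal \<bar>vlim x - vlim x\<bar>"
          by (intro tendsto_intros vlim tendsto_ennrealI)
        then show "(\<lambda>k. indicator \<Omega> x * ennreal \<bar>v j (r k) x - vlim x\<bar>) \<longlonglongrightarrow> 0"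
          by (cases "x \<in> \<Omega>") auto
      qed
    qed measurable
    then have "(\<lambda>k. \<integral>\<^sup>+x. indicator \<Omega> x * ennreal \<bar>v j (r k) x - vlim x\<bar> \<partial>lborel) \<longlonglongrightarrow> 0" by simp
    moreover have "0 < ennreal (W j * e / 4)" using W[of j] e by simp
    ultimately obtain N where N: "\<And>k. k \<ge> N \<Longrightarrow>
        (\<integral>\<^sup>+x. indicator \<Omega> x * ennreal \<bar>v j (r k) x - vlim x\<bar> \<partial>lborel) < ennreal (W j * e / 4)"
      unfolding order_tendsto_iff eventually_sequentially by blast
    have err: "(\<integral>\<^sup>+x. ennreal \<bar>v j k x - W j * u k x\<bar> \<partial>lborel) \<le> ennreal (2 * h j * C * W j)" for k
      unfolding v_def W_def by (rule tent_smoothing_error[OF h u C C2])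
    show "\<exists>N. \<forall>k\<ge>N. \<forall>l\<ge>N. (\<integral>\<^sup>+x. ennreal \<bar>u (r k) x - u (r l) x\<bar> \<partial>lborel) < ennreal e"
    proof (intro exI allI impI)
      fix k l assume k: "k \<ge> N" and l: "l \<ge> N"
      \<comment> \<open>Outside \<Omega> the left side vanishes, which is why the indicator may
        stand on the right.\<close>
      have pw: "ennreal (W j) * ennreal \<bar>u (r k) x - u (r l) x\<bar> \<le>
          (ennreal \<bar>v j (r k) x - W j * u (r k) x\<bar> + ennreal \<bar>v j (r l) x - W j * u (r l) x\<bar>) +
          (indicator \<Omega> x * ennreal \<bar>v j (r k) x - vlim x\<bar> + indicator \<Omega> x * ennreal \<bar>v j (r l) x - vlim x\<bar>)" for x
      proof (cases "x \<in> \<Omega>")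
        case True
        have "W j * \<bar>u (r k) x - u (r l) x\<bar> = \<bar>W j * u (r k) x - W j * u (r l) x\<bar>"
          using W[of j] by (simp add: abs_mult right_diff_distrib[symmetric])
        also have "\<dots> \<le> \<bar>v j (r k) x - W j * u (r k) x\<bar> + \<bar>v j (r l) x - W j * u (r l) x\<bar> +
            (\<bar>v j (r k) x - vlim x\<bar> + \<bar>v j (r l) x - vlim x\<bar>)" by linarith
        finally have "ennreal (W j * \<bar>u (r k) x - u (r l) x\<bar>) \<le> ennreal (\<bar>v j (r k) x - W j * u (r k) x\<bar> +
            \<bar>v j (r l) x - W j * u (r l) x\<bar> + (\<bar>v j (r k) x - vlim x\<bar> + \<bar>v j (r l) x - vlim x\<bar>))"
          by (rule ennreal_leI)
        then show ?thesis using True W[of j] by (simp add: ennreal_mult ennreal_plus)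
      qed (simp add: test_function_outside[OF u])
      have "ennreal (W j) * (\<integral>\<^sup>+x. ennreal \<bar>u (r k) x - u (r l) x\<bar> \<partial>lborel) =
         (\<integral>\<^sup>+x. ennreal (W j) * ennreal \<bar>u (r k) x - u (r l) x\<bar> \<partial>lborel)"
        by (simp add: nn_integral_cmult)
      also have "\<dots> \<le> (\<integral>\<^sup>+x. (ennreal \<bar>v j (r k) x - W j * u (r k) x\<bar> + ennreal \<bar>v j (r l) x - W j * u (r l) x\<bar>) +
          (indicator \<Omega> x * ennreal \<bar>v j (r k) x - vlim x\<bar> + indicator \<Omega> x * ennreal \<bar>v j (r l) x - vlim x\<bar>) \<partial>lborel)"
        by (intro nn_integral_mono pw)
      also have "\<dots> = ((\<integral>\<^sup>+x. ennreal \<bar>v j (r k) x - W j * u (r k) x\<bar> \<partial>lborel) +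
          (\<integral>\<^sup>+x. ennreal \<bar>v j (r l) x - W j * u (r l) x\<bar> \<partial>lborel)) +
          ((\<integral>\<^sup>+x. indicator \<Omega> x * ennreal \<bar>v j (r k) x - vlim x\<bar> \<partial>lborel) +
           (\<integral>\<^sup>+x. indicator \<Omega> x * ennreal \<bar>v j (r l) x - vlim x\<bar> \<partial>lborel))"
        by (simp add: nn_integral_add)
      also have "\<dots> \<le> (ennreal (2 * h j * C * W j) + ennreal (2 * h j * C * W j)) +
          (ennreal (W j * e / 4) + ennreal (W j * e / 4))"
        using N[OF k] N[OF l] by (intro add_mono err) (auto simp: less_imp_le)
      also have "\<dots> = ennreal (W j * (4 * h j * C + e / 2))"
        using W[of j] h[of j] C e by (simp add: ennreal_plus[symmetric] algebra_simps del: ennreal_plus)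
      also have "\<dots> < ennreal (W j * e)"
        using W[of j] hj e h[of j] C by (subst ennreal_less_iff) (auto intro!: mult_strict_left_mono)
      finally have "ennreal (W j) * (\<integral>\<^sup>+x. ennreal \<bar>u (r k) x - u (r l) x\<bar> \<partial>lborel) < ennreal (W j) * ennreal e"
        using W[of j] e by (simp add: ennreal_mult)
      then show "(\<integral>\<^sup>+x. ennreal \<bar>u (r k) x - u (r l) x\<bar> \<partial>lborel) < ennreal e"
        by (meson linorder_not_le mult_left_mono zero_le)
    qed
  qed
qed

subsection \<open>Inequalities for powers\<close>

text \<open>Young's inequality with constants 1: the larger of \<open>x\<close> and
  \<open>y powr (p - 1)\<close> decides which term dominates. These crude constants are uniform in
  \<open>p\<close>.\<close>

lemma mult_le_powr_add_powr:
  fixes x y p :: real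
  assumes "0 \<le> x" "0 \<le> y" "1 < p"
  shows "x * y \<le> x powr (p / (p - 1)) + y powr p"
proof (cases "x = 0 \<or> y = 0")
  case False
  then have pos: "0 < x" "0 < y" using assms by auto
  show ?thesis
  proof (cases "x \<le> y powr (p - 1)")
    case True
    then have "x * y \<le> y powr (p - 1) * y" using pos by (intro mult_right_mono) auto
    also have "\<dots> = y powr p" using pos by (simp add: powr_diff)
    finally show ?thesis using powr_ge_zero[of x "p / (p - 1)"] by linarith
  next
    case False
    then have "(y powr (p - 1)) powr (1 / (p - 1)) \<le> x powr (1 / (p - 1))"
      using assms by (intro powr_mono2) auto
    then have "y \<le> x powr (1 / (p - 1))" using assms pos by (simp add: powr_powr)
    then have "x * y \<le> x * x powr (1 / (p - 1))" using pos by (intro mult_left_mono) auto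
    also have "\<dots> = x powr (1 + 1 / (p - 1))" using pos by (simp add: powr_add)
    also have "1 + 1 / (p - 1) = p / (p - 1)" using assms by (simp add: field_simps)
    finally show ?thesis using powr_ge_zero[of y p] by linarith
  qed
qed auto

text \<open>Young's inequality after scaling one factor by \<delta> and the other by
  \<open>1 / \<delta>\<close>. The powers of \<delta> that arise depend on \<open>p\<close>;
  bounding the conjugate exponent by 1 and 2, and \<open>p\<close> by \<open>P\<close>, makes the
  constants uniform.\<close>

lemma mult_le_small_powr:
  fixes x y p \<delta> P :: real
  assumes "0 \<le> x" "0 \<le> y" "2 \<le> p" "p \<le> P" "0 < \<delta>" "\<delta> \<le> 1"
  shows "x * y \<le> \<delta> * y powr p + (1 / \<delta>)\<^sup>2 * x powr (p / (p - 1))"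
    and "x * y \<le> \<delta> * x powr (p / (p - 1)) + (1 / \<delta>) powr P * y powr p"
proof -
  have p': "1 \<le> p / (p - 1)" "p / (p - 1) \<le> 2" using assms by (auto simp: field_simps)
  have d1: "1 \<le> 1 / \<delta>" using assms by simp
  have "x * y = (x * (1 / \<delta>)) * (y * \<delta>)" using assms by simp
  also have "\<dots> \<le> (x * (1 / \<delta>)) powr (p / (p - 1)) + (y * \<delta>) powr p"
    using assms by (intro mult_le_powr_add_powr) auto
  also have "(x * (1 / \<delta>)) powr (p / (p - 1)) = x powr (p / (p - 1)) * (1 / \<delta>) powr (p / (p - 1))"
    using assms by (subst powr_mult) auto
  also have "(y * \<delta>) powr p = y powr p * \<delta> powr p" using assms by (subst powr_mult) auto
  finally have 1: "x * y \<le> x powr (p / (p - 1)) * (1 / \<delta>) powr (p / (p - 1)) + y powr p * \<delta> powr p" .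
  have "(1 / \<delta>) powr (p / (p - 1)) \<le> (1 / \<delta>) powr 2" using p' d1 by (intro powr_mono) auto
  also have "\<dots> = (1 / \<delta>)\<^sup>2" using assms by (simp add: powr_numeral)
  finally have "x powr (p / (p - 1)) * (1 / \<delta>) powr (p / (p - 1)) \<le> x powr (p / (p - 1)) * (1 / \<delta>)\<^sup>2"
    by (intro mult_left_mono) auto
  moreover have "\<delta> powr p \<le> \<delta> powr 1" using assms by (intro powr_mono') auto
  then have "y powr p * \<delta> powr p \<le> y powr p * \<delta>" using assms by (intro mult_left_mono) auto
  ultimately show "x * y \<le> \<delta> * y powr p + (1 / \<delta>)\<^sup>2 * x powr (p / (p - 1))"
    using 1 by (simp only: mult.commute)
  have "x * y = (x * \<delta>) * (y * (1 / \<delta>))" using assms by simp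
  also have "\<dots> \<le> (x * \<delta>) powr (p / (p - 1)) + (y * (1 / \<delta>)) powr p"
    using assms by (intro mult_le_powr_add_powr) auto
  also have "(x * \<delta>) powr (p / (p - 1)) = x powr (p / (p - 1)) * \<delta> powr (p / (p - 1))"
    using assms by (subst powr_mult) auto
  also have "(y * (1 / \<delta>)) powr p = y powr p * (1 / \<delta>) powr p" using assms by (subst powr_mult) auto
  finally have 2: "x * y \<le> x powr (p / (p - 1)) * \<delta> powr (p / (p - 1)) + y powr p * (1 / \<delta>) powr p" .
  have "\<delta> powr (p / (p - 1)) \<le> \<delta> powr 1" using assms p' by (intro powr_mono') auto
  then have "x powr (p / (p - 1)) * \<delta> powr (p / (p - 1)) \<le> x powr (p / (p - 1)) * \<delta>"
    using assms by (intro mult_left_mono) auto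
  moreover have "(1 / \<delta>) powr p \<le> (1 / \<delta>) powr P" using d1 assms by (intro powr_mono) auto
  then have "y powr p * (1 / \<delta>) powr p \<le> y powr p * (1 / \<delta>) powr P" by (intro mult_left_mono) auto
  ultimately show "x * y \<le> \<delta> * x powr (p / (p - 1)) + (1 / \<delta>) powr P * y powr p"
    using 2 by (simp only: mult.commute)
qed

text \<open>Above the threshold \<open>(1 / \<delta>) powr (1 / (p0 - s))\<close> the factor
  \<delta> is compensated by \<open>y powr (p0 - s)\<close>; below it, \<open>y powr s\<close> is at
  most its value at the threshold, which is the additive constant.\<close>

lemma powr_le_small_powr:
  fixes y s p0 p \<delta> :: real
  assumes "0 \<le> y" "0 < s" "s < p0" "p0 \<le> p" "0 < \<delta>" "\<delta> \<le> 1"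
  shows "y powr s \<le> \<delta> * y powr p + (1 / \<delta>) powr (s / (p0 - s))"
proof (cases "(1 / \<delta>) powr (1 / (p0 - s)) \<le> y")
  case True
  have "1 \<le> (1 / \<delta>) powr (1 / (p0 - s))" using assms by (intro ge_one_powr_ge_zero) auto
  then have y1: "1 \<le> y" using True by linarith
  have "((1 / \<delta>) powr (1 / (p0 - s))) powr (p0 - s) \<le> y powr (p0 - s)"
    using True assms by (intro powr_mono2) auto
  then have "1 / \<delta> \<le> y powr (p0 - s)" using assms by (simp add: powr_powr)
  also have "\<dots> \<le> y powr (p - s)" using y1 assms by (intro powr_mono) auto
  finally have "1 \<le> \<delta> * y powr (p - s)" using assms by (simp add: pos_divide_le_eq mult.commute)
  then have "y powr s * 1 \<le> y powr s * (\<delta> * y powr (p - s))" by (intro mult_left_mono) auto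
  also have "\<dots> = \<delta> * y powr p" using y1 by (simp add: powr_add[symmetric] mult.left_commute)
  finally show ?thesis using powr_ge_zero[of "1 / \<delta>" "s / (p0 - s)"] by linarith
next
  case False
  then have "y powr s \<le> ((1 / \<delta>) powr (1 / (p0 - s))) powr s" using assms by (intro powr_mono2) auto
  also have "\<dots> = (1 / \<delta>) powr (s / (p0 - s))" by (simp add: powr_powr)
  moreover have "0 \<le> \<delta> * y powr p" using assms by simp
  ultimately show ?thesis by linarith
qed

text \<open>Each of the two powers is at most its base times
  \<open>(a + b) powr (s - 1)\<close>.\<close>

lemma powr_add_le_powr_sum:
  fixes a b s :: real
  assumes "0 \<le> a" "0 \<le> b" "1 \<le> s"
  shows "a powr s + b powr s \<le> (a + b) powr s"
proof (cases "a + b = 0")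
  case False
  then have pos: "0 < a + b" using assms by auto
  have *: "x powr s \<le> x * (a + b) powr (s - 1)" if "0 \<le> x" "x \<le> a + b" for x
  proof (cases "x = 0")
    case False
    then have "x powr s = x * x powr (s - 1)" using that by (simp add: powr_diff)
    also have "\<dots> \<le> x * (a + b) powr (s - 1)"
      using that assms by (intro mult_left_mono powr_mono2) auto
    finally show ?thesis .
  qed (use assms in auto)
  have "a powr s + b powr s \<le> a * (a + b) powr (s - 1) + b * (a + b) powr (s - 1)"
    using assms by (intro add_mono *) auto
  also have "\<dots> = (a + b) * (a + b) powr (s - 1)" by (simp only: distrib_right)
  also have "\<dots> = (a + b) powr s" using pos by (simp add: powr_mult_base)
  finally show ?thesis .
next
  case True
  then have "a = 0" "b = 0" using assms by auto
  then show ?thesis by simp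
qed

text \<open>The tangent inequalities at the midpoint are added; their linear parts are
  opposite.\<close>

lemma powr_midpoint_le:
  fixes a b s :: real
  assumes "0 \<le> a" "0 \<le> b" "1 \<le> s"
  shows "((a + b) / 2) powr s \<le> (a powr s + b powr s) / 2"
proof (cases "a + b = 0")
  case False
  then have m: "0 < (a + b) / 2" using assms by auto
  define t where "t = s * ((a + b) / 2) powr (s - 1)"
  define d where "d = t * (a - (a + b) / 2)"
  have 1: "((a + b) / 2) powr s + d \<le> a powr s"
    unfolding d_def t_def by (intro powr_tangent_le assms m)
  have eq: "t * (b - (a + b) / 2) = - d"
    by (simp add: d_def field_simps)
  have "((a + b) / 2) powr s + t * (b - (a + b) / 2) \<le> b powr s"
    unfolding t_def by (intro powr_tangent_le assms m)
  then show ?thesis using 1 unfolding eq by simp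
qed (use assms in auto)

text \<open>Clarkson's inequality, from the parallelogram law and convexity of \<open>t powr (p / 2)\<close>.\<close>

lemma clarkson:
  fixes a b :: "'a::real_inner"
  assumes p: "2 \<le> p"
  shows "norm ((1 / 2) *\<^sub>R (a + b)) powr p + norm ((1 / 2) *\<^sub>R (a - b)) powr p \<le> (norm a powr p + norm b powr p) / 2"
proof -
  have sq: "x powr p = (x\<^sup>2) powr (p / 2)" if "0 \<le> x" for x :: real
    using that by (cases "x = 0") (auto simp: powr_powr powr_numeral[symmetric] simp del: powr_numeral)
  have par: "(norm ((1 / 2) *\<^sub>R (a + b)))\<^sup>2 + (norm ((1 / 2) *\<^sub>R (a - b)))\<^sup>2 = ((norm a)\<^sup>2 + (norm b)\<^sup>2) / 2"
    by (simp add: power2_norm_eq_inner inner_add_left inner_add_right inner_diff_left inner_diff_right inner_commute field_simps)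
  have "norm ((1 / 2) *\<^sub>R (a + b)) powr p + norm ((1 / 2) *\<^sub>R (a - b)) powr p \<le>
      (((norm a)\<^sup>2 + (norm b)\<^sup>2) / 2) powr (p / 2)"
    unfolding par[symmetric] sq[OF norm_ge_zero] using p by (intro powr_add_le_powr_sum) auto
  also have "\<dots> \<le> (((norm a)\<^sup>2) powr (p / 2) + ((norm b)\<^sup>2) powr (p / 2)) / 2"
    using p by (intro powr_midpoint_le) auto
  finally show ?thesis by (simp add: sq)
qed

lemma norm_add_powr_le:
  fixes a b :: "'a::real_normed_vector"
  assumes "1 \<le> p"
  shows "norm (a + b) powr p \<le> 2 powr (p - 1) * (norm a powr p + norm b powr p)"
proof -
  have "norm (a + b) powr p \<le> (2 * ((norm a + norm b) / 2)) powr p"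
    using assms norm_triangle_ineq[of a b] by (intro powr_mono2) auto
  also have "\<dots> = 2 powr p * ((norm a + norm b) / 2) powr p" by (subst powr_mult) auto
  also have "\<dots> \<le> 2 powr p * ((norm a powr p + norm b powr p) / 2)"
    using assms by (intro mult_left_mono powr_midpoint_le) auto
  also have "\<dots> = 2 powr (p - 1) * (norm a powr p + norm b powr p)" by (simp add: powr_diff)
  finally show ?thesis .
qed

subsection \<open>Passing to the limit under the integral\<close>

lemma clamp_tendsto:
  fixes h H :: real
  assumes "0 \<le> H"
  shows "\<bar>min H (max (- H) h) - h\<bar> \<le> max 0 (\<bar>h\<bar> - H)"
  using assms by (auto simp: min_def max_def abs_if)

text \<open>A Vitali type theorem: the growth hypothesis is uniform integrability in disguise.
  Clamping at an integrable \<open>G\<close> makes dominated convergence available, and what is cut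
  off has integral at most \<open>e * C\<close>, for the limit function by Fatou's lemma.\<close>

lemma integral_tendsto_small_growth:
  fixes h :: "nat \<Rightarrow> 'b \<Rightarrow> real" and U :: "nat \<Rightarrow> 'b \<Rightarrow> real"
  assumes hm: "\<And>n. h n \<in> borel_measurable M" and hm0: "h0 \<in> borel_measurable M"
    and lim: "AE x in M. (\<lambda>n. h n x) \<longlonglongrightarrow> h0 x"
    and Ui: "\<And>n. integrable M (U n)" and U0: "\<And>n. AE x in M. 0 \<le> U n x" and UC: "\<And>n. (LINT x|M. U n x) \<le> C"
    and growth: "\<And>e. 0 < e \<Longrightarrow> e \<le> 1 \<Longrightarrow> \<exists>H. integrable M H \<and> (\<forall>n. AE x in M. \<bar>h n x\<bar> \<le> e * U n x + H x)"
  shows "\<And>n. integrable M (h n)" and "integrable M h0" and "(\<lambda>n. LINT x|M. h n x) \<longlonglongrightarrow> (LINT x|M. h0 x)"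
proof -
  have C0: "0 \<le> C" using integral_nonneg_AE[OF U0[of 0]] UC[of 0] by linarith
  have I: "integrable M (h n)" for n
  proof -
    obtain H where H: "integrable M H" "\<And>n. AE x in M. \<bar>h n x\<bar> \<le> 1 * U n x + H x"
      using growth[of 1] by auto
    show ?thesis
      by (rule Bochner_Integration.integrable_bound[of _ "\<lambda>x. U n x + H x"])
         (use H(1) Ui hm H(2)[of n] in \<open>auto elim!: eventually_mono\<close>)
  qed
  then show "\<And>n. integrable M (h n)" .
  have cut: "\<exists>G. integrable M G \<and> (\<forall>n. (LINT x|M. \<bar>min (G x) (max (- G x) (h n x)) - h n x\<bar>) \<le> e * C) \<and> (\<forall>x. 0 \<le> G x)
     \<and> (\<forall>n. (\<integral>\<^sup>+x. ennreal (\<bar>h n x\<bar> - G x) \<partial>M) \<le> ennreal (e * C))"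
    if e: "0 < e" "e \<le> 1" for e
  proof -
    obtain H where H: "integrable M H" "\<And>n. AE x in M. \<bar>h n x\<bar> \<le> e * U n x + H x"
      using growth[OF e] by auto
    define G where "G = (\<lambda>x. \<bar>H x\<bar>)"
    have G: "integrable M G" unfolding G_def using H(1) by auto
    have m: "(\<lambda>x. \<bar>min (G x) (max (- G x) (h n x)) - h n x\<bar>) \<in> borel_measurable M" for n
      using borel_measurable_integrable[OF G] hm[of n] by measurable
    have b: "AE x in M. \<bar>min (G x) (max (- G x) (h n x)) - h n x\<bar> \<le> e * U n x" for n
      using H(2)[of n] U0[of n]
    proof eventually_elim
      case (elim x)
      have "\<bar>min (G x) (max (- G x) (h n x)) - h n x\<bar> \<le> max 0 (\<bar>h n x\<bar> - G x)"
        by (rule clamp_tendsto) (simp add: G_def)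
      also have "\<dots> \<le> e * U n x" using elim e unfolding G_def by auto
      finally show ?case .
    qed
    have "(LINT x|M. \<bar>min (G x) (max (- G x) (h n x)) - h n x\<bar>) \<le> e * C" for n
    proof -
      have "(LINT x|M. \<bar>min (G x) (max (- G x) (h n x)) - h n x\<bar>) \<le> (LINT x|M. e * U n x)"
      proof (rule integral_mono_AE)
        show "integrable M (\<lambda>x. e * U n x)" using Ui by auto
        then show "integrable M (\<lambda>x. \<bar>min (G x) (max (- G x) (h n x)) - h n x\<bar>)"
          by (rule Bochner_Integration.integrable_bound[OF _ m]) (use b[of n] in \<open>auto elim!: eventually_mono\<close>)
        show "AE x in M. \<bar>min (G x) (max (- G x) (h n x)) - h n x\<bar> \<le> e * U n x" by (rule b)
      qed
      also have "\<dots> \<le> e * C" using UC[of n] e by simp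
      finally show ?thesis .
    qed
    moreover have "(\<integral>\<^sup>+x. ennreal (\<bar>h n x\<bar> - G x) \<partial>M) \<le> ennreal (e * C)" for n
    proof -
      have "(\<integral>\<^sup>+x. ennreal (\<bar>h n x\<bar> - G x) \<partial>M) \<le> (\<integral>\<^sup>+x. ennreal (e * U n x) \<partial>M)"
        using H(2)[of n] by (intro nn_integral_mono_AE) (auto simp: G_def intro!: ennreal_leI elim!: eventually_mono)
      also have "\<dots> = ennreal (LINT x|M. e * U n x)"
        using Ui[of n] U0[of n] e by (intro nn_integral_eq_integral) (auto elim!: eventually_mono)
      also have "\<dots> \<le> ennreal (e * C)" using UC[of n] e by (intro ennreal_leI) simp
      finally show ?thesis .
    qed
    ultimately show ?thesis using G by (intro exI[of _ G]) (auto simp: G_def)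
  qed
  have fatou0: "(\<integral>\<^sup>+x. ennreal (\<bar>h0 x\<bar> - G x) \<partial>M) \<le> ennreal c"
    if G: "integrable M G" and n: "\<And>n. (\<integral>\<^sup>+x. ennreal (\<bar>h n x\<bar> - G x) \<partial>M) \<le> ennreal c" for G c
  proof -
    have "(\<integral>\<^sup>+x. ennreal (\<bar>h0 x\<bar> - G x) \<partial>M) = (\<integral>\<^sup>+x. liminf (\<lambda>n. ennreal (\<bar>h n x\<bar> - G x)) \<partial>M)"
    proof (intro nn_integral_cong_AE, use lim in eventually_elim)
      case (elim x)
      have "(\<lambda>n. ennreal (\<bar>h n x\<bar> - G x)) \<longlonglongrightarrow> ennreal (\<bar>h0 x\<bar> - G x)"
        by (intro tendsto_intros tendsto_ennrealI elim)
      then show ?case by (simp add: lim_imp_Liminf)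
    qed
    also have "\<dots> \<le> liminf (\<lambda>n. \<integral>\<^sup>+x. ennreal (\<bar>h n x\<bar> - G x) \<partial>M)"
      using hm borel_measurable_integrable[OF G] by (intro nn_integral_liminf) auto
    also have "\<dots> \<le> ennreal c"
      using n by (intro Liminf_le) auto
    finally show ?thesis .
  qed
  show I0: "integrable M h0"
  proof -
    obtain G where G: "integrable M G" "\<And>x. 0 \<le> G x" "\<And>n. (\<integral>\<^sup>+x. ennreal (\<bar>h n x\<bar> - G x) \<partial>M) \<le> ennreal (1 * C)"
      using cut[of 1] by auto
    have "(\<integral>\<^sup>+x. ennreal \<bar>h0 x\<bar> \<partial>M) \<le> (\<integral>\<^sup>+x. ennreal (\<bar>h0 x\<bar> - G x) + ennreal (G x) \<partial>M)"
    proof (rule nn_integral_mono)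
      fix x
      have "ennreal \<bar>h0 x\<bar> \<le> ennreal (max 0 (\<bar>h0 x\<bar> - G x) + G x)" by (intro ennreal_leI) auto
      also have "\<dots> = ennreal (\<bar>h0 x\<bar> - G x) + ennreal (G x)"
        using G(2)[of x] by (simp add: ennreal_plus max_0L[symmetric] del: max_0L) (metis ennreal_max_0)
      finally show "ennreal \<bar>h0 x\<bar> \<le> ennreal (\<bar>h0 x\<bar> - G x) + ennreal (G x)" .
    qed
    also have "\<dots> = (\<integral>\<^sup>+x. ennreal (\<bar>h0 x\<bar> - G x) \<partial>M) + (\<integral>\<^sup>+x. ennreal (G x) \<partial>M)"
      using hm0 borel_measurable_integrable[OF G(1)] by (intro nn_integral_add) auto
    also have "\<dots> < \<infinity>"
      using fatou0[OF G(1,3)] G(1,2) by (simp add: nn_integral_eq_integral less_top[symmetric] top_unique)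
         (metis ennreal_neq_top neq_top_trans)
    finally show ?thesis using hm0 by (intro integrableI_bounded) auto
  qed
  show "(\<lambda>n. LINT x|M. h n x) \<longlonglongrightarrow> (LINT x|M. h0 x)"
  proof (rule LIMSEQ_I)
    fix \<epsilon> :: real assume \<epsilon>: "0 < \<epsilon>"
    define K where "K = C + 1"
    have K: "0 < K" "C \<le> K" using C0 by (auto simp: K_def)
    \<comment> \<open>The constant \<open>K\<close> is positive also for \<open>C = 0\<close>. The
      choice keeps the cut-off errors of \<open>h n\<close> and of \<open>h0\<close> at
      \<open>\<epsilon> / 4\<close> each.\<close>
    define e where "e = min 1 (\<epsilon> / (4 * K))"
    have e: "0 < e" "e \<le> 1" using \<epsilon> K by (auto simp: e_def)
    have eC: "e * C \<le> \<epsilon> / 4"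
    proof -
      have "e * C \<le> \<epsilon> / (4 * K) * K" using C0 \<epsilon> e K by (intro mult_mono) (auto simp: e_def)
      also have "\<dots> = \<epsilon> / 4" using K by simp
      finally show ?thesis .
    qed
    obtain G where G: "integrable M G" "\<And>x. 0 \<le> G x"
      "\<And>n. (LINT x|M. \<bar>min (G x) (max (- G x) (h n x)) - h n x\<bar>) \<le> e * C"
      "\<And>n. (\<integral>\<^sup>+x. ennreal (\<bar>h n x\<bar> - G x) \<partial>M) \<le> ennreal (e * C)"
      using cut[OF e] by auto
    let ?c = "\<lambda>n x. min (G x) (max (- G x) (h n x))" and ?k = "\<lambda>x. min (G x) (max (- G x) (h0 x))"
    have Gm [measurable]: "G \<in> borel_measurable M" using G(1) by auto
    note hm [measurable] hm0 [measurable]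
    have ci: "integrable M (?c n)" for n
      by (rule Bochner_Integration.integrable_bound[OF G(1)]) (use G(2) in \<open>auto simp: min_def max_def\<close>)
    have c0i: "integrable M ?k"
      by (rule Bochner_Integration.integrable_bound[OF G(1)]) (use G(2) in \<open>auto simp: min_def max_def\<close>)
    have "(\<lambda>n. LINT x|M. ?c n x) \<longlonglongrightarrow> (LINT x|M. ?k x)"
    proof (rule integral_dominated_convergence[OF _ _ G(1)])
      show "AE x in M. (\<lambda>n. ?c n x) \<longlonglongrightarrow> ?k x"
        using lim by eventually_elim (intro tendsto_intros)
      show "AE x in M. norm (?c n x) \<le> G x" for n
        using G(2) by (auto simp: min_def max_def)
    qed measurable
    from LIMSEQ_D[OF this, of "\<epsilon> / 4"] \<epsilon>
    obtain N where N: "\<And>n. n \<ge> N \<Longrightarrow> \<bar>(LINT x|M. ?c n x) - (LINT x|M. ?k x)\<bar> < \<epsilon> / 4"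
      unfolding real_norm_def by auto
    have d0: "\<bar>(LINT x|M. ?k x) - (LINT x|M. h0 x)\<bar> \<le> e * C"
    proof -
      have "ennreal \<bar>(LINT x|M. ?k x) - (LINT x|M. h0 x)\<bar> = ennreal (norm (LINT x|M. ?k x - h0 x))"
        using c0i I0 by simp
      also have "\<dots> \<le> (\<integral>\<^sup>+x. ennreal (norm (?k x - h0 x)) \<partial>M)"
        using c0i I0 by (intro integral_norm_bound_ennreal) auto
      also have "\<dots> \<le> (\<integral>\<^sup>+x. ennreal (\<bar>h0 x\<bar> - G x) \<partial>M)"
      proof (rule nn_integral_mono)
        fix x
        have "norm (?k x - h0 x) \<le> max 0 (\<bar>h0 x\<bar> - G x)" using clamp_tendsto[OF G(2)[of x]] by simp
        then have "ennreal (norm (?k x - h0 x)) \<le> ennreal (max 0 (\<bar>h0 x\<bar> - G x))" by (rule ennreal_leI)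
        then show "ennreal (norm (?k x - h0 x)) \<le> ennreal (\<bar>h0 x\<bar> - G x)" by (simp add: ennreal_max_0)
      qed
      also have "\<dots> \<le> ennreal (e * C)" by (rule fatou0[OF G(1,4)])
      finally show ?thesis using e C0 by simp
    qed
    have dn: "\<bar>(LINT x|M. ?c n x) - (LINT x|M. h n x)\<bar> \<le> e * C" for n
    proof -
      have "\<bar>(LINT x|M. ?c n x) - (LINT x|M. h n x)\<bar> = \<bar>LINT x|M. ?c n x - h n x\<bar>" using ci I by simp
      also have "\<dots> \<le> (LINT x|M. \<bar>?c n x - h n x\<bar>)" by (rule integral_abs_bound)
      also have "\<dots> \<le> e * C" by (rule G(3))
      finally show ?thesis .
    qed
    show "\<exists>N. \<forall>n\<ge>N. norm ((LINT x|M. h n x) - (LINT x|M. h0 x)) < \<epsilon>"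
    proof (intro exI allI impI)
      fix n assume "n \<ge> N"
      then show "norm ((LINT x|M. h n x) - (LINT x|M. h0 x)) < \<epsilon>"
        using N[of n] d0 dn[of n] eC \<epsilon> unfolding real_norm_def by linarith
    qed
  qed
qed

subsection \<open>Variable exponent spaces\<close>

text \<open>Local integrability yields measurability on each closed box of a countable cover of
  \<Omega>, and the pieces are glued.\<close>

lemma has_weak_gradient_measurable:
  fixes u :: "'a::euclidean_space \<Rightarrow> real"
  assumes op: "open \<Omega>" and w: "has_weak_gradient \<Omega> u g"
  shows "u \<in> borel_measurable (lebesgue_on \<Omega>)" "g \<in> borel_measurable (lebesgue_on \<Omega>)"
proof -
  obtain \<D> where D: "countable \<D>" "\<D> \<subseteq> Pow \<Omega>" "\<And>X. X \<in> \<D> \<Longrightarrow> \<exists>a b. X = cbox a b" "\<Union>\<D> = \<Omega>"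
    using open_countable_Union_open_cbox[OF op] by metis
  have pw: "f \<in> borel_measurable (lebesgue_on \<Omega>)"
    if f: "\<And>K. compact K \<Longrightarrow> K \<subseteq> \<Omega> \<Longrightarrow> f absolutely_integrable_on K" for f :: "'a \<Rightarrow> 'b::euclidean_space"
  proof (rule measurable_piecewise_restrict[OF D(1)])
    show "space (lebesgue_on \<Omega>) \<subseteq> \<Union>\<D>" using D(4) by simp
    fix X assume X: "X \<in> \<D>"
    then obtain a b where ab: "X = cbox a b" using D(3) by blast
    have sub: "X \<subseteq> \<Omega>" using X D(2) by blast
    have \<Omega>: "\<Omega> \<in> sets lebesgue" using op by auto
    have Xl: "X \<in> sets lebesgue" by (simp add: ab)
    show "X \<inter> space (lebesgue_on \<Omega>) \<in> sets (lebesgue_on \<Omega>)"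
      using sub \<Omega> Xl by (auto simp: sets_restrict_space_iff Int_absorb2)
    have "f absolutely_integrable_on X" using f sub by (simp add: ab)
    then have "(\<lambda>x. indicator X x *\<^sub>R f x) \<in> borel_measurable lebesgue"
      unfolding set_integrable_def by (rule borel_measurable_integrable)
    then have "f \<in> borel_measurable (lebesgue_on X)"
      using Xl by (subst borel_measurable_restrict_space_iff) auto
    moreover have "restrict_space (lebesgue_on \<Omega>) X = lebesgue_on X"
      using \<Omega> Xl sub by (subst restrict_restrict_space) (auto simp: Int_absorb1)
    ultimately show "f \<in> borel_measurable (restrict_space (lebesgue_on \<Omega>) X)" by simp
  qed
  show "u \<in> borel_measurable (lebesgue_on \<Omega>)"
    by (rule pw) (use w in \<open>simp add: has_weak_gradient_def\<close>)
  show "g \<in> borel_measurable (lebesgue_on \<Omega>)"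
    by (rule pw) (use w in \<open>simp add: has_weak_gradient_def\<close>)
qed

text \<open>\<open>p0\<close> and \<open>P\<close> stand for the extreme values of the exponent. The
  bound \<open>2 < p0\<close> serves Clarkson's inequality and keeps the conjugate exponent between
  1 and 2.\<close>

locale variable_exponent =
  fixes \<Omega> :: "'a::euclidean_space set" and p :: "'a \<Rightarrow> real" and p0 P :: real
  assumes op: "open \<Omega>" and bd: "bounded \<Omega>" and pc: "continuous_on (closure \<Omega>) p"
    and p02: "2 < p0" and p_bounds: "\<And>x. x \<in> closure \<Omega> \<Longrightarrow> p0 \<le> p x \<and> p x \<le> P"
begin

abbreviation "M \<equiv> lebesgue_on \<Omega>"

text \<open>The modular for vector valued functions. Smallness in the Luxemburg norm is expressed
  throughout by \<open>rho (\<lambda>x. (1 / \<mu>) *\<^sub>R g x) \<le> 1\<close>, which bounds the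
  norm by \<mu> and is easier to handle under integrals.\<close>

definition rho :: "('a \<Rightarrow> 'b::euclidean_space) \<Rightarrow> ennreal" where
  "rho g = (\<integral>\<^sup>+x. ennreal (norm (g x) powr p x) \<partial>M)"

definition rho' :: "('a \<Rightarrow> 'b::euclidean_space) \<Rightarrow> ennreal" where
  "rho' g = (\<integral>\<^sup>+x. ennreal (norm (g x) powr conj_exp p x) \<partial>M)"

lemma p_pos: "x \<in> \<Omega> \<Longrightarrow> 2 < p x \<and> p0 \<le> p x \<and> p x \<le> P"
  using p_bounds[of x] p02 closure_subset[of \<Omega>] by fastforce

lemma \<Omega>_lebesgue: "\<Omega> \<in> sets lebesgue"
  using op by auto

sublocale M: finite_measure M
  using bd op by (intro finite_measure_lebesgue_on bounded_set_imp_lmeasurable) auto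

lemma emeasure_M_finite: "emeasure M \<Omega> < top"
  by (metis M.emeasure_finite infinity_ennreal_def less_top)

lemma p_measurable [measurable]: "p \<in> borel_measurable M"
  using pc closure_subset[of \<Omega>] \<Omega>_lebesgue
  by (intro continuous_imp_measurable_on_sets_lebesgue) (auto intro: continuous_on_subset)

lemma conj_exp_measurable [measurable]: "conj_exp p \<in> borel_measurable M"
  unfolding conj_exp_def by measurable

lemma measurable_M_borel: "f \<in> borel_measurable borel \<Longrightarrow> f \<in> borel_measurable M"
  by (intro measurable_restrict_space1 measurable_completion) simp

lemma modular_eq_rho: "modular \<Omega> p u = rho u" "modular \<Omega> p (\<lambda>x. norm (g x)) = rho g"
  by (simp_all add: modular_def rho_def)

lemma rho_norm [simp]: "rho (\<lambda>x. norm (g x)) = rho g"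
  by (simp add: rho_def)

lemma rho_cong_AE: "AE x in M. g x = h x \<Longrightarrow> rho g = rho h"
  unfolding rho_def by (intro nn_integral_cong_AE) (auto elim!: eventually_mono)

lemma rho_mono:
  assumes "AE x in M. norm (g x) \<le> norm (h x)" shows "rho g \<le> rho h"
  unfolding rho_def
proof (intro nn_integral_mono_AE, use assms AE_space in eventually_elim)
  case (elim x)
  then show ?case using p_pos[of x] by (intro ennreal_leI powr_mono2) auto
qed

text \<open>For \<open>c \<le> 1\<close> the factors \<open>c powr p x\<close> are at most
  \<open>c powr p0\<close>. This estimate and its counterpart for \<open>c \<ge> 1\<close> take the
  place of homogeneity.\<close>

lemma rho_cmult_le:
  assumes [measurable]: "g \<in> borel_measurable M" and "0 \<le> c" "c \<le> 1"
  shows "rho (\<lambda>x. c *\<^sub>R g x) \<le> ennreal (c powr p0) * rho g"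
proof -
  have "rho (\<lambda>x. c *\<^sub>R g x) \<le> (\<integral>\<^sup>+x. ennreal (c powr p0) * ennreal (norm (g x) powr p x) \<partial>M)"
    unfolding rho_def
  proof (intro nn_integral_mono)
    fix x assume "x \<in> space M"
    then have px: "p0 \<le> p x" "2 < p x" using p_pos by auto
    have "c powr p x \<le> c powr p0" using px assms by (intro powr_mono') auto
    then have "c powr p x * norm (g x) powr p x \<le> c powr p0 * norm (g x) powr p x"
      by (intro mult_right_mono) auto
    then show "ennreal (norm (c *\<^sub>R g x) powr p x) \<le> ennreal (c powr p0) * ennreal (norm (g x) powr p x)"
      using assms by (simp add: powr_mult ennreal_mult[symmetric] ennreal_leI)
  qed
  then show ?thesis by (simp add: nn_integral_cmult rho_def)
qed

lemma rho_cmult_ge: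
  assumes [measurable]: "g \<in> borel_measurable M" and "1 \<le> c"
  shows "rho (\<lambda>x. c *\<^sub>R g x) \<le> ennreal (c powr P) * rho g"
proof -
  have "rho (\<lambda>x. c *\<^sub>R g x) \<le> (\<integral>\<^sup>+x. ennreal (c powr P) * ennreal (norm (g x) powr p x) \<partial>M)"
    unfolding rho_def
  proof (intro nn_integral_mono)
    fix x assume "x \<in> space M"
    then have px: "p x \<le> P" using p_pos by auto
    have "c powr p x \<le> c powr P" using px assms by (intro powr_mono) auto
    then have "c powr p x * norm (g x) powr p x \<le> c powr P * norm (g x) powr p x"
      by (intro mult_right_mono) auto
    then show "ennreal (norm (c *\<^sub>R g x) powr p x) \<le> ennreal (c powr P) * ennreal (norm (g x) powr p x)"
      using assms by (simp add: powr_mult ennreal_mult[symmetric] ennreal_leI)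
  qed
  then show ?thesis by (simp add: nn_integral_cmult rho_def)
qed

lemma rho_cmult_finite:
  assumes "g \<in> borel_measurable M" "rho g < \<infinity>"
  shows "rho (\<lambda>x. c *\<^sub>R g x) < \<infinity>"
proof -
  define d where "d = max 1 \<bar>c\<bar>"
  have "rho (\<lambda>x. c *\<^sub>R g x) \<le> rho (\<lambda>x. d *\<^sub>R g x)"
    by (intro rho_mono) (auto simp: d_def intro!: mult_right_mono)
  also have "\<dots> \<le> ennreal (d powr P) * rho g" by (rule rho_cmult_ge[OF assms(1)]) (simp add: d_def)
  also have "\<dots> < \<infinity>" using assms(2) by (simp add: ennreal_mult_less_top)
  finally show ?thesis .
qed

lemma rho_add_le:
  assumes [measurable]: "g \<in> borel_measurable M" "h \<in> borel_measurable M"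
  shows "rho (\<lambda>x. g x + h x) \<le> ennreal (2 powr P) * (rho g + rho h)"
proof -
  have "rho (\<lambda>x. g x + h x) \<le>
      (\<integral>\<^sup>+x. ennreal (2 powr P) * (ennreal (norm (g x) powr p x) + ennreal (norm (h x) powr p x)) \<partial>M)"
    unfolding rho_def
  proof (intro nn_integral_mono)
    fix x assume "x \<in> space M"
    then have px: "p x \<le> P" "2 < p x" using p_pos by auto
    have "norm (g x + h x) powr p x \<le> 2 powr (p x - 1) * (norm (g x) powr p x + norm (h x) powr p x)"
      using px by (intro norm_add_powr_le) auto
    also have "\<dots> \<le> 2 powr P * (norm (g x) powr p x + norm (h x) powr p x)"
      using px by (intro mult_right_mono powr_mono) auto
    finally have "ennreal (norm (g x + h x) powr p x) \<le> ennreal (2 powr P * (norm (g x) powr p x + norm (h x) powr p x))"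
      by (rule ennreal_leI)
    then show "ennreal (norm (g x + h x) powr p x) \<le>
        ennreal (2 powr P) * (ennreal (norm (g x) powr p x) + ennreal (norm (h x) powr p x))"
      by (simp add: ennreal_mult ennreal_plus)
  qed
  then show ?thesis by (simp add: nn_integral_cmult nn_integral_add rho_def)
qed

lemma rho_add_finite:
  assumes "g \<in> borel_measurable M" "h \<in> borel_measurable M" "rho g < \<infinity>" "rho h < \<infinity>"
  shows "rho (\<lambda>x. g x + h x) < \<infinity>"
  by (rule le_less_trans[OF rho_add_le[OF assms(1,2)]]) (use assms in \<open>simp add: ennreal_mult_less_top\<close>)

lemma rho_diff_finite:
  assumes "g \<in> borel_measurable M" "h \<in> borel_measurable M" "rho g < \<infinity>" "rho h < \<infinity>"
  shows "rho (\<lambda>x. g x - h x) < \<infinity>"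
proof -
  have "rho (\<lambda>x. g x + (-1) *\<^sub>R h x) < \<infinity>"
    by (intro rho_add_finite rho_cmult_finite assms borel_measurable_scaleR borel_measurable_const)
  then show ?thesis by simp
qed

lemma rho_bounded_finite:
  assumes "\<And>x. x \<in> \<Omega> \<Longrightarrow> norm (g x) \<le> B"
  shows "rho g < \<infinity>"
proof -
  have "rho g \<le> (\<integral>\<^sup>+x. ennreal ((max 1 B) powr P) \<partial>M)"
    unfolding rho_def
  proof (intro nn_integral_mono ennreal_leI)
    fix x assume x: "x \<in> space M"
    then have px: "p x \<le> P" "2 < p x" using p_pos by auto
    have "norm (g x) powr p x \<le> max 1 B powr p x"
      using assms[of x] x px by (intro powr_mono2) auto
    also have "\<dots> \<le> max 1 B powr P" using px by (intro powr_mono) auto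
    finally show "norm (g x) powr p x \<le> max 1 B powr P" .
  qed
  also have "\<dots> < \<infinity>" using emeasure_M_finite by (simp add: ennreal_mult_less_top)
  finally show ?thesis .
qed

lemma conj_exp_bounds: "x \<in> \<Omega> \<Longrightarrow> 1 \<le> conj_exp p x \<and> conj_exp p x \<le> 2"
  using p_pos[of x] by (auto simp: conj_exp_def field_simps)

lemma nn_pairing_le:
  assumes [measurable]: "A \<in> borel_measurable M" "W \<in> borel_measurable M"
  shows "(\<integral>\<^sup>+x. ennreal (norm (A x) * norm (W x)) \<partial>M) \<le> rho' A + rho W"
proof -
  have "(\<integral>\<^sup>+x. ennreal (norm (A x) * norm (W x)) \<partial>M) \<le>
      (\<integral>\<^sup>+x. ennreal (norm (A x) powr conj_exp p x) + ennreal (norm (W x) powr p x) \<partial>M)"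
  proof (intro nn_integral_mono)
    fix x assume x: "x \<in> space M"
    have "norm (A x) * norm (W x) \<le> norm (A x) powr (p x / (p x - 1)) + norm (W x) powr p x"
      using p_pos[of x] x by (intro mult_le_powr_add_powr) auto
    then have "ennreal (norm (A x) * norm (W x)) \<le> ennreal (norm (A x) powr conj_exp p x + norm (W x) powr p x)"
      by (intro ennreal_leI) (simp add: conj_exp_def)
    then show "ennreal (norm (A x) * norm (W x)) \<le> ennreal (norm (A x) powr conj_exp p x) + ennreal (norm (W x) powr p x)"
      by (simp add: ennreal_plus)
  qed
  then show ?thesis by (simp add: nn_integral_add rho_def rho'_def)
qed

lemma pairing_integrable:
  assumes [measurable]: "A \<in> borel_measurable M" "W \<in> borel_measurable M" and "rho' A < \<infinity>" "rho W < \<infinity>"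
  shows "integrable M (\<lambda>x. A x \<bullet> W x)" "integrable M (\<lambda>x. norm (A x) * norm (W x))"
proof -
  have fin: "(\<integral>\<^sup>+x. ennreal (norm (A x) * norm (W x)) \<partial>M) < \<infinity>"
    by (rule le_less_trans[OF nn_pairing_le]) (use assms in auto)
  then show I: "integrable M (\<lambda>x. norm (A x) * norm (W x))"
    by (intro integrableI_nonneg) auto
  show "integrable M (\<lambda>x. A x \<bullet> W x)"
    by (rule Bochner_Integration.integrable_bound[OF I]) (auto simp: Cauchy_Schwarz_ineq2)
qed

text \<open>Hoelder's inequality in modular form: \<mu> is pulled out of \<open>W\<close> before
  Young's inequality is applied, so a small Luxemburg norm of \<open>W\<close> makes the pairing
  small although \<open>A\<close> is controlled only by a modular bound.\<close>

lemma pairing_bound: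
  assumes [measurable]: "A \<in> borel_measurable M" "W \<in> borel_measurable M"
    and A: "rho' A \<le> ennreal C" and W: "rho (\<lambda>x. (1 / \<mu>) *\<^sub>R W x) \<le> 1" and \<mu>: "0 < \<mu>" and C: "0 \<le> C"
  shows "(LINT x|M. norm (A x) * norm (W x)) \<le> \<mu> * (C + 1)" "\<bar>LINT x|M. A x \<bullet> W x\<bar> \<le> \<mu> * (C + 1)"
proof -
  have "rho (\<lambda>x. \<mu> *\<^sub>R ((1 / \<mu>) *\<^sub>R W x)) < \<infinity>"
  proof (rule rho_cmult_finite)
    show "rho (\<lambda>x. (1 / \<mu>) *\<^sub>R W x) < \<infinity>" by (rule le_less_trans[OF W]) simp
  qed measurable
  then have Wf: "rho W < \<infinity>" using \<mu> by simp
  have Af: "rho' A < \<infinity>" using A by (rule le_less_trans) simp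
  note I = pairing_integrable[OF assms(1,2) Af Wf]
  have "ennreal (LINT x|M. norm (A x) * norm (W x)) = (\<integral>\<^sup>+x. ennreal (norm (A x) * norm (W x)) \<partial>M)"
    using I(2) by (intro nn_integral_eq_integral[symmetric]) auto
  also have "\<dots> = (\<integral>\<^sup>+x. ennreal \<mu> * ennreal (norm (A x) * norm ((1 / \<mu>) *\<^sub>R W x)) \<partial>M)"
    using \<mu> by (intro nn_integral_cong) (simp add: ennreal_mult[symmetric])
  also have "\<dots> = ennreal \<mu> * (\<integral>\<^sup>+x. ennreal (norm (A x) * norm ((1 / \<mu>) *\<^sub>R W x)) \<partial>M)"
    by (rule nn_integral_cmult) measurable
  also have "\<dots> \<le> ennreal \<mu> * (rho' A + rho (\<lambda>x. (1 / \<mu>) *\<^sub>R W x))"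
    by (intro mult_left_mono nn_pairing_le) auto
  also have "\<dots> \<le> ennreal \<mu> * (ennreal C + 1)"
    using A W by (intro mult_left_mono add_mono) auto
  also have "\<dots> = ennreal (\<mu> * (C + 1))"
    using C \<mu> by (simp add: ennreal_mult ennreal_plus)
  finally show *: "(LINT x|M. norm (A x) * norm (W x)) \<le> \<mu> * (C + 1)"
    using C \<mu> by simp
  have "\<bar>LINT x|M. A x \<bullet> W x\<bar> \<le> (LINT x|M. \<bar>A x \<bullet> W x\<bar>)" by (rule integral_abs_bound)
  also have "\<dots> \<le> (LINT x|M. norm (A x) * norm (W x))"
    using I by (intro integral_mono) (auto simp: Cauchy_Schwarz_ineq2)
  finally show "\<bar>LINT x|M. A x \<bullet> W x\<bar> \<le> \<mu> * (C + 1)" using * by linarith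
qed

text \<open>Pointwise \<open>t \<le> 1 + t powr p x\<close> for the rescaled function; scaling back
  leaves the factor \<mu>, so a small Luxemburg norm forces a small \<open>L^1\<close> norm.\<close>

lemma L1_le_rho:
  assumes [measurable]: "g \<in> borel_measurable M" and \<mu>: "0 < \<mu>"
  shows "(\<integral>\<^sup>+x. ennreal (norm (g x)) \<partial>M) \<le> ennreal \<mu> * (emeasure M \<Omega> + rho (\<lambda>x. (1 / \<mu>) *\<^sub>R g x))"
proof -
  have "(\<integral>\<^sup>+x. ennreal (norm (g x)) \<partial>M) \<le> (\<integral>\<^sup>+x. ennreal \<mu> * (1 + ennreal (norm ((1 / \<mu>) *\<^sub>R g x) powr p x)) \<partial>M)"
  proof (intro nn_integral_mono)
    fix x assume x: "x \<in> space M"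
    have "norm ((1 / \<mu>) *\<^sub>R g x) powr 1 \<le> 1 + norm ((1 / \<mu>) *\<^sub>R g x) powr p x"
      using p_pos[of x] x by (intro powr_le_one_plus_powr) auto
    then have "\<mu> * norm ((1 / \<mu>) *\<^sub>R g x) \<le> \<mu> * (1 + norm ((1 / \<mu>) *\<^sub>R g x) powr p x)"
      using \<mu> by (intro mult_left_mono) auto
    then have "norm (g x) \<le> \<mu> * (1 + norm ((1 / \<mu>) *\<^sub>R g x) powr p x)" using \<mu> by simp
    then have "ennreal (norm (g x)) \<le> ennreal (\<mu> * (1 + norm ((1 / \<mu>) *\<^sub>R g x) powr p x))" by (rule ennreal_leI)
    then show "ennreal (norm (g x)) \<le> ennreal \<mu> * (1 + ennreal (norm ((1 / \<mu>) *\<^sub>R g x) powr p x))"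
      using \<mu> by (simp add: ennreal_mult ennreal_plus del: norm_scaleR)
  qed
  also have "\<dots> = ennreal \<mu> * (emeasure M \<Omega> + rho (\<lambda>x. (1 / \<mu>) *\<^sub>R g x))"
    by (simp add: nn_integral_cmult nn_integral_add rho_def del: norm_scaleR)
  finally show ?thesis .
qed

lemma rho_finite_integrable:
  assumes [measurable]: "g \<in> borel_measurable M" and "rho g < \<infinity>"
  shows "integrable M g" "integrable M (\<lambda>x. norm (g x) powr p x)"
proof -
  have "(\<integral>\<^sup>+x. ennreal (norm (g x)) \<partial>M) \<le> ennreal 1 * (emeasure M \<Omega> + rho (\<lambda>x. (1 / 1) *\<^sub>R g x))"
    by (rule L1_le_rho) auto
  also have "\<dots> < \<infinity>" using assms(2) emeasure_M_finite by simp
  finally show "integrable M g" by (intro integrableI_bounded) auto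
  show "integrable M (\<lambda>x. norm (g x) powr p x)"
    using assms(2) by (intro integrableI_nonneg) (auto simp: rho_def)
qed

lemma test_function_rho:
  assumes \<phi>: "\<phi> \<in> test_functions \<Omega>"
  shows "\<phi> \<in> borel_measurable M" "grad \<phi> \<in> borel_measurable M" "rho \<phi> < \<infinity>" "rho (grad \<phi>) < \<infinity>"
proof -
  have sm: "smooth \<phi>" using \<phi> by (rule test_function_smooth)
  show "\<phi> \<in> borel_measurable M" "grad \<phi> \<in> borel_measurable M"
    by (intro measurable_M_borel borel_measurable_continuous_onI smooth_continuous_on smooth_continuous_on_grad sm)+
  obtain B C where "\<And>x. \<bar>\<phi> x\<bar> \<le> B" "\<And>x. norm (grad \<phi> x) \<le> C"
    using test_function_bounded[OF \<phi>] test_grad_bounded[OF \<phi>] by blast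
  then show "rho \<phi> < \<infinity>" "rho (grad \<phi>) < \<infinity>"
    using rho_bounded_finite[of \<phi> B] rho_bounded_finite[of "grad \<phi>" C] by auto
qed

lemma Lvar_iff: "u \<in> Lvar \<Omega> p \<longleftrightarrow> u \<in> borel_measurable M \<and> rho u < \<infinity>"
  by (simp add: Lvar_def modular_eq_rho)

lemma Lvar_norm_le:
  assumes "0 < \<mu>" "rho (\<lambda>x. (1 / \<mu>) *\<^sub>R u x) \<le> 1"
  shows "Lvar_norm \<Omega> p u \<le> \<mu>"
  unfolding Lvar_norm_def
  using assms by (intro cInf_lower bdd_belowI[of _ 0]) (auto simp: modular_eq_rho)

lemma Lvar_norm_less:
  assumes u: "u \<in> Lvar \<Omega> p"
  shows "0 \<le> Lvar_norm \<Omega> p u" "Lvar_norm \<Omega> p u < \<epsilon> \<Longrightarrow> rho (\<lambda>x. (1 / \<epsilon>) *\<^sub>R u x) \<le> 1"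
proof -
  let ?S = "{\<mu>. 0 < \<mu> \<and> modular \<Omega> p (\<lambda>x. u x / \<mu>) \<le> 1}"
  have um: "u \<in> borel_measurable M" and fin: "rho u < \<infinity>" using u by (auto simp: Lvar_iff)
  obtain R where R: "rho u = ennreal R" "0 \<le> R" using fin by (cases "rho u") auto
  \<comment> \<open>Witness that the infimum in the norm ranges over a nonempty set: division by
    \<open>\<mu> \<ge> 1\<close> shrinks the modular at least by the factor
    \<open>1 / \<mu>\<close>.\<close>
  define \<mu> where "\<mu> = max 1 R"
  have \<mu>: "1 \<le> \<mu>" by (simp add: \<mu>_def)
  have "rho (\<lambda>x. (1 / \<mu>) *\<^sub>R u x) \<le> ennreal ((1 / \<mu>) powr p0) * rho u"
    using \<mu> by (intro rho_cmult_le um) auto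
  also have "\<dots> \<le> ennreal ((1 / \<mu>) powr 1) * rho u"
    using \<mu> p02 by (intro mult_right_mono ennreal_leI powr_mono') auto
  also have "\<dots> = ennreal (R / \<mu>)" using \<mu> R by (simp add: ennreal_mult[symmetric])
  also have "\<dots> \<le> ennreal 1" using R by (intro ennreal_leI) (auto simp: \<mu>_def divide_le_eq)
  finally have "\<mu> \<in> ?S" using \<mu> by (simp add: modular_eq_rho)
  then have ne: "?S \<noteq> {}" by blast
  show "0 \<le> Lvar_norm \<Omega> p u"
    unfolding Lvar_norm_def by (rule cInf_greatest[OF ne]) auto
  assume "Lvar_norm \<Omega> p u < \<epsilon>"
  then obtain \<nu> where \<nu>: "0 < \<nu>" "rho (\<lambda>x. u x / \<nu>) \<le> 1" "\<nu> < \<epsilon>"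
    unfolding Lvar_norm_def using cInf_lessD[OF ne] by (auto simp: modular_eq_rho)
  have "rho (\<lambda>x. (1 / \<epsilon>) *\<^sub>R u x) \<le> rho (\<lambda>x. u x / \<nu>)"
    using \<nu> by (intro rho_mono always_eventually allI) (auto intro!: divide_left_mono)
  then show "rho (\<lambda>x. (1 / \<epsilon>) *\<^sub>R u x) \<le> 1" using \<nu>(2) by (rule order_trans)
qed

lemma W1_D:
  assumes "v \<in> W1 \<Omega> p"
  shows "v \<in> borel_measurable M" "wgrad \<Omega> v \<in> borel_measurable M" "rho v < \<infinity>" "rho (wgrad \<Omega> v) < \<infinity>"
    "has_weak_gradient \<Omega> v (wgrad \<Omega> v)"
proof -
  show w: "has_weak_gradient \<Omega> v (wgrad \<Omega> v)"
    using assms has_weak_gradient_wgrad by (auto simp: W1_def)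
  show "v \<in> borel_measurable M" "wgrad \<Omega> v \<in> borel_measurable M"
    by (rule has_weak_gradient_measurable[OF op w])+
  show "rho v < \<infinity>" using assms by (simp add: W1_def Lvar_iff)
  show "rho (wgrad \<Omega> v) < \<infinity>" using assms by (simp add: W1_def Lvar_def modular_eq_rho)
qed

text \<open>Makes the norm condition in \<open>W01\<close> accessible: the chosen weak gradient of
  the difference equals the difference of gradients only almost everywhere, which the modular cannot
  see.\<close>

lemma W1_diff_test:
  assumes v: "v \<in> W1 \<Omega> p" and \<phi>: "\<phi> \<in> test_functions \<Omega>"
  shows "AE x in M. wgrad \<Omega> (\<lambda>x. v x - \<phi> x) x = wgrad \<Omega> v x - grad \<phi> x"
    "(\<lambda>x. v x - \<phi> x) \<in> Lvar \<Omega> p" "(\<lambda>x. norm (wgrad \<Omega> (\<lambda>x. v x - \<phi> x) x)) \<in> Lvar \<Omega> p"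
    "rho (\<lambda>x. c *\<^sub>R norm (wgrad \<Omega> (\<lambda>x. v x - \<phi> x) x)) = rho (\<lambda>x. c *\<^sub>R (wgrad \<Omega> v x - grad \<phi> x))"
proof -
  note V = W1_D[OF v] and T = test_function_rho[OF \<phi>]
  have w: "has_weak_gradient \<Omega> (\<lambda>x. v x - \<phi> x) (\<lambda>x. wgrad \<Omega> v x - grad \<phi> x)"
    by (rule has_weak_gradient_diff[OF op V(5) has_weak_gradient_grad[OF op \<phi>]])
  show AE: "AE x in M. wgrad \<Omega> (\<lambda>x. v x - \<phi> x) x = wgrad \<Omega> v x - grad \<phi> x"
    by (rule wgrad_eq[OF op w])
  have m: "wgrad \<Omega> (\<lambda>x. v x - \<phi> x) \<in> borel_measurable M"
    by (rule has_weak_gradient_measurable(2)[OF op has_weak_gradient_wgrad[OF w]])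
  show "(\<lambda>x. v x - \<phi> x) \<in> Lvar \<Omega> p"
    unfolding Lvar_iff using V(1) T(1) rho_diff_finite[OF V(1) T(1) V(3) T(3)] by auto
  have "rho (wgrad \<Omega> (\<lambda>x. v x - \<phi> x)) = rho (\<lambda>x. wgrad \<Omega> v x - grad \<phi> x)"
    using AE by (rule rho_cong_AE)
  also have "\<dots> < \<infinity>" using V T by (intro rho_diff_finite)
  finally show "(\<lambda>x. norm (wgrad \<Omega> (\<lambda>x. v x - \<phi> x) x)) \<in> Lvar \<Omega> p"
    using m by (simp add: Lvar_def modular_eq_rho)
  show "rho (\<lambda>x. c *\<^sub>R norm (wgrad \<Omega> (\<lambda>x. v x - \<phi> x) x)) = rho (\<lambda>x. c *\<^sub>R (wgrad \<Omega> v x - grad \<phi> x))"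
    unfolding rho_def using AE by (intro nn_integral_cong_AE) (auto simp: abs_mult elim!: eventually_mono)
qed

lemma W01_D:
  assumes v: "v \<in> W01 \<Omega> p" and \<epsilon>: "0 < \<epsilon>"
  obtains \<phi> where "\<phi> \<in> test_functions \<Omega>" "rho (\<lambda>x. (1 / \<epsilon>) *\<^sub>R (v x - \<phi> x)) \<le> 1"
    "rho (\<lambda>x. (1 / \<epsilon>) *\<^sub>R (wgrad \<Omega> v x - grad \<phi> x)) \<le> 1"
proof -
  have v1: "v \<in> W1 \<Omega> p" using v by (simp add: W01_def)
  obtain \<phi> where \<phi>: "\<phi> \<in> test_functions \<Omega>" and n: "W1_norm \<Omega> p (\<lambda>x. v x - \<phi> x) < \<epsilon>"
    using v \<epsilon> by (auto simp: W01_def)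
  note L = W1_diff_test[OF v1 \<phi>]
  have "Lvar_norm \<Omega> p (\<lambda>x. v x - \<phi> x) < \<epsilon>" "Lvar_norm \<Omega> p (\<lambda>x. norm (wgrad \<Omega> (\<lambda>x. v x - \<phi> x) x)) < \<epsilon>"
    using n Lvar_norm_less(1)[OF L(2)] Lvar_norm_less(1)[OF L(3)] unfolding W1_norm_def by linarith+
  from Lvar_norm_less(2)[OF L(2) this(1)] Lvar_norm_less(2)[OF L(3) this(2)] show ?thesis using that[OF \<phi>] unfolding L(4) by blast
qed

lemma W01_I:
  assumes v1: "v \<in> W1 \<Omega> p"
    and approx: "\<And>\<epsilon>. 0 < \<epsilon> \<Longrightarrow> \<exists>\<phi>\<in>test_functions \<Omega>. rho (\<lambda>x. (1 / \<epsilon>) *\<^sub>R (v x - \<phi> x)) \<le> 1 \<and>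
      rho (\<lambda>x. (1 / \<epsilon>) *\<^sub>R (wgrad \<Omega> v x - grad \<phi> x)) \<le> 1"
  shows "v \<in> W01 \<Omega> p"
  unfolding W01_def
proof (intro CollectI conjI v1 allI impI)
  fix \<epsilon> :: real assume \<epsilon>: "0 < \<epsilon>"
  \<comment> \<open>Two norms of at most \<open>\<epsilon> / 3\<close> leave room for the strict
    inequality.\<close>
  then obtain \<phi> where \<phi>: "\<phi> \<in> test_functions \<Omega>" "rho (\<lambda>x. (1 / (\<epsilon> / 3)) *\<^sub>R (v x - \<phi> x)) \<le> 1"
      "rho (\<lambda>x. (1 / (\<epsilon> / 3)) *\<^sub>R (wgrad \<Omega> v x - grad \<phi> x)) \<le> 1"
    using approx[of "\<epsilon> / 3"] by auto
  have "Lvar_norm \<Omega> p (\<lambda>x. v x - \<phi> x) \<le> \<epsilon> / 3"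
    using \<epsilon> \<phi>(2) by (intro Lvar_norm_le) auto
  moreover have "Lvar_norm \<Omega> p (\<lambda>x. norm (wgrad \<Omega> (\<lambda>x. v x - \<phi> x) x)) \<le> \<epsilon> / 3"
    by (rule Lvar_norm_le) (use \<epsilon> in simp, unfold W1_diff_test(4)[OF v1 \<phi>(1)], rule \<phi>(3))
  ultimately have "W1_norm \<Omega> p (\<lambda>x. v x - \<phi> x) < \<epsilon>" using \<epsilon> unfolding W1_norm_def by linarith
  then show "\<exists>\<phi>\<in>test_functions \<Omega>. W1_norm \<Omega> p (\<lambda>x. v x - \<phi> x) < \<epsilon>" using \<phi>(1) by blast
qed

end

text \<open>Iterated midpoints take the place of the convex combinations in Mazur's lemma: midpoints are
  all that Clarkson's inequality needs.\<close>

inductive_set mids :: "(nat \<Rightarrow> 'a \<Rightarrow> real) \<Rightarrow> nat \<Rightarrow> ('a \<Rightarrow> real) set" for u N where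
  base: "N \<le> n \<Longrightarrow> u n \<in> mids u N"
| mid: "f \<in> mids u N \<Longrightarrow> g \<in> mids u N \<Longrightarrow> (\<lambda>x. (1 / 2) * (f x + g x)) \<in> mids u N"

lemma mids_antimono: "N \<le> K \<Longrightarrow> mids u K \<subseteq> mids u N"
proof
  fix f assume "N \<le> K" "f \<in> mids u K"
  show "f \<in> mids u N" using \<open>f \<in> mids u K\<close>
    by (induction rule: mids.induct) (rule mids.base, use \<open>N \<le> K\<close> in simp, rule mids.mid)
qed

lemma test_function_diff:
  assumes "\<phi> \<in> test_functions \<Omega>" "\<psi> \<in> test_functions \<Omega>"
  shows "(\<lambda>x. \<phi> x - \<psi> x) \<in> test_functions \<Omega>" "grad (\<lambda>x. \<phi> x - \<psi> x) x = grad \<phi> x - grad \<psi> x"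
proof -
  have eq: "(\<lambda>x. \<phi> x - \<psi> x) = (\<lambda>x. \<phi> x + (-1) * \<psi> x)" by simp
  note sm = assms[THEN test_function_smooth]
  show "(\<lambda>x. \<phi> x - \<psi> x) \<in> test_functions \<Omega>"
    unfolding eq by (intro test_function_add test_function_cmult assms)
  have "smooth (\<lambda>x. (-1) * \<psi> x)" by (intro smooth_mult smooth_const sm)
  then show "grad (\<lambda>x. \<phi> x - \<psi> x) x = grad \<phi> x - grad \<psi> x"
    using grad_add[OF sm(1) \<open>smooth (\<lambda>x. (-1) * \<psi> x)\<close>, of x] grad_cmult[OF sm(2), of "-1" x] by simp
qed

lemma test_function_midpoint:
  assumes "\<phi> \<in> test_functions \<Omega>" "\<psi> \<in> test_functions \<Omega>"
  shows "(\<lambda>x. c * (\<phi> x + \<psi> x)) \<in> test_functions \<Omega>" "grad (\<lambda>x. c * (\<phi> x + \<psi> x)) x = c *\<^sub>R (grad \<phi> x + grad \<psi> x)"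
  using assms[THEN test_function_smooth]
  by (auto intro!: test_function_cmult test_function_add assms simp: grad_cmult smooth_add grad_add)

lemma mids_test:
  assumes "f \<in> mids u N" "\<And>n. u n \<in> test_functions \<Omega>"
  shows "f \<in> test_functions \<Omega>"
  using assms(1) by (induction rule: mids.induct) (rule assms(2), rule test_function_midpoint(1))

lemma L1_tendsto_bounded_mult:
  fixes f :: "nat \<Rightarrow> 'b \<Rightarrow> real"
  assumes f: "\<And>n. integrable M (f n)" and f0: "integrable M f0"
    and lim: "(\<lambda>n. LINT x|M. \<bar>f n x - f0 x\<bar>) \<longlonglongrightarrow> 0"
    and [measurable]: "\<psi> \<in> borel_measurable M" and B: "\<And>x. \<bar>\<psi> x\<bar> \<le> B"
  shows "(\<lambda>n. LINT x|M. f n x * \<psi> x) \<longlonglongrightarrow> (LINT x|M. f0 x * \<psi> x)"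
proof -
  have I: "integrable M (\<lambda>x. h x * \<psi> x)" if "integrable M h" for h
  proof (rule Bochner_Integration.integrable_bound[of _ "\<lambda>x. B * h x"])
    show "AE x in M. norm (h x * \<psi> x) \<le> norm (B * h x)"
    proof (intro always_eventually allI)
      fix x
      have "\<bar>h x\<bar> * \<bar>\<psi> x\<bar> \<le> \<bar>h x\<bar> * \<bar>B\<bar>" using B[of x] by (intro mult_left_mono) auto
      then show "norm (h x * \<psi> x) \<le> norm (B * h x)" by (simp add: abs_mult mult.commute)
    qed
  qed (use that in auto)
  have "(\<lambda>n. (LINT x|M. f n x * \<psi> x) - (LINT x|M. f0 x * \<psi> x)) \<longlonglongrightarrow> 0"
  proof (rule Lim_null_comparison)
    show "(\<lambda>n. B * (LINT x|M. \<bar>f n x - f0 x\<bar>)) \<longlonglongrightarrow> 0"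
      using tendsto_mult_right_zero[OF lim] .
    show "\<forall>\<^sub>F n in sequentially. norm ((LINT x|M. f n x * \<psi> x) - (LINT x|M. f0 x * \<psi> x)) \<le> B * (LINT x|M. \<bar>f n x - f0 x\<bar>)"
    proof (intro always_eventually allI)
      fix n
      have "(LINT x|M. f n x * \<psi> x) - (LINT x|M. f0 x * \<psi> x) = (LINT x|M. (f n x - f0 x) * \<psi> x)"
        using I[OF f[of n]] I[OF f0] by (simp add: left_diff_distrib)
      also have "\<bar>\<dots>\<bar> \<le> (LINT x|M. \<bar>(f n x - f0 x) * \<psi> x\<bar>)" by (rule integral_abs_bound)
      also have "\<dots> \<le> (LINT x|M. B * \<bar>f n x - f0 x\<bar>)"
      proof (rule integral_mono)
        show "integrable M (\<lambda>x. \<bar>(f n x - f0 x) * \<psi> x\<bar>)"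
          using f[of n] f0 by (intro integrable_abs I) auto
        show "integrable M (\<lambda>x. B * \<bar>f n x - f0 x\<bar>)" using f[of n] f0 by auto
        fix x
        have "\<bar>f n x - f0 x\<bar> * \<bar>\<psi> x\<bar> \<le> \<bar>f n x - f0 x\<bar> * B" using B by (intro mult_left_mono) auto
        then show "\<bar>(f n x - f0 x) * \<psi> x\<bar> \<le> B * \<bar>f n x - f0 x\<bar>" by (simp add: abs_mult mult.commute)
      qed
      finally show "norm ((LINT x|M. f n x * \<psi> x) - (LINT x|M. f0 x * \<psi> x)) \<le> B * (LINT x|M. \<bar>f n x - f0 x\<bar>)"
        by simp
    qed
  qed
  then show ?thesis by (simp add: LIM_zero_iff)
qed

section \<open>Poincare inequality in norm form and limits of test functions\<close>

context variable_exponent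
begin

text \<open>The modular inequality is applied to \<phi> divided by \<mu>. For the last claim the
  constant moves inside: division by \<open>C \<ge> 1\<close> shrinks the modular at least by the
  factor \<open>1 / C\<close>, which turns the bound \<open>C\<close> into 1.\<close>

lemma poincare:
  obtains C where "1 \<le> C"
    "\<And>\<phi> \<mu>. \<phi> \<in> test_functions \<Omega> \<Longrightarrow> 0 < \<mu> \<Longrightarrow> rho (\<lambda>x. (1 / \<mu>) *\<^sub>R grad \<phi> x) \<le> 1 \<Longrightarrow>
      rho (\<lambda>x. (1 / \<mu>) *\<^sub>R \<phi> x) \<le> ennreal C"
    "\<And>\<phi> \<mu>. \<phi> \<in> test_functions \<Omega> \<Longrightarrow> 0 < \<mu> \<Longrightarrow> rho (\<lambda>x. (C / \<mu>) *\<^sub>R grad \<phi> x) \<le> 1 \<Longrightarrow>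
      rho (\<lambda>x. (1 / \<mu>) *\<^sub>R \<phi> x) \<le> 1"
proof -
  obtain C where C: "1 \<le> C"
    "\<And>\<phi>. \<phi> \<in> test_functions \<Omega> \<Longrightarrow> modular \<Omega> p (\<lambda>x. norm (grad \<phi> x)) \<le> 1 \<Longrightarrow> modular \<Omega> p \<phi> \<le> ennreal C"
    using poincare_modular[OF op bd pc] p_bounds p02 by (metis less_imp_le order_trans)
  have 1: "rho (\<lambda>x. (1 / \<mu>) *\<^sub>R \<phi> x) \<le> ennreal C"
    if \<phi>: "\<phi> \<in> test_functions \<Omega>" and \<mu>: "0 < \<mu>" and r: "rho (\<lambda>x. (1 / \<mu>) *\<^sub>R grad \<phi> x) \<le> 1" for \<phi> \<mu>
  proof -
    have "(\<lambda>x. (1 / \<mu>) * \<phi> x) \<in> test_functions \<Omega>" by (rule test_function_cmult[OF \<phi>])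
    from C(2)[OF this, unfolded modular_eq_rho rho_norm grad_cmult[OF test_function_smooth[OF \<phi>]] ] r
    show ?thesis by simp
  qed
  show ?thesis
  proof (rule that[OF C(1) 1])
    fix \<phi> and \<mu> :: real
    assume \<phi>: "\<phi> \<in> test_functions \<Omega>" and \<mu>: "0 < \<mu>" and r: "rho (\<lambda>x. (C / \<mu>) *\<^sub>R grad \<phi> x) \<le> 1"
    have [measurable]: "\<phi> \<in> borel_measurable M" by (rule test_function_rho[OF \<phi>])
    have "rho (\<lambda>x. (1 / (\<mu> / C)) *\<^sub>R \<phi> x) \<le> ennreal C"
      by (rule 1[OF \<phi>]) (use \<mu> C(1) r in auto)
    then have *: "rho (\<lambda>x. (C / \<mu>) *\<^sub>R \<phi> x) \<le> ennreal C" by simp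
    have "rho (\<lambda>x. (1 / C) *\<^sub>R ((C / \<mu>) *\<^sub>R \<phi> x)) \<le> ennreal ((1 / C) powr p0) * rho (\<lambda>x. (C / \<mu>) *\<^sub>R \<phi> x)"
      using C(1) by (intro rho_cmult_le) auto
    also have "\<dots> \<le> ennreal ((1 / C) powr 1) * ennreal C"
      using * C(1) p02 by (intro mult_mono ennreal_leI powr_mono') auto
    also have "\<dots> = 1" using C(1) by (simp add: ennreal_mult[symmetric])
    finally show "rho (\<lambda>x. (1 / \<mu>) *\<^sub>R \<phi> x) \<le> 1" using C(1) by simp
  qed auto
qed

text \<open>Lower semicontinuity of the modular under almost everywhere convergence; with it a
  Cauchy estimate passes to the limit in one of its two indices.\<close>

lemma rho_fatou:
  assumes h: "\<And>i. h i \<in> borel_measurable M" and lim: "AE x in M. (\<lambda>i. h i x) \<longlonglongrightarrow> h0 x"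
    and le: "eventually (\<lambda>i. rho (h i) \<le> c) sequentially"
  shows "rho h0 \<le> c"
proof -
  have "rho h0 = (\<integral>\<^sup>+x. liminf (\<lambda>i. ennreal (norm (h i x) powr p x)) \<partial>M)"
    unfolding rho_def
  proof (intro nn_integral_cong_AE, use lim AE_space in eventually_elim)
    case (elim x)
    have "(\<lambda>i. norm (h i x) powr p x) \<longlonglongrightarrow> norm (h0 x) powr p x"
      using elim p_pos[of x] by (intro tendsto_powr' tendsto_norm tendsto_const) auto
    then have "(\<lambda>i. ennreal (norm (h i x) powr p x)) \<longlonglongrightarrow> ennreal (norm (h0 x) powr p x)"
      by (rule tendsto_ennrealI)
    then show ?case using lim_imp_Liminf[OF trivial_limit_sequentially] by metis
  qed
  also have "\<dots> \<le> liminf (\<lambda>i. rho (h i))"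
    unfolding rho_def using h p_measurable by (intro nn_integral_liminf) simp_all
  also have "\<dots> \<le> c" using le by (intro Liminf_le) auto
  finally show ?thesis .
qed

lemma rho_tendsto_L1:
  assumes f: "\<And>n. f n \<in> borel_measurable M" and f0: "f0 \<in> borel_measurable M"
    and conv: "\<And>\<mu>. 0 < \<mu> \<Longrightarrow> \<exists>N. \<forall>n\<ge>N. rho (\<lambda>x. (1 / \<mu>) *\<^sub>R (f0 x - f n x)) \<le> 1"
    and e: "0 < e"
  shows "\<exists>N. \<forall>n\<ge>N. (\<integral>\<^sup>+x. ennreal (norm (f n x - f0 x)) \<partial>M) < ennreal e"
proof -
  obtain V where V: "emeasure M \<Omega> = ennreal V" "0 \<le> V" using emeasure_M_finite by (cases "emeasure M \<Omega>") auto
  define \<mu> where "\<mu> = e / (2 * (V + 1))"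
  have \<mu>: "0 < \<mu>" using e V by (simp add: \<mu>_def)
  have \<mu>V: "\<mu> * (V + 1) = e / 2" using V unfolding \<mu>_def by (simp add: field_simps)
  obtain N where N: "\<And>n. n \<ge> N \<Longrightarrow> rho (\<lambda>x. (1 / \<mu>) *\<^sub>R (f0 x - f n x)) \<le> 1" using conv[OF \<mu>] by blast
  show ?thesis
  proof (intro exI allI impI)
    fix n assume n: "n \<ge> N"
    have "(\<integral>\<^sup>+x. ennreal (norm (f n x - f0 x)) \<partial>M) = (\<integral>\<^sup>+x. ennreal (norm (f0 x - f n x)) \<partial>M)"
      by (simp add: norm_minus_commute)
    also have "\<dots> \<le> ennreal \<mu> * (emeasure M \<Omega> + rho (\<lambda>x. (1 / \<mu>) *\<^sub>R (f0 x - f n x)))"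
      using f[of n] f0 by (intro L1_le_rho \<mu>) measurable
    also have "\<dots> \<le> ennreal \<mu> * (ennreal V + 1)" using N[OF n] V by (intro mult_left_mono add_mono) auto
    also have "\<dots> = ennreal (\<mu> * (V + 1))" using \<mu> V(2) by (simp add: ennreal_mult ennreal_plus)
    also have "\<dots> < ennreal e" unfolding \<mu>V using e by (simp add: ennreal_less_iff)
    finally show "(\<integral>\<^sup>+x. ennreal (norm (f n x - f0 x)) \<partial>M) < ennreal e" .
  qed
qed

lemma tendsto_LINT_of_nn:
  fixes f :: "nat \<Rightarrow> 'a \<Rightarrow> real"
  assumes i: "\<And>n. integrable M (f n)" "integrable M f0"
    and lim: "\<And>e. 0 < e \<Longrightarrow> \<exists>N. \<forall>n\<ge>N. (\<integral>\<^sup>+x. ennreal (norm (f n x - f0 x)) \<partial>M) < ennreal e"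
  shows "(\<lambda>n. LINT x|M. \<bar>f n x - f0 x\<bar>) \<longlonglongrightarrow> 0"
proof (rule LIMSEQ_I)
  fix e :: real assume e: "0 < e"
  then obtain N where N: "\<And>n. n \<ge> N \<Longrightarrow> (\<integral>\<^sup>+x. ennreal (norm (f n x - f0 x)) \<partial>M) < ennreal e" using lim by blast
  have "(LINT x|M. \<bar>f n x - f0 x\<bar>) < e" if "n \<ge> N" for n
  proof -
    have "ennreal (LINT x|M. \<bar>f n x - f0 x\<bar>) = (\<integral>\<^sup>+x. ennreal (norm (f n x - f0 x)) \<partial>M)"
      using i(1)[of n] i(2) by (subst nn_integral_eq_integral) auto
    also have "\<dots> < ennreal e" using N that by blast
    finally show ?thesis by (subst (asm) ennreal_less_iff) (auto intro: integral_nonneg_AE)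
  qed
  then show "\<exists>N. \<forall>n\<ge>N. norm ((LINT x|M. \<bar>f n x - f0 x\<bar>) - 0) < e"
    by (intro exI[of _ N]) (auto simp: abs_of_nonneg integral_nonneg_AE)
qed

lemma integrable_M_imp_absolutely_integrable_on:
  fixes f :: "'a \<Rightarrow> 'b::euclidean_space"
  assumes "integrable M f" "K \<subseteq> \<Omega>" "compact K"
  shows "f absolutely_integrable_on K"
proof -
  have "f absolutely_integrable_on \<Omega>"
    using assms(1) \<Omega>_lebesgue by (simp add: set_integrable_def integrable_restrict_space)
  then show ?thesis
    by (rule set_integrable_subset) (use assms lmeasurable_compact[OF assms(3)] in \<open>auto intro: fmeasurableD\<close>)
qed

text \<open>Both sides of the defining identity are continuous under \<open>L^1\<close> convergence,
  because a test function and its derivatives are bounded.\<close>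

lemma has_weak_gradient_limit:
  assumes w: "\<And>n. w n \<in> test_functions \<Omega>"
    and u: "integrable M u" "(\<lambda>n. LINT x|M. \<bar>w n x - u x\<bar>) \<longlonglongrightarrow> 0"
    and g: "integrable M g" "\<And>e. 0 < e \<Longrightarrow> \<exists>N. \<forall>n\<ge>N. (\<integral>\<^sup>+x. ennreal (norm (grad (w n) x - g x)) \<partial>M) < ennreal e"
  shows "has_weak_gradient \<Omega> u g"
  unfolding has_weak_gradient_def
proof (intro conjI allI impI ballI)
  fix K assume "compact K \<and> K \<subseteq> \<Omega>"
  then show "u absolutely_integrable_on K" "g absolutely_integrable_on K"
    using integrable_M_imp_absolutely_integrable_on[OF u(1)] integrable_M_imp_absolutely_integrable_on[OF g(1)] by auto
next
  fix \<phi> and i :: 'a assume \<phi>: "\<phi> \<in> test_functions \<Omega>" and i: "i \<in> Basis"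
  note T = test_function_rho[OF w]
  have wi: "integrable M (w n)" "integrable M (grad (w n))" for n
    using rho_finite_integrable T by blast+
  have [measurable]: "\<phi> \<in> borel_measurable M" "grad \<phi> \<in> borel_measurable M" by (rule test_function_rho[OF \<phi>])+
  obtain B1 B2 where B: "\<And>x. \<bar>\<phi> x\<bar> \<le> B1" "\<And>x. norm (grad \<phi> x) \<le> B2"
    using test_function_bounded[OF \<phi>] test_grad_bounded[OF \<phi>] by blast
  have B2: "\<bar>grad \<phi> x \<bullet> i\<bar> \<le> B2" for x
    using Basis_le_norm[OF i, of "grad \<phi> x"] B(2)[of x] by linarith
  have 1: "(\<lambda>n. LINT x|M. w n x * (grad \<phi> x \<bullet> i)) \<longlonglongrightarrow> (LINT x|M. u x * (grad \<phi> x \<bullet> i))"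
    by (rule L1_tendsto_bounded_mult[OF wi(1) u(1) u(2) _ B2]) measurable
  have gn: "(\<lambda>n. LINT x|M. \<bar>grad (w n) x \<bullet> i - g x \<bullet> i\<bar>) \<longlonglongrightarrow> 0"
  proof (rule tendsto_LINT_of_nn)
    fix e :: real assume "0 < e"
    then obtain N where N: "\<And>n. n \<ge> N \<Longrightarrow> (\<integral>\<^sup>+x. ennreal (norm (grad (w n) x - g x)) \<partial>M) < ennreal e" using g(2) by blast
    show "\<exists>N. \<forall>n\<ge>N. (\<integral>\<^sup>+x. ennreal (norm (grad (w n) x \<bullet> i - g x \<bullet> i)) \<partial>M) < ennreal e"
    proof (intro exI allI impI)
      fix n assume "n \<ge> N"
      have "(\<integral>\<^sup>+x. ennreal (norm (grad (w n) x \<bullet> i - g x \<bullet> i)) \<partial>M) \<le> (\<integral>\<^sup>+x. ennreal (norm (grad (w n) x - g x)) \<partial>M)"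
        using Basis_le_norm[OF i] by (intro nn_integral_mono ennreal_leI) (simp add: inner_diff_left[symmetric])
      also have "\<dots> < ennreal e" using N \<open>n \<ge> N\<close> by blast
      finally show "(\<integral>\<^sup>+x. ennreal (norm (grad (w n) x \<bullet> i - g x \<bullet> i)) \<partial>M) < ennreal e" .
    qed
  qed (use wi g(1) in auto)
  have 2: "(\<lambda>n. LINT x|M. (grad (w n) x \<bullet> i) * \<phi> x) \<longlonglongrightarrow> (LINT x|M. (g x \<bullet> i) * \<phi> x)"
    by (rule L1_tendsto_bounded_mult[OF _ _ gn _ B(1)]) (use wi g(1) in auto)
  have fd: "frechet_derivative \<phi> (at x) i = grad \<phi> x \<bullet> i" for x
    by (rule frechet_derivative_eq_grad[OF test_function_smooth[OF \<phi>]])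
  have "(LINT x|M. w n x * (grad \<phi> x \<bullet> i)) = - (LINT x|M. (grad (w n) x \<bullet> i) * \<phi> x)" for n
    using bspec[OF bspec[OF conjunct2[OF has_weak_gradient_grad[OF op w[of n], unfolded has_weak_gradient_def]] \<phi>] i]
    by (simp add: fd)
  then have "(\<lambda>n. LINT x|M. w n x * (grad \<phi> x \<bullet> i)) \<longlonglongrightarrow> - (LINT x|M. (g x \<bullet> i) * \<phi> x)"
    using tendsto_minus[OF 2] by simp
  then have "(LINT x|M. u x * (grad \<phi> x \<bullet> i)) = - (LINT x|M. (g x \<bullet> i) * \<phi> x)"
    using 1 by (rule LIMSEQ_unique[rotated])
  then show "(LINT x|lebesgue_on \<Omega>. u x * frechet_derivative \<phi> (at x) i) = - (LINT x|lebesgue_on \<Omega>. g x \<bullet> i * \<phi> x)"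
    by (simp add: fd)
qed

text \<open>Completeness, for test functions whose gradients are Cauchy in norm. An almost
  everywhere limit of a subsequence provides the candidate gradient, Fatou's lemma upgrades this to
  norm convergence of the whole sequence, and Poincare's inequality transfers the Cauchy property to
  the functions themselves.\<close>

lemma W01_limit:
  assumes w: "\<And>n. w n \<in> test_functions \<Omega>"
    and cauchy: "\<And>\<mu>. 0 < \<mu> \<Longrightarrow> \<exists>N. \<forall>m\<ge>N. \<forall>n\<ge>N. rho (\<lambda>x. (1 / \<mu>) *\<^sub>R (grad (w m) x - grad (w n) x)) \<le> 1"
    and u: "integrable M u" "(\<lambda>n. LINT x|M. \<bar>w n x - u x\<bar>) \<longlonglongrightarrow> 0"
  shows "u \<in> W01 \<Omega> p"
    and "\<And>\<mu>. 0 < \<mu> \<Longrightarrow> \<exists>N. \<forall>n\<ge>N. rho (\<lambda>x. (1 / \<mu>) *\<^sub>R (wgrad \<Omega> u x - grad (w n) x)) \<le> 1"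
    and "\<And>\<mu>. 0 < \<mu> \<Longrightarrow> \<exists>N. \<forall>n\<ge>N. rho (\<lambda>x. (1 / \<mu>) *\<^sub>R (u x - w n x)) \<le> 1"
proof -
  note T = test_function_rho[OF w]
  note [measurable] = T(1,2)
  have um [measurable]: "u \<in> borel_measurable M" using u(1) by auto
  have wi: "integrable M (w n)" "integrable M (grad (w n))" for n
    using rho_finite_integrable T by blast+
  have "\<exists>N. \<forall>i\<ge>N. \<forall>j\<ge>N. (LINT x|M. norm (grad (w i) x - grad (w j) x)) < e" if e: "0 < e" for e
  proof -
    obtain V where V: "emeasure M \<Omega> = ennreal V" "0 \<le> V" using emeasure_M_finite by (cases "emeasure M \<Omega>") auto
    define \<mu> where "\<mu> = e / (2 * (V + 1))"
    have \<mu>: "0 < \<mu>" using e V by (simp add: \<mu>_def)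
    have \<mu>V: "\<mu> * (V + 1) = e / 2" using V unfolding \<mu>_def by (simp add: field_simps)
    obtain N where N: "\<And>m n. m \<ge> N \<Longrightarrow> n \<ge> N \<Longrightarrow> rho (\<lambda>x. (1 / \<mu>) *\<^sub>R (grad (w m) x - grad (w n) x)) \<le> 1"
      using cauchy[OF \<mu>] by blast
    show ?thesis
    proof (intro exI allI impI)
      fix i j assume ij: "i \<ge> N" "j \<ge> N"
      have "ennreal (LINT x|M. norm (grad (w i) x - grad (w j) x)) = (\<integral>\<^sup>+x. ennreal (norm (grad (w i) x - grad (w j) x)) \<partial>M)"
        using wi by (subst nn_integral_eq_integral) auto
      also have "\<dots> \<le> ennreal \<mu> * (emeasure M \<Omega> + rho (\<lambda>x. (1 / \<mu>) *\<^sub>R (grad (w i) x - grad (w j) x)))"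
        by (intro L1_le_rho \<mu>) measurable
      also have "\<dots> \<le> ennreal \<mu> * (ennreal V + 1)" using N[OF ij] V by (intro mult_left_mono add_mono) auto
      also have "\<dots> = ennreal (e / 2)" using \<mu> V(2) by (simp add: ennreal_mult[symmetric] ennreal_plus[symmetric] \<mu>V del: ennreal_plus flip: ennreal_1)
      finally show "(LINT x|M. norm (grad (w i) x - grad (w j) x)) < e" using e by simp
    qed
  qed
  then obtain r where r: "strict_mono r" and rc: "AE x in M. Cauchy (\<lambda>i. grad (w (r i)) x)"
    by (rule cauchy_L1_AE_cauchy_subseq[of M "\<lambda>n. grad (w n)", OF wi(2)]) blast
  define g where "g = (\<lambda>x. lim (\<lambda>i. grad (w (r i)) x))"
  have gm [measurable]: "g \<in> borel_measurable M" unfolding g_def by measurable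
  have glim: "AE x in M. (\<lambda>i. grad (w (r i)) x) \<longlonglongrightarrow> g x"
    using rc by eventually_elim (simp add: g_def Cauchy_convergent_iff convergent_LIMSEQ_iff)
  have rge: "i \<le> r i" for i using r by (rule seq_suble)
  have gconv: "\<exists>N. \<forall>n\<ge>N. rho (\<lambda>x. (1 / \<mu>) *\<^sub>R (g x - grad (w n) x)) \<le> 1" if \<mu>: "0 < \<mu>" for \<mu>
  proof -
    obtain N where N: "\<And>m n. m \<ge> N \<Longrightarrow> n \<ge> N \<Longrightarrow> rho (\<lambda>x. (1 / \<mu>) *\<^sub>R (grad (w m) x - grad (w n) x)) \<le> 1"
      using cauchy[OF \<mu>] by blast
    show ?thesis
    proof (intro exI allI impI)
      fix n assume n: "n \<ge> N"
      show "rho (\<lambda>x. (1 / \<mu>) *\<^sub>R (g x - grad (w n) x)) \<le> 1"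
      proof (rule rho_fatou)
        show "AE x in M. (\<lambda>i. (1 / \<mu>) *\<^sub>R (grad (w (r i)) x - grad (w n) x)) \<longlonglongrightarrow> (1 / \<mu>) *\<^sub>R (g x - grad (w n) x)"
          using glim by eventually_elim (intro tendsto_intros)
        show "\<forall>\<^sub>F i in sequentially. rho (\<lambda>x. (1 / \<mu>) *\<^sub>R (grad (w (r i)) x - grad (w n) x)) \<le> 1"
          using N n rge by (intro eventually_sequentiallyI[of N]) (meson order_trans)
      qed measurable
    qed
  qed
  have "\<exists>s::nat\<Rightarrow>nat. strict_mono s \<and> (AE x in M. (\<lambda>n. w (s n) x - u x) \<longlonglongrightarrow> 0)"
    by (rule tendsto_L1_AE_subseq) (use wi u in auto)
  then obtain s :: "nat \<Rightarrow> nat" where s: "strict_mono s" and s0: "AE x in M. (\<lambda>n. w (s n) x - u x) \<longlonglongrightarrow> 0" by blast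
  have slim: "AE x in M. (\<lambda>n. w (s n) x) \<longlonglongrightarrow> u x"
    using s0 by eventually_elim (simp add: LIM_zero_iff)
  have sge: "i \<le> s i" for i using s by (rule seq_suble)
  obtain C where C: "1 \<le> C" "\<And>\<phi> \<mu>. \<phi> \<in> test_functions \<Omega> \<Longrightarrow> 0 < \<mu> \<Longrightarrow> rho (\<lambda>x. (C / \<mu>) *\<^sub>R grad \<phi> x) \<le> 1 \<Longrightarrow>
      rho (\<lambda>x. (1 / \<mu>) *\<^sub>R \<phi> x) \<le> 1" using poincare by metis
  show uconv: "\<exists>N. \<forall>n\<ge>N. rho (\<lambda>x. (1 / \<mu>) *\<^sub>R (u x - w n x)) \<le> 1" if \<mu>: "0 < \<mu>" for \<mu>
  proof -
    \<comment> \<open>Cauchy at level \<open>\<mu> / C\<close> for the gradients gives level \<mu>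
      for the functions.\<close>
    have "0 < \<mu> / C" using \<mu> C(1) by simp
    then obtain N where N: "\<And>m n. m \<ge> N \<Longrightarrow> n \<ge> N \<Longrightarrow> rho (\<lambda>x. (1 / (\<mu> / C)) *\<^sub>R (grad (w m) x - grad (w n) x)) \<le> 1"
      using cauchy by blast
    show ?thesis
    proof (intro exI allI impI)
      fix n assume n: "n \<ge> N"
      show "rho (\<lambda>x. (1 / \<mu>) *\<^sub>R (u x - w n x)) \<le> 1"
      proof (rule rho_fatou)
        show "AE x in M. (\<lambda>i. (1 / \<mu>) *\<^sub>R (w (s i) x - w n x)) \<longlonglongrightarrow> (1 / \<mu>) *\<^sub>R (u x - w n x)"
          using slim by eventually_elim (intro tendsto_intros)
        have "rho (\<lambda>x. (1 / \<mu>) *\<^sub>R (w m x - w n x)) \<le> 1" if "m \<ge> N" for m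
          using C(2)[OF test_function_diff(1)[OF w[of m] w[of n]] \<mu>] N[OF that n]
          by (simp add: test_function_diff(2)[OF w[of m] w[of n]])
        then show "\<forall>\<^sub>F i in sequentially. rho (\<lambda>x. (1 / \<mu>) *\<^sub>R (w (s i) x - w n x)) \<le> 1"
          using sge by (intro eventually_sequentiallyI[of N]) (meson order_trans)
      qed measurable
    qed
  qed
  \<comment> \<open>The limit differs from some member of the sequence by a function of modular at
    most 1.\<close>
  have fin: "rho f0 < \<infinity>" if m: "f0 \<in> borel_measurable M" "\<And>n. f n \<in> borel_measurable M" "\<And>n. rho (f n) < \<infinity>"
      and c: "\<exists>N. \<forall>n\<ge>N. rho (\<lambda>x. (1 / 1) *\<^sub>R (f0 x - f n x)) \<le> 1" for f0 and f :: "nat \<Rightarrow> 'a \<Rightarrow> 'b::euclidean_space"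
  proof -
    obtain n where "rho (\<lambda>x. f0 x - f n x) \<le> 1" using c by auto
    then have "rho (\<lambda>x. f0 x - f n x) < \<infinity>" by (rule le_less_trans) simp
    then have "rho (\<lambda>x. (f0 x - f n x) + f n x) < \<infinity>"
      using m by (intro rho_add_finite) auto
    then show ?thesis by simp
  qed
  have ufin: "rho u < \<infinity>" using uconv[of 1] T by (intro fin[of u w]) auto
  have gfin: "rho g < \<infinity>" using gconv[of 1] T by (intro fin[of g "\<lambda>n. grad (w n)"]) auto
  have gi: "integrable M g" using rho_finite_integrable(1)[OF gm gfin] .
  have wg: "has_weak_gradient \<Omega> u g"
    by (rule has_weak_gradient_limit[OF w u gi]) (rule rho_tendsto_L1[OF T(2) gm gconv])
  have AE: "AE x in M. wgrad \<Omega> u x = g x" by (rule wgrad_eq[OF op wg])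
  have wm: "wgrad \<Omega> u \<in> borel_measurable M"
    by (rule has_weak_gradient_measurable(2)[OF op has_weak_gradient_wgrad[OF wg]])
  have eq: "rho (\<lambda>x. (1 / \<mu>) *\<^sub>R (wgrad \<Omega> u x - grad (w n) x)) = rho (\<lambda>x. (1 / \<mu>) *\<^sub>R (g x - grad (w n) x))" for \<mu> n
    using AE by (intro rho_cong_AE) (auto elim!: eventually_mono)
  show gc: "\<exists>N. \<forall>n\<ge>N. rho (\<lambda>x. (1 / \<mu>) *\<^sub>R (wgrad \<Omega> u x - grad (w n) x)) \<le> 1" if "0 < \<mu>" for \<mu>
    unfolding eq by (rule gconv[OF that])
  have W1: "u \<in> W1 \<Omega> p"
    unfolding W1_def Lvar_iff using ufin gfin wg rho_cong_AE[OF AE] wm by auto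
  show "u \<in> W01 \<Omega> p"
  proof (rule W01_I[OF W1])
    fix \<epsilon> :: real assume \<epsilon>: "0 < \<epsilon>"
    obtain N1 N2 where "\<forall>n\<ge>N1. rho (\<lambda>x. (1 / \<epsilon>) *\<^sub>R (u x - w n x)) \<le> 1"
      "\<forall>n\<ge>N2. rho (\<lambda>x. (1 / \<epsilon>) *\<^sub>R (wgrad \<Omega> u x - grad (w n) x)) \<le> 1"
      using uconv[OF \<epsilon>] gc[OF \<epsilon>] by blast
    then show "\<exists>\<phi>\<in>test_functions \<Omega>. rho (\<lambda>x. (1 / \<epsilon>) *\<^sub>R (u x - \<phi> x)) \<le> 1 \<and>
        rho (\<lambda>x. (1 / \<epsilon>) *\<^sub>R (wgrad \<Omega> u x - grad \<phi> x)) \<le> 1"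
      using w by (intro bexI[of _ "w (max N1 N2)"]) auto
  qed
qed

end

section \<open>Strong convergence of gradients along iterated midpoints\<close>

context variable_exponent
begin

text \<open>Let \<open>d N\<close> be the infimum of the energy over midpoints of the tail from
  \<open>N\<close>; it increases to a limit \<open>L\<close>. The midpoint of two almost minimisers
  of late tails lies again in a late tail, so its energy is not much below \<open>L\<close>, and
  Clarkson's inequality leaves almost nothing for the difference of their gradients.\<close>

lemma mids_limit:
  assumes u: "\<And>n. u n \<in> test_functions \<Omega>"
    and u0: "integrable M u0" "(\<lambda>n. LINT x|M. \<bar>u n x - u0 x\<bar>) \<longlonglongrightarrow> 0"
    and R: "\<And>n. (LINT x|M. norm (grad (u n) x) powr p x) \<le> R"
  obtains w where "\<And>N. w N \<in> mids u N" "u0 \<in> W01 \<Omega> p"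
    "\<And>\<mu>. 0 < \<mu> \<Longrightarrow> \<exists>N. \<forall>n\<ge>N. rho (\<lambda>x. (1 / \<mu>) *\<^sub>R (wgrad \<Omega> u0 x - grad (w n) x)) \<le> 1"
    "\<And>\<mu>. 0 < \<mu> \<Longrightarrow> \<exists>N. \<forall>n\<ge>N. rho (\<lambda>x. (1 / \<mu>) *\<^sub>R (u0 x - w n x)) \<le> 1"
proof -
  define J where "J = (\<lambda>f. LINT x|M. norm (grad f x) powr p x)"
  have test: "f \<in> test_functions \<Omega>" if "f \<in> mids u N" for f N
    using mids_test[OF that u] .
  have J0: "0 \<le> J f" for f unfolding J_def by (intro integral_nonneg_AE) auto
  have Ji: "integrable M (\<lambda>x. norm (grad f x) powr p x)" if "f \<in> test_functions \<Omega>" for f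
    using rho_finite_integrable(2) test_function_rho[OF that] by blast
  define d where "d = (\<lambda>N. Inf (J ` mids u N))"
  have bdd: "bdd_below (J ` mids u N)" for N using J0 by (intro bdd_belowI[of _ 0]) auto
  have ne: "J ` mids u N \<noteq> {}" for N using mids.base[of N N u] by blast
  have d_le: "d N \<le> J f" if "f \<in> mids u N" for N f
    unfolding d_def using that bdd by (intro cInf_lower) auto
  have dR: "d N \<le> R" for N
    using d_le[OF mids.base[of N N u]] R[of N] unfolding J_def by linarith
  have dmono: "incseq d"
  proof (rule incseq_SucI)
    fix N
    show "d N \<le> d (Suc N)"
      unfolding d_def using mids_antimono[of N "Suc N" u] by (intro cInf_superset_mono ne bdd image_mono) auto
  qed
  obtain L where L: "d \<longlonglongrightarrow> L" using incseq_convergent[OF dmono, of R] dR by blast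
  have "\<exists>f\<in>mids u N. J f < d N + 1 / real (Suc N)" for N
  proof -
    have "Inf (J ` mids u N) < d N + 1 / real (Suc N)" by (simp add: d_def)
    from cInf_lessD[OF ne this] show ?thesis by blast
  qed
  then obtain w where w: "\<And>N. w N \<in> mids u N" and wJ: "\<And>N. J (w N) < d N + 1 / real (Suc N)" by metis
  have wt: "w N \<in> test_functions \<Omega>" for N using test[OF w] .
  note T = test_function_rho[OF wt]
  note [measurable] = T(1,2)
  have half: "rho (\<lambda>x. (1 / 2) *\<^sub>R (grad (w m) x - grad (w n) x)) \<le> ennreal ((L - d (min m n)) + 1 / real (Suc (min m n)))" for m n
  proof -
    have mids: "w m \<in> mids u (min m n)" "w n \<in> mids u (min m n)"
      using w[of m] w[of n] mids_antimono[of "min m n" m u] mids_antimono[of "min m n" n u] by auto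
    define f where "f = (\<lambda>x. (1 / 2) * (w m x + w n x))"
    have fm: "f \<in> mids u (min m n)" unfolding f_def using mids by (rule mids.mid)
    have gf: "grad f x = (1 / 2) *\<^sub>R (grad (w m) x + grad (w n) x)" for x
      unfolding f_def by (rule test_function_midpoint(2)[OF wt wt])
    have ft: "f \<in> test_functions \<Omega>" using test[OF fm] .
    let ?h = "\<lambda>x. norm ((1 / 2) *\<^sub>R (grad (w m) x - grad (w n) x)) powr p x"
    have hf: "rho (\<lambda>x. (1 / 2) *\<^sub>R (grad (w m) x - grad (w n) x)) < \<infinity>"
      by (intro rho_cmult_finite rho_diff_finite T borel_measurable_diff)
    have hi: "integrable M ?h"
      using rho_finite_integrable(2)[OF _ hf] by simp
    have "J f + (LINT x|M. ?h x) = (LINT x|M. norm (grad f x) powr p x + ?h x)"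
      unfolding J_def using Ji[OF ft] hi by (rule Bochner_Integration.integral_add[symmetric])
    also have "\<dots> \<le> (LINT x|M. (norm (grad (w m) x) powr p x + norm (grad (w n) x) powr p x) / 2)"
    proof (rule integral_mono)
      show "integrable M (\<lambda>x. norm (grad f x) powr p x + ?h x)"
        using Ji[OF ft] hi by (rule Bochner_Integration.integrable_add)
      show "integrable M (\<lambda>x. (norm (grad (w m) x) powr p x + norm (grad (w n) x) powr p x) / 2)"
        using Ji[OF wt] Ji[OF wt] by auto
      fix x assume "x \<in> space M"
      then show "norm (grad f x) powr p x + ?h x \<le> (norm (grad (w m) x) powr p x + norm (grad (w n) x) powr p x) / 2"
        unfolding gf using p_pos[of x] by (intro clarkson) auto
    qed
    also have "\<dots> = (J (w m) + J (w n)) / 2"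
      unfolding J_def using Ji[OF wt] by simp
    finally have "(LINT x|M. ?h x) \<le> (J (w m) + J (w n)) / 2 - d (min m n)"
      using d_le[OF fm] by linarith
    moreover have "J (w k) \<le> L + 1 / real (Suc (min m n))" if "min m n \<le> k" for k
    proof -
      have "J (w k) \<le> d k + 1 / real (Suc k)" using wJ[of k] by linarith
      moreover have "d k \<le> L" by (rule incseq_le[OF dmono L])
      moreover have "1 / real (Suc k) \<le> 1 / real (Suc (min m n))" using that by (intro divide_left_mono) auto
      ultimately show ?thesis by linarith
    qed
    from this[of m] this[of n] have "(J (w m) + J (w n)) / 2 \<le> L + 1 / real (Suc (min m n))" by (simp add: field_simps)
    ultimately have "(LINT x|M. ?h x) \<le> (L - d (min m n)) + 1 / real (Suc (min m n))" by linarith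
    moreover have "rho (\<lambda>x. (1 / 2) *\<^sub>R (grad (w m) x - grad (w n) x)) = ennreal (LINT x|M. ?h x)"
      unfolding rho_def using hi by (intro nn_integral_eq_integral) auto
    ultimately show ?thesis by (simp add: ennreal_leI)
  qed
  have cauchy: "\<exists>N. \<forall>m\<ge>N. \<forall>n\<ge>N. rho (\<lambda>x. (1 / \<mu>) *\<^sub>R (grad (w m) x - grad (w n) x)) \<le> 1" if \<mu>: "0 < \<mu>" for \<mu>
  proof -
    \<comment> \<open>\<open>k / 2 \<ge> 1 / \<mu>\<close> trades the factor \<open>1 / 2\<close> of
      Clarkson's inequality for the required \<open>1 / \<mu>\<close>, at the cost of the constant
      \<open>k powr P\<close>.\<close>
    define k where "k = max 1 (2 / \<mu>)"
    have k1: "1 \<le> k" by (simp add: k_def)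
    have "(\<lambda>N. (L - d N) + 1 / real (Suc N)) \<longlonglongrightarrow> (L - L) + 0"
      by (intro tendsto_intros L lim_1_over_n[THEN LIMSEQ_Suc])
    then have lim0: "(\<lambda>N. (L - d N) + 1 / real (Suc N)) \<longlonglongrightarrow> 0" by simp
    have "0 < 1 / k powr P" using k1 by simp
    from LIMSEQ_D[OF lim0 this] obtain N where
      N: "\<And>n. n \<ge> N \<Longrightarrow> (L - d n) + 1 / real (Suc n) < 1 / k powr P"
      by (auto simp: abs_less_iff)
    show ?thesis
    proof (intro exI allI impI)
      fix m n assume mn: "m \<ge> N" "n \<ge> N"
      have "rho (\<lambda>x. (1 / \<mu>) *\<^sub>R (grad (w m) x - grad (w n) x)) \<le> rho (\<lambda>x. k *\<^sub>R ((1 / 2) *\<^sub>R (grad (w m) x - grad (w n) x)))"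
      proof (intro rho_mono always_eventually allI)
        fix x
        have "1 / \<mu> \<le> k * (1 / 2)" by (simp add: k_def)
        then have "1 / \<mu> * norm (grad (w m) x - grad (w n) x) \<le> k * (1 / 2) * norm (grad (w m) x - grad (w n) x)"
          by (intro mult_right_mono) auto
        then show "norm ((1 / \<mu>) *\<^sub>R (grad (w m) x - grad (w n) x)) \<le> norm (k *\<^sub>R ((1 / 2) *\<^sub>R (grad (w m) x - grad (w n) x)))"
          using \<mu> k1 by simp
      qed
      also have "\<dots> \<le> ennreal (k powr P) * rho (\<lambda>x. (1 / 2) *\<^sub>R (grad (w m) x - grad (w n) x))"
        by (rule rho_cmult_ge[OF _ k1]) measurable
      also have "\<dots> \<le> ennreal (k powr P) * ennreal ((L - d (min m n)) + 1 / real (Suc (min m n)))"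
        by (intro mult_left_mono half) auto
      also have "\<dots> \<le> ennreal (k powr P) * ennreal (1 / k powr P)"
        using N[of "min m n"] mn by (intro mult_left_mono ennreal_leI) auto
      also have "\<dots> = 1" using k1 by (simp add: ennreal_mult[symmetric])
      finally show "rho (\<lambda>x. (1 / \<mu>) *\<^sub>R (grad (w m) x - grad (w n) x)) \<le> 1" .
    qed
  qed
  have L1: "(\<lambda>N. LINT x|M. \<bar>w N x - u0 x\<bar>) \<longlonglongrightarrow> 0"
  proof (rule LIMSEQ_I)
    fix e :: real assume e: "0 < e"
    from LIMSEQ_D[OF u0(2), of "e / 2"] e obtain N where N: "\<And>n. n \<ge> N \<Longrightarrow> (LINT x|M. \<bar>u n x - u0 x\<bar>) < e / 2"
      by (auto simp: abs_less_iff)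
    have ti: "integrable M f" if "f \<in> test_functions \<Omega>" for f
      using rho_finite_integrable(1) test_function_rho[OF that] by blast
    \<comment> \<open>Midpoints stay in an \<open>L^1\<close> ball around \<open>u0\<close> because
      balls are convex.\<close>
    have m: "(LINT x|M. \<bar>f x - u0 x\<bar>) \<le> e / 2" if "f \<in> mids u N" for f
      using that
    proof (induction rule: mids.induct)
      case (base n)
      then show ?case using N[of n] by simp
    next
      case (mid f g)
      have fg: "integrable M f" "integrable M g" using mid test ti by blast+
      have "(LINT x|M. \<bar>(1 / 2) * (f x + g x) - u0 x\<bar>) \<le> (LINT x|M. (1 / 2) * \<bar>f x - u0 x\<bar> + (1 / 2) * \<bar>g x - u0 x\<bar>)"
      proof (rule integral_mono)
        show "integrable M (\<lambda>x. \<bar>(1 / 2) * (f x + g x) - u0 x\<bar>)"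
          "integrable M (\<lambda>x. (1 / 2) * \<bar>f x - u0 x\<bar> + (1 / 2) * \<bar>g x - u0 x\<bar>)"
          using fg u0(1) by auto
      qed (simp add: abs_if field_simps)
      also have "\<dots> = (1 / 2) * (LINT x|M. \<bar>f x - u0 x\<bar>) + (1 / 2) * (LINT x|M. \<bar>g x - u0 x\<bar>)"
        using fg u0(1) by simp
      also have "\<dots> \<le> e / 2" using mid.IH by simp
      finally show ?case .
    qed
    have "norm ((LINT x|M. \<bar>w n x - u0 x\<bar>) - 0) < e" if "n \<ge> N" for n
    proof -
      have "w n \<in> mids u N" using w[of n] mids_antimono[OF that, of u] by blast
      from m[OF this] e show ?thesis by (simp add: abs_of_nonneg integral_nonneg_AE)
    qed
    then show "\<exists>N. \<forall>n\<ge>N. norm ((LINT x|M. \<bar>w n x - u0 x\<bar>) - 0) < e" by blast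
  qed
  show ?thesis
    by (rule that[OF w]) (rule W01_limit[OF wt cauchy u0(1) L1]; assumption)+
qed

section \<open>Caratheodory functions and superposition operators\<close>

text \<open>Completeness of Lebesgue measure; it accommodates the exceptional null sets in the
  Caratheodory conditions.\<close>

lemma measurable_M_AE:
  fixes f g :: "'a \<Rightarrow> 'b::euclidean_space"
  assumes f: "f \<in> borel_measurable M" and AE: "AE x in M. f x = g x"
  shows "g \<in> borel_measurable M"
proof -
  have "(\<lambda>x. indicator \<Omega> x *\<^sub>R f x) \<in> borel_measurable lebesgue"
    using f \<Omega>_lebesgue by (subst (asm) borel_measurable_restrict_space_iff) auto
  moreover have "AE x in lebesgue. indicator \<Omega> x *\<^sub>R f x = indicator \<Omega> x *\<^sub>R g x"
    using AE \<Omega>_lebesgue by (subst (asm) AE_restrict_space_iff) (auto elim!: eventually_mono simp: indicator_def)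
  ultimately have "(\<lambda>x. indicator \<Omega> x *\<^sub>R g x) \<in> borel_measurable lebesgue"
    by (rule borel_measurable_AE)
  then show ?thesis using \<Omega>_lebesgue by (subst borel_measurable_restrict_space_iff) auto
qed

text \<open>For a simple \<open>g\<close> the composition is patched from countably many measurable
  functions; continuity in the second argument carries measurability to limits of simple functions.
  On the exceptional null set the value 0 is substituted, so that convergence holds at every
  point.\<close>

lemma caratheodory_measurable:
  fixes A :: "'a \<Rightarrow> 'b::euclidean_space \<Rightarrow> 'c::euclidean_space"
  assumes meas: "\<And>\<xi>. (\<lambda>x. A x \<xi>) \<in> borel_measurable M" and cont: "AE x in M. continuous_on UNIV (A x)"
    and g: "g \<in> borel_measurable M"
  shows "(\<lambda>x. A x (g x)) \<in> borel_measurable M"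
proof -
  obtain s where s: "\<And>i. simple_function M (s i)" and slim: "\<And>x. x \<in> space M \<Longrightarrow> (\<lambda>i. s i x) \<longlonglongrightarrow> g x"
    using borel_measurable_implies_sequence_metric[OF g, of 0] by blast
  have sm: "(\<lambda>x. A x (s i x)) \<in> borel_measurable M" for i
  proof (rule measurable_compose_countable'[where I="s i ` space M" and f="\<lambda>\<xi> x. A x \<xi>"])
    show "countable (s i ` space M)" using simple_functionD(1)[OF s] by (rule countable_finite)
    show "s i \<in> measurable M (count_space (s i ` space M))"
      using simple_functionD(2)[OF s] by (intro measurableI) auto
  qed (rule meas)
  obtain N where N: "N \<in> null_sets M" "{x \<in> space M. \<not> continuous_on UNIV (A x)} \<subseteq> N"
    using cont by (auto simp: eventually_ae_filter)
  have Nm [measurable]: "N \<in> sets M" using N(1) by auto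
  have "(\<lambda>x. if x \<in> N then 0 else A x (g x)) \<in> borel_measurable M"
  proof (rule borel_measurable_LIMSEQ_metric)
    show "(\<lambda>x. if x \<in> N then 0 else A x (s i x)) \<in> borel_measurable M" for i
      using sm[of i] by measurable
    fix x assume x: "x \<in> space M"
    show "(\<lambda>i. if x \<in> N then 0 else A x (s i x)) \<longlonglongrightarrow> (if x \<in> N then 0 else A x (g x))"
    proof (cases "x \<in> N")
      case False
      then have "continuous_on UNIV (A x)" using N(2) x by blast
      then have "isCont (A x) (g x)" by (simp add: continuous_on_eq_continuous_at)
      from isCont_tendsto_compose[OF this slim[OF x]] False show ?thesis by simp
    qed simp
  qed
  moreover have "AE x in M. (if x \<in> N then 0 else A x (g x)) = A x (g x)"
    using AE_not_in[OF N(1)] by eventually_elim simp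
  ultimately show ?thesis by (rule measurable_M_AE)
qed

lemma rho'_add_le:
  assumes [measurable]: "g \<in> borel_measurable M" "h \<in> borel_measurable M"
  shows "rho' (\<lambda>x. g x + h x) \<le> ennreal 2 * (rho' g + rho' h)"
proof -
  have "rho' (\<lambda>x. g x + h x) \<le>
      (\<integral>\<^sup>+x. ennreal 2 * (ennreal (norm (g x) powr conj_exp p x) + ennreal (norm (h x) powr conj_exp p x)) \<partial>M)"
    unfolding rho'_def
  proof (intro nn_integral_mono)
    fix x assume "x \<in> space M"
    then have q: "1 \<le> conj_exp p x" "conj_exp p x \<le> 2" using conj_exp_bounds by auto
    have "norm (g x + h x) powr conj_exp p x \<le>
        2 powr (conj_exp p x - 1) * (norm (g x) powr conj_exp p x + norm (h x) powr conj_exp p x)"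
      using q by (intro norm_add_powr_le) auto
    also have "\<dots> \<le> 2 powr 1 * (norm (g x) powr conj_exp p x + norm (h x) powr conj_exp p x)"
      using q by (intro mult_right_mono powr_mono) auto
    finally have "ennreal (norm (g x + h x) powr conj_exp p x) \<le>
        ennreal (2 * (norm (g x) powr conj_exp p x + norm (h x) powr conj_exp p x))"
      by (intro ennreal_leI) simp
    then show "ennreal (norm (g x + h x) powr conj_exp p x) \<le>
        ennreal 2 * (ennreal (norm (g x) powr conj_exp p x) + ennreal (norm (h x) powr conj_exp p x))"
      by (simp add: ennreal_mult ennreal_plus)
  qed
  then show ?thesis by (simp add: nn_integral_cmult nn_integral_add rho'_def)
qed

lemma rho'_cmult_finite:
  assumes [measurable]: "g \<in> borel_measurable M" and g: "rho' (g :: 'a \<Rightarrow> real) < \<infinity>"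
  shows "rho' (\<lambda>x. c * g x) < \<infinity>"
proof -
  have "rho' (\<lambda>x. c * g x) \<le> (\<integral>\<^sup>+x. ennreal ((max 1 \<bar>c\<bar>)\<^sup>2) * ennreal (norm (g x) powr conj_exp p x) \<partial>M)"
    unfolding rho'_def
  proof (intro nn_integral_mono)
    fix x assume "x \<in> space M"
    then have q: "1 \<le> conj_exp p x" "conj_exp p x \<le> 2" using conj_exp_bounds by auto
    have "\<bar>c\<bar> powr conj_exp p x \<le> max 1 \<bar>c\<bar> powr conj_exp p x" using q by (intro powr_mono2) auto
    also have "\<dots> \<le> max 1 \<bar>c\<bar> powr 2" using q by (intro powr_mono) auto
    also have "\<dots> = (max 1 \<bar>c\<bar>)\<^sup>2" by (subst powr_numeral) auto
    finally have "norm (c * g x) powr conj_exp p x \<le> (max 1 \<bar>c\<bar>)\<^sup>2 * norm (g x) powr conj_exp p x"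
      by (simp add: abs_mult powr_mult mult_right_mono)
    then show "ennreal (norm (c * g x) powr conj_exp p x) \<le> ennreal ((max 1 \<bar>c\<bar>)\<^sup>2) * ennreal (norm (g x) powr conj_exp p x)"
      by (simp add: ennreal_mult[symmetric] ennreal_leI)
  qed
  also have "\<dots> = ennreal ((max 1 \<bar>c\<bar>)\<^sup>2) * rho' g" by (simp add: nn_integral_cmult rho'_def)
  also have "\<dots> < \<infinity>" using g by (simp add: ennreal_mult_less_top)
  finally show ?thesis .
qed

lemma rho'_const_finite: "rho' (\<lambda>x. c :: real) < \<infinity>"
proof -
  have "rho' (\<lambda>x. 1 :: real) < \<infinity>" using emeasure_M_finite by (simp add: rho'_def)
  then show ?thesis using rho'_cmult_finite[of "\<lambda>x. 1" c] by simp
qed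

lemma rho'_affine_finite:
  assumes "k \<in> borel_measurable M" "rho' (k :: 'a \<Rightarrow> real) < \<infinity>"
  shows "rho' (\<lambda>x. c * k x + d) < \<infinity>"
proof -
  have "rho' (\<lambda>x. c * k x + d) \<le> ennreal 2 * (rho' (\<lambda>x. c * k x) + rho' (\<lambda>x. d))"
    using assms by (intro rho'_add_le) auto
  also have "\<dots> < \<infinity>" using rho'_cmult_finite[OF assms] rho'_const_finite by (simp add: ennreal_mult_less_top)
  finally show ?thesis .
qed

text \<open>Caratheodory functions of the growth for which \<open>u \<mapsto> A (\<cdot>, u)\<close> maps the space with exponent
  \<open>p\<close> to its dual.\<close>

definition nemytskii :: "('a \<Rightarrow> 'b::euclidean_space \<Rightarrow> 'c::euclidean_space) \<Rightarrow> bool" where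
  "nemytskii A \<longleftrightarrow> (\<forall>\<xi>. (\<lambda>x. A x \<xi>) \<in> borel_measurable M) \<and> (AE x in M. continuous_on UNIV (A x)) \<and>
    (\<exists>B c. B \<in> borel_measurable M \<and> rho' (B :: 'a \<Rightarrow> real) < \<infinity> \<and> 0 \<le> c \<and>
      (AE x in M. \<forall>\<xi>. norm (A x \<xi>) \<le> B x + c * norm \<xi> powr (p x - 1)))"

lemma nemytskii_measurable:
  "nemytskii A \<Longrightarrow> g \<in> borel_measurable M \<Longrightarrow> (\<lambda>x. A x (g x)) \<in> borel_measurable M"
  by (rule caratheodory_measurable) (auto simp: nemytskii_def)

text \<open>The growth exponent is adapted to duality:
  \<open>(p x - 1) * conj_exp p x = p x\<close>. The square in \<open>k\<close> is enough because
  the conjugate exponent is at most 2.\<close>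

lemma nemytskii_bound:
  assumes "nemytskii A"
  obtains C where "0 \<le> C"
    "\<And>g R. g \<in> borel_measurable M \<Longrightarrow> 0 \<le> R \<Longrightarrow> rho g \<le> ennreal R \<Longrightarrow> rho' (\<lambda>x. A x (g x)) \<le> ennreal (C * (1 + R))"
proof -
  obtain B c where B [measurable]: "B \<in> borel_measurable M" and Bf: "rho' (B :: 'a \<Rightarrow> real) < \<infinity>" and c: "0 \<le> c"
    and gr: "AE x in M. \<forall>\<xi>. norm (A x \<xi>) \<le> B x + c * norm \<xi> powr (p x - 1)"
    using assms unfolding nemytskii_def by blast
  obtain b where b: "rho' B = ennreal b" "0 \<le> b" using Bf by (cases "rho' B") auto
  define k where "k = (max 1 c)\<^sup>2"
  have k1: "1 \<le> k" by (simp add: k_def one_le_power)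
  show ?thesis
  proof (rule that[of "2 * (b + k)"])
    show "0 \<le> 2 * (b + k)" using b k1 by simp
    fix g :: "'a \<Rightarrow> 'b" and R :: real
    assume g [measurable]: "g \<in> borel_measurable M" and R: "0 \<le> R" "rho g \<le> ennreal R"
    let ?h = "\<lambda>x. c * norm (g x) powr (p x - 1)"
    have "rho' (\<lambda>x. A x (g x)) \<le> rho' (\<lambda>x. \<bar>B x\<bar> + ?h x)"
      unfolding rho'_def
    proof (intro nn_integral_mono_AE, use gr AE_space in eventually_elim)
      case (elim x)
      then have q: "1 \<le> conj_exp p x" using conj_exp_bounds by auto
      have "norm (A x (g x)) \<le> B x + c * norm (g x) powr (p x - 1)" using elim by blast
      also have "\<dots> \<le> norm (\<bar>B x\<bar> + ?h x)" by simp
      finally show ?case using q by (intro ennreal_leI powr_mono2) auto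
    qed
    also have "\<dots> \<le> ennreal 2 * (rho' (\<lambda>x. \<bar>B x\<bar>) + rho' ?h)" by (rule rho'_add_le) measurable
    also have "\<dots> \<le> ennreal 2 * (ennreal b + ennreal k * ennreal R)"
    proof (intro mult_left_mono add_mono)
      show "rho' (\<lambda>x. \<bar>B x\<bar>) \<le> ennreal b" using b by (simp add: rho'_def)
      have "rho' ?h \<le> (\<integral>\<^sup>+x. ennreal k * ennreal (norm (g x) powr p x) \<partial>M)"
        unfolding rho'_def
      proof (intro nn_integral_mono)
        fix x assume x: "x \<in> space M"
        then have q: "1 \<le> conj_exp p x" "conj_exp p x \<le> 2" using conj_exp_bounds by auto
        have e: "(p x - 1) * conj_exp p x = p x" using p_pos[of x] x by (simp add: conj_exp_def)
        have "norm (?h x) powr conj_exp p x = c powr conj_exp p x * (norm (g x) powr (p x - 1)) powr conj_exp p x"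
          using c by (simp add: powr_mult)
        also have "\<dots> = c powr conj_exp p x * norm (g x) powr p x" by (simp only: powr_powr e)
        also have "\<dots> \<le> k * norm (g x) powr p x"
        proof (intro mult_right_mono)
          have "c powr conj_exp p x \<le> max 1 c powr conj_exp p x" using c q by (intro powr_mono2) auto
          also have "\<dots> \<le> max 1 c powr 2" using q by (intro powr_mono) auto
          also have "\<dots> = k" unfolding k_def by (subst powr_numeral) auto
          finally show "c powr conj_exp p x \<le> k" .
        qed auto
        finally have "ennreal (norm (?h x) powr conj_exp p x) \<le> ennreal (k * norm (g x) powr p x)" by (rule ennreal_leI)
        then show "ennreal (norm (?h x) powr conj_exp p x) \<le> ennreal k * ennreal (norm (g x) powr p x)"
          using k1 by (simp add: ennreal_mult)
      qed
      also have "\<dots> = ennreal k * rho g" by (simp add: nn_integral_cmult rho_def)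
      also have "\<dots> \<le> ennreal k * ennreal R" using R by (intro mult_left_mono) auto
      finally show "rho' ?h \<le> ennreal k * ennreal R" .
    qed auto
    also have "\<dots> = ennreal (2 * (b + k * R))"
      using b k1 R by (simp add: ennreal_mult ennreal_plus)
    also have "\<dots> \<le> ennreal (2 * (b + k) * (1 + R))"
    proof (rule ennreal_leI)
      have "0 \<le> b * R + k" using b k1 R by simp
      then show "2 * (b + k * R) \<le> 2 * (b + k) * (1 + R)" by (simp add: algebra_simps)
    qed
    finally show "rho' (\<lambda>x. A x (g x)) \<le> ennreal (2 * (b + k) * (1 + R))" .
  qed
qed

lemma nemytskii_rho'_finite:
  assumes "nemytskii A" "g \<in> borel_measurable M" "rho g < \<infinity>"
  shows "rho' (\<lambda>x. A x (g x)) < \<infinity>"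
proof -
  obtain R where "rho g = ennreal R" "0 \<le> R" using assms(3) by (cases "rho g") auto
  moreover obtain C where "\<And>g R. g \<in> borel_measurable M \<Longrightarrow> 0 \<le> R \<Longrightarrow> rho g \<le> ennreal R \<Longrightarrow>
      rho' (\<lambda>x. A x (g x)) \<le> ennreal (C * (1 + R))"
    using nemytskii_bound[OF assms(1)] by metis
  ultimately have "rho' (\<lambda>x. A x (g x)) \<le> ennreal (C * (1 + R))" using assms(2) by simp
  then show ?thesis by (rule le_less_trans) simp
qed

text \<open>The first argument converges only almost everywhere, with bounded modular, and the
  second converges in norm. With \<open>W0\<close> fixed, Young's inequality with a small factor on
  the bounded term yields the growth condition of the Vitali type theorem; the difference of
  \<open>W n\<close> and \<open>W0\<close> is left to \<open>pairing_bound\<close>.\<close>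

lemma nemytskii_tendsto:
  fixes A :: "'a \<Rightarrow> 'b::euclidean_space \<Rightarrow> 'c::euclidean_space"
  assumes A: "nemytskii A" and g [measurable]: "\<And>n. g n \<in> borel_measurable M" "g0 \<in> borel_measurable M"
    and lim: "AE x in M. (\<lambda>n. g n x) \<longlonglongrightarrow> g0 x"
    and R: "\<And>n. rho (g n) \<le> ennreal R" "0 \<le> R"
    and W [measurable]: "\<And>n. W n \<in> borel_measurable M" "W0 \<in> borel_measurable M" and Wf: "rho W0 < \<infinity>"
    and Wlim: "\<And>\<mu>. 0 < \<mu> \<Longrightarrow> \<exists>N. \<forall>n\<ge>N. rho (\<lambda>x. (1 / \<mu>) *\<^sub>R (W0 x - W n x)) \<le> 1"
  shows "(\<lambda>n. LINT x|M. A x (g n x) \<bullet> W n x) \<longlonglongrightarrow> (LINT x|M. A x (g0 x) \<bullet> W0 x)"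
proof -
  have Am [measurable]: "(\<lambda>x. A x (g n x)) \<in> borel_measurable M" "(\<lambda>x. A x (g0 x)) \<in> borel_measurable M" for n
    by (rule nemytskii_measurable[OF A]; measurable)+
  obtain C' where C': "0 \<le> C'" "\<And>g R. g \<in> borel_measurable M \<Longrightarrow> 0 \<le> R \<Longrightarrow> rho g \<le> ennreal R \<Longrightarrow>
      rho' (\<lambda>x. A x (g x)) \<le> ennreal (C' * (1 + R))"
    using nemytskii_bound[OF A] by blast
  define C where "C = C' * (1 + R)"
  have C0: "0 \<le> C" using C' R by (simp add: C_def)
  have AC: "rho' (\<lambda>x. A x (g n x)) \<le> ennreal C" for n
    unfolding C_def using C' R by simp
  have Afin: "rho' (\<lambda>x. A x (g n x)) < \<infinity>" for n using AC[of n] by (rule le_less_trans) simp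
  have cont: "AE x in M. continuous_on UNIV (A x)" using A by (simp add: nemytskii_def)
  let ?U = "\<lambda>n x. norm (A x (g n x)) powr conj_exp p x"
  have Ui: "integrable M (?U n)" for n
    using Afin[of n] by (intro integrableI_nonneg) (auto simp: rho'_def)
  have UC: "(LINT x|M. ?U n x) \<le> C" for n
  proof -
    have "ennreal (LINT x|M. ?U n x) = rho' (\<lambda>x. A x (g n x))"
      unfolding rho'_def using Ui by (intro nn_integral_eq_integral[symmetric]) auto
    also have "\<dots> \<le> ennreal C" by (rule AC)
    finally show ?thesis using C0 by simp
  qed
  have 1: "(\<lambda>n. LINT x|M. A x (g n x) \<bullet> W0 x) \<longlonglongrightarrow> (LINT x|M. A x (g0 x) \<bullet> W0 x)"
  proof (rule integral_tendsto_small_growth(3)[where U="?U" and C=C])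
    show "AE x in M. (\<lambda>n. A x (g n x) \<bullet> W0 x) \<longlonglongrightarrow> A x (g0 x) \<bullet> W0 x"
      using lim cont
    proof eventually_elim
      case (elim x)
      then have "isCont (A x) (g0 x)" by (simp add: continuous_on_eq_continuous_at)
      from isCont_tendsto_compose[OF this elim(1)] show ?case by (intro tendsto_intros)
    qed
    fix e :: real assume e: "0 < e" "e \<le> 1"
    show "\<exists>H. integrable M H \<and> (\<forall>n. AE x in M. \<bar>A x (g n x) \<bullet> W0 x\<bar> \<le> e * ?U n x + H x)"
    proof (intro exI conjI allI)
      show "integrable M (\<lambda>x. (1 / e) powr P * norm (W0 x) powr p x)"
        using rho_finite_integrable(2)[OF W(2) Wf] by simp
      fix n
      show "AE x in M. \<bar>A x (g n x) \<bullet> W0 x\<bar> \<le> e * ?U n x + (1 / e) powr P * norm (W0 x) powr p x"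
      proof (use AE_space in eventually_elim)
        case (elim x)
        have "\<bar>A x (g n x) \<bullet> W0 x\<bar> \<le> norm (A x (g n x)) * norm (W0 x)" by (rule Cauchy_Schwarz_ineq2)
        also have "\<dots> \<le> e * norm (A x (g n x)) powr (p x / (p x - 1)) + (1 / e) powr P * norm (W0 x) powr p x"
          using p_pos[of x] elim e by (intro mult_le_small_powr(2)) auto
        finally show ?case by (simp add: conj_exp_def)
      qed
    qed
  qed (use Ui UC in auto)
  have 2: "(\<lambda>n. LINT x|M. A x (g n x) \<bullet> (W n x - W0 x)) \<longlonglongrightarrow> 0"
  proof (rule LIMSEQ_I)
    fix e :: real assume e: "0 < e"
    define \<mu> where "\<mu> = e / (2 * (C + 1))"
    have \<mu>: "0 < \<mu>" using e C0 by (simp add: \<mu>_def)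
    have \<mu>C: "\<mu> * (C + 1) = e / 2" using C0 by (simp add: \<mu>_def field_simps)
    obtain N where N: "\<And>n. n \<ge> N \<Longrightarrow> rho (\<lambda>x. (1 / \<mu>) *\<^sub>R (W0 x - W n x)) \<le> 1" using Wlim[OF \<mu>] by blast
    have "norm ((LINT x|M. A x (g n x) \<bullet> (W n x - W0 x)) - 0) < e" if "n \<ge> N" for n
    proof -
      have "rho (\<lambda>x. (1 / \<mu>) *\<^sub>R (W n x - W0 x)) = rho (\<lambda>x. (1 / \<mu>) *\<^sub>R (W0 x - W n x))"
        by (simp add: rho_def norm_minus_commute)
      also have "\<dots> \<le> 1" using N[OF that] .
      finally have "\<bar>LINT x|M. A x (g n x) \<bullet> (W n x - W0 x)\<bar> \<le> \<mu> * (C + 1)"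
        by (intro pairing_bound(2) AC \<mu> C0) measurable
      then show ?thesis using e by (simp add: \<mu>C)
    qed
    then show "\<exists>N. \<forall>n\<ge>N. norm ((LINT x|M. A x (g n x) \<bullet> (W n x - W0 x)) - 0) < e" by blast
  qed
  \<comment> \<open>The integral may be split only when the difference of \<open>W n\<close> and
    \<open>W0\<close> has finite modular, which is known from some index on.\<close>
  obtain N where N: "\<And>n. n \<ge> N \<Longrightarrow> rho (\<lambda>x. (1 / 1) *\<^sub>R (W0 x - W n x)) \<le> 1" using Wlim[of 1] by auto
  have eq: "(LINT x|M. A x (g n x) \<bullet> W n x) = (LINT x|M. A x (g n x) \<bullet> W0 x) + (LINT x|M. A x (g n x) \<bullet> (W n x - W0 x))"
    if "n \<ge> N" for n
  proof -
    have "rho (\<lambda>x. W n x - W0 x) = rho (\<lambda>x. W0 x - W n x)" by (simp add: rho_def norm_minus_commute)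
    also have "\<dots> < \<infinity>" by (rule le_less_trans[OF N[OF that, simplified]]) simp
    finally have f: "rho (\<lambda>x. W n x - W0 x) < \<infinity>" .
    have "integrable M (\<lambda>x. A x (g n x) \<bullet> W0 x)" by (intro pairing_integrable(1) Afin Wf) measurable
    moreover have "integrable M (\<lambda>x. A x (g n x) \<bullet> (W n x - W0 x))" by (intro pairing_integrable(1) Afin f) measurable
    ultimately show ?thesis
      by (subst Bochner_Integration.integral_add[symmetric]) (auto simp: inner_diff_right)
  qed
  have "(\<lambda>n. (LINT x|M. A x (g n x) \<bullet> W0 x) + (LINT x|M. A x (g n x) \<bullet> (W n x - W0 x))) \<longlonglongrightarrow> (LINT x|M. A x (g0 x) \<bullet> W0 x)"
    using tendsto_add[OF 1 2] by simp
  then show ?thesis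
    by (rule Lim_transform_eventually) (use eq in \<open>auto simp: eventually_sequentially intro!: exI[of _ N]\<close>)
qed

end

subsection \<open>The Galerkin approximation\<close>

context variable_exponent
begin

text \<open>A power with exponent at most \<open>p0 - 1\<close> is bounded by 1 plus the power with
  exponent \<open>p x - 1\<close>; the surplus constant joins the free term.\<close>

lemma nemytskii_subcritical:
  fixes F :: "'a \<Rightarrow> real \<Rightarrow> real"
  assumes F_meas: "\<And>\<eta>. (\<lambda>x. F x \<eta>) \<in> borel_measurable M"
    and F_cont: "AE x in M. continuous_on UNIV (F x)"
    and F_growth: "AE x in M. \<forall>\<eta>. \<bar>F x \<eta>\<bar> \<le> K x + C * \<bar>\<eta>\<bar> powr (s - 1)"
    and K: "K \<in> borel_measurable M" "rho' (K :: 'a \<Rightarrow> real) < \<infinity>" and C: "0 \<le> C" and s: "1 \<le> s" "s \<le> p0"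
  shows "nemytskii F"
  unfolding nemytskii_def
proof (intro conjI allI F_meas F_cont exI)
  note K(1)[measurable]
  show "(\<lambda>x. \<bar>K x\<bar> + C) \<in> borel_measurable M" by measurable
  have "rho' (\<lambda>x. \<bar>K x\<bar> + C) \<le> ennreal 2 * (rho' (\<lambda>x. \<bar>K x\<bar>) + rho' (\<lambda>x. C))"
    by (intro rho'_add_le) measurable
  also have "\<dots> < \<infinity>" using K(2) rho'_const_finite[of C] by (simp add: ennreal_mult_less_top rho'_def)
  finally show "rho' (\<lambda>x. \<bar>K x\<bar> + C) < \<infinity>" .
  show "AE x in M. \<forall>\<xi>. norm (F x \<xi>) \<le> \<bar>K x\<bar> + C + C * norm \<xi> powr (p x - 1)"
    using F_growth AE_space
  proof eventually_elim
    case (elim x)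
    show ?case
    proof
      fix \<xi>
      have "\<bar>\<xi>\<bar> powr (s - 1) \<le> 1 + \<bar>\<xi>\<bar> powr (p x - 1)"
        using s p_pos[of x] elim by (intro powr_le_one_plus_powr) auto
      then have "C * \<bar>\<xi>\<bar> powr (s - 1) \<le> C * (1 + \<bar>\<xi>\<bar> powr (p x - 1))" using C by (rule mult_left_mono)
      moreover have "\<bar>F x \<xi>\<bar> \<le> K x + C * \<bar>\<xi>\<bar> powr (s - 1)" using elim by blast
      ultimately have "\<bar>F x \<xi>\<bar> \<le> \<bar>K x\<bar> + C * (1 + \<bar>\<xi>\<bar> powr (p x - 1))" by linarith
      then show "norm (F x \<xi>) \<le> \<bar>K x\<bar> + C + C * norm \<xi> powr (p x - 1)" by (simp add: algebra_simps)
    qed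
  qed
qed (rule C)

end

text \<open>\<open>F\<close> collects all lower order terms, the nonlinearity and the \<lambda>
  term, under one constant growth exponent \<open>s\<close> strictly below \<open>p0\<close>. This
  gap is the source both of the energy bound and of the convergence of the lower order term.\<close>

locale leray_lions = variable_exponent \<Omega> p p0 P
  for \<Omega> :: "'a::euclidean_space set" and p :: "'a \<Rightarrow> real" and p0 P :: real +
  fixes a :: "'a \<Rightarrow> 'a \<Rightarrow> 'a" and F :: "'a \<Rightarrow> real \<Rightarrow> real" and K :: "'a \<Rightarrow> real" and s C c' :: real
  assumes a_nem: "nemytskii a"
    and a_mono: "AE x in M. \<forall>\<xi> \<xi>'. 0 \<le> (a x \<xi> - a x \<xi>') \<bullet> (\<xi> - \<xi>')"
    and a_coer: "AE x in M. \<forall>\<xi>. c' * norm \<xi> powr p x \<le> a x \<xi> \<bullet> \<xi>" and c': "0 < c'"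
    and F_meas: "\<And>\<eta>. (\<lambda>x. F x \<eta>) \<in> borel_measurable M"
    and F_cont: "AE x in M. continuous_on UNIV (F x)"
    and F_growth: "AE x in M. \<forall>\<eta>. \<bar>F x \<eta>\<bar> \<le> K x + C * \<bar>\<eta>\<bar> powr (s - 1)"
    and K: "K \<in> borel_measurable M" "rho' K < \<infinity>" and C: "0 \<le> C" and s: "2 \<le> s" "s < p0"
begin

lemma F_nem: "nemytskii F"
  by (rule nemytskii_subcritical[OF F_meas F_cont F_growth K C]) (use s in auto)

lemma p_powr_integrable:
  assumes "g \<in> borel_measurable M" "rho g < \<infinity>" "rho g \<le> ennreal R" "0 \<le> R"
  shows "(LINT x|M. norm (g x) powr p x) \<le> R"
proof -
  have "ennreal (LINT x|M. norm (g x) powr p x) = rho g"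
    unfolding rho_def using rho_finite_integrable(2)[OF assms(1,2)]
    by (intro nn_integral_eq_integral[symmetric]) auto
  then show ?thesis using assms(3,4) by (metis ennreal_le_iff)
qed

lemma K_integrable: "integrable M (\<lambda>x. \<bar>K x\<bar> powr conj_exp p x)"
  using K by (intro integrableI_nonneg) (auto simp: rho'_def)

text \<open>Both factors converge only almost everywhere. As \<open>s < p0\<close>, arbitrarily
  small multiples of the integrands of the two modulars dominate the product up to a fixed
  integrable function, which is what the Vitali type theorem asks for.\<close>

lemma F_tendsto:
  assumes u [measurable]: "\<And>n. u n \<in> borel_measurable M" "u0 \<in> borel_measurable M"
    and v [measurable]: "\<And>n. v n \<in> borel_measurable M" "v0 \<in> borel_measurable M"
    and ulim: "AE x in M. (\<lambda>n. u n x) \<longlonglongrightarrow> u0 x" and vlim: "AE x in M. (\<lambda>n. v n x) \<longlonglongrightarrow> v0 x"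
    and R: "\<And>n. rho (u n) \<le> ennreal R" "\<And>n. rho (v n) \<le> ennreal R" "0 \<le> R"
  shows "(\<lambda>n. LINT x|M. F x (u n x) * v n x) \<longlonglongrightarrow> (LINT x|M. F x (u0 x) * v0 x)"
proof -
  have Fm [measurable]: "(\<lambda>x. F x (u n x)) \<in> borel_measurable M" "(\<lambda>x. F x (u0 x)) \<in> borel_measurable M" for n
    by (rule nemytskii_measurable[OF F_nem]; measurable)+
  have uf: "rho (u n) < \<infinity>" "rho (v n) < \<infinity>" for n
    using R(1,2)[of n] by (auto intro: le_less_trans)
  let ?U = "\<lambda>n x. norm (u n x) powr p x + norm (v n x) powr p x"
  have I: "integrable M (\<lambda>x. norm (u n x) powr p x)" "integrable M (\<lambda>x. norm (v n x) powr p x)" for n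
    by (intro rho_finite_integrable(2) u v uf)+
  have UC: "(LINT x|M. ?U n x) \<le> 2 * R" for n
    using I[of n] p_powr_integrable[OF u(1) uf(1) R(1,3), of n] p_powr_integrable[OF v(1) uf(2) R(2,3), of n] by simp
  show ?thesis
  proof (rule integral_tendsto_small_growth(3)[where U="?U" and C="2 * R"])
    show "AE x in M. (\<lambda>n. F x (u n x) * v n x) \<longlonglongrightarrow> F x (u0 x) * v0 x"
      using ulim vlim F_cont
    proof eventually_elim
      case (elim x)
      then have "isCont (F x) (u0 x)" by (simp add: continuous_on_eq_continuous_at)
      from isCont_tendsto_compose[OF this elim(1)] elim(2) show ?case by (rule tendsto_mult)
    qed
    fix e :: real assume e: "0 < e" "e \<le> 1"
    \<comment> \<open>Makes \<open>d + C * d\<close>, the largest coefficient collected in front of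
      the powers below, equal to \<open>e / 2\<close>.\<close>
    define d where "d = e / (2 * (C + 1))"
    have d: "0 < d" "d \<le> 1" "d \<le> e / 2" "C * d \<le> e / 2"
    proof -
      have d': "d * (C + 1) = e / 2" using C by (simp add: d_def field_simps)
      show d0: "0 < d" using e C by (simp add: d_def)
      have Cd: "0 \<le> C * d" using C d0 by simp
      show "C * d \<le> e / 2" "d \<le> e / 2" using d' d0 Cd unfolding distrib_left mult.commute[of d C] mult_1_right by linarith+
      then show "d \<le> 1" using e by linarith
    qed
    define H where "H = (\<lambda>x. (1 / d)\<^sup>2 * \<bar>K x\<bar> powr conj_exp p x + C * (2 * (1 / d) powr (s / (p0 - s))))"
    show "\<exists>H. integrable M H \<and> (\<forall>n. AE x in M. \<bar>F x (u n x) * v n x\<bar> \<le> e * ?U n x + H x)"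
    proof (intro exI[of _ H] conjI allI)
      show "integrable M H" unfolding H_def using K_integrable by auto
      fix n
      show "AE x in M. \<bar>F x (u n x) * v n x\<bar> \<le> e * ?U n x + H x"
        using F_growth AE_space
      proof eventually_elim
        case (elim x)
        then have px: "2 < p x" "p0 \<le> p x" "p x \<le> P" using p_pos by auto
        define \<alpha> \<beta> where "\<alpha> = \<bar>u n x\<bar>" and "\<beta> = \<bar>v n x\<bar>"
        have ab: "0 \<le> \<alpha>" "0 \<le> \<beta>" by (auto simp: \<alpha>_def \<beta>_def)
        have "\<bar>F x (u n x)\<bar> \<le> \<bar>K x\<bar> + C * \<alpha> powr (s - 1)" using elim(1) unfolding \<alpha>_def by (smt (verit))
        then have "\<bar>F x (u n x) * v n x\<bar> \<le> (\<bar>K x\<bar> + C * \<alpha> powr (s - 1)) * \<beta>"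
          unfolding abs_mult \<beta>_def by (rule mult_right_mono) simp
        also have "\<dots> = \<bar>K x\<bar> * \<beta> + C * (\<alpha> powr (s - 1) * \<beta>)" by (simp add: algebra_simps)
        also have "\<dots> \<le> (d * \<beta> powr p x + (1 / d)\<^sup>2 * \<bar>K x\<bar> powr conj_exp p x) +
            C * ((d * \<alpha> powr p x + (1 / d) powr (s / (p0 - s))) + (d * \<beta> powr p x + (1 / d) powr (s / (p0 - s))))"
        proof (intro add_mono mult_left_mono C)
          show "\<bar>K x\<bar> * \<beta> \<le> d * \<beta> powr p x + (1 / d)\<^sup>2 * \<bar>K x\<bar> powr conj_exp p x"
            unfolding conj_exp_def using px d ab by (intro mult_le_small_powr(1)[where P=P]) auto
          have "\<alpha> powr (s - 1) * \<beta> \<le> \<alpha> powr s + \<beta> powr s"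
          proof -
            define m where "m = max \<alpha> \<beta>"
            have "\<alpha> powr (s - 1) * \<beta> \<le> m powr (s - 1) * m"
              using ab s by (intro mult_mono powr_mono2) (auto simp: m_def)
            also have "\<dots> = m powr s" using ab by (simp add: powr_mult_base mult.commute m_def)
            also have "\<dots> \<le> \<alpha> powr s + \<beta> powr s" by (auto simp: m_def max_def)
            finally show ?thesis .
          qed
          also have "\<dots> \<le> (d * \<alpha> powr p x + (1 / d) powr (s / (p0 - s))) + (d * \<beta> powr p x + (1 / d) powr (s / (p0 - s)))"
            using ab s px d by (intro add_mono powr_le_small_powr) auto
          finally show "\<alpha> powr (s - 1) * \<beta> \<le> (d * \<alpha> powr p x + (1 / d) powr (s / (p0 - s))) + (d * \<beta> powr p x + (1 / d) powr (s / (p0 - s)))" .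
        qed
        also have "\<dots> = (C * d) * \<alpha> powr p x + (d + C * d) * \<beta> powr p x + H x"
          by (simp add: H_def algebra_simps)
        also have "\<dots> \<le> e * \<alpha> powr p x + e * \<beta> powr p x + H x"
          using d e by (intro add_mono mult_right_mono) auto
        finally show ?case by (simp add: \<alpha>_def \<beta>_def algebra_simps)
      qed
    qed
  qed (use I UC in auto)
qed

abbreviation "J f \<equiv> (LINT x|M. norm (grad f x) powr p x)"

lemma test_rho_grad:
  assumes f: "f \<in> test_functions \<Omega>"
  shows "rho (grad f) = ennreal (J f)"
  unfolding rho_def
  by (rule nn_integral_eq_integral[OF rho_finite_integrable(2)[OF test_function_rho(2,4)[OF f]]]) auto

lemma J_nonneg: "0 \<le> J f"
  by (intro integral_nonneg_AE) auto

text \<open>Division by \<open>m \<ge> 1\<close> shrinks the modular at least by the factor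
  \<open>m powr (- p0)\<close>, since \<open>p\<close> is never below \<open>p0\<close>.\<close>

lemma test_scale:
  assumes f: "f \<in> test_functions \<Omega>" and m: "1 \<le> m" "J f \<le> m powr p0"
  shows "rho (\<lambda>x. (1 / m) *\<^sub>R grad f x) \<le> 1"
proof -
  have "rho (\<lambda>x. (1 / m) *\<^sub>R grad f x) \<le> ennreal ((1 / m) powr p0) * rho (grad f)"
    using m by (intro rho_cmult_le test_function_rho[OF f]) auto
  also have "\<dots> = ennreal ((1 / m) powr p0 * J f)"
    by (simp add: test_rho_grad[OF f] ennreal_mult J_nonneg)
  also have "\<dots> \<le> ennreal 1"
  proof (rule ennreal_leI)
    have "(1 / m) powr p0 * J f \<le> (1 / m) powr p0 * m powr p0" using m by (intro mult_left_mono) auto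
    also have "\<dots> = 1" using m by (simp add: powr_divide)
    finally show "(1 / m) powr p0 * J f \<le> 1" .
  qed
  finally show ?thesis by simp
qed

text \<open>The gradient is normalised with \<open>test_scale\<close>, Poincare's inequality is
  applied, and the scaling is undone at the cost of \<open>m powr P\<close>.\<close>

lemma test_rho_bound:
  obtains R' where "0 \<le> R'" "\<And>f. f \<in> test_functions \<Omega> \<Longrightarrow> J f \<le> R \<Longrightarrow> rho f \<le> ennreal R'"
proof -
  obtain C1 where C1: "1 \<le> C1" "\<And>\<phi> \<mu>. \<phi> \<in> test_functions \<Omega> \<Longrightarrow> 0 < \<mu> \<Longrightarrow>
      rho (\<lambda>x. (1 / \<mu>) *\<^sub>R grad \<phi> x) \<le> 1 \<Longrightarrow> rho (\<lambda>x. (1 / \<mu>) *\<^sub>R \<phi> x) \<le> ennreal C1"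
    using poincare by metis
  define m where "m = max 1 R"
  have m: "1 \<le> m" "R \<le> m powr p0"
  proof -
    show "1 \<le> m" by (simp add: m_def)
    then have "m powr 1 \<le> m powr p0" using p02 by (intro powr_mono) auto
    then show "R \<le> m powr p0" by (simp add: m_def)
  qed
  show ?thesis
  proof (rule that[of "m powr P * C1"])
    show "0 \<le> m powr P * C1" using C1 by simp
    fix f assume f: "f \<in> test_functions \<Omega>" and J: "J f \<le> R"
    have 1: "rho (\<lambda>x. (1 / m) *\<^sub>R f x) \<le> ennreal C1"
      using m J by (intro C1(2) f test_scale) auto
    have [measurable]: "f \<in> borel_measurable M" by (rule test_function_rho[OF f])
    have "rho (\<lambda>x. m *\<^sub>R ((1 / m) *\<^sub>R f x)) \<le> ennreal (m powr P) * rho (\<lambda>x. (1 / m) *\<^sub>R f x)"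
      by (rule rho_cmult_ge[OF _ m(1)]) measurable
    also have "\<dots> \<le> ennreal (m powr P) * ennreal C1" using 1 by (intro mult_left_mono) auto
    also have "\<dots> = ennreal (m powr P * C1)" using C1 by (simp add: ennreal_mult)
    finally show "rho f \<le> ennreal (m powr P * C1)" using m by simp
  qed
qed

lemma F_pairing_integrable:
  assumes "u \<in> borel_measurable M" "rho u < \<infinity>" "v \<in> borel_measurable M" "rho v < \<infinity>"
  shows "integrable M (\<lambda>x. F x (u x) * v x)"
  using pairing_integrable(1)[OF nemytskii_measurable[OF F_nem assms(1)] assms(3)
      nemytskii_rho'_finite[OF F_nem assms(1,2)] assms(4)] by simp

lemma a_pairing_integrable:
  assumes "g \<in> borel_measurable M" "rho g < \<infinity>" "h \<in> borel_measurable M" "rho h < \<infinity>"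
  shows "integrable M (\<lambda>x. a x (g x) \<bullet> h x)"
  using pairing_integrable(1)[OF nemytskii_measurable[OF a_nem assms(1)] assms(3)
      nemytskii_rho'_finite[OF a_nem assms(1,2)] assms(4)] .

text \<open>After scaling \<open>f\<close> to \<open>y = f / m\<close>, with \<open>m\<close> of
  size \<open>J f powr (1 / p0)\<close>, Poincare's inequality bounds the modular of
  \<open>y\<close> by a constant. The pairing with \<open>F\<close> then grows like
  \<open>m powr s\<close>, that is, like \<open>J f\<close> to the power \<open>s / p0 < 1\<close>,
  and half of the coercivity constant absorbs it.\<close>

lemma energy_bound:
  obtains C3 where "0 \<le> C3" "\<And>f. f \<in> test_functions \<Omega> \<Longrightarrow>
    c' / 2 * J f - C3 \<le> (LINT x|M. a x (grad f x) \<bullet> grad f x) - (LINT x|M. F x (f x) * f x)"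
proof -
  obtain C1 where C1: "1 \<le> C1" "\<And>\<phi> \<mu>. \<phi> \<in> test_functions \<Omega> \<Longrightarrow> 0 < \<mu> \<Longrightarrow>
      rho (\<lambda>x. (1 / \<mu>) *\<^sub>R grad \<phi> x) \<le> 1 \<Longrightarrow> rho (\<lambda>x. (1 / \<mu>) *\<^sub>R \<phi> x) \<le> ennreal C1"
    using poincare by metis
  define k where "k = (LINT x|M. \<bar>K x\<bar> powr conj_exp p x)"
  define V where "V = measure M \<Omega>"
  \<comment> \<open>Bound for the integral of the scaled majorant. Then \<delta> is chosen with
    \<open>B * \<delta> \<le> c' / 2\<close>, and \<open>q\<close> is the additive constant that
    this choice costs.\<close>
  define B where "B = k + C * V + (1 + C) * C1"
  have k0: "0 \<le> k" unfolding k_def by (intro integral_nonneg_AE) auto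
  have V0: "0 \<le> V" by (simp add: V_def)
  have B0: "0 \<le> B" unfolding B_def using k0 V0 C C1 by simp
  define \<delta> where "\<delta> = min 1 (c' / (2 * (B + 1)))"
  have \<delta>: "0 < \<delta>" "\<delta> \<le> 1" using c' B0 by (auto simp: \<delta>_def)
  have B\<delta>: "B * \<delta> \<le> c' / 2"
  proof -
    have "B * \<delta> \<le> (B + 1) * (c' / (2 * (B + 1)))" using B0 c' \<delta> by (intro mult_mono) (auto simp: \<delta>_def)
    also have "\<dots> = c' / 2" using B0 by (simp add: field_simps)
    finally show ?thesis .
  qed
  define \<theta> where "\<theta> = s / p0"
  have \<theta>: "0 < \<theta>" "\<theta> < 1" using s by (auto simp: \<theta>_def)
  define q where "q = (1 / \<delta>) powr (\<theta> / (1 - \<theta>))"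
  have q0: "0 \<le> q" by (simp add: q_def)
  show ?thesis
  proof (rule that[of "B * (1 + q)"])
    show "0 \<le> B * (1 + q)" using B0 q0 by simp
    fix f assume f: "f \<in> test_functions \<Omega>"
    note T = test_function_rho[OF f]
    define X where "X = J f"
    have X0: "0 \<le> X" unfolding X_def by (rule J_nonneg)
    \<comment> \<open>The maximum with 1 keeps the scaling estimates valid for small
      energies.\<close>
    define m where "m = max 1 (X powr (1 / p0))"
    have m1: "1 \<le> m" by (simp add: m_def)
    have "X = (X powr (1 / p0)) powr p0" using X0 p02 by (simp add: powr_powr)
    also have "\<dots> \<le> m powr p0" using p02 by (intro powr_mono2) (auto simp: m_def)
    finally have Xm: "X \<le> m powr p0" .
    define y where "y = (\<lambda>x. (1 / m) *\<^sub>R f x)"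
    have ym: "y \<in> borel_measurable M" unfolding y_def using T by measurable
    have yr: "rho y \<le> ennreal C1"
      unfolding y_def using m1 Xm by (intro C1(2) f test_scale) (auto simp: X_def)
    have yf: "rho y < \<infinity>" using yr by (rule le_less_trans) simp
    have ms: "m powr s \<le> 1 + X powr \<theta>"
    proof (cases "X powr (1 / p0) \<le> 1")
      case True
      then show ?thesis by (simp add: m_def max_def)
    next
      case False
      then have "m powr s = X powr \<theta>" by (simp add: m_def max_def powr_powr \<theta>_def)
      then show ?thesis by simp
    qed
    have "(LINT x|M. F x (f x) * f x) \<le> (LINT x|M. m powr s * (\<bar>K x\<bar> powr conj_exp p x + C + (1 + C) * norm (y x) powr p x))"
    proof (rule integral_mono_AE)
      show "integrable M (\<lambda>x. F x (f x) * f x)" by (intro F_pairing_integrable T)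
      show "integrable M (\<lambda>x. m powr s * (\<bar>K x\<bar> powr conj_exp p x + C + (1 + C) * norm (y x) powr p x))"
        using K_integrable rho_finite_integrable(2)[OF ym yf] by auto
      show "AE x in M. F x (f x) * f x \<le> m powr s * (\<bar>K x\<bar> powr conj_exp p x + C + (1 + C) * norm (y x) powr p x)"
        using F_growth AE_space
      proof eventually_elim
        case (elim x)
        then have px: "2 < p x" "p0 \<le> p x" using p_pos by auto
        define \<beta> where "\<beta> = \<bar>y x\<bar>"
        have b0: "0 \<le> \<beta>" by (simp add: \<beta>_def)
        have fb: "\<bar>f x\<bar> = m * \<beta>" using m1 by (simp add: \<beta>_def y_def)
        have "F x (f x) * f x \<le> \<bar>F x (f x)\<bar> * \<bar>f x\<bar>" by (simp add: abs_mult[symmetric])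
        also have "\<dots> \<le> (\<bar>K x\<bar> + C * \<bar>f x\<bar> powr (s - 1)) * \<bar>f x\<bar>"
          using elim(1)[rule_format, of "f x"] by (intro mult_right_mono) auto
        also have "\<dots> = \<bar>K x\<bar> * \<bar>f x\<bar> + C * \<bar>f x\<bar> powr s"
          by (simp add: distrib_right powr_mult_base mult.assoc mult.commute[of "\<bar>f x\<bar> powr (s - 1)"])
        also have "\<dots> = m * (\<bar>K x\<bar> * \<beta>) + m powr s * (C * \<beta> powr s)"
          unfolding fb using m1 b0 by (simp add: powr_mult algebra_simps)
        also have "\<dots> \<le> m powr s * (\<bar>K x\<bar> powr conj_exp p x + \<beta> powr p x) + m powr s * (C * (1 + \<beta> powr p x))"
        proof (intro add_mono mult_mono mult_left_mono C)
          show "m \<le> m powr s" using m1 s powr_mono[of 1 s m] by simp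
          show "\<bar>K x\<bar> * \<beta> \<le> \<bar>K x\<bar> powr conj_exp p x + \<beta> powr p x"
            unfolding conj_exp_def using px b0 by (intro mult_le_powr_add_powr) auto
          show "\<beta> powr s \<le> 1 + \<beta> powr p x" using px b0 s by (intro powr_le_one_plus_powr) auto
        qed (use b0 m1 C in auto)
        finally show ?case by (simp add: \<beta>_def algebra_simps)
      qed
    qed
    also have "\<dots> = m powr s * (k + C * V + (1 + C) * (LINT x|M. norm (y x) powr p x))"
      using K_integrable rho_finite_integrable(2)[OF ym yf] by (simp add: k_def V_def)
    also have "\<dots> \<le> m powr s * B"
      unfolding B_def using p_powr_integrable[OF ym yf yr] C1 C by (intro mult_left_mono add_mono) auto
    also have "\<dots> \<le> (1 + X powr \<theta>) * B" using ms B0 by (intro mult_right_mono) auto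
    also have "\<dots> \<le> (1 + (\<delta> * X + q)) * B"
    proof (intro mult_right_mono add_left_mono B0)
      show "X powr \<theta> \<le> \<delta> * X + q"
        using powr_le_small_powr[of X \<theta> 1 1 \<delta>] X0 \<theta> \<delta> by (simp add: q_def)
    qed
    also have "\<dots> = (B * \<delta>) * X + B * (1 + q)" by (simp add: algebra_simps)
    also have "\<dots> \<le> c' / 2 * X + B * (1 + q)" using B\<delta> X0 by (intro add_right_mono mult_right_mono)
    finally have Fb: "(LINT x|M. F x (f x) * f x) \<le> c' / 2 * X + B * (1 + q)" .
    have "c' * X = (LINT x|M. c' * norm (grad f x) powr p x)" by (simp add: X_def)
    also have "\<dots> \<le> (LINT x|M. a x (grad f x) \<bullet> grad f x)"
    proof (rule integral_mono_AE)
      show "integrable M (\<lambda>x. c' * norm (grad f x) powr p x)" using rho_finite_integrable(2)[OF T(2,4)] by simp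
      show "integrable M (\<lambda>x. a x (grad f x) \<bullet> grad f x)" by (intro a_pairing_integrable T)
      show "AE x in M. c' * norm (grad f x) powr p x \<le> a x (grad f x) \<bullet> grad f x"
        using a_coer by eventually_elim blast
    qed
    finally show "c' / 2 * J f - B * (1 + q) \<le> (LINT x|M. a x (grad f x) \<bullet> grad f x) - (LINT x|M. F x (f x) * f x)"
      using Fb unfolding X_def by simp
  qed
qed

text \<open>The regularising term \<open>\<kappa> * c i\<close> keeps the finite dimensional map coercive when the \<open>D i\<close> are
  linearly dependent.\<close>

lemma galerkin:
  fixes D :: "nat \<Rightarrow> 'a \<Rightarrow> real"
  assumes D: "\<And>m. D m \<in> test_functions \<Omega>" and \<kappa>: "0 < \<kappa>" and C3: "0 \<le> C3" "\<And>f. f \<in> test_functions \<Omega> \<Longrightarrow>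
    c' / 2 * J f - C3 \<le> (LINT x|M. a x (grad f x) \<bullet> grad f x) - (LINT x|M. F x (f x) * f x)"
  obtains u where "u \<in> test_functions \<Omega>" "J u \<le> 2 * C3 / c'"
    "\<And>m. m < n \<Longrightarrow> - sqrt (\<kappa> * C3) \<le>
      (LINT x|M. a x (grad u x) \<bullet> (grad (D m) x - grad u x)) - (LINT x|M. F x (u x) * (D m x - u x))"
proof -
  define U where "U = (\<lambda>c x. \<Sum>j<n. c j * D j x)"
  have U: "U c \<in> test_functions \<Omega>" "grad (U c) x = (\<Sum>j<n. c j *\<^sub>R grad (D j) x)" for c x
  proof -
    have "U c \<in> test_functions \<Omega> \<and> (\<forall>x. grad (U c) x = (\<Sum>j<n. c j *\<^sub>R grad (D j) x))"
      unfolding U_def using D by (intro test_function_sum) auto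
    then show "U c \<in> test_functions \<Omega>" "grad (U c) x = (\<Sum>j<n. c j *\<^sub>R grad (D j) x)" by auto
  qed
  note TD = test_function_rho[OF D] and TU = test_function_rho[OF U(1)]
  note [measurable] = TD(1,2) TU(1,2)
  \<comment> \<open>The residual of the equation tested with \<open>D i\<close>. Its pairing with
    the coefficient vector is the energy expression of \<open>U c\<close> plus \<kappa> times the
    sum of squares.\<close>
  define E where "E = (\<lambda>c i. (LINT x|M. a x (grad (U c) x) \<bullet> grad (D i) x) - (LINT x|M. F x (U c x) * D i x) + \<kappa> * c i)"
  have pair: "(\<Sum>i<n. c i * E c i) = (LINT x|M. a x (grad (U c) x) \<bullet> grad (U c) x) - (LINT x|M. F x (U c x) * U c x) + \<kappa> * (\<Sum>i<n. (c i)\<^sup>2)" for c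
  proof -
    have ai: "integrable M (\<lambda>x. a x (grad (U c) x) \<bullet> grad (D i) x)" for i by (intro a_pairing_integrable TU TD)
    have Fi: "integrable M (\<lambda>x. F x (U c x) * D i x)" for i by (intro F_pairing_integrable TU TD)
    have 1: "(LINT x|M. a x (grad (U c) x) \<bullet> grad (U c) x) = (\<Sum>i<n. c i * (LINT x|M. a x (grad (U c) x) \<bullet> grad (D i) x))"
    proof -
      have "(LINT x|M. a x (grad (U c) x) \<bullet> grad (U c) x) = (LINT x|M. (\<Sum>i<n. c i * (a x (grad (U c) x) \<bullet> grad (D i) x)))"
        by (intro Bochner_Integration.integral_cong refl) (simp add: U(2)[of c] inner_sum_right)
      also have "\<dots> = (\<Sum>i<n. c i * (LINT x|M. a x (grad (U c) x) \<bullet> grad (D i) x))"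
        using ai by (subst Bochner_Integration.integral_sum) auto
      finally show ?thesis .
    qed
    have 2: "(LINT x|M. F x (U c x) * U c x) = (\<Sum>i<n. c i * (LINT x|M. F x (U c x) * D i x))"
    proof -
      have "(LINT x|M. F x (U c x) * U c x) = (LINT x|M. (\<Sum>i<n. c i * (F x (U c x) * D i x)))"
        by (intro Bochner_Integration.integral_cong refl) (simp add: U_def sum_distrib_left mult.left_commute)
      also have "\<dots> = (\<Sum>i<n. c i * (LINT x|M. F x (U c x) * D i x))"
        using Fi by (subst Bochner_Integration.integral_sum) auto
      finally show ?thesis .
    qed
    show ?thesis
      unfolding 1 2 E_def
      by (simp add: distrib_left right_diff_distrib sum.distrib sum_subtractf sum_distrib_left power2_eq_square mult.left_commute)
  qed
  \<comment> \<open>Bounded coefficients give uniform bounds for the functions and their gradients,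
    so \<open>nemytskii_tendsto\<close> applies with a fixed second argument.\<close>
  have cont: "(\<lambda>k. E (cs k) i) \<longlonglongrightarrow> E c i" if i: "i < n" and lim: "\<And>j. j < n \<Longrightarrow> (\<lambda>k. cs k j) \<longlonglongrightarrow> c j" for c cs i
  proof -
    have "\<exists>b. \<forall>j<n. \<forall>k. \<bar>cs k j\<bar> \<le> b"
    proof -
      have "\<exists>b. \<forall>k. \<bar>cs k j\<bar> \<le> b" if "j < n" for j
        using convergent_imp_Bseq[OF convergentI[OF lim[OF that]]] by (auto simp: Bseq_def)
      then obtain b where b: "\<And>j k. j < n \<Longrightarrow> \<bar>cs k j\<bar> \<le> b j" by metis
      have "\<bar>cs k j\<bar> \<le> (\<Sum>j<n. \<bar>b j\<bar>)" if "j < n" for j k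
        using b[OF that, of k] member_le_sum[of j "{..<n}" "\<lambda>j. \<bar>b j\<bar>"] that by force
      then show ?thesis by blast
    qed
    then obtain b where b: "\<And>j k. j < n \<Longrightarrow> \<bar>cs k j\<bar> \<le> b" by blast
    obtain B1 where B1: "\<And>j x. \<bar>D j x\<bar> \<le> B1 j" using test_function_bounded[OF D] by metis
    obtain B2 where B2: "\<And>j x. norm (grad (D j) x) \<le> B2 j" using test_grad_bounded[OF D] by metis
    have gb: "norm (grad (U (cs k)) x) \<le> (\<Sum>j<n. b * B2 j)" for k x
      unfolding U(2) by (rule order_trans[OF norm_sum sum_mono]) (auto intro!: mult_mono b B2 order_trans[OF abs_ge_zero b])
    have ub: "norm (U (cs k) x) \<le> (\<Sum>j<n. b * B1 j)" for k x
      unfolding U_def by (rule order_trans[OF norm_sum sum_mono]) (auto simp: abs_mult intro!: mult_mono b B1 order_trans[OF abs_ge_zero b])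
    obtain Rg where Rg: "\<And>k. rho (grad (U (cs k))) \<le> ennreal Rg" "0 \<le> Rg"
    proof -
      have "rho (grad (U (cs k))) \<le> rho (\<lambda>x. (\<Sum>j<n. b * B2 j))" for k
        using gb by (intro rho_mono always_eventually allI) (simp add: order_trans[OF _ abs_ge_self])
      moreover have "rho (\<lambda>x. (\<Sum>j<n. b * B2 j)) < \<infinity>" by (rule rho_bounded_finite) (rule order_refl)
      ultimately show ?thesis using that by (metis ennreal_cases infinity_ennreal_def less_irrefl)
    qed
    obtain Ru where Ru: "\<And>k. rho (U (cs k)) \<le> ennreal Ru" "0 \<le> Ru"
    proof -
      have "rho (U (cs k)) \<le> rho (\<lambda>x. (\<Sum>j<n. b * B1 j))" for k
        using ub by (intro rho_mono always_eventually allI) (simp add: order_trans[OF _ abs_ge_self])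
      moreover have "rho (\<lambda>x. (\<Sum>j<n. b * B1 j)) < \<infinity>" by (rule rho_bounded_finite) (rule order_refl)
      ultimately show ?thesis using that by (metis ennreal_cases infinity_ennreal_def less_irrefl)
    qed
    have z: "rho (\<lambda>x. (1 / \<mu>) *\<^sub>R (W x - W x)) \<le> 1" for \<mu> and W :: "'a \<Rightarrow> 'b::euclidean_space"
      by (simp add: rho_def)
    have "(\<lambda>k. LINT x|M. a x (grad (U (cs k)) x) \<bullet> grad (D i) x) \<longlonglongrightarrow> (LINT x|M. a x (grad (U c) x) \<bullet> grad (D i) x)"
      by (rule nemytskii_tendsto[OF a_nem _ _ _ Rg _ _ TD(4)])
         (use z lim in \<open>auto simp: U(2) intro!: tendsto_intros\<close>)
    moreover have "(\<lambda>k. LINT x|M. F x (U (cs k) x) \<bullet> D i x) \<longlonglongrightarrow> (LINT x|M. F x (U c x) \<bullet> D i x)"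
      by (rule nemytskii_tendsto[OF F_nem _ _ _ Ru _ _ TD(3)])
         (use z lim in \<open>auto simp: U_def intro!: tendsto_intros\<close>)
    ultimately show ?thesis
      unfolding E_def using lim[OF i] by (intro tendsto_intros) auto
  qed
  \<comment> \<open>As soon as one coefficient has size \<open>R\<close>, the regularising term is
    at least \<open>\<kappa> * R\<^sup>2 = C3 + 1\<close> and beats the possible loss
    \<open>C3\<close> of the energy.\<close>
  define R where "R = sqrt ((C3 + 1) / \<kappa>)"
  have R: "0 < R" "\<kappa> * R\<^sup>2 = C3 + 1" using \<kappa> C3 by (auto simp: R_def)
  have coercive: "0 < (\<Sum>i<n. c i * E c i)" if "i < n" "\<bar>c i\<bar> = R" for c i
  proof -
    have "R\<^sup>2 = (c i)\<^sup>2" using that(2) by (metis power2_abs)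
    also have "\<dots> \<le> (\<Sum>i<n. (c i)\<^sup>2)" using that(1) by (intro member_le_sum) auto
    finally have "C3 + 1 \<le> \<kappa> * (\<Sum>i<n. (c i)\<^sup>2)" using \<kappa> R(2) mult_left_mono[of "R\<^sup>2" _ \<kappa>] by fastforce
    moreover have "0 \<le> c' / 2 * J (U c)" using c' J_nonneg by simp
    ultimately show ?thesis using C3(2)[OF U(1), of c] unfolding pair by linarith
  qed
  have "\<exists>c. \<forall>i<n. E c i = 0"
  proof (rule coercive_zero[of n E R])
    show "(\<lambda>k. E (cs k) i) \<longlonglongrightarrow> E c i" if "i < n" "\<And>j. j < n \<Longrightarrow> (\<lambda>k. cs k j) \<longlonglongrightarrow> c j" for c cs i
      using that by (rule cont)
    show "0 < (\<Sum>i<n. c i * E c i)" if "i < n" "\<bar>c i\<bar> = R" for c i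
      using that by (rule coercive)
  qed (use R(1) in auto)
  then obtain c where c: "\<And>i. i < n \<Longrightarrow> E c i = 0" by blast
  have "(\<Sum>i<n. c i * E c i) = 0" using c by (intro sum.neutral) auto
  then have energy: "(LINT x|M. a x (grad (U c) x) \<bullet> grad (U c) x) - (LINT x|M. F x (U c x) * U c x) = - (\<kappa> * (\<Sum>i<n. (c i)\<^sup>2))"
    unfolding pair by linarith
  have S0: "0 \<le> \<kappa> * (\<Sum>i<n. (c i)\<^sup>2)" using \<kappa> by (simp add: sum_nonneg)
  have b: "c' / 2 * J (U c) + \<kappa> * (\<Sum>i<n. (c i)\<^sup>2) \<le> C3" using C3(2)[OF U(1), of c] energy by linarith
  have cJ: "0 \<le> c' / 2 * J (U c)" using c' J_nonneg by simp
  show ?thesis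
  proof (rule that[OF U(1)[of c]])
    have "c' / 2 * J (U c) \<le> C3" using b S0 by linarith
    then show "J (U c) \<le> 2 * C3 / c'" using c' by (simp add: field_simps)
    fix m assume m: "m < n"
    have "(c m)\<^sup>2 \<le> (\<Sum>i<n. (c i)\<^sup>2)" using m by (intro member_le_sum) auto
    then have "\<kappa> * (c m)\<^sup>2 \<le> C3" using b cJ \<kappa> mult_left_mono[of "(c m)\<^sup>2" "\<Sum>i<n. (c i)\<^sup>2" \<kappa>] by linarith
    \<comment> \<open>The contribution \<open>\<kappa> * c m\<close> of the regularisation to each
      equation is bounded by a quantity that vanishes with \<kappa>, although \<open>c m\<close>
      itself has no bound independent of \<kappa>.\<close>
    then have "(\<kappa> * \<bar>c m\<bar>)\<^sup>2 \<le> \<kappa> * C3"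
      using \<kappa> mult_left_mono[of "\<kappa> * (c m)\<^sup>2" C3 \<kappa>] by (simp add: power_mult_distrib power2_eq_square mult_ac)
    then have cm: "\<kappa> * \<bar>c m\<bar> \<le> sqrt (\<kappa> * C3)" by (rule real_le_rsqrt)
    have "(LINT x|M. a x (grad (U c) x) \<bullet> (grad (D m) x - grad (U c) x)) =
       (LINT x|M. a x (grad (U c) x) \<bullet> grad (D m) x) - (LINT x|M. a x (grad (U c) x) \<bullet> grad (U c) x)"
      unfolding inner_diff_right by (intro Bochner_Integration.integral_diff a_pairing_integrable TU TD)
    moreover have "(LINT x|M. F x (U c x) * (D m x - U c x)) = (LINT x|M. F x (U c x) * D m x) - (LINT x|M. F x (U c x) * U c x)"
      unfolding right_diff_distrib by (intro Bochner_Integration.integral_diff F_pairing_integrable TU TD)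
    moreover have "\<kappa> * c m \<le> \<kappa> * \<bar>c m\<bar>" using \<kappa> by (intro mult_left_mono) auto
    \<comment> \<open>The sum of squares from the energy identity enters with a favourable sign and
      is dropped.\<close>
    ultimately show "- sqrt (\<kappa> * C3) \<le> (LINT x|M. a x (grad (U c) x) \<bullet> (grad (D m) x - grad (U c) x)) -
        (LINT x|M. F x (U c x) * (D m x - U c x))"
      using c[OF m] energy S0 cm unfolding E_def by linarith
  qed
qed

end

subsection \<open>Passage to the limit\<close>

context leray_lions
begin

lemma rho_minus: "rho (\<lambda>x. c *\<^sub>R (g x - h x)) = rho (\<lambda>x. c *\<^sub>R (h x - g x))"
  by (simp add: rho_def norm_minus_commute)

text \<open>For \<open>t \<le> 1\<close> the modular is at most \<open>t powr p0 \<le> t\<close>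
  times the measure of \<Omega>. This turns uniform approximation into approximation in
  norm.\<close>

lemma rho_uniformly_small:
  obtains t where "0 < t" "\<And>h :: 'a \<Rightarrow> 'b::euclidean_space. (\<forall>x\<in>\<Omega>. norm (h x) \<le> t) \<Longrightarrow> rho h \<le> 1"
proof -
  obtain V where V: "emeasure M \<Omega> = ennreal V" "0 \<le> V" using emeasure_M_finite by (cases "emeasure M \<Omega>") auto
  define t where "t = 1 / (V + 1)"
  have t: "0 < t" "t \<le> 1" "t * V \<le> 1" using V(2) by (auto simp: t_def divide_le_eq)
  show ?thesis
  proof (rule that[OF t(1)])
    fix h :: "'a \<Rightarrow> 'b::euclidean_space" assume h: "\<forall>x\<in>\<Omega>. norm (h x) \<le> t"
    have "rho h \<le> rho (\<lambda>x. t *\<^sub>R (1::real))"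
      using h AE_space[of M] t by (intro rho_mono) (auto elim!: eventually_mono)
    also have "\<dots> \<le> ennreal (t powr p0) * rho (\<lambda>x. 1::real)" using t by (intro rho_cmult_le) auto
    also have "\<dots> = ennreal (t powr p0) * ennreal V" by (simp add: rho_def V)
    also have "\<dots> \<le> ennreal (t powr 1) * ennreal V"
      using t p02 by (intro mult_right_mono ennreal_leI powr_mono') auto
    also have "\<dots> = ennreal (t * V)" using t V(2) by (simp add: ennreal_mult)
    also have "\<dots> \<le> ennreal 1" using t(3) by (rule ennreal_leI)
    finally show "rho h \<le> 1" by simp
  qed
qed

lemma nn_integral_M_eq_lborel:
  assumes "f \<in> borel_measurable borel" "\<And>x. x \<notin> \<Omega> \<Longrightarrow> f x = 0"
  shows "(\<integral>\<^sup>+x. f x \<partial>M) = (\<integral>\<^sup>+x. f x \<partial>lborel)"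
proof -
  have "(\<integral>\<^sup>+x. f x \<partial>M) = (\<integral>\<^sup>+x. f x * indicator \<Omega> x \<partial>lebesgue)"
    using \<Omega>_lebesgue by (subst nn_integral_restrict_space) auto
  also have "(\<lambda>x. f x * indicator \<Omega> x) = f" using assms(2) by (auto simp: indicator_def)
  finally show ?thesis by (simp add: nn_integral_completion)
qed

text \<open>The energy bound is independent of the dimension of the Galerkin space. The subsequence
  from Rellich's theorem is thinned once more for almost everywhere convergence; the limit inherits
  a finite modular by Fatou's lemma, and the bounded modulars give \<open>L^1\<close> convergence to
  it.\<close>

lemma galerkin_sequence:
  fixes D :: "nat \<Rightarrow> 'a \<Rightarrow> real"
  assumes D: "\<And>m. D m \<in> test_functions \<Omega>"
  obtains v u0 R e where "\<And>k. v k \<in> test_functions \<Omega>" "\<And>k. J (v k) \<le> R" "\<And>k. rho (v k) \<le> ennreal R" "0 \<le> R"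
    "integrable M u0" "(\<lambda>k. LINT x|M. \<bar>v k x - u0 x\<bar>) \<longlonglongrightarrow> 0" "AE x in M. (\<lambda>k. v k x) \<longlonglongrightarrow> u0 x" "e \<longlonglongrightarrow> (0::real)"
    "\<And>k m. m < k \<Longrightarrow> - e k \<le>
      (LINT x|M. a x (grad (v k) x) \<bullet> (grad (D m) x - grad (v k) x)) - (LINT x|M. F x (v k x) * (D m x - v k x))"
proof -
  obtain C3 where C3: "0 \<le> C3" "\<And>f. f \<in> test_functions \<Omega> \<Longrightarrow>
    c' / 2 * J f - C3 \<le> (LINT x|M. a x (grad f x) \<bullet> grad f x) - (LINT x|M. F x (f x) * f x)"
    by (rule energy_bound) (rule that)
  define R0 where "R0 = 2 * C3 / c'"
  have R0: "0 \<le> R0" using C3(1) c' by (simp add: R0_def)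
  obtain R1 where R1: "0 \<le> R1" "\<And>f. f \<in> test_functions \<Omega> \<Longrightarrow> J f \<le> R0 \<Longrightarrow> rho f \<le> ennreal R1"
    by (rule test_rho_bound) (rule that)
  \<comment> \<open>The regularisation fades as the dimension grows, and with it the residual error
    \<open>sqrt (\<kappa> n * C3)\<close>.\<close>
  define \<kappa> where "\<kappa> = (\<lambda>n. 1 / real (Suc n))"
  have "\<exists>u. u \<in> test_functions \<Omega> \<and> J u \<le> R0 \<and> (\<forall>m<n. - sqrt (\<kappa> n * C3) \<le>
      (LINT x|M. a x (grad u x) \<bullet> (grad (D m) x - grad u x)) - (LINT x|M. F x (u x) * (D m x - u x)))" for n
    by (rule galerkin[where D=D and \<kappa>="\<kappa> n" and n=n, OF D _ C3]) (auto simp: \<kappa>_def R0_def)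
  then have "\<forall>n. \<exists>u. u \<in> test_functions \<Omega> \<and> J u \<le> R0 \<and> (\<forall>m<n. - sqrt (\<kappa> n * C3) \<le>
      (LINT x|M. a x (grad u x) \<bullet> (grad (D m) x - grad u x)) - (LINT x|M. F x (u x) * (D m x - u x)))" ..
  from choice[OF this] obtain u where u: "\<And>n. u n \<in> test_functions \<Omega>" "\<And>n. J (u n) \<le> R0"
    "\<And>m n. m < n \<Longrightarrow> - sqrt (\<kappa> n * C3) \<le>
      (LINT x|M. a x (grad (u n) x) \<bullet> (grad (D m) x - grad (u n) x)) - (LINT x|M. F x (u n x) * (D m x - u n x))"
    by blast
  have ur: "rho (u n) \<le> ennreal R1" for n using R1(2)[OF u(1,2)] .
  note T = test_function_rho[OF u(1)]
  note [measurable] = T(1,2)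
  obtain V where V: "emeasure M \<Omega> = ennreal V" "0 \<le> V" using emeasure_M_finite by (cases "emeasure M \<Omega>") auto
  define C4 where "C4 = V + R0 + R1"
  have C4: "0 \<le> C4" using V R0 R1 by (simp add: C4_def)
  have cont: "continuous_on UNIV (u n)" "continuous_on UNIV (grad (u n))" for n
    by (intro smooth_continuous_on smooth_continuous_on_grad test_function_smooth[OF u(1)])+
  have [measurable]: "u n \<in> borel_measurable borel" "grad (u n) \<in> borel_measurable borel" for n
    using cont by (auto intro: borel_measurable_continuous_onI)
  have B1: "(\<integral>\<^sup>+x. ennreal \<bar>u n x\<bar> \<partial>lborel) \<le> ennreal C4" for n
  proof -
    have "(\<integral>\<^sup>+x. ennreal \<bar>u n x\<bar> \<partial>lborel) = (\<integral>\<^sup>+x. ennreal (norm (u n x)) \<partial>M)"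
      by (subst nn_integral_M_eq_lborel) (auto simp: test_function_outside[OF u(1)])
    also have "\<dots> \<le> ennreal 1 * (emeasure M \<Omega> + rho (\<lambda>x. (1 / 1) *\<^sub>R u n x))"
      by (rule L1_le_rho) auto
    also have "\<dots> \<le> ennreal V + ennreal R1" using ur[of n] V by (simp add: add_left_mono)
    also have "\<dots> \<le> ennreal C4" using V R0 R1 by (simp add: C4_def ennreal_plus[symmetric] del: ennreal_plus)
    finally show ?thesis .
  qed
  have B2: "(\<integral>\<^sup>+x. ennreal (norm (grad (u n) x)) \<partial>lborel) \<le> ennreal C4" for n
  proof -
    have "(\<integral>\<^sup>+x. ennreal (norm (grad (u n) x)) \<partial>lborel) = (\<integral>\<^sup>+x. ennreal (norm (grad (u n) x)) \<partial>M)"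
      by (subst nn_integral_M_eq_lborel) (auto simp: test_grad_outside[OF u(1)])
    also have "\<dots> \<le> ennreal 1 * (emeasure M \<Omega> + rho (\<lambda>x. (1 / 1) *\<^sub>R grad (u n) x))"
      by (rule L1_le_rho) auto
    also have "\<dots> \<le> ennreal V + ennreal R0"
      using u(2)[of n] V by (simp add: add_left_mono test_rho_grad[OF u(1)] ennreal_leI)
    also have "\<dots> \<le> ennreal C4" using V R0 R1 by (simp add: C4_def ennreal_plus[symmetric] del: ennreal_plus)
    finally show ?thesis .
  qed
  obtain r :: "nat \<Rightarrow> nat" where r: "strict_mono r"
    and rc: "\<And>e. 0 < e \<Longrightarrow> \<exists>N. \<forall>i\<ge>N. \<forall>j\<ge>N. (\<integral>\<^sup>+x. ennreal \<bar>u (r i) x - u (r j) x\<bar> \<partial>lborel) < ennreal e"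
    by (rule rellich_L1[where u=u, OF op bd u(1) B1 B2 C4]) (rule that)
  have ui: "integrable M (u n)" for n using rho_finite_integrable(1)[OF T(1,3)] .
  have "\<exists>N. \<forall>i\<ge>N. \<forall>j\<ge>N. (LINT x|M. norm (u (r i) x - u (r j) x)) < e" if e: "0 < e" for e
  proof -
    obtain N where N: "\<And>i j. i \<ge> N \<Longrightarrow> j \<ge> N \<Longrightarrow> (\<integral>\<^sup>+x. ennreal \<bar>u (r i) x - u (r j) x\<bar> \<partial>lborel) < ennreal e"
      using rc[OF e] by blast
    show ?thesis
    proof (intro exI allI impI)
      fix i j assume ij: "i \<ge> N" "j \<ge> N"
      have "ennreal (LINT x|M. norm (u (r i) x - u (r j) x)) = (\<integral>\<^sup>+x. ennreal \<bar>u (r i) x - u (r j) x\<bar> \<partial>M)"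
        using ui by (subst nn_integral_eq_integral) auto
      also have "\<dots> = (\<integral>\<^sup>+x. ennreal \<bar>u (r i) x - u (r j) x\<bar> \<partial>lborel)"
        by (rule nn_integral_M_eq_lborel) (auto simp: test_function_outside[OF u(1)])
      also have "\<dots> < ennreal e" using N[OF ij] .
      finally show "(LINT x|M. norm (u (r i) x - u (r j) x)) < e"
        by (subst (asm) ennreal_less_iff) (auto intro: integral_nonneg_AE)
    qed
  qed
  then obtain q where q: "strict_mono q" and qc: "AE x in M. Cauchy (\<lambda>i. u (r (q i)) x)"
    by (rule cauchy_L1_AE_cauchy_subseq[of M "\<lambda>i. u (r i)", OF ui]) blast
  define v where "v = (\<lambda>k. u (r (q k)))"
  define u0 where "u0 = (\<lambda>x. lim (\<lambda>k. v k x))"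
  have [measurable]: "v k \<in> borel_measurable M" for k unfolding v_def by measurable
  have u0m [measurable]: "u0 \<in> borel_measurable M" unfolding u0_def by measurable
  have vlim: "AE x in M. (\<lambda>k. v k x) \<longlonglongrightarrow> u0 x"
    using qc unfolding v_def[symmetric] by eventually_elim (simp add: u0_def v_def Cauchy_convergent_iff convergent_LIMSEQ_iff)
  have vr: "rho (v k) \<le> ennreal R1" for k unfolding v_def by (rule ur)
  have "rho u0 \<le> ennreal R1"
    by (rule rho_fatou[OF _ vlim]) (use vr in auto)
  then have u0f: "rho u0 < \<infinity>" by (rule le_less_trans) simp
  have u0i: "integrable M u0" by (rule rho_finite_integrable(1)[OF u0m u0f])
  have vf: "rho (v k) < \<infinity>" for k using vr[of k] by (rule le_less_trans) simp
  have L1: "(\<lambda>k. LINT x|M. \<bar>v k x - u0 x\<bar>) \<longlonglongrightarrow> (LINT x|M. 0)"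
  proof (rule integral_tendsto_small_growth(3)[where U="\<lambda>k x. norm (v k x) powr p x" and C=R1])
    show "AE x in M. (\<lambda>k. \<bar>v k x - u0 x\<bar>) \<longlonglongrightarrow> 0"
      using vlim by eventually_elim (intro tendsto_rabs_zero, simp add: LIM_zero_iff)
    show "integrable M (\<lambda>x. norm (v k x) powr p x)" for k by (rule rho_finite_integrable(2)[OF _ vf]) measurable
    show "(LINT x|M. norm (v k x) powr p x) \<le> R1" for k
      by (rule p_powr_integrable[OF _ vf vr R1(1)]) measurable
    fix e :: real assume e: "0 < e" "e \<le> 1"
    define c where "c = (1 / e) powr (1 / (p0 - 1))"
    show "\<exists>H. integrable M H \<and> (\<forall>k. AE x in M. \<bar>\<bar>v k x - u0 x\<bar>\<bar> \<le> e * norm (v k x) powr p x + H x)"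
    proof (intro exI[of _ "\<lambda>x. c + \<bar>u0 x\<bar>"] conjI allI)
      show "integrable M (\<lambda>x. c + \<bar>u0 x\<bar>)" using u0i by auto
      fix k
      show "AE x in M. \<bar>\<bar>v k x - u0 x\<bar>\<bar> \<le> e * norm (v k x) powr p x + (c + \<bar>u0 x\<bar>)"
      proof (use AE_space in eventually_elim)
        case (elim x)
        have "\<bar>v k x\<bar> powr 1 \<le> e * \<bar>v k x\<bar> powr p x + (1 / e) powr (1 / (p0 - 1))"
          using p_pos[of x] elim p02 e by (intro powr_le_small_powr) auto
        then show ?case by (simp add: c_def)
      qed
    qed
  qed auto
  \<comment> \<open>Ensures that \<open>m < k\<close> places \<open>D m\<close> among the functions
    spanning the space of the selected solution \<open>v k\<close>.\<close>
  have idx: "k \<le> r (q k)" for k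
    using seq_suble[OF r, of "q k"] seq_suble[OF q, of k] by linarith
  show ?thesis
  proof (rule that[of v "max R0 R1" u0 "\<lambda>k. sqrt (\<kappa> (r (q k)) * C3)"])
    show "v k \<in> test_functions \<Omega>" "J (v k) \<le> max R0 R1" "rho (v k) \<le> ennreal (max R0 R1)" for k
      using u(1) u(2)[of "r (q k)"] order_trans[OF vr[of k], of "ennreal (max R0 R1)"] by (auto simp: v_def ennreal_leI)
    show "(\<lambda>k. LINT x|M. \<bar>v k x - u0 x\<bar>) \<longlonglongrightarrow> 0" using L1 by simp
    have "\<kappa> \<longlonglongrightarrow> 0" unfolding \<kappa>_def by (intro lim_1_over_n[THEN LIMSEQ_Suc])
    then have "(\<lambda>k. \<kappa> (r (q k))) \<longlonglongrightarrow> 0"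
      using LIMSEQ_subseq_LIMSEQ[OF _ strict_mono_o[OF r q], of \<kappa> 0] by (simp add: o_def)
    then have "(\<lambda>k. sqrt (\<kappa> (r (q k)) * C3)) \<longlonglongrightarrow> sqrt (0 * C3)" by (intro tendsto_intros)
    then show "(\<lambda>k. sqrt (\<kappa> (r (q k)) * C3)) \<longlonglongrightarrow> 0" by simp
    show "- sqrt (\<kappa> (r (q k)) * C3) \<le> (LINT x|M. a x (grad (v k) x) \<bullet> (grad (D m) x - grad (v k) x)) -
        (LINT x|M. F x (v k x) * (D m x - v k x))" if "m < k" for m k
      unfolding v_def by (rule u(3)) (use that idx[of k] in linarith)
  qed (use R0 u0i vlim in auto)
qed

lemma rho_bounded_add:
  assumes "g \<in> borel_measurable M" "h \<in> borel_measurable M" "rho g \<le> ennreal A" "rho h \<le> ennreal B" "0 \<le> A" "0 \<le> B"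
  shows "rho (\<lambda>x. g x + h x) \<le> ennreal (2 powr P * (A + B))"
proof -
  have "rho (\<lambda>x. g x + h x) \<le> ennreal (2 powr P) * (rho g + rho h)" by (rule rho_add_le[OF assms(1,2)])
  also have "\<dots> \<le> ennreal (2 powr P) * (ennreal A + ennreal B)" using assms by (intro mult_left_mono add_mono) auto
  also have "\<dots> = ennreal (2 powr P * (A + B))" using assms by (simp add: ennreal_mult ennreal_plus)
  finally show ?thesis .
qed

lemma rho_self_diff: "rho (\<lambda>x. c *\<^sub>R (g x - g x)) \<le> 1"
  by (simp add: rho_def)

text \<open>The Minty inequality is affine in the gradient of the Galerkin solutions, so it survives
  the passage to iterated midpoints, whose gradients converge strongly.\<close>

lemma minty_inequality:
  obtains u0 and w :: "nat \<Rightarrow> _" where "u0 \<in> W01 \<Omega> p" "\<And>n. w n \<in> test_functions \<Omega>"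
    "\<And>\<mu>. 0 < \<mu> \<Longrightarrow> \<exists>N. \<forall>n\<ge>N. rho (\<lambda>x. (1 / \<mu>) *\<^sub>R (wgrad \<Omega> u0 x - grad (w n) x)) \<le> 1"
    "\<And>\<mu>. 0 < \<mu> \<Longrightarrow> \<exists>N. \<forall>n\<ge>N. rho (\<lambda>x. (1 / \<mu>) *\<^sub>R (u0 x - w n x)) \<le> 1"
    "\<And>\<phi>. \<phi> \<in> test_functions \<Omega> \<Longrightarrow>
      (LINT x|M. F x (u0 x) * (\<phi> x - u0 x)) \<le> (LINT x|M. a x (grad \<phi> x) \<bullet> (grad \<phi> x - wgrad \<Omega> u0 x))"
proof -
  obtain D :: "nat \<Rightarrow> 'a \<Rightarrow> real" where D: "\<And>m. D m \<in> test_functions \<Omega>"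
    and dense: "\<And>\<phi> e. \<phi> \<in> test_functions \<Omega> \<Longrightarrow> 0 < e \<Longrightarrow>
      \<exists>m. \<forall>x\<in>\<Omega>. \<bar>\<phi> x - D m x\<bar> \<le> e \<and> norm (grad \<phi> x - grad (D m) x) \<le> e"
    by (rule countable_dense_test_functions[OF bd]) (rule that)
  obtain v u0 R e where v: "\<And>k. v k \<in> test_functions \<Omega>" "\<And>k. J (v k) \<le> R" "\<And>k. rho (v k) \<le> ennreal R" and R: "0 \<le> R"
    and u0i: "integrable M u0" and L1: "(\<lambda>k. LINT x|M. \<bar>v k x - u0 x\<bar>) \<longlonglongrightarrow> 0"
    and vlim: "AE x in M. (\<lambda>k. v k x) \<longlonglongrightarrow> u0 x" and e: "e \<longlonglongrightarrow> (0::real)"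
    and gal: "\<And>k m. m < k \<Longrightarrow> - e k \<le>
      (LINT x|M. a x (grad (v k) x) \<bullet> (grad (D m) x - grad (v k) x)) - (LINT x|M. F x (v k x) * (D m x - v k x))"
    by (rule galerkin_sequence[OF D]) (rule that)
  obtain w where w: "\<And>N. w N \<in> mids v N" and W01: "u0 \<in> W01 \<Omega> p"
    and wg: "\<And>\<mu>. 0 < \<mu> \<Longrightarrow> \<exists>N. \<forall>n\<ge>N. rho (\<lambda>x. (1 / \<mu>) *\<^sub>R (wgrad \<Omega> u0 x - grad (w n) x)) \<le> 1"
    and wu: "\<And>\<mu>. 0 < \<mu> \<Longrightarrow> \<exists>N. \<forall>n\<ge>N. rho (\<lambda>x. (1 / \<mu>) *\<^sub>R (u0 x - w n x)) \<le> 1"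
    by (rule mids_limit[OF v(1) u0i L1 v(2)]) (rule that)
  have wt: "w n \<in> test_functions \<Omega>" for n using mids_test[OF w v(1)] .
  define G where "G = wgrad \<Omega> u0"
  have "u0 \<in> W1 \<Omega> p" using W01 by (simp add: W01_def)
  note U = W1_D[OF this, folded G_def]
  note TD = test_function_rho[OF D] and Tv = test_function_rho[OF v(1)] and Tw = test_function_rho[OF wt]
  note [measurable] = U(1,2) TD(1,2) Tv(1,2) Tw(1,2)
  \<comment> \<open>First for members of the dense sequence: \<open>D m\<close> is admissible in the
    Galerkin inequality for indices above \<open>m\<close>, which late tails respect.\<close>
  have dD: "(LINT x|M. F x (u0 x) * (D m x - u0 x)) \<le> (LINT x|M. a x (grad (D m) x) \<bullet> (grad (D m) x - G x))" for m
  proof -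
    define \<beta> where "\<beta> = (LINT x|M. F x (u0 x) * (D m x - u0 x))"
    let ?A = "\<lambda>f. LINT x|M. a x (grad (D m) x) \<bullet> (grad (D m) x - grad f x)"
    obtain d where d: "rho (D m) \<le> ennreal d" "0 \<le> d" using TD(3)[of m] by (cases "rho (D m)") auto
    have Ai: "integrable M (\<lambda>x. a x (grad (D m) x) \<bullet> (grad (D m) x - grad f x))" if "f \<in> test_functions \<Omega>" for f
      by (intro a_pairing_integrable TD borel_measurable_diff rho_diff_finite test_function_rho[OF that])
    have Bi: "integrable M (\<lambda>x. a x (grad f x) \<bullet> (grad (D m) x - grad f x))" if "f \<in> test_functions \<Omega>" for f
      by (intro a_pairing_integrable TD borel_measurable_diff rho_diff_finite test_function_rho[OF that])
    \<comment> \<open>Almost everywhere convergence and bounded modulars settle the lower order term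
      here; its limit \<beta> is a constant in the midpoint argument that follows.\<close>
    have FB: "(\<lambda>k. LINT x|M. F x (v k x) * (D m x - v k x)) \<longlonglongrightarrow> \<beta>"
      unfolding \<beta>_def
    proof (rule F_tendsto[where R="max R (2 powr P * (d + R))"])
      show "AE x in M. (\<lambda>k. D m x - v k x) \<longlonglongrightarrow> D m x - u0 x"
        using vlim by eventually_elim (intro tendsto_intros)
      fix k
      show "rho (v k) \<le> ennreal (max R (2 powr P * (d + R)))"
        by (rule order_trans[OF v(3)]) (auto intro: ennreal_leI)
      have "rho (\<lambda>x. D m x + - v k x) \<le> ennreal (2 powr P * (d + R))"
        using v(3)[of k] by (intro rho_bounded_add d R) (auto simp: rho_def)
      also have "\<dots> \<le> ennreal (max R (2 powr P * (d + R)))" by (intro ennreal_leI) auto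
      finally show "rho (\<lambda>x. D m x - v k x) \<le> ennreal (max R (2 powr P * (d + R)))" by simp
    qed (use vlim R in auto)
    have "\<beta> - \<epsilon> \<le> (LINT x|M. a x (grad (D m) x) \<bullet> (grad (D m) x - G x))" if \<epsilon>: "0 < \<epsilon>" for \<epsilon>
    proof -
      have \<epsilon>2: "0 < \<epsilon> / 2" using \<epsilon> by simp
      obtain N1 where N1: "\<And>k. k \<ge> N1 \<Longrightarrow> \<bar>(LINT x|M. F x (v k x) * (D m x - v k x)) - \<beta>\<bar> < \<epsilon> / 2"
        using LIMSEQ_D[OF FB \<epsilon>2] unfolding real_norm_def by blast
      obtain N2 where N2: "\<And>k. k \<ge> N2 \<Longrightarrow> \<bar>e k - 0\<bar> < \<epsilon> / 2"
        using LIMSEQ_D[OF e \<epsilon>2] unfolding real_norm_def by blast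
      define N where "N = max (Suc m) (max N1 N2)"
      have base: "\<beta> - \<epsilon> \<le> ?A (v k)" if "k \<ge> N" for k
      proof -
        have k: "m < k" "k \<ge> N1" "k \<ge> N2" using that by (auto simp: N_def)
        \<comment> \<open>Monotonicity trades \<open>a\<close> at the unknown gradient for
          \<open>a\<close> at the fixed gradient of \<open>D m\<close>.\<close>
        have "(LINT x|M. a x (grad (v k) x) \<bullet> (grad (D m) x - grad (v k) x)) \<le> ?A (v k)"
        proof (rule integral_mono_AE[OF Bi[OF v(1)] Ai[OF v(1)]])
          show "AE x in M. a x (grad (v k) x) \<bullet> (grad (D m) x - grad (v k) x) \<le>
              a x (grad (D m) x) \<bullet> (grad (D m) x - grad (v k) x)"
            using a_mono
          proof eventually_elim
            case (elim x)
            then have "0 \<le> (a x (grad (D m) x) - a x (grad (v k) x)) \<bullet> (grad (D m) x - grad (v k) x)" by blast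
            then show ?case by (simp add: inner_diff_left)
          qed
        qed
        then show ?thesis using gal[OF k(1)] N1[OF k(2)] N2[OF k(3)] by linarith
      qed
      have mid: "\<beta> - \<epsilon> \<le> ?A f" if "f \<in> mids v N" for f
        using that
      proof (induction rule: mids.induct)
        case (base n)
        then show ?case using \<open>\<And>k. k \<ge> N \<Longrightarrow> \<beta> - \<epsilon> \<le> ?A (v k)\<close> by blast
      next
        case (mid f g)
        have t: "f \<in> test_functions \<Omega>" "g \<in> test_functions \<Omega>" using mid mids_test v(1) by blast+
        have "?A (\<lambda>x. (1 / 2) * (f x + g x)) =
          (LINT x|M. (1 / 2) * (a x (grad (D m) x) \<bullet> (grad (D m) x - grad f x)) + (1 / 2) * (a x (grad (D m) x) \<bullet> (grad (D m) x - grad g x)))"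
        proof (intro Bochner_Integration.integral_cong refl)
          fix x
          show "a x (grad (D m) x) \<bullet> (grad (D m) x - grad (\<lambda>x. (1 / 2) * (f x + g x)) x) =
            (1 / 2) * (a x (grad (D m) x) \<bullet> (grad (D m) x - grad f x)) + (1 / 2) * (a x (grad (D m) x) \<bullet> (grad (D m) x - grad g x))"
            unfolding test_function_midpoint(2)[OF t]
            by (simp add: inner_diff_right inner_add_right field_simps)
        qed
        also have "\<dots> = (1 / 2) * ?A f + (1 / 2) * ?A g" using Ai[OF t(1)] Ai[OF t(2)] by simp
        finally show ?case using mid.IH by linarith
      qed
      have "(\<lambda>n. ?A (w n)) \<longlonglongrightarrow> (LINT x|M. a x (grad (D m) x) \<bullet> (grad (D m) x - G x))"
      proof -
        obtain d' where d': "rho (grad (D m)) \<le> ennreal d'" "0 \<le> d'" using TD(4)[of m] by (cases "rho (grad (D m))") auto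
        show ?thesis
        proof (rule nemytskii_tendsto[OF a_nem, where R=d'])
          show "rho (\<lambda>x. grad (D m) x - G x) < \<infinity>" by (intro rho_diff_finite TD U)
          show "\<exists>N. \<forall>n\<ge>N. rho (\<lambda>x. (1 / \<mu>) *\<^sub>R (grad (D m) x - G x - (grad (D m) x - grad (w n) x))) \<le> 1" if "0 < \<mu>" for \<mu>
            using wg[OF that] rho_minus[of "1 / \<mu>" G] by (simp add: G_def)
        qed (use d' in auto)
      qed
      moreover have "\<forall>n\<ge>N. \<beta> - \<epsilon> \<le> ?A (w n)"
        using mid w mids_antimono[of N _ v] by blast
      ultimately show ?thesis by (intro LIMSEQ_le_const) auto
    qed
    then have "\<beta> \<le> (LINT x|M. a x (grad (D m) x) \<bullet> (grad (D m) x - G x)) + \<epsilon>" if "0 < \<epsilon>" for \<epsilon>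
      using that by (simp add: diff_le_eq)
    then show ?thesis unfolding \<beta>_def by (rule field_le_epsilon)
  qed
  show ?thesis
  proof (rule that[OF W01 wt wg wu])
    fix \<phi> assume \<phi>: "\<phi> \<in> test_functions \<Omega>"
    note T = test_function_rho[OF \<phi>]
    note [measurable] = T(1,2)
    have "\<forall>k. \<exists>m. \<forall>x\<in>\<Omega>. \<bar>\<phi> x - D m x\<bar> \<le> 1 / real (Suc k) \<and> norm (grad \<phi> x - grad (D m) x) \<le> 1 / real (Suc k)"
      by (intro allI dense[OF \<phi>]) simp
    from choice[OF this] obtain m where m: "\<And>k x. x \<in> \<Omega> \<Longrightarrow> \<bar>\<phi> x - D (m k) x\<bar> \<le> 1 / real (Suc k)"
      "\<And>k x. x \<in> \<Omega> \<Longrightarrow> norm (grad \<phi> x - grad (D (m k)) x) \<le> 1 / real (Suc k)"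
      by blast
    have inv0: "(\<lambda>k. 1 / real (Suc k)) \<longlonglongrightarrow> 0" by (intro lim_1_over_n[THEN LIMSEQ_Suc])
    \<comment> \<open>Uniform closeness at rate \<open>1 / Suc n\<close> on the bounded set \<Omega>
      gives closeness in norm; it feeds the limits on both sides of the inequality.\<close>
    have small: "\<exists>N. \<forall>n\<ge>N. rho (\<lambda>x. (1 / \<mu>) *\<^sub>R h n x) \<le> 1"
      if h: "\<And>n x. x \<in> \<Omega> \<Longrightarrow> norm (h n x) \<le> 1 / real (Suc n)" and \<mu>: "0 < \<mu>" for h :: "nat \<Rightarrow> 'a \<Rightarrow> 'b::euclidean_space" and \<mu>
    proof -
      obtain t where t: "0 < t" "\<And>h :: 'a \<Rightarrow> 'b. (\<forall>x\<in>\<Omega>. norm (h x) \<le> t) \<Longrightarrow> rho h \<le> 1"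
        by (rule rho_uniformly_small) (rule that)
      have "0 < t * \<mu>" using t \<mu> by simp
      then obtain N where N: "\<And>n. n \<ge> N \<Longrightarrow> 1 / real (Suc n) < t * \<mu>"
        using LIMSEQ_D[OF inv0] by (auto simp: abs_less_iff)
      show ?thesis
      proof (intro exI allI impI t(2) ballI)
        fix n x assume n: "n \<ge> N" and x: "x \<in> \<Omega>"
        have "norm (h n x) \<le> t * \<mu>" using h[OF x, of n] N[OF n] by linarith
        then show "norm ((1 / \<mu>) *\<^sub>R h n x) \<le> t" using \<mu> by (simp add: divide_le_eq)
      qed
    qed
    have lim: "AE x in M. (\<lambda>k. grad (D (m k)) x) \<longlonglongrightarrow> grad \<phi> x"
    proof (use AE_space in eventually_elim)
      case (elim x)
      have "(\<lambda>k. grad (D (m k)) x - grad \<phi> x) \<longlonglongrightarrow> 0"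
        by (rule Lim_null_comparison[OF _ inv0]) (use m(2) elim in \<open>simp add: norm_minus_commute\<close>)
      then show ?case by (simp add: LIM_zero_iff)
    qed
    obtain B where B: "\<And>x. norm (grad \<phi> x) \<le> B" using test_grad_bounded[OF \<phi>] by blast
    have gb: "norm (grad (D (m k)) x) \<le> B + 1" if "x \<in> \<Omega>" for k x
    proof -
      have "norm (grad (D (m k)) x) \<le> norm (grad \<phi> x) + norm (grad \<phi> x - grad (D (m k)) x)"
        using norm_triangle_sub[of "grad (D (m k)) x" "grad \<phi> x"] by (simp add: norm_minus_commute)
      moreover have "1 / real (Suc k) \<le> 1" by simp
      ultimately show ?thesis using B[of x] m(2)[OF that, of k] by linarith
    qed
    obtain R2 where R2: "\<And>k. rho (grad (D (m k))) \<le> ennreal R2" "0 \<le> R2"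
    proof -
      have "rho (grad (D (m k))) \<le> rho (\<lambda>x. B + 1)" for k
        using gb[of _ k] AE_space[of M] by (intro rho_mono) (auto elim!: eventually_mono intro: order_trans[OF _ abs_ge_self])
      moreover have "rho (\<lambda>x. B + 1) < \<infinity>" by (rule rho_bounded_finite) (rule order_refl)
      moreover obtain R where "rho (\<lambda>x. B + 1) = ennreal R" "0 \<le> R"
        using \<open>rho (\<lambda>x. B + 1) < \<infinity>\<close> by (cases "rho (\<lambda>x. B + 1)") auto
      ultimately show ?thesis using that[of R] by simp
    qed
    have 1: "(\<lambda>k. LINT x|M. a x (grad (D (m k)) x) \<bullet> (grad (D (m k)) x - G x)) \<longlonglongrightarrow> (LINT x|M. a x (grad \<phi> x) \<bullet> (grad \<phi> x - G x))"
    proof (rule nemytskii_tendsto[OF a_nem _ _ lim R2])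
      show "rho (\<lambda>x. grad \<phi> x - G x) < \<infinity>" by (intro rho_diff_finite T U)
      show "\<exists>N. \<forall>n\<ge>N. rho (\<lambda>x. (1 / \<mu>) *\<^sub>R (grad \<phi> x - G x - (grad (D (m n)) x - G x))) \<le> 1" if "0 < \<mu>" for \<mu>
        using small[OF _ that, of "\<lambda>n x. grad \<phi> x - grad (D (m n)) x"] m(2) by simp
    qed measurable
    obtain R3 where R3: "rho u0 \<le> ennreal R3" "0 \<le> R3" using U(3) by (cases "rho u0") auto
    have 2: "(\<lambda>k. LINT x|M. F x (u0 x) \<bullet> (D (m k) x - u0 x)) \<longlonglongrightarrow> (LINT x|M. F x (u0 x) \<bullet> (\<phi> x - u0 x))"
    proof (rule nemytskii_tendsto[OF F_nem _ _ _ R3])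
      show "rho (\<lambda>x. \<phi> x - u0 x) < \<infinity>" by (intro rho_diff_finite T U)
      show "\<exists>N. \<forall>n\<ge>N. rho (\<lambda>x. (1 / \<mu>) *\<^sub>R (\<phi> x - u0 x - (D (m n) x - u0 x))) \<le> 1" if "0 < \<mu>" for \<mu>
        using small[OF _ that, of "\<lambda>n x. \<phi> x - D (m n) x"] m(1) by simp
    qed auto
    have "(LINT x|M. F x (u0 x) \<bullet> (\<phi> x - u0 x)) \<le> (LINT x|M. a x (grad \<phi> x) \<bullet> (grad \<phi> x - G x))"
      by (rule LIMSEQ_le[OF 2 1]) (use dD in auto)
    then show "(LINT x|M. F x (u0 x) * (\<phi> x - u0 x)) \<le> (LINT x|M. a x (grad \<phi> x) \<bullet> (grad \<phi> x - wgrad \<Omega> u0 x))"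
      by (simp add: G_def)
  qed
qed

text \<open>The perturbed function \<open>u + t \<psi>\<close> need not be a test function, so
  Minty's inequality is used at \<open>z n + t \<psi>\<close>, where \<open>z n\<close> tends to
  \<open>u\<close> in norm. The resulting identity for test functions extends to \<open>W01\<close>
  by density, because both sides are controlled by the norm of the second argument.\<close>

lemma exists_solution:
  obtains u where "u \<in> W01 \<Omega> p"
    "\<And>v. v \<in> W01 \<Omega> p \<Longrightarrow> (LINT x|M. a x (wgrad \<Omega> u x) \<bullet> wgrad \<Omega> v x) = (LINT x|M. F x (u x) * v x)"
proof -
  obtain u and w :: "nat \<Rightarrow> _" where W01: "u \<in> W01 \<Omega> p" and wt: "\<And>n. w n \<in> test_functions \<Omega>"
    and wg: "\<And>\<mu>. 0 < \<mu> \<Longrightarrow> \<exists>N. \<forall>n\<ge>N. rho (\<lambda>x. (1 / \<mu>) *\<^sub>R (wgrad \<Omega> u x - grad (w n) x)) \<le> 1"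
    and wu: "\<And>\<mu>. 0 < \<mu> \<Longrightarrow> \<exists>N. \<forall>n\<ge>N. rho (\<lambda>x. (1 / \<mu>) *\<^sub>R (u x - w n x)) \<le> 1"
    and minty: "\<And>\<phi>. \<phi> \<in> test_functions \<Omega> \<Longrightarrow>
      (LINT x|M. F x (u x) * (\<phi> x - u x)) \<le> (LINT x|M. a x (grad \<phi> x) \<bullet> (grad \<phi> x - wgrad \<Omega> u x))"
    by (rule minty_inequality) (rule that)
  define G where "G = wgrad \<Omega> u"
  have "u \<in> W1 \<Omega> p" using W01 by (simp add: W01_def)
  note U = W1_D[OF this, folded G_def]
  note Tw = test_function_rho[OF wt]
  note [measurable] = U(1,2) Tw(1,2)
  note wg = wg[folded G_def] and minty = minty[folded G_def]
  obtain RG where RG: "rho G \<le> ennreal RG" "0 \<le> RG" using U(4) by (cases "rho G") auto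
  obtain Ru where Ru: "rho u \<le> ennreal Ru" "0 \<le> Ru" using U(3) by (cases "rho u") auto
  have wi: "integrable M (grad (w n))" for n by (rule rho_finite_integrable(1)[OF Tw(2,4)])
  have Gi: "integrable M G" by (rule rho_finite_integrable(1)[OF U(2,4)])
  obtain q :: "nat \<Rightarrow> nat" where q: "strict_mono q" and qlim: "AE x in M. (\<lambda>n. grad (w (q n)) x) \<longlonglongrightarrow> G x"
  proof -
    have "(\<lambda>n. LINT x|M. norm (grad (w n) x - G x)) \<longlonglongrightarrow> 0"
    proof (rule LIMSEQ_I)
      fix e :: real assume e: "0 < e"
      then obtain N where N: "\<And>n. n \<ge> N \<Longrightarrow> (\<integral>\<^sup>+x. ennreal (norm (grad (w n) x - G x)) \<partial>M) < ennreal e"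
        using rho_tendsto_L1[of "\<lambda>n. grad (w n)" G e] wg by auto
      have "(LINT x|M. norm (grad (w n) x - G x)) < e" if "n \<ge> N" for n
      proof -
        have "ennreal (LINT x|M. norm (grad (w n) x - G x)) = (\<integral>\<^sup>+x. ennreal (norm (grad (w n) x - G x)) \<partial>M)"
          using wi Gi by (subst nn_integral_eq_integral) auto
        also have "\<dots> < ennreal e" using N that by blast
        finally show ?thesis by (subst (asm) ennreal_less_iff) (auto intro: integral_nonneg_AE)
      qed
      then show "\<exists>N. \<forall>n\<ge>N. norm ((LINT x|M. norm (grad (w n) x - G x)) - 0) < e"
        by (intro exI[of _ N]) (auto simp: abs_of_nonneg integral_nonneg_AE)
    qed
    then have "\<exists>r::nat\<Rightarrow>nat. strict_mono r \<and> (AE x in M. (\<lambda>n. grad (w (r n)) x - G x) \<longlonglongrightarrow> 0)"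
      using wi Gi by (intro tendsto_L1_AE_subseq) auto
    then show ?thesis using that by (auto simp: LIM_zero_iff)
  qed
  obtain N1 where N1: "\<And>n. n \<ge> N1 \<Longrightarrow> rho (\<lambda>x. (1 / 1) *\<^sub>R (G x - grad (w n) x)) \<le> 1" using wg[of 1] by auto
  \<comment> \<open>The subsequence \<open>q\<close> gives almost everywhere convergence of the
    gradients. The shift by \<open>N1\<close> makes the modular of their distance to
    \<open>G\<close> at most 1 for every index, as the limit theorem demands.\<close>
  define z where "z = (\<lambda>n. w (q (n + N1)))"
  have zt: "z n \<in> test_functions \<Omega>" for n by (simp add: z_def wt)
  note Tz = test_function_rho[OF zt]
  note [measurable] = Tz(1,2)
  have qge: "n \<le> q (n + N1)" "N1 \<le> q (n + N1)" for n using seq_suble[OF q, of "n + N1"] by linarith+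
  have zlim: "AE x in M. (\<lambda>n. grad (z n) x) \<longlonglongrightarrow> G x"
    using qlim by eventually_elim (simp add: z_def LIMSEQ_ignore_initial_segment[of "\<lambda>n. grad (w (q n)) _"])
  have zg: "\<exists>N. \<forall>n\<ge>N. rho (\<lambda>x. (1 / \<mu>) *\<^sub>R (G x - grad (z n) x)) \<le> 1" if \<mu>: "0 < \<mu>" for \<mu>
  proof -
    obtain N where "\<And>n. n \<ge> N \<Longrightarrow> rho (\<lambda>x. (1 / \<mu>) *\<^sub>R (G x - grad (w n) x)) \<le> 1" using wg[OF \<mu>] by blast
    then show ?thesis unfolding z_def by (intro exI[of _ N] allI impI) (use order_trans[OF _ qge(1)] in blast)
  qed
  have zu: "\<exists>N. \<forall>n\<ge>N. rho (\<lambda>x. (1 / \<mu>) *\<^sub>R (u x - z n x)) \<le> 1" if \<mu>: "0 < \<mu>" for \<mu>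
  proof -
    obtain N where "\<And>n. n \<ge> N \<Longrightarrow> rho (\<lambda>x. (1 / \<mu>) *\<^sub>R (u x - w n x)) \<le> 1" using wu[OF \<mu>] by blast
    then show ?thesis unfolding z_def by (intro exI[of _ N] allI impI) (use order_trans[OF _ qge(1)] in blast)
  qed
  have z1: "rho (\<lambda>x. grad (z n) x - G x) \<le> ennreal 1" for n
    using N1[OF qge(2)[of n]] rho_minus[of 1 G] by (simp add: z_def)
  \<comment> \<open>The limit in \<open>n\<close> is taken at fixed \<open>t\<close>; afterwards the
    positive factor \<open>t\<close> is divided out.\<close>
  have ineq_t: "(LINT x|M. F x (u x) * \<psi> x) \<le> (LINT x|M. a x (G x + t *\<^sub>R grad \<psi> x) \<bullet> grad \<psi> x)"
    if \<psi>: "\<psi> \<in> test_functions \<Omega>" and t: "0 < t" for \<psi> t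
  proof -
    note T = test_function_rho[OF \<psi>]
    note [measurable] = T(1,2)
    have tf: "(\<lambda>x. z n x + t * \<psi> x) \<in> test_functions \<Omega>" for n
      by (intro test_function_add zt test_function_cmult \<psi>)
    have gr: "grad (\<lambda>x. z n x + t * \<psi> x) x = grad (z n) x + t *\<^sub>R grad \<psi> x" for n x
      using test_function_smooth[OF zt] test_function_smooth[OF \<psi>]
      by (simp add: grad_add grad_cmult smooth_mult smooth_const)
    have fin: "rho (\<lambda>x. t *\<^sub>R grad \<psi> x) < \<infinity>" by (intro rho_cmult_finite T)
    have fin': "rho (\<lambda>x. t * \<psi> x) < \<infinity>" using rho_cmult_finite[OF T(1,3), of t] by simp
    have "rho (\<lambda>x. G x + t *\<^sub>R grad \<psi> x) < \<infinity>" by (intro rho_add_finite U fin) measurable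
    then obtain S where S: "rho (\<lambda>x. G x + t *\<^sub>R grad \<psi> x) \<le> ennreal S" "0 \<le> S"
      by (cases "rho (\<lambda>x. G x + t *\<^sub>R grad \<psi> x)") auto
    have 1: "(\<lambda>n. LINT x|M. a x (grad (z n) x + t *\<^sub>R grad \<psi> x) \<bullet> (grad (z n) x + t *\<^sub>R grad \<psi> x - G x))
        \<longlonglongrightarrow> (LINT x|M. a x (G x + t *\<^sub>R grad \<psi> x) \<bullet> (t *\<^sub>R grad \<psi> x))"
    proof (rule nemytskii_tendsto[OF a_nem, where R="2 powr P * (S + 1)"])
      show "AE x in M. (\<lambda>n. grad (z n) x + t *\<^sub>R grad \<psi> x) \<longlonglongrightarrow> G x + t *\<^sub>R grad \<psi> x"
        using zlim by eventually_elim (intro tendsto_intros)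
      show "rho (\<lambda>x. grad (z n) x + t *\<^sub>R grad \<psi> x) \<le> ennreal (2 powr P * (S + 1))" for n
        using rho_bounded_add[OF _ _ S(1) z1[of n] S(2)] by (simp add: add.commute)
      show "\<exists>N. \<forall>n\<ge>N. rho (\<lambda>x. (1 / \<mu>) *\<^sub>R (t *\<^sub>R grad \<psi> x - (grad (z n) x + t *\<^sub>R grad \<psi> x - G x))) \<le> 1"
        if "0 < \<mu>" for \<mu>
        using zg[OF that] by simp
    qed (use S fin in auto)
    have 2: "(\<lambda>n. LINT x|M. F x (u x) \<bullet> (z n x + t * \<psi> x - u x)) \<longlonglongrightarrow> (LINT x|M. F x (u x) \<bullet> (t * \<psi> x))"
    proof (rule nemytskii_tendsto[OF F_nem _ _ _ Ru])
      show "\<exists>N. \<forall>n\<ge>N. rho (\<lambda>x. (1 / \<mu>) *\<^sub>R (t * \<psi> x - (z n x + t * \<psi> x - u x))) \<le> 1" if "0 < \<mu>" for \<mu>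
        using zu[OF that] by simp
    qed (use fin' in auto)
    have "(LINT x|M. F x (u x) \<bullet> (t * \<psi> x)) \<le> (LINT x|M. a x (G x + t *\<^sub>R grad \<psi> x) \<bullet> (t *\<^sub>R grad \<psi> x))"
      by (rule LIMSEQ_le[OF 2 1]) (use minty[OF tf] in \<open>simp add: gr\<close>)
    then have "t * (LINT x|M. F x (u x) * \<psi> x) \<le> t * (LINT x|M. a x (G x + t *\<^sub>R grad \<psi> x) \<bullet> grad \<psi> x)"
      by (simp add: mult.left_commute)
    then show ?thesis using t by simp
  qed
  have ineq: "(LINT x|M. F x (u x) * \<psi> x) \<le> (LINT x|M. a x (G x) \<bullet> grad \<psi> x)" if \<psi>: "\<psi> \<in> test_functions \<Omega>" for \<psi>
  proof -
    note T = test_function_rho[OF \<psi>]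
    note [measurable] = T(1,2)
    obtain S where S: "rho (grad \<psi>) \<le> ennreal S" "0 \<le> S" using T(4) by (cases "rho (grad \<psi>)") auto
    \<comment> \<open>Now \<open>t = 1 / Suc n\<close> tends to 0: the second argument stays fixed,
      and continuity of \<open>a\<close> in the gradient moves the first.\<close>
    have "(\<lambda>n. LINT x|M. a x (G x + (1 / real (Suc n)) *\<^sub>R grad \<psi> x) \<bullet> grad \<psi> x) \<longlonglongrightarrow> (LINT x|M. a x (G x) \<bullet> grad \<psi> x)"
    proof (rule nemytskii_tendsto[OF a_nem, where R="2 powr P * (RG + S)"])
      show "AE x in M. (\<lambda>n. G x + (1 / real (Suc n)) *\<^sub>R grad \<psi> x) \<longlonglongrightarrow> G x"
      proof (intro always_eventually allI)
        fix x
        have "(\<lambda>n. G x + (1 / real (Suc n)) *\<^sub>R grad \<psi> x) \<longlonglongrightarrow> G x + 0 *\<^sub>R grad \<psi> x"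
          by (intro tendsto_intros lim_1_over_n[THEN LIMSEQ_Suc])
        then show "(\<lambda>n. G x + (1 / real (Suc n)) *\<^sub>R grad \<psi> x) \<longlonglongrightarrow> G x" by simp
      qed
      fix n
      have "rho (\<lambda>x. (1 / real (Suc n)) *\<^sub>R grad \<psi> x) \<le> rho (grad \<psi>)"
        by (intro rho_mono always_eventually allI) (auto simp: divide_le_eq distrib_left)
      also have "\<dots> \<le> ennreal S" by (rule S)
      finally show "rho (\<lambda>x. G x + (1 / real (Suc n)) *\<^sub>R grad \<psi> x) \<le> ennreal (2 powr P * (RG + S))"
        by (intro rho_bounded_add RG S) auto
    qed (use RG S T rho_self_diff in auto)
    then show ?thesis
      by (rule LIMSEQ_le_const) (use ineq_t[OF \<psi>] in auto)
  qed
  have eq: "(LINT x|M. a x (G x) \<bullet> grad \<psi> x) = (LINT x|M. F x (u x) * \<psi> x)" if \<psi>: "\<psi> \<in> test_functions \<Omega>" for \<psi>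
  proof (rule antisym)
    \<comment> \<open>Replacing \<psi> by its negative reverses the inequality.\<close>
    have "(\<lambda>x. (-1) * \<psi> x) \<in> test_functions \<Omega>" by (rule test_function_cmult[OF \<psi>])
    from ineq[OF this] show "(LINT x|M. a x (G x) \<bullet> grad \<psi> x) \<le> (LINT x|M. F x (u x) * \<psi> x)"
      unfolding grad_cmult[OF test_function_smooth[OF \<psi>]] by simp
  qed (rule ineq[OF \<psi>])
  show ?thesis
  proof (rule that[OF W01])
    fix v assume v: "v \<in> W01 \<Omega> p"
    then have v1: "v \<in> W1 \<Omega> p" by (simp add: W01_def)
    note V = W1_D[OF v1]
    note [measurable] = V(1,2)
    have aG [measurable]: "(\<lambda>x. a x (G x)) \<in> borel_measurable M" and Fu [measurable]: "(\<lambda>x. F x (u x)) \<in> borel_measurable M"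
      by (intro nemytskii_measurable[OF a_nem] nemytskii_measurable[OF F_nem] U)+
    obtain A where A: "rho' (\<lambda>x. a x (G x)) \<le> ennreal A" "0 \<le> A"
      using nemytskii_rho'_finite[OF a_nem U(2,4)] by (cases "rho' (\<lambda>x. a x (G x))") auto
    obtain B where B: "rho' (\<lambda>x. F x (u x)) \<le> ennreal B" "0 \<le> B"
      using nemytskii_rho'_finite[OF F_nem U(1,3)] by (cases "rho' (\<lambda>x. F x (u x))") auto
    define X where "X = (LINT x|M. a x (G x) \<bullet> wgrad \<Omega> v x) - (LINT x|M. F x (u x) * v x)"
    have "\<bar>X\<bar> \<le> \<epsilon>" if \<epsilon>: "0 < \<epsilon>" for \<epsilon>
    proof -
      \<comment> \<open>Balances the pairing bounds for \<open>a\<close> and for \<open>F\<close> so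
        that they add up to \<epsilon>.\<close>
      define \<mu> where "\<mu> = \<epsilon> / (A + B + 2)"
      have \<mu>: "0 < \<mu>" using \<epsilon> A B by (simp add: \<mu>_def)
      have \<mu>\<epsilon>: "\<mu> * (A + 1) + \<mu> * (B + 1) = \<epsilon>"
      proof -
        have "\<mu> * (A + B + 2) = \<epsilon>" using A B by (simp add: \<mu>_def)
        then show ?thesis by (simp add: algebra_simps)
      qed
      obtain \<phi> where \<phi>: "\<phi> \<in> test_functions \<Omega>" "rho (\<lambda>x. (1 / \<mu>) *\<^sub>R (v x - \<phi> x)) \<le> 1"
        "rho (\<lambda>x. (1 / \<mu>) *\<^sub>R (wgrad \<Omega> v x - grad \<phi> x)) \<le> 1" by (rule W01_D[OF v \<mu>]) (rule that)
      note T = test_function_rho[OF \<phi>(1)]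
      note [measurable] = T(1,2)
      have 1: "\<bar>LINT x|M. a x (G x) \<bullet> (wgrad \<Omega> v x - grad \<phi> x)\<bar> \<le> \<mu> * (A + 1)"
        by (rule pairing_bound(2)[OF _ _ A(1) \<phi>(3) \<mu> A(2)]) measurable
      have 2: "\<bar>LINT x|M. F x (u x) \<bullet> (v x - \<phi> x)\<bar> \<le> \<mu> * (B + 1)"
        by (rule pairing_bound(2)[OF _ _ B(1) \<phi>(2) \<mu> B(2)]) measurable
      have "(LINT x|M. a x (G x) \<bullet> (wgrad \<Omega> v x - grad \<phi> x)) =
          (LINT x|M. a x (G x) \<bullet> wgrad \<Omega> v x) - (LINT x|M. a x (G x) \<bullet> grad \<phi> x)"
        unfolding inner_diff_right by (intro Bochner_Integration.integral_diff a_pairing_integrable U V T)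
      moreover have "(LINT x|M. F x (u x) \<bullet> (v x - \<phi> x)) = (LINT x|M. F x (u x) * v x) - (LINT x|M. F x (u x) * \<phi> x)"
        unfolding inner_real_def right_diff_distrib by (intro Bochner_Integration.integral_diff F_pairing_integrable U V T)
      ultimately have "X = (LINT x|M. a x (G x) \<bullet> (wgrad \<Omega> v x - grad \<phi> x)) - (LINT x|M. F x (u x) \<bullet> (v x - \<phi> x))"
        using eq[OF \<phi>(1)] by (simp add: X_def)
      then show "\<bar>X\<bar> \<le> \<epsilon>" using 1 2 \<mu>\<epsilon> by linarith
    qed
    then have "\<bar>X\<bar> \<le> 0" using field_le_epsilon[of "\<bar>X\<bar>" 0] by simp
    then show "(LINT x|M. a x (wgrad \<Omega> u x) \<bullet> wgrad \<Omega> v x) = (LINT x|M. F x (u x) * v x)"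
      by (simp add: X_def G_def)
  qed
qed

end

section \<open>From the hypotheses of the theorem to the abstract setting\<close>

text \<open>For \<open>t < 2\<close> the factor with exponent \<open>t - 2\<close> is singular at 0,
  but the product has absolute value \<open>\<bar>\<eta>\<bar> powr (t - 1)\<close>, which tends to
  0, the value of the product there.\<close>

lemma continuous_on_odd_power:
  fixes t :: real
  assumes t: "1 < t"
  shows "continuous_on UNIV (\<lambda>\<eta>::real. \<bar>\<eta>\<bar> powr (t - 2) * \<eta>)"
  unfolding continuous_on_eq_continuous_at[OF open_UNIV]
proof
  fix \<eta> :: real
  show "isCont (\<lambda>\<eta>::real. \<bar>\<eta>\<bar> powr (t - 2) * \<eta>) \<eta>"
  proof (cases "\<eta> = 0")
    case True
    have eq: "\<bar>\<bar>\<eta>\<bar> powr (t - 2) * \<eta>\<bar> = \<bar>\<eta>\<bar> powr (t - 1)" for \<eta> :: real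
      using powr_mult_base[of "\<bar>\<eta>\<bar>" "t - 2"] by (simp add: abs_mult mult.commute)
    have "((\<lambda>\<eta>::real. \<bar>\<eta>\<bar> powr (t - 1)) \<longlongrightarrow> \<bar>0\<bar> powr (t - 1)) (at 0)"
      using t by (intro tendsto_powr2 tendsto_intros) auto
    then have "((\<lambda>\<eta>::real. \<bar>\<bar>\<eta>\<bar> powr (t - 2) * \<eta>\<bar>) \<longlongrightarrow> 0) (at 0)" using t by (simp add: eq)
    then show ?thesis using True by (simp add: isCont_def tendsto_rabs_zero_iff)
  qed (auto intro!: continuous_intros)
qed

context variable_exponent
begin

lemma Lvar_conj_exp: "k \<in> Lvar \<Omega> (conj_exp p) \<Longrightarrow> k \<in> borel_measurable M \<and> rho' k < \<infinity>"
  by (simp add: Lvar_def modular_def rho'_def)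

end

text \<open>Compactness of the closure makes the image bounded; without this the conditional infimum
  and supremum would carry no information.\<close>

lemma exp_bounds:
  assumes "h \<in> C_plus \<Omega>" "bounded \<Omega>" "x \<in> closure \<Omega>"
  shows "exp_min \<Omega> h \<le> h x" "h x \<le> exp_max \<Omega> h"
proof -
  have "compact (h ` closure \<Omega>)"
    using assms by (intro compact_continuous_image) (auto simp: C_plus_def compact_closure)
  then have "bounded (h ` closure \<Omega>)" by (rule compact_imp_bounded)
  then show "exp_min \<Omega> h \<le> h x" "h x \<le> exp_max \<Omega> h"
    unfolding exp_min_def exp_max_def
    using assms(3) by (auto intro!: cINF_lower cSUP_upper dest: bounded_imp_bdd_below bounded_imp_bdd_above)
qed

lemma W01_imp_W1: "u \<in> W01 \<Omega> p \<Longrightarrow> u \<in> W1 \<Omega> p"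
  by (simp add: W01_def)

theorem theorem3p4:
  fixes \<Omega> :: "'a::euclidean_space set"
    and p q r k b :: "'a \<Rightarrow> real"
    and l c c' c1 :: real
    and f :: "'a \<Rightarrow> real \<Rightarrow> real"
    and a :: "'a \<Rightarrow> 'a \<Rightarrow> 'a"
  assumes dim: "2 \<le> DIM('a)"
    and dom: "smooth_bounded_domain \<Omega>"
    and exponents: "p \<in> C_plus \<Omega>" "q \<in> C_plus \<Omega>" "r \<in> C_plus \<Omega>"
    and p_log: "log_Hoelder \<Omega> p"
    and q_bounds: "1 < exp_min \<Omega> q" "exp_max \<Omega> q < exp_min \<Omega> p"
    and r_bounds: "2 < exp_min \<Omega> r" "exp_max \<Omega> r < exp_min \<Omega> p"
    and f_meas: "\<And>\<eta>. (\<lambda>x. f x \<eta>) \<in> borel_measurable (lebesgue_on \<Omega>)"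
    and f_cont: "AE x in lebesgue_on \<Omega>. continuous_on UNIV (f x)"
    and f_growth: "0 < c1" "k \<in> Lvar \<Omega> (conj_exp p)" "AE x in lebesgue_on \<Omega>. 0 \<le> k x"
      "AE x in lebesgue_on \<Omega>. \<forall>\<eta>. \<bar>f x \<eta>\<bar> \<le> c1 * (k x + \<bar>\<eta>\<bar> powr (r x - 1))"
    and a_meas: "\<And>\<xi>. (\<lambda>x. a x \<xi>) \<in> borel_measurable (lebesgue_on \<Omega>)"
    and a_cont: "AE x in lebesgue_on \<Omega>. continuous_on UNIV (a x)"
    and a_growth: "b \<in> Lvar \<Omega> (conj_exp p)" "AE x in lebesgue_on \<Omega>. 0 < b x" "0 < c"
      "AE x in lebesgue_on \<Omega>. \<forall>\<xi>. norm (a x \<xi>) \<le> b x + c * norm \<xi> powr (p x - 1)"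
    and a_monotone: "AE x in lebesgue_on \<Omega>. \<forall>\<xi> \<xi>'. \<xi> \<noteq> \<xi>' \<longrightarrow> 0 < (a x \<xi> - a x \<xi>') \<bullet> (\<xi> - \<xi>')"
    and a_coercive: "0 < c'" "AE x in lebesgue_on \<Omega>. \<forall>\<xi>. a x \<xi> \<bullet> \<xi> \<ge> c' * norm \<xi> powr p x"
  shows "\<exists>u. weak_solution \<Omega> p q l a f u"
proof -
  have \<Omega>: "open \<Omega>" "bounded \<Omega>" "\<Omega> \<noteq> {}" using dom by (auto simp: smooth_bounded_domain_def)
  note eb = exp_bounds[OF _ \<Omega>(2)]
  obtain x0 where x0: "x0 \<in> closure \<Omega>" using \<Omega>(3) closure_subset[of \<Omega>] by blast
  \<comment> \<open>One constant that dominates both lower order exponents. It exceeds 2 because the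
    values of \<open>r\<close> do, and both maxima lie below the minimum of
    \<open>p\<close>.\<close>
  define s where "s = max (exp_max \<Omega> r) (exp_max \<Omega> q)"
  have s: "2 < s" "s < exp_min \<Omega> p"
    using eb[OF exponents(3) x0] q_bounds r_bounds by (auto simp: s_def)
  interpret variable_exponent \<Omega> p "exp_min \<Omega> p" "exp_max \<Omega> p"
  proof
    show "continuous_on (closure \<Omega>) p" using exponents(1) by (simp add: C_plus_def)
    show "2 < exp_min \<Omega> p" using s by simp
    show "exp_min \<Omega> p \<le> p x \<and> p x \<le> exp_max \<Omega> p" if "x \<in> closure \<Omega>" for x
      using eb[OF exponents(1) that] by simp
  qed (use \<Omega> in auto)
  have sub: "x \<in> closure \<Omega>" if "x \<in> \<Omega>" for x using that closure_subset[of \<Omega>] by blast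
  \<comment> \<open>Absorbs the variable exponents into the constant \<open>s\<close>; the added 1
    goes into the free term of the growth bound.\<close>
  have small: "\<bar>\<eta>\<bar> powr (t - 1) \<le> 1 + \<bar>\<eta>\<bar> powr (s - 1)" if "1 \<le> t" "t \<le> s" for \<eta> t
    using that by (intro powr_le_one_plus_powr) auto
  note k = Lvar_conj_exp[OF f_growth(2)] and b = Lvar_conj_exp[OF a_growth(1)]
  have a_nem: "nemytskii a"
    unfolding nemytskii_def by (intro conjI allI exI[of _ b] exI[of _ c] a_meas a_cont a_growth(4) b[THEN conjunct1] b[THEN conjunct2] less_imp_le[OF a_growth(3)])
  \<comment> \<open>The \<lambda> term, treated as a part of the right-hand side. Its growth is what
    enters the estimates, so \<open>l\<close> appears in them through its absolute value.\<close>
  define Q where "Q = (\<lambda>x \<eta>. l * (\<bar>\<eta>\<bar> powr (q x - 2) * \<eta>))"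
  have Q_meas: "(\<lambda>x. Q x \<eta>) \<in> borel_measurable M" for \<eta>
  proof -
    have "continuous_on \<Omega> q"
      by (rule continuous_on_subset[OF _ closure_subset]) (use exponents(2) in \<open>simp add: C_plus_def\<close>)
    then have [measurable]: "q \<in> borel_measurable M"
      using \<Omega>(1) by (intro continuous_imp_measurable_on_sets_lebesgue) auto
    show ?thesis unfolding Q_def by measurable
  qed
  have Q_cont: "AE x in M. continuous_on UNIV (Q x)"
    using AE_space
  proof eventually_elim
    case (elim x)
    then have "1 < q x" using exponents(2) sub by (auto simp: C_plus_def)
    then show ?case unfolding Q_def by (intro continuous_on_mult_left continuous_on_odd_power)
  qed
  have Q_growth: "AE x in M. \<forall>\<eta>. \<bar>Q x \<eta>\<bar> \<le> \<bar>l\<bar> + \<bar>l\<bar> * \<bar>\<eta>\<bar> powr (s - 1)"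
    using AE_space
  proof eventually_elim
    case (elim x)
    then have x: "x \<in> closure \<Omega>" using sub by simp
    have q: "1 \<le> q x" "q x \<le> s"
      using eb[OF exponents(2) x] q_bounds(1) by (auto simp: s_def)
    show ?case
    proof
      fix \<eta>
      have "\<bar>Q x \<eta>\<bar> = \<bar>l\<bar> * \<bar>\<eta>\<bar> powr (q x - 1)"
        using powr_mult_base[of "\<bar>\<eta>\<bar>" "q x - 2"] by (simp add: Q_def abs_mult mult.commute)
      also have "\<dots> \<le> \<bar>l\<bar> * (1 + \<bar>\<eta>\<bar> powr (s - 1))" using small[OF q] by (intro mult_left_mono) auto
      finally show "\<bar>Q x \<eta>\<bar> \<le> \<bar>l\<bar> + \<bar>l\<bar> * \<bar>\<eta>\<bar> powr (s - 1)" by (simp add: algebra_simps)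
    qed
  qed
  have f_growth': "AE x in M. \<forall>\<eta>. \<bar>f x \<eta>\<bar> \<le> (c1 * k x + c1) + c1 * \<bar>\<eta>\<bar> powr (s - 1)"
    using AE_space f_growth(4)
  proof eventually_elim
    case (elim x)
    then have x: "x \<in> closure \<Omega>" using sub by simp
    have r: "1 \<le> r x" "r x \<le> s"
      using eb[OF exponents(3) x] r_bounds(1) by (auto simp: s_def)
    show ?case
    proof
      fix \<eta>
      have "\<bar>f x \<eta>\<bar> \<le> c1 * (k x + \<bar>\<eta>\<bar> powr (r x - 1))" using elim by blast
      also have "\<dots> \<le> c1 * (k x + (1 + \<bar>\<eta>\<bar> powr (s - 1)))"
        using small[OF r] f_growth(1) by (intro mult_left_mono add_left_mono) auto
      finally show "\<bar>f x \<eta>\<bar> \<le> (c1 * k x + c1) + c1 * \<bar>\<eta>\<bar> powr (s - 1)" by (simp add: algebra_simps)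
    qed
  qed
  have f_nem: "nemytskii f"
    by (rule nemytskii_subcritical[OF f_meas f_cont f_growth'])
      (use k rho'_affine_finite[of k c1 c1] f_growth(1) s in auto)
  have Q_nem: "nemytskii Q"
    by (rule nemytskii_subcritical[OF Q_meas Q_cont Q_growth])
      (use s rho'_const_finite[of "\<bar>l\<bar>"] in auto)
  \<comment> \<open>The constants add the growth bounds of \<open>f\<close> and \<open>Q\<close>;
    \<open>c1 + \<bar>l\<bar>\<close> occurs both as a free term and as the coefficient of the
    power.\<close>
  interpret leray_lions \<Omega> p "exp_min \<Omega> p" "exp_max \<Omega> p" a "\<lambda>x \<eta>. f x \<eta> - Q x \<eta>"
    "\<lambda>x. c1 * k x + (c1 + \<bar>l\<bar>)" s "c1 + \<bar>l\<bar>" c'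
  proof
    show "AE x in M. \<forall>\<xi> \<xi>'. 0 \<le> (a x \<xi> - a x \<xi>') \<bullet> (\<xi> - \<xi>')"
      using a_monotone
    proof eventually_elim
      case (elim x)
      show ?case
      proof (intro allI)
        fix \<xi> \<xi>'
        show "0 \<le> (a x \<xi> - a x \<xi>') \<bullet> (\<xi> - \<xi>')" using elim by (cases "\<xi> = \<xi>'") (auto intro: less_imp_le)
      qed
    qed
    show "AE x in M. continuous_on UNIV (\<lambda>\<eta>. f x \<eta> - Q x \<eta>)"
      using f_cont Q_cont by eventually_elim (rule continuous_on_diff)
    show "AE x in M. \<forall>\<eta>. \<bar>f x \<eta> - Q x \<eta>\<bar> \<le> c1 * k x + (c1 + \<bar>l\<bar>) + (c1 + \<bar>l\<bar>) * \<bar>\<eta>\<bar> powr (s - 1)"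
      using f_growth' Q_growth
    proof eventually_elim
      case (elim x)
      show ?case
      proof
        fix \<eta>
        have "\<bar>f x \<eta> - Q x \<eta>\<bar> \<le> \<bar>f x \<eta>\<bar> + \<bar>Q x \<eta>\<bar>" by (rule abs_triangle_ineq4)
        also have "\<dots> \<le> ((c1 * k x + c1) + c1 * \<bar>\<eta>\<bar> powr (s - 1)) + (\<bar>l\<bar> + \<bar>l\<bar> * \<bar>\<eta>\<bar> powr (s - 1))"
          using elim by (intro add_mono) blast+
        finally show "\<bar>f x \<eta> - Q x \<eta>\<bar> \<le> c1 * k x + (c1 + \<bar>l\<bar>) + (c1 + \<bar>l\<bar>) * \<bar>\<eta>\<bar> powr (s - 1)"
          by (simp add: algebra_simps)
      qed
    qed
    show "(\<lambda>x. f x \<eta> - Q x \<eta>) \<in> borel_measurable M" for \<eta>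
      by (intro borel_measurable_diff f_meas Q_meas)
    show "rho' (\<lambda>x. c1 * k x + (c1 + \<bar>l\<bar>)) < \<infinity>" using k by (intro rho'_affine_finite) auto
    show "(\<lambda>x. c1 * k x + (c1 + \<bar>l\<bar>)) \<in> borel_measurable M"
      by (intro borel_measurable_add borel_measurable_times k[THEN conjunct1]) auto
  qed (use s f_growth(1) in \<open>simp_all add: a_nem a_coercive\<close>)
  obtain u where u: "u \<in> W01 \<Omega> p"
    and eq: "\<And>v. v \<in> W01 \<Omega> p \<Longrightarrow>
      (LINT x|M. a x (wgrad \<Omega> u x) \<bullet> wgrad \<Omega> v x) = (LINT x|M. (f x (u x) - Q x (u x)) * v x)"
    by (rule exists_solution) (rule that)
  note U = W1_D[OF W01_imp_W1[OF u]]
  have "weak_solution \<Omega> p q l a f u"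
    unfolding weak_solution_def
  proof (intro conjI ballI u)
    fix v assume v: "v \<in> W01 \<Omega> p"
    note V = W1_D[OF W01_imp_W1[OF v]]
    \<comment> \<open>Integrability of the separate terms is demanded of a weak solution, and it
      allows the integral of the combined lower order term to be split.\<close>
    have *: "integrable M (\<lambda>x. h x (u x) * v x)" if "nemytskii h" for h :: "'a \<Rightarrow> real \<Rightarrow> real"
      using pairing_integrable(1)[OF nemytskii_measurable[OF that U(1)] V(1) nemytskii_rho'_finite[OF that U(1,3)] V(3)]
      by simp
    note fi = *[OF f_nem] and Qi = *[OF Q_nem]
    show "integrable M (\<lambda>x. a x (wgrad \<Omega> u x) \<bullet> wgrad \<Omega> v x)"
      by (rule a_pairing_integrable[OF U(2,4) V(2,4)])
    show "integrable M (\<lambda>x. f x (u x) * v x)" by (rule fi)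
    show "integrable M (\<lambda>x. l * (\<bar>u x\<bar> powr (q x - 2) * u x) * v x)" using Qi unfolding Q_def .
    have "(LINT x|M. a x (wgrad \<Omega> u x) \<bullet> wgrad \<Omega> v x) = (LINT x|M. f x (u x) * v x) - (LINT x|M. Q x (u x) * v x)"
      unfolding eq[OF v] left_diff_distrib by (rule Bochner_Integration.integral_diff[OF fi Qi])
    then show "(LINT x|M. a x (wgrad \<Omega> u x) \<bullet> wgrad \<Omega> v x) =
        - (LINT x|M. l * (\<bar>u x\<bar> powr (q x - 2) * u x) * v x) + (LINT x|M. f x (u x) * v x)"
      unfolding Q_def by simp
  qed
  then show ?thesis by blast
qed

end
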